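(* Let $K$, $\Sigma$, $V$, $M$ be as in the context, and assume that $\Sigma\times V$ admits an $M$-decomposition with associated subspaces $\widetilde\Sigma\subset\Sigma$, $\widetilde V\subset V$, and that the stabilization operator $\alpha$ satisfies (S1), (S2), (S3). Then the auxiliary HDG-projection is well defined; that is, for every $(\sigma,u)\in H^1(K;\mathbb S)\times H^1(K)^n$ there is a unique $(\Pi_\Sigma\sigma,\Pi_V u)\in\Sigma\times V$ such that $$(\Pi_\Sigma\sigma,\tau)_K=(\sigma,\tau)_K\ \ \forall\tau\in\widetilde\Sigma,\qquad (\Pi_V u,v)_K=(u,v)_K\ \ \forall v\in\widetilde V,$$ $$\langle \Pi_\Sigma\sigma\, n-\alpha(\Pi_V u),\mu\rangle_{\partial K}=\langle\sigma n-\alpha(P_M u),\mu\rangle_{\partial K}\ \ \forall\mu\in M.$$ Moreover, $$\|\sigma-\Pi_\Sigma\sigma\|_K\le\|(Id-P_\Sigma)\sigma\|_K+\mathsf C_1h_K^{1/2}\|((Id-P_\Sigma)\sigma)n\|_{\partial K}+\mathsf C_2h_K\|(Id-P_{\widetilde V})\nabla\cdot\sigma\|_K+\mathsf C_3h_K^{1/2}\|(Id-P_V)u\|_{\partial K},$$ $$\|u-\Pi_Vu\|_K\le\|(Id-P_V)u\|_K+\mathsf C_4h_K^{1/2}\|(Id-P_V)u\|_{\partial K}+\mathsf C_5h_K\|(Id-P_{\widetilde V})\nabla\cdot\sigma\|_K,$$ where $\mathsf C_1=C_{\widetilde\Sigma^\perp}$, $\mathsf C_2=\frac{C_{\widetilde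 V^\perp}}{a_{\widetilde V^\perp}}C_{\widetilde\Sigma^\perp}\|\alpha\|$, $\mathsf C_3=\Big(1+\frac{\|\alpha\|}{a_{\widetilde V^\perp}}\Big)C_{\widetilde\Sigma^\perp}\|\alpha\|$, $\mathsf C_4=\frac{C_{\widetilde V^\perp}}{a_{\widetilde V^\perp}}\|\alpha\|$, $\mathsf C_5=\frac{C_{\widetilde V^\perp}^2}{a_{\widetilde V^\perp}}$, and $$C_{\widetilde\Sigma^\perp}=\sup_{\tau\in\widetilde\Sigma^\perp\setminus\{0\}}\frac{h_K^{-1/2}\|\tau\|_K}{\|\tau n\|_{\partial K}},\qquad C_{\widetilde V^\perp}=\sup_{v\in\widetilde V^\perp\setminus\{0\}}\frac{h_K^{-1/2}\|v\|_K}{\|v\|_{\partial K}}.$$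
   Context: $K\subset\mathbb R^n$ ($n=2,3$) is a polygonal/polyhedral element, $h_K=\mathrm{diam}(K)$, $n$ also denotes the outward unit normal on $\partial K$, $\mathbb S$ is the space of real symmetric $n\times n$ matrices. $\Sigma$ is a finite-dimensional subspace of $\{\tau\in H(\mathrm{div},K;\mathbb S):\tau n|_{\partial K}\in L^2(\partial K)^n\}$, $V$ a finite-dimensional subspace of $H^1(K)^n$, $M$ a finite-dimensional subspace of $L^2(\partial K)^n$. $(\cdot,\cdot)_K$, $\langle\cdot,\cdot\rangle_{\partial K}$, $\|\cdot\|_K$, $\|\cdot\|_{\partial K}$ are $L^2$ inner products and norms; $\epsilon(v)=\frac12(\nabla v+\nabla v^T)$; $\nabla\cdot\tau$ is the row-wise divergence. $P_\Sigma,P_V,P_{\widetilde V},P_M$ are the $L^2$-orthogonal projections onto $\Sigma,V,\widetilde V$ (in $L^2(K)$) and $M$ (in $L^2(\partial K)$). $M$-decomposition: let $\mathrm{tr}(\tau,v)=(\tau n+v)|_{\partial K}$. $\Sigma\times V$ admits an $M$-decomposition if (a) $\mathrm{tr}(\Sigma\times V)\subset M$, and there are subspaces $\widetilde\Sigma\subset\Sigma$, $\widetilde V\subset V$ with (b) $\epsilon(V)\subset\widetilde\Sigma$, $\nabla\cdot\Sigma\subset\widetilde V$, and (c) $\mathrm{tr}:\widetilde\Sigma^\perp\times\widetilde V^\perp\to M$ is an isomorphism, where $\widetilde\Sigma^\perp$, $\widetilde V^\perp$ are the $L^2(K)$-orthogonal complements of $\widetilde\Sigma$ in $\Sigma$ and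 of $\widetilde V$ in $V$. The stabilization operator $\alpha:L^2(\partial K)^n\to L^2(\partial K)^n$ is linear, with: (S1) $\langle\alpha(\lambda),\mu\rangle_{\partial K}=\langle\alpha(\mu),\lambda\rangle_{\partial K}$ for all $\lambda,\mu\in L^2(\partial K)^n$; (S2) $\langle\alpha(\mu),\mu\rangle_{\partial K}\ge0$ for all $\mu\in L^2(\partial K)^n$; (S3) $a_{\widetilde V^\perp}>0$. Here $a_{\widetilde V^\perp}=\inf\{\langle\alpha(\mu),\mu\rangle_{\partial K}/\|\mu\|_{\partial K}^2:\mu\in\widetilde V^\perp|_{\partial K}\setminus\{0\}\}$ if $\widetilde V^\perp\ne\{0\}$ and $a_{\widetilde V^\perp}=\infty$ if $\widetilde V^\perp=\{0\}$; $\|\alpha\|=\sup_{\lambda,\mu\in M\setminus\{0\}}\langle\alpha(\lambda),\mu\rangle_{\partial K}/(\|\lambda\|_{\partial K}\|\mu\|_{\partial K})$. Convention: when $\widetilde V^\perp=\{0\}$ one takes $\alpha=0$, so $\|\alpha\|=0$, and quotients by $a_{\widetilde V^\perp}=\infty$ are $0$. Suprema over empty sets are $0$. *)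

theory Defs
  imports "HOL-Analysis.Analysis"
begin

section \<open>Square-integrable functions\<close>

text \<open>
  Elements of an \<open>L\<^sup>2\<close> space are represented by functions, and two functions stand for the same
  element when they agree almost everywhere. A subspace is represented by the set of all
  representatives of its elements, so that inclusions between subspaces are inclusions of sets.
\<close>

definition ae_eq :: "'a measure \<Rightarrow> ('a \<Rightarrow> 'b) \<Rightarrow> ('a \<Rightarrow> 'b) \<Rightarrow> bool" where
  "ae_eq M f g \<longleftrightarrow> (AE x in M. f x = g x)"

definition L2 :: "'a measure \<Rightarrow> ('a \<Rightarrow> 'b::euclidean_space) set" where
  "L2 M = {f \<in> borel_measurable M. integrable M (\<lambda>x. (norm (f x))\<^sup>2)}"

definition l2_inner :: "'a measure \<Rightarrow> ('a \<Rightarrow> 'b::euclidean_space) \<Rightarrow> ('a \<Rightarrow> 'b) \<Rightarrow> real" where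
  "l2_inner M f g = (\<integral>x. f x \<bullet> g x \<partial>M)"

definition l2_norm :: "'a measure \<Rightarrow> ('a \<Rightarrow> 'b::euclidean_space) \<Rightarrow> real" where
  "l2_norm M f = sqrt (\<integral>x. (norm (f x))\<^sup>2 \<partial>M)"

definition l2_subspace :: "'a measure \<Rightarrow> ('a \<Rightarrow> 'b::euclidean_space) set \<Rightarrow> bool" where
  "l2_subspace M S \<longleftrightarrow> S \<subseteq> L2 M \<and> (\<lambda>x. 0) \<in> S
     \<and> (\<forall>f\<in>S. \<forall>g\<in>S. (\<lambda>x. f x + g x) \<in> S)
     \<and> (\<forall>c. \<forall>f\<in>S. (\<lambda>x. c *\<^sub>R f x) \<in> S)
     \<and> (\<forall>f\<in>S. \<forall>g\<in>L2 M. ae_eq M f g \<longrightarrow> g \<in> S)"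

definition finite_dim_l2_subspace :: "'a measure \<Rightarrow> ('a \<Rightarrow> 'b::euclidean_space) set \<Rightarrow> bool" where
  "finite_dim_l2_subspace M S \<longleftrightarrow> l2_subspace M S
     \<and> (\<exists>B. finite B \<and> B \<subseteq> S \<and> (\<forall>f\<in>S. \<exists>c. ae_eq M f (\<lambda>x. \<Sum>b\<in>B. c b *\<^sub>R b x)))"

definition l2_complement ::
  "'a measure \<Rightarrow> ('a \<Rightarrow> 'b::euclidean_space) set \<Rightarrow> ('a \<Rightarrow> 'b) set \<Rightarrow> ('a \<Rightarrow> 'b) set" where
  "l2_complement M S T = {f \<in> S. \<forall>g\<in>T. l2_inner M f g = 0}"

definition l2_proj ::
  "'a measure \<Rightarrow> ('a \<Rightarrow> 'b::euclidean_space) set \<Rightarrow> ('a \<Rightarrow> 'b) \<Rightarrow> ('a \<Rightarrow> 'b)" where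
  "l2_proj M S f = (SOME p. p \<in> S \<and> (\<forall>s\<in>S. l2_inner M (f - p) s = 0))"


section \<open>Polyhedral elements and their surface measure\<close>

text \<open>
  An element is taken to be open. The condition \<open>interior (closure K) = K\<close> excludes slits.
\<close>

definition polyhedral_element :: "(real^'n) set \<Rightarrow> bool" where
  "polyhedral_element K \<longleftrightarrow> open K \<and> bounded K \<and> connected K \<and> K \<noteq> {} \<and> interior (closure K) = K
     \<and> (\<exists>P. finite P \<and> (\<forall>(\<nu>, c)\<in>P. \<nu> \<noteq> 0) \<and> frontier K \<subseteq> (\<Union>(\<nu>, c)\<in>P. {x. \<nu> \<bullet> x = c}))"

text \<open>
  Surface measure on the hyperplane \<open>{x. \<nu> \<bullet> x = c}\<close> with unit normal \<open>\<nu>\<close>: the area of \<open>A\<close> is the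
  volume of the prism of height 1 over \<open>A\<close>.
\<close>

definition plane_measure :: "real^'n \<Rightarrow> real \<Rightarrow> (real^'n) measure" where
  "plane_measure \<nu> c = distr (restrict_space lborel {x. c \<le> \<nu> \<bullet> x \<and> \<nu> \<bullet> x \<le> c + 1}) borel
     (\<lambda>x. x - (\<nu> \<bullet> x - c) *\<^sub>R \<nu>)"

text \<open>
  The boundary points near which \<open>K\<close> is the half-space \<open>{y. \<nu> \<bullet> y < c}\<close>, that is, those in whose
  neighbourhood the boundary is flat with outward unit normal \<open>\<nu>\<close>. The remaining boundary points
  (vertices, and edges if \<open>n = 3\<close>) have surface measure zero.
\<close>

definition facet :: "(real^'n) set \<Rightarrow> real^'n \<Rightarrow> real \<Rightarrow> (real^'n) set" where
  "facet K \<nu> c = {x. \<nu> \<bullet> x = c \<and> (\<exists>e>0. K \<inter> ball x e = {y \<in> ball x e. \<nu> \<bullet> y < c})}"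

definition facet_planes :: "(real^'n) set \<Rightarrow> ((real^'n) \<times> real) set" where
  "facet_planes K = {(\<nu>, c). norm \<nu> = 1 \<and> facet K \<nu> c \<noteq> {}}"

definition vol :: "(real^'n) set \<Rightarrow> (real^'n) measure" where
  "vol K = restrict_space lborel K"

definition surf :: "(real^'n) set \<Rightarrow> (real^'n) measure" where
  "surf K = measure_of UNIV (sets borel)
     (\<lambda>A. \<Sum>(\<nu>, c)\<in>facet_planes K. emeasure (plane_measure \<nu> c) (A \<inter> facet K \<nu> c))"


section \<open>Sobolev spaces and traces\<close>

definition C1_function :: "(real^'n \<Rightarrow> real) \<Rightarrow> (real^'n \<Rightarrow> real^'n) \<Rightarrow> bool" where
  "C1_function f Df \<longleftrightarrow> (\<forall>x. GDERIV f x :> Df x) \<and> continuous_on UNIV Df"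

text \<open>
  \<open>H\<^sup>1(K)\<close> is the completion, inside \<open>L\<^sup>2(K)\<close>, of the functions that are continuously
  differentiable up to the boundary, with respect to the \<open>H\<^sup>1(K)\<close> norm; the weak gradient is the
  limit of the gradients. (Using \<open>C\<^sup>\<infinity>\<close> instead of \<open>C\<^sup>1\<close> functions gives the same space.) The trace
  is the continuous extension of the restriction to the boundary.
\<close>

definition H1_limit ::
  "(real^'n) set \<Rightarrow> (nat \<Rightarrow> real^'n \<Rightarrow> real) \<Rightarrow> (real^'n \<Rightarrow> real) \<Rightarrow> (real^'n \<Rightarrow> real^'n) \<Rightarrow> bool" where
  "H1_limit K \<phi> u G \<longleftrightarrow> u \<in> L2 (vol K) \<and> G \<in> L2 (vol K)
     \<and> (\<exists>D\<phi>. (\<forall>k. C1_function (\<phi> k) (D\<phi> k))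
          \<and> (\<lambda>k. l2_norm (vol K) (\<phi> k - u)) \<longlonglongrightarrow> 0
          \<and> (\<lambda>k. l2_norm (vol K) (D\<phi> k - G)) \<longlonglongrightarrow> 0)"

definition H1 :: "(real^'n) set \<Rightarrow> (real^'n \<Rightarrow> real) set" where
  "H1 K = {u. \<exists>\<phi> G. H1_limit K \<phi> u G}"

definition weak_grad :: "(real^'n) set \<Rightarrow> (real^'n \<Rightarrow> real) \<Rightarrow> (real^'n \<Rightarrow> real^'n)" where
  "weak_grad K u = (SOME G. \<exists>\<phi>. H1_limit K \<phi> u G)"

definition has_trace :: "(real^'n) set \<Rightarrow> (real^'n \<Rightarrow> real) \<Rightarrow> (real^'n \<Rightarrow> real) \<Rightarrow> bool" where
  "has_trace K u g \<longleftrightarrow> g \<in> L2 (surf K)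
     \<and> (\<exists>\<phi> G. H1_limit K \<phi> u G \<and> (\<lambda>k. l2_norm (surf K) (\<phi> k - g)) \<longlonglongrightarrow> 0)"

definition trace1 :: "(real^'n) set \<Rightarrow> (real^'n \<Rightarrow> real) \<Rightarrow> (real^'n \<Rightarrow> real)" where
  "trace1 K u = (SOME g. has_trace K u g)"

definition H1_vec :: "(real^'n) set \<Rightarrow> (real^'n \<Rightarrow> real^'n) set" where
  "H1_vec K = {v. \<forall>i. (\<lambda>x. v x $ i) \<in> H1 K}"

definition H1_sym :: "(real^'n) set \<Rightarrow> (real^'n \<Rightarrow> real^'n^'n) set" where
  "H1_sym K = {\<tau>. (AE x in vol K. transpose (\<tau> x) = \<tau> x) \<and> (\<forall>i j. (\<lambda>x. \<tau> x $ i $ j) \<in> H1 K)}"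

definition bd :: "(real^'n) set \<Rightarrow> (real^'n \<Rightarrow> real^'n) \<Rightarrow> (real^'n \<Rightarrow> real^'n)" where
  "bd K v = (\<lambda>x. \<chi> i. trace1 K (\<lambda>y. v y $ i) x)"

definition grad_vec :: "(real^'n) set \<Rightarrow> (real^'n \<Rightarrow> real^'n) \<Rightarrow> (real^'n \<Rightarrow> real^'n^'n)" where
  "grad_vec K v = (\<lambda>x. \<chi> i. weak_grad K (\<lambda>y. v y $ i) x)"

definition sym_grad :: "(real^'n) set \<Rightarrow> (real^'n \<Rightarrow> real^'n) \<Rightarrow> (real^'n \<Rightarrow> real^'n^'n)" where
  "sym_grad K v = (\<lambda>x. (1/2) *\<^sub>R (grad_vec K v x + transpose (grad_vec K v x)))"

text \<open>Weak row-wise divergence; \<open>\<tau> x $ i\<close> is the \<open>i\<close>-th row of \<open>\<tau> x\<close>.\<close>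

definition has_weak_div ::
  "(real^'n) set \<Rightarrow> (real^'n \<Rightarrow> real^'n^'n) \<Rightarrow> (real^'n \<Rightarrow> real^'n) \<Rightarrow> bool" where
  "has_weak_div K \<tau> d \<longleftrightarrow> d \<in> L2 (vol K)
     \<and> (\<forall>\<phi> D\<phi> C. C1_function \<phi> D\<phi> \<longrightarrow> compact C \<longrightarrow> C \<subseteq> K \<longrightarrow> (\<forall>x. x \<notin> C \<longrightarrow> \<phi> x = 0) \<longrightarrow>
          (\<forall>i. (\<integral>x. d x $ i * \<phi> x \<partial>vol K) = - (\<integral>x. \<tau> x $ i \<bullet> D\<phi> x \<partial>vol K)))"

definition weak_div :: "(real^'n) set \<Rightarrow> (real^'n \<Rightarrow> real^'n^'n) \<Rightarrow> (real^'n \<Rightarrow> real^'n)" where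
  "weak_div K \<tau> = (SOME d. has_weak_div K \<tau> d)"

definition Hdiv_sym :: "(real^'n) set \<Rightarrow> (real^'n \<Rightarrow> real^'n^'n) set" where
  "Hdiv_sym K = {\<tau> \<in> L2 (vol K). (AE x in vol K. transpose (\<tau> x) = \<tau> x) \<and> (\<exists>d. has_weak_div K \<tau> d)}"

text \<open>
  The normal trace \<open>\<tau> n\<close> of \<open>\<tau> \<in> H(div)\<close> is the functional on traces of \<open>H\<^sup>1\<close> functions given by
  Green's formula; \<open>has_normal_trace K \<tau> g\<close> says that it is represented by \<open>g \<in> L\<^sup>2(\<partial>K)\<close>.
\<close>

definition has_normal_trace ::
  "(real^'n) set \<Rightarrow> (real^'n \<Rightarrow> real^'n^'n) \<Rightarrow> (real^'n \<Rightarrow> real^'n) \<Rightarrow> bool" where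
  "has_normal_trace K \<tau> g \<longleftrightarrow> g \<in> L2 (surf K)
     \<and> (\<forall>v\<in>H1_vec K. l2_inner (surf K) g (bd K v)
          = l2_inner (vol K) (weak_div K \<tau>) v + l2_inner (vol K) \<tau> (grad_vec K v))"

definition normal_trace :: "(real^'n) set \<Rightarrow> (real^'n \<Rightarrow> real^'n^'n) \<Rightarrow> (real^'n \<Rightarrow> real^'n)" where
  "normal_trace K \<tau> = (SOME g. has_normal_trace K \<tau> g)"


section \<open>M-decompositions, stabilization and the projection\<close>

definition tr :: "(real^'n) set \<Rightarrow> (real^'n \<Rightarrow> real^'n^'n) \<Rightarrow> (real^'n \<Rightarrow> real^'n) \<Rightarrow> (real^'n \<Rightarrow> real^'n)" where
  "tr K \<tau> v = (\<lambda>x. normal_trace K \<tau> x + bd K v x)"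

text \<open>Since \<open>tr\<close> is linear, it is an isomorphism when it is a bijection of a.e. classes.\<close>

definition M_decomposition ::
  "(real^'n) set \<Rightarrow> (real^'n \<Rightarrow> real^'n^'n) set \<Rightarrow> (real^'n \<Rightarrow> real^'n) set \<Rightarrow> (real^'n \<Rightarrow> real^'n) set
    \<Rightarrow> (real^'n \<Rightarrow> real^'n^'n) set \<Rightarrow> (real^'n \<Rightarrow> real^'n) set \<Rightarrow> bool" where
  "M_decomposition K S V M S' V' \<longleftrightarrow>
     (\<forall>\<tau>\<in>S. \<forall>v\<in>V. tr K \<tau> v \<in> M)
     \<and> l2_subspace (vol K) S' \<and> S' \<subseteq> S \<and> l2_subspace (vol K) V' \<and> V' \<subseteq> V
     \<and> (\<forall>v\<in>V. sym_grad K v \<in> S') \<and> (\<forall>\<tau>\<in>S. weak_div K \<tau> \<in> V')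
     \<and> (let Sp = l2_complement (vol K) S S'; Vp = l2_complement (vol K) V V' in
          (\<forall>\<tau>\<in>Sp. \<forall>v\<in>Vp. \<forall>\<tau>'\<in>Sp. \<forall>v'\<in>Vp. ae_eq (surf K) (tr K \<tau> v) (tr K \<tau>' v')
             \<longrightarrow> ae_eq (vol K) \<tau> \<tau>' \<and> ae_eq (vol K) v v')
          \<and> (\<forall>\<mu>\<in>M. \<exists>\<tau>\<in>Sp. \<exists>v\<in>Vp. ae_eq (surf K) (tr K \<tau> v) \<mu>))"

definition nonzero :: "'a measure \<Rightarrow> ('a \<Rightarrow> 'b::euclidean_space) set \<Rightarrow> ('a \<Rightarrow> 'b) set" where
  "nonzero M S = {f \<in> S. \<not> ae_eq M f (\<lambda>x. 0)}"

text \<open>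
  The constants take values in \<open>[0, \<infinity>]\<close>, where the supremum of the empty set is \<open>0\<close>, the
  infimum of the empty set is \<open>\<infinity>\<close> and \<open>x / \<infinity> = 0\<close>. The argument \<open>Vp\<close> below stands for the
  orthogonal complement of \<open>V'\<close> in \<open>V\<close>, and \<open>Sp\<close> for that of \<open>S'\<close> in \<open>S\<close>.
\<close>

definition a_const ::
  "(real^'n) set \<Rightarrow> ((real^'n \<Rightarrow> real^'n) \<Rightarrow> (real^'n \<Rightarrow> real^'n)) \<Rightarrow> (real^'n \<Rightarrow> real^'n) set \<Rightarrow> ennreal" where
  "a_const K \<alpha> Vp = (if nonzero (vol K) Vp = {} then \<infinity>
     else INF \<mu>\<in>nonzero (surf K) (bd K ` Vp).
       ennreal (l2_inner (surf K) (\<alpha> \<mu>) \<mu> / (l2_norm (surf K) \<mu>)\<^sup>2))"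

definition alpha_norm ::
  "(real^'n) set \<Rightarrow> ((real^'n \<Rightarrow> real^'n) \<Rightarrow> (real^'n \<Rightarrow> real^'n)) \<Rightarrow> (real^'n \<Rightarrow> real^'n) set \<Rightarrow> ennreal" where
  "alpha_norm K \<alpha> M = (SUP \<eta>\<in>nonzero (surf K) M. SUP \<mu>\<in>nonzero (surf K) M.
     ennreal (l2_inner (surf K) (\<alpha> \<eta>) \<mu> / (l2_norm (surf K) \<eta> * l2_norm (surf K) \<mu>)))"

definition C_stress :: "(real^'n) set \<Rightarrow> (real^'n \<Rightarrow> real^'n^'n) set \<Rightarrow> ennreal" where
  "C_stress K Sp = (SUP \<tau>\<in>nonzero (vol K) Sp.
     ennreal (diameter K powr (-1/2) * l2_norm (vol K) \<tau>) / ennreal (l2_norm (surf K) (normal_trace K \<tau>)))"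

definition C_displ :: "(real^'n) set \<Rightarrow> (real^'n \<Rightarrow> real^'n) set \<Rightarrow> ennreal" where
  "C_displ K Vp = (SUP v\<in>nonzero (vol K) Vp.
     ennreal (diameter K powr (-1/2) * l2_norm (vol K) v) / ennreal (l2_norm (surf K) (bd K v)))"

definition linear_L2_operator ::
  "'a measure \<Rightarrow> (('a \<Rightarrow> 'b::euclidean_space) \<Rightarrow> ('a \<Rightarrow> 'b)) \<Rightarrow> bool" where
  "linear_L2_operator M \<alpha> \<longleftrightarrow> (\<forall>f\<in>L2 M. \<alpha> f \<in> L2 M)
     \<and> (\<forall>f\<in>L2 M. \<forall>g\<in>L2 M. ae_eq M f g \<longrightarrow> ae_eq M (\<alpha> f) (\<alpha> g))
     \<and> (\<forall>f\<in>L2 M. \<forall>g\<in>L2 M. ae_eq M (\<alpha> (\<lambda>x. f x + g x)) (\<lambda>x. \<alpha> f x + \<alpha> g x))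
     \<and> (\<forall>c. \<forall>f\<in>L2 M. ae_eq M (\<alpha> (\<lambda>x. c *\<^sub>R f x)) (\<lambda>x. c *\<^sub>R \<alpha> f x))"

text \<open>The last conjunct is the convention that \<open>\<alpha> = 0\<close> when \<open>Vp = {0}\<close>.\<close>

definition stabilization ::
  "(real^'n) set \<Rightarrow> ((real^'n \<Rightarrow> real^'n) \<Rightarrow> (real^'n \<Rightarrow> real^'n)) \<Rightarrow> (real^'n \<Rightarrow> real^'n) set \<Rightarrow> bool" where
  "stabilization K \<alpha> Vp \<longleftrightarrow> linear_L2_operator (surf K) \<alpha>
     \<and> (\<forall>\<eta>\<in>L2 (surf K). \<forall>\<mu>\<in>L2 (surf K).
          l2_inner (surf K) (\<alpha> \<eta>) \<mu> = l2_inner (surf K) (\<alpha> \<mu>) \<eta>)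
     \<and> (\<forall>\<mu>\<in>L2 (surf K). 0 \<le> l2_inner (surf K) (\<alpha> \<mu>) \<mu>)
     \<and> 0 < a_const K \<alpha> Vp
     \<and> (nonzero (vol K) Vp = {} \<longrightarrow> (\<forall>\<mu>\<in>L2 (surf K). ae_eq (surf K) (\<alpha> \<mu>) (\<lambda>x. 0)))"

definition hdg_projection ::
  "(real^'n) set \<Rightarrow> (real^'n \<Rightarrow> real^'n^'n) set \<Rightarrow> (real^'n \<Rightarrow> real^'n) set \<Rightarrow> (real^'n \<Rightarrow> real^'n) set
    \<Rightarrow> (real^'n \<Rightarrow> real^'n^'n) set \<Rightarrow> (real^'n \<Rightarrow> real^'n) set
    \<Rightarrow> ((real^'n \<Rightarrow> real^'n) \<Rightarrow> (real^'n \<Rightarrow> real^'n))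
    \<Rightarrow> (real^'n \<Rightarrow> real^'n^'n) \<Rightarrow> (real^'n \<Rightarrow> real^'n)
    \<Rightarrow> (real^'n \<Rightarrow> real^'n^'n) \<Rightarrow> (real^'n \<Rightarrow> real^'n) \<Rightarrow> bool" where
  "hdg_projection K S V M S' V' \<alpha> \<sigma> u \<xi> w \<longleftrightarrow> \<xi> \<in> S \<and> w \<in> V
     \<and> (\<forall>\<tau>\<in>S'. l2_inner (vol K) \<xi> \<tau> = l2_inner (vol K) \<sigma> \<tau>)
     \<and> (\<forall>v\<in>V'. l2_inner (vol K) w v = l2_inner (vol K) u v)
     \<and> (\<forall>\<mu>\<in>M. l2_inner (surf K) (normal_trace K \<xi> - \<alpha> (bd K w)) \<mu>
           = l2_inner (surf K) (normal_trace K \<sigma> - \<alpha> (l2_proj (surf K) M (bd K u))) \<mu>)"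

end

theory Submission
  imports Defs
begin

text \<open>
  For \<open>\<tau>\<close> in \<open>Sp\<close> and \<open>v\<close> in \<open>Vp\<close> Green's formula makes \<open>\<tau> n\<close> and \<open>v\<close> orthogonal on the boundary, because
  \<open>\<epsilon>(v)\<close> lies in \<open>S'\<close> and the divergence of \<open>\<tau>\<close> lies in \<open>V'\<close>. Since these traces span \<open>M\<close>, the boundary
  equation of the projection decouples: testing with traces from \<open>Vp\<close> gives a problem for \<open>v\<close> alone,
  which is definite by (S3), and testing with traces from \<open>Sp\<close> then determines \<open>\<tau>\<close>. Testing the
  equation for the difference to the \<open>L\<^sup>2\<close> projections with \<open>v\<close> and with \<open>\<tau> n\<close> yields two energy
  identities, from which both estimates follow by Cauchy-Schwarz.

  Green's formula itself needs traces of Sobolev functions on a domain bounded by finitely many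
  hyperplanes. For a \<open>C\<^sup>1\<close> function, the difference quotient in a direction \<open>e\<close> leaves an integral over
  thin strips along the facets; rescaled in the normal direction, it converges to the surface
  integral of \<open>f (e \<bullet> n)\<close>. The \<open>L\<^sup>2\<close> norm on the boundary is bounded by the \<open>H\<^sup>1\<close> norm on
  each convex cell of the arrangement of all hyperplanes, where the divergence theorem applies to
  the field \<open>f\<^sup>2 (x - p)\<close> with an interior point \<open>p\<close>.
\<close>

section \<open>Surface measure\<close>

text \<open>Traces, weak gradients, divergences, normal traces and projections are all picked by
  \<open>SOME\<close>, and from functions rather than from classes. Nothing can be said about them
  before existence is known, and they are linear and compatible with a.e. equality only up to null
  sets; the uniqueness behind this rests on the density of polynomials, that is, on
  Stone-Weierstrass.

  No local charts occur: the geometric input is a finite set of hyperplanes. A shift by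
  \<open>t e\<close> changes the indicator of the element only in strips of thickness
  \<open>t (e \<bullet> \<nu>)\<close>; stretching them to thickness 1 has a Jacobian which, divided
  by \<open>t\<close>, is exactly the factor \<open>e \<bullet> \<nu>\<close> of the flux. The field
  \<open>x - p\<close> is used on convex cells because there \<open>(x - p) \<bullet> \<nu>\<close>
  has a positive lower bound on every facet, which can fail on a general element.

  The constants take values in \<open>[0, \<infinity>]\<close> and are never shown to be finite. The
  estimates are therefore carried out in \<open>ennreal\<close>, and a factor is cancelled only
  where it is known to be finite and positive.\<close>

text \<open>Uniqueness of translation-invariant measures: Fubini and the invariance of both measures
  turn \<open>\<mu> A * lborel B\<close> into \<open>lborel A * \<mu> B\<close> for a symmetric set
  \<open>B\<close>, and on a ball around 0 the two measures agree because \<open>R\<close> preserves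
  norms.\<close>

lemma lborel_distr_isometry:
  fixes R :: "real^'n \<Rightarrow> real^'n"
  assumes "orthogonal_transformation R"
  shows "distr lborel borel R = lborel"
proof (rule measure_eqI)
  have linR: "linear R" using assms orthogonal_transformation_linear by blast
  have [measurable]: "R \<in> borel_measurable borel"
    using linR by (simp add: borel_measurable_continuous_onI linear_continuous_on linear_linear)
  define \<mu> where "\<mu> = distr lborel borel R"
  have sets_mu [measurable_cong]: "sets \<mu> = sets borel" by (simp add: \<mu>_def)
  interpret mu: sigma_finite_measure \<mu>
  proof -
    obtain R' where R': "orthogonal_transformation R'" "\<And>x. R' (R x) = x" "\<And>x. R (R' x) = x"
      using assms by (metis orthogonal_transformation_bij orthogonal_transformation_inv bij_inv_eq_iff bij_is_surj surj_f_inv_f)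
    show "sigma_finite_measure \<mu>"
    proof
      show "\<exists>A. countable A \<and> A \<subseteq> sets \<mu> \<and> \<Union> A = space \<mu> \<and> (\<forall>a\<in>A. emeasure \<mu> a \<noteq> \<infinity>)"
      proof (intro exI conjI ballI)
        let ?A = "range (\<lambda>n::nat. ball (0::real^'n) (real n))"
        show "countable ?A" by simp
        show "?A \<subseteq> sets \<mu>" by (auto simp: sets_mu)
        show "\<Union>?A = space \<mu>"
          by (auto simp: \<mu>_def) (meson reals_Archimedean2)
        fix a assume "a \<in> ?A"
        then obtain n :: nat where a: "a = ball 0 (real n)" by auto
        have "R -` a = a" using assms a by (auto simp: orthogonal_transformation_norm)
        then show "emeasure \<mu> a \<noteq> \<infinity>"
          using emeasure_bounded_finite[of a] by (auto simp: \<mu>_def emeasure_distr a)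
      qed
    qed
  qed
  interpret pr: pair_sigma_finite \<mu> lborel ..
  have tr_lb: "(\<integral>\<^sup>+y. f (y + x) \<partial>lborel) = (\<integral>\<^sup>+y. f y \<partial>lborel)"
    if [measurable]: "f \<in> borel_measurable borel" for f and x :: "real^'n"
    by (subst (2) lborel_distr_plus[of x, symmetric]) (simp add: nn_integral_distr add.commute)
  have tr_mu: "(\<integral>\<^sup>+y. f (y + x) \<partial>\<mu>) = (\<integral>\<^sup>+y. f y \<partial>\<mu>)"
    if [measurable]: "f \<in> borel_measurable borel" for f and x :: "real^'n"
  proof -
    \<comment> \<open>By linearity of \<open>R\<close>, translating the image by \<open>x\<close>
      amounts to translating the argument by a preimage of \<open>x\<close>.\<close>
    obtain x' where x': "R x' = x"
      using orthogonal_transformation_surj[OF assms] by (metis surjD)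
    have "(\<integral>\<^sup>+y. f (y + x) \<partial>\<mu>) = (\<integral>\<^sup>+y. f (R (y + x')) \<partial>lborel)"
      by (simp add: \<mu>_def nn_integral_distr linear_add[OF linR] x')
    also have "\<dots> = (\<integral>\<^sup>+y. f (R y) \<partial>lborel)" by (rule tr_lb) measurable
    also have "\<dots> = (\<integral>\<^sup>+y. f y \<partial>\<mu>)" by (simp add: \<mu>_def nn_integral_distr)
    finally show ?thesis .
  qed
  \<comment> \<open>The reference set: invariant under \<open>R\<close>, symmetric under negation,
    and of finite positive volume, so that it cancels at the end.\<close>
  define B where "B = ball (0::real^'n) 1"
  have [measurable]: "B \<in> sets borel" by (simp add: B_def)
  have Bsym: "-x \<in> B \<longleftrightarrow> x \<in> B" for x by (simp add: B_def)
  have muB: "emeasure \<mu> B = emeasure lborel B"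
  proof -
    have "R -` B = B" using assms by (auto simp: B_def orthogonal_transformation_norm)
    then show ?thesis by (simp add: \<mu>_def emeasure_distr)
  qed
  fix A assume "A \<in> sets (distr lborel borel R)"
  then have [measurable]: "A \<in> sets borel" by simp
  have "emeasure \<mu> A * emeasure lborel B = (\<integral>\<^sup>+x. \<integral>\<^sup>+y. indicator A x * indicator B y \<partial>lborel \<partial>\<mu>)"
    by (simp add: nn_integral_cmult nn_integral_multc sets_mu)
  also have "\<dots> = (\<integral>\<^sup>+x. \<integral>\<^sup>+y. indicator A x * indicator B (y + (- x)) \<partial>lborel \<partial>\<mu>)"
    by (intro nn_integral_cong tr_lb[symmetric]) measurable
  also have "\<dots> = (\<integral>\<^sup>+y. \<integral>\<^sup>+x. indicator A x * indicator B (y + (- x)) \<partial>\<mu> \<partial>lborel)"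
    by (rule pr.Fubini'[symmetric]) measurable
  also have "\<dots> = (\<integral>\<^sup>+y. \<integral>\<^sup>+x. indicator A (x + y) * indicator B (y + (- (x + y))) \<partial>\<mu> \<partial>lborel)"
    by (intro nn_integral_cong tr_mu[symmetric]) measurable
  also have "\<dots> = (\<integral>\<^sup>+y. \<integral>\<^sup>+x. indicator A (y + x) * indicator B x \<partial>\<mu> \<partial>lborel)"
    by (simp add: indicator_def Bsym add.commute)
  also have "\<dots> = (\<integral>\<^sup>+x. \<integral>\<^sup>+y. indicator A (y + x) * indicator B x \<partial>lborel \<partial>\<mu>)"
    by (rule pr.Fubini') measurable
  also have "\<dots> = (\<integral>\<^sup>+x. \<integral>\<^sup>+y. indicator A y * indicator B x \<partial>lborel \<partial>\<mu>)"
    by (intro nn_integral_cong tr_lb[where f = "\<lambda>y. indicator A y * indicator B _"]) measurable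
  also have "\<dots> = emeasure lborel A * emeasure lborel B"
    by (simp add: nn_integral_cmult nn_integral_multc sets_mu muB)
  finally have "emeasure \<mu> A * emeasure lborel B = emeasure lborel A * emeasure lborel B" .
  moreover have "emeasure lborel B \<noteq> \<infinity>" 
    using emeasure_bounded_finite[of B] by (simp add: B_def)
  moreover have "emeasure lborel B \<noteq> 0"
    using content_ball_pos[of 1 "0 :: real^'n"] by (auto simp: B_def measure_def)
  ultimately show "emeasure (distr lborel borel R) A = emeasure lborel A"
    unfolding \<mu>_def by (simp add: mult.commute[of _ "emeasure lborel B"] ennreal_mult_cancel_left)
qed simp

text \<open>The map stretches by \<open>s\<close> along \<open>\<nu>\<close> and fixes the plane
  \<open>\<nu> \<bullet> x = c\<close>. A rotation that takes an axis to \<open>\<nu>\<close>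
  reduces it to the scaling of one coordinate followed by a translation, hence the density
  \<open>s\<close>.\<close>

lemma lborel_normal_scaling:
  fixes \<nu> :: "real^'n"
  assumes "norm \<nu> = 1" "0 < s"
  shows "lborel = density (distr lborel borel (\<lambda>y. y + ((s - 1) * (\<nu> \<bullet> y - c)) *\<^sub>R \<nu>)) (\<lambda>_. ennreal s)"
proof -
  fix k0 :: 'n
  define k where "k = axis k0 (1::real)"
  have kB: "k \<in> Basis" by (simp add: k_def)
  obtain R where R: "orthogonal_transformation R" "R k = \<nu>"
    using orthogonal_transformation_exists[of k \<nu>] assms by (auto simp: k_def)
  have linR: "linear R" using R orthogonal_transformation_linear by blast
  define D where "D x = (\<Sum>j\<in>Basis. ((if j = k then s else 1) * (x \<bullet> j)) *\<^sub>R j)" for x :: "real^'n"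
  \<comment> \<open>Moves the fixed plane from the origin to level \<open>c\<close>.\<close>
  define t where "t = - ((s - 1) * c) *\<^sub>R \<nu>"
  have D: "D x = x + ((s - 1) * (x \<bullet> k)) *\<^sub>R k" for x
  proof -
    have "D x = (\<Sum>j\<in>Basis. (x \<bullet> j) *\<^sub>R j + (if j = k then ((s - 1) * (x \<bullet> k)) *\<^sub>R k else 0))"
      unfolding D_def by (intro sum.cong) (auto simp: algebra_simps)
    then show ?thesis using kB by (simp add: sum.distrib euclidean_representation)
  qed
  have [measurable]: "R \<in> borel_measurable borel"
    using linR by (simp add: borel_measurable_continuous_onI linear_continuous_on linear_linear)
  have [measurable]: "D \<in> borel_measurable borel" unfolding D_def by measurable
  have lbD: "lborel = density (distr lborel borel D) (\<lambda>_. ennreal s)"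
  proof -
    have "lborel = density (distr lborel borel (\<lambda>x. 0 + (\<Sum>j\<in>Basis. ((if j = k then s else 1) * (x \<bullet> j)) *\<^sub>R j)))
       (\<lambda>_. ennreal (\<Prod>j\<in>Basis. \<bar>if j = k then s else 1\<bar>))"
      using lborel_affine_euclidean[of "\<lambda>j. if j = k then s else 1" "0 :: real^'n"] assms(2) by auto
    moreover have "(\<Prod>j\<in>Basis. \<bar>if j = k then s else 1\<bar>) = s"
      using assms kB by (subst prod.remove[of _ k]) auto
    ultimately show ?thesis unfolding D_def by simp
  qed
  define T where "T y = y + ((s - 1) * (\<nu> \<bullet> y - c)) *\<^sub>R \<nu>" for y
  have T: "T (R x) = t + R (D x)" for x
  proof -
    have "\<nu> \<bullet> R x = x \<bullet> k"
      using R by (metis inner_commute orthogonal_transformation_def)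
    then show ?thesis
      using R(2) by (simp add: T_def t_def D linear_add[OF linR] linear_diff[OF linR] linear_scale[OF linR] algebra_simps)
  qed
  have [measurable]: "T \<in> borel_measurable borel" unfolding T_def by measurable
  show ?thesis
  proof (rule measure_eqI)
    fix A :: "(real^'n) set" assume "A \<in> sets lborel"
    then have [measurable]: "A \<in> sets borel" by simp
    have m1: "(+) t -` A \<in> sets borel" by (rule measurable_sets_borel) measurable
    then have m2: "R -` ((+) t -` A) \<in> sets borel" by (rule measurable_sets_borel[rotated]) measurable
    have "distr lborel borel T = distr (distr lborel borel R) borel T"
      using R by (simp add: lborel_distr_isometry)
    also have "\<dots> = distr (distr (distr lborel borel D) borel R) borel ((+) t)"
      by (simp add: distr_distr o_def T)
    finally have dT: "distr lborel borel T = distr (distr (distr lborel borel D) borel R) borel ((+) t)" .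
    have "emeasure (density (distr lborel borel T) (\<lambda>_. ennreal s)) A = ennreal s * emeasure (distr lborel borel T) A"
      by (simp add: emeasure_density_const)
    also have "\<dots> = emeasure (density (distr lborel borel D) (\<lambda>_. ennreal s)) (R -` ((+) t -` A))"
      unfolding dT using m1 m2 by (simp add: emeasure_density_const emeasure_distr del: vimage_comp)
    also have "\<dots> = emeasure (distr (distr lborel borel R) borel ((+) t)) A"
      unfolding lbD[symmetric] using m1 m2 by (simp add: emeasure_distr)
    also have "\<dots> = emeasure lborel A"
      using R by (simp add: lborel_distr_isometry lborel_distr_plus)
    finally show "emeasure lborel A = emeasure (density (distr lborel borel (\<lambda>y. y + ((s - 1) * (\<nu> \<bullet> y - c)) *\<^sub>R \<nu>)) (\<lambda>_. ennreal s)) A"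
      by (simp add: T_def[abs_def])
  qed simp
qed

text \<open>Used with \<open>s = t * \<nu> $ i\<close>, where it replaces a thin strip along a plane
  by the slab of height 1.\<close>

lemma integral_normal_scaling:
  fixes \<nu> :: "real^'n" and f :: "real^'n \<Rightarrow> real"
  assumes "norm \<nu> = 1" "0 < s" and [measurable]: "f \<in> borel_measurable borel"
  shows "(\<integral>x. f x \<partial>lborel) = s * (\<integral>y. f (y + ((s - 1) * (\<nu> \<bullet> y - c)) *\<^sub>R \<nu>) \<partial>lborel)"
proof -
  have "(\<integral>x. f x \<partial>lborel) = (\<integral>x. f x \<partial>density (distr lborel borel (\<lambda>y. y + ((s - 1) * (\<nu> \<bullet> y - c)) *\<^sub>R \<nu>)) (\<lambda>_. ennreal s))"
    using lborel_normal_scaling[OF assms(1,2), of c] by simp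
  also have "\<dots> = s * (\<integral>y. f (y + ((s - 1) * (\<nu> \<bullet> y - c)) *\<^sub>R \<nu>) \<partial>lborel)"
    using assms(2) by (subst integral_density) (auto simp: integral_distr)
  finally show ?thesis .
qed

section \<open>The measure on a hyperplane\<close>

definition plane_proj :: "real^'n \<Rightarrow> real \<Rightarrow> real^'n \<Rightarrow> real^'n" where
  "plane_proj \<nu> c x = x - (\<nu> \<bullet> x - c) *\<^sub>R \<nu>"

definition slab :: "real^'n \<Rightarrow> real \<Rightarrow> (real^'n) set" where
  "slab \<nu> c = {x. c \<le> \<nu> \<bullet> x \<and> \<nu> \<bullet> x \<le> c + 1}"

lemma slab_borel [measurable]: "slab \<nu> c \<in> sets borel"
  unfolding slab_def by measurable

lemma plane_proj_borel [measurable]: "plane_proj \<nu> c \<in> borel_measurable borel"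
  unfolding plane_proj_def[abs_def] by measurable

lemma plane_measure_eq: "plane_measure \<nu> c = distr (restrict_space lborel (slab \<nu> c)) borel (plane_proj \<nu> c)"
  by (simp add: plane_measure_def slab_def plane_proj_def[abs_def])

lemma sets_plane_measure [simp, measurable_cong]: "sets (plane_measure \<nu> c) = sets borel"
  and space_plane_measure [simp]: "space (plane_measure \<nu> c) = UNIV"
  by (simp_all add: plane_measure_def)

lemma plane_proj_restr [measurable]: "plane_proj \<nu> c \<in> borel_measurable (restrict_space lborel (slab \<nu> c))"
  by (rule measurable_restrict_space1) measurable

lemma nn_integral_plane_measure:
  assumes [measurable]: "f \<in> borel_measurable borel"
  shows "(\<integral>\<^sup>+x. f x \<partial>plane_measure \<nu> c) = (\<integral>\<^sup>+x. f (plane_proj \<nu> c x) * indicator (slab \<nu> c) x \<partial>lborel)"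
  unfolding plane_measure_eq by (subst nn_integral_distr) (simp_all add: nn_integral_restrict_space)

lemma integral_plane_measure:
  fixes f :: "real^'n \<Rightarrow> real"
  assumes [measurable]: "f \<in> borel_measurable borel"
  shows "(\<integral>x. f x \<partial>plane_measure \<nu> c) = (\<integral>x. indicator (slab \<nu> c) x * f (plane_proj \<nu> c x) \<partial>lborel)"
  unfolding plane_measure_eq by (subst integral_distr) (simp_all add: integral_restrict_space)

lemma emeasure_plane_measure:
  assumes [measurable]: "A \<in> sets borel"
  shows "emeasure (plane_measure \<nu> c) A = emeasure lborel {x \<in> slab \<nu> c. plane_proj \<nu> c x \<in> A}"
proof -
  have "emeasure (plane_measure \<nu> c) A = (\<integral>\<^sup>+x. indicator A x \<partial>plane_measure \<nu> c)"
    by simp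
  also have "\<dots> = (\<integral>\<^sup>+x. indicator {x \<in> slab \<nu> c. plane_proj \<nu> c x \<in> A} x \<partial>lborel)"
    by (subst nn_integral_plane_measure) (auto simp del: nn_integral_indicator intro!: nn_integral_cong split: split_indicator)
  also have "\<dots> = emeasure lborel {x \<in> slab \<nu> c. plane_proj \<nu> c x \<in> A}"
    by (subst nn_integral_indicator) auto
  finally show ?thesis .
qed

lemma inner_plane_proj:
  assumes "norm \<nu> = 1"
  shows "\<nu> \<bullet> plane_proj \<nu> c x = c"
proof -
  have "\<nu> \<bullet> \<nu> = 1" using assms by (simp add: dot_square_norm)
  then show ?thesis by (simp add: plane_proj_def algebra_simps)
qed

lemma norm_diff_plane_proj: "norm \<nu> = 1 \<Longrightarrow> norm (plane_proj \<nu> c x - x) = \<bar>\<nu> \<bullet> x - c\<bar>"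
  by (simp add: plane_proj_def)

text \<open>The projection moves points of the slab by at most 1, so the prism over a bounded set is
  bounded.\<close>

lemma emeasure_plane_measure_bounded:
  assumes "norm \<nu> = 1" "bounded A" and [measurable]: "A \<in> sets borel"
  shows "emeasure (plane_measure \<nu> c) A < \<infinity>"
proof -
  obtain r where r: "\<And>x. x \<in> A \<Longrightarrow> norm x \<le> r" using assms(2) by (auto simp: bounded_iff)
  have "{x \<in> slab \<nu> c. plane_proj \<nu> c x \<in> A} \<subseteq> cball 0 (r + 1)"
  proof clarify
    fix x assume x: "x \<in> slab \<nu> c" "plane_proj \<nu> c x \<in> A"
    have "norm x \<le> norm (plane_proj \<nu> c x) + norm (plane_proj \<nu> c x - x)"
      by (metis norm_minus_commute norm_triangle_sub)
    then show "x \<in> cball 0 (r + 1)"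
      using x r[OF x(2)] norm_diff_plane_proj[OF assms(1)] by (auto simp: slab_def)
  qed
  then show ?thesis
    using emeasure_bounded_finite[OF bounded_subset[OF bounded_cball]]
    by (subst emeasure_plane_measure) auto
qed

lemma AE_plane_measure_on:
  assumes "norm \<nu> = 1"
  shows "AE x in plane_measure \<nu> c. \<nu> \<bullet> x = c"
proof (rule AE_I[where N = "{x. \<nu> \<bullet> x \<noteq> c}"])
  show "emeasure (plane_measure \<nu> c) {x. \<nu> \<bullet> x \<noteq> c} = 0"
    by (subst emeasure_plane_measure) (auto simp: inner_plane_proj[OF assms])
qed auto

text \<open>This makes edges negligible. Composed with the projection, the equation of the second
  plane reads \<open>w \<bullet> x = d\<close>, where \<open>w\<close> is the part of
  \<open>\<nu>'\<close> tangential to the first plane. If \<open>w\<close> is nonzero this is a null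
  hyperplane; otherwise \<open>\<nu>'\<close> is \<open>\<nu>\<close> or its opposite, and the two
  exclusions make \<open>d\<close> nonzero.\<close>

lemma AE_plane_measure_other:
  assumes "norm \<nu> = 1" "norm \<nu>' = 1" "(\<nu>', c') \<noteq> (\<nu>, c)" "(\<nu>', c') \<noteq> (-\<nu>, -c)"
  shows "AE x in plane_measure \<nu> c. \<nu>' \<bullet> x \<noteq> c'"
proof (rule AE_I[where N = "{x. \<nu>' \<bullet> x = c'}"])
  define w where "w = \<nu>' - (\<nu>' \<bullet> \<nu>) *\<^sub>R \<nu>"
  define d where "d = c' - c * (\<nu>' \<bullet> \<nu>)"
  have eq: "\<nu>' \<bullet> plane_proj \<nu> c x = c' \<longleftrightarrow> w \<bullet> x = d" for x
    by (auto simp: plane_proj_def w_def d_def algebra_simps)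
  have "emeasure lborel {x. w \<bullet> x = d} = 0"
  proof (cases "w = 0")
    case False
    then have "negligible {x. w \<bullet> x = d}" by (rule negligible_hyperplane[OF disjI1])
    then show ?thesis
      by (subst (asm) negligible_iff_null_sets) (auto simp: null_sets_def)
  next
    case True
    then have par: "\<nu>' = (\<nu>' \<bullet> \<nu>) *\<^sub>R \<nu>" by (simp add: w_def)
    then have "norm \<nu>' = \<bar>\<nu>' \<bullet> \<nu>\<bar> * norm \<nu>" by (metis norm_scaleR)
    then have "\<nu>' \<bullet> \<nu> = 1 \<or> \<nu>' \<bullet> \<nu> = -1" using assms by auto
    then have "d \<noteq> 0" using par assms(3,4) by (auto simp: d_def)
    then show ?thesis using True by simp
  qed
  moreover have "emeasure lborel {x \<in> slab \<nu> c. w \<bullet> x = d} \<le> emeasure lborel {x. w \<bullet> x = d}"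
    by (rule emeasure_mono) auto
  ultimately show "emeasure (plane_measure \<nu> c) {x. \<nu>' \<bullet> x = c'} = 0"
    by (subst emeasure_plane_measure) (auto simp: eq)
qed auto

text \<open>The two prisms over a set lie on opposite sides of the plane, and translation by
  \<open>\<nu>\<close> matches them.\<close>

lemma plane_measure_uminus: "plane_measure (-\<nu>) (-c) = plane_measure \<nu> c" if n: "norm \<nu> = 1"
proof (rule measure_eqI)
  fix A assume "A \<in> sets (plane_measure (-\<nu>) (-c))"
  then have [measurable]: "A \<in> sets borel" by simp
  have nn: "\<nu> \<bullet> \<nu> = 1" using n by (simp add: dot_square_norm)
  have pp: "plane_proj (-\<nu>) (-c) (x - \<nu>) = plane_proj \<nu> c x" for x
    using nn by (simp add: plane_proj_def algebra_simps)
  have "emeasure (plane_measure \<nu> c) A = emeasure lborel {x \<in> slab \<nu> c. plane_proj \<nu> c x \<in> A}"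
    by (rule emeasure_plane_measure) measurable
  also have "{x \<in> slab \<nu> c. plane_proj \<nu> c x \<in> A} = (+) (-\<nu>) -` {x \<in> slab (-\<nu>) (-c). plane_proj (-\<nu>) (-c) x \<in> A}"
    using nn pp by (auto simp: slab_def algebra_simps)
  also have "emeasure lborel \<dots> = emeasure (distr lborel borel ((+) (-\<nu>))) {x \<in> slab (-\<nu>) (-c). plane_proj (-\<nu>) (-c) x \<in> A}"
    by (subst emeasure_distr) auto
  also have "\<dots> = emeasure (plane_measure (-\<nu>) (-c)) A"
    unfolding lborel_distr_plus by (rule emeasure_plane_measure[symmetric]) measurable
  finally show "emeasure (plane_measure (-\<nu>) (-c)) A = emeasure (plane_measure \<nu> c) A" by simp
qed simp

section \<open>Facets and the surface measure that they carry\<close>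

text \<open>Small steps along \<open>-\<nu>\<close> from a facet point enter \<open>K\<close>, while
  the point itself violates the strict inequality that describes \<open>K\<close> there.\<close>

lemma facet_subset_frontier:
  assumes "open K" "\<nu> \<noteq> 0"
  shows "facet K \<nu> c \<subseteq> frontier K"
proof
  fix x assume "x \<in> facet K \<nu> c"
  then obtain e where e: "\<nu> \<bullet> x = c" "e > 0" "K \<inter> ball x e = {y \<in> ball x e. \<nu> \<bullet> y < c}"
    by (auto simp: facet_def)
  have "x \<notin> K"
  proof
    assume "x \<in> K"
    then have "x \<in> K \<inter> ball x e" using e(2) by simp
    then show False unfolding e(3) using e(1) by simp
  qed
  moreover have "x \<in> closure K"
  proof (subst closure_approachable, intro allI impI)
    fix \<delta> :: real assume "\<delta> > 0"
    define s where "s = min \<delta> e / (2 * norm \<nu>)"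
    have s: "s > 0" "s * norm \<nu> < \<delta>" "s * norm \<nu> < e"
      using \<open>\<delta> > 0\<close> e assms(2) by (auto simp: s_def min_def field_simps)
    define y where "y = x - s *\<^sub>R \<nu>"
    have "dist y x = s * norm \<nu>" using s by (simp add: y_def dist_norm)
    moreover have "\<nu> \<bullet> y < c" using s e assms by (simp add: y_def inner_diff_right)
    ultimately have "y \<in> K \<inter> ball x e" unfolding e(3) using s by (simp add: dist_commute)
    then have "y \<in> K" by simp
    then show "\<exists>y\<in>K. dist y x < \<delta>" using s \<open>dist y x = s * norm \<nu>\<close> by (intro bexI[of _ y]) simp_all
  qed
  ultimately show "x \<in> frontier K"
    using assms(1) by (simp add: frontier_def interior_open)
qed

text \<open>The local half-space condition survives small displacements, so a facet is an open set
  intersected with its hyperplane.\<close>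

lemma facet_borel [measurable]: "facet K \<nu> c \<in> sets borel"
proof -
  define U where "U = {x. \<exists>e>0. K \<inter> ball x e = {y \<in> ball x e. \<nu> \<bullet> y < c}}"
  have "open U"
  proof (subst open_contains_ball, intro ballI)
    fix x assume "x \<in> U"
    then obtain e where e: "e > 0" "K \<inter> ball x e = {y \<in> ball x e. \<nu> \<bullet> y < c}" by (auto simp: U_def)
    have "ball x (e/2) \<subseteq> U"
    proof
      fix z assume z: "z \<in> ball x (e/2)"
      have sub: "ball z (e/2) \<subseteq> ball x e"
      proof
        fix y assume "y \<in> ball z (e/2)"
        then have "dist z y < e/2" "dist x z < e/2" using z by simp_all
        then show "y \<in> ball x e" using dist_triangle[of x y z] unfolding mem_ball by linarith
      qed
      have "K \<inter> ball z (e/2) = (K \<inter> ball x e) \<inter> ball z (e/2)" using sub by auto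
      also have "\<dots> = {y \<in> ball z (e/2). \<nu> \<bullet> y < c}" unfolding e(2) using sub by auto
      finally have "K \<inter> ball z (e/2) = {y \<in> ball z (e/2). \<nu> \<bullet> y < c}" .
      moreover have "0 < e/2" using e(1) by simp
      ultimately show "z \<in> U" unfolding U_def mem_Collect_eq by (intro exI conjI)
    qed
    then show "\<exists>e>0. ball x e \<subseteq> U" using e(1) by (intro exI[of _ "e/2"]) simp
  qed
  moreover have "facet K \<nu> c = {x. \<nu> \<bullet> x = c} \<inter> U" by (auto simp: facet_def U_def)
  ultimately show ?thesis by simp
qed

text \<open>Both half-spaces describe \<open>K\<close> near \<open>x\<close>, so they contain the
  same directions. The part of \<open>\<nu>'\<close> orthogonal to \<open>\<nu>\<close>, and its
  negative, are directions into neither; this makes the normals parallel, and the direction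
  \<open>-\<nu>\<close> decides the sign.\<close>

lemma facet_unique:
  assumes "norm \<nu> = 1" "norm \<nu>' = 1" "x \<in> facet K \<nu> c" "x \<in> facet K \<nu>' c'"
  shows "\<nu>' = \<nu> \<and> c' = c"
proof -
  obtain e where e: "\<nu> \<bullet> x = c" "e > 0" "K \<inter> ball x e = {y \<in> ball x e. \<nu> \<bullet> y < c}"
    using assms(3) by (auto simp: facet_def)
  obtain e' where e': "\<nu>' \<bullet> x = c'" "e' > 0" "K \<inter> ball x e' = {y \<in> ball x e'. \<nu>' \<bullet> y < c'}"
    using assms(4) by (auto simp: facet_def)
  have nn: "\<nu> \<bullet> \<nu> = 1" "\<nu>' \<bullet> \<nu>' = 1" using assms by (simp_all add: dot_square_norm)
  have same: "\<nu> \<bullet> v < 0 \<longleftrightarrow> \<nu>' \<bullet> v < 0" for v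
  proof -
    \<comment> \<open>Short enough to stay in both balls; the \<open>+ 1\<close> covers
      \<open>v = 0\<close>.\<close>
    define s where "s = min e e' / (2 * (norm v + 1))"
    have s: "s > 0" "s * norm v < e" "s * norm v < e'"
    proof -
      show "s > 0" using e e' by (auto simp: s_def add_nonneg_pos)
      have "s * norm v \<le> s * (norm v + 1)" using \<open>s > 0\<close> by (simp add: algebra_simps)
      also have "\<dots> = min e e' / 2" by (simp add: s_def add_nonneg_eq_0_iff divide_simps)
      finally show "s * norm v < e" "s * norm v < e'" using e e' by auto
    qed
    have "x + s *\<^sub>R v \<in> ball x e" "x + s *\<^sub>R v \<in> ball x e'" using s by (auto simp: dist_norm)
    then have "\<nu> \<bullet> (x + s *\<^sub>R v) < c \<longleftrightarrow> \<nu>' \<bullet> (x + s *\<^sub>R v) < c'" using e e' by blast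
    then show ?thesis using s e e' by (simp add: inner_add_right mult_less_0_iff)
  qed
  define v where "v = \<nu>' - (\<nu> \<bullet> \<nu>') *\<^sub>R \<nu>"
  have "\<nu> \<bullet> v = 0" using nn by (simp add: v_def algebra_simps)
  then have "\<not> \<nu>' \<bullet> v < 0" "\<not> \<nu>' \<bullet> (- v) < 0" using same[of v] same[of "-v"] by auto
  then have "\<nu>' \<bullet> v = 0" by simp
  then have q: "(\<nu> \<bullet> \<nu>')\<^sup>2 = 1" using nn by (simp add: v_def algebra_simps power2_eq_square inner_commute)
  have "\<nu> \<bullet> (-\<nu>) < 0" using nn by simp
  then have "\<nu>' \<bullet> (-\<nu>) < 0" using same by blast
  then have "\<nu> \<bullet> \<nu>' = 1" using q by (auto simp: power2_eq_1_iff inner_commute)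
  then have "(norm (\<nu>' - \<nu>))\<^sup>2 = 0" using nn
    by (simp add: power2_norm_eq_inner algebra_simps inner_commute)
  then show ?thesis using e e' by auto
qed

text \<open>These axioms pass to the convex cells that the planes cut out of \<open>K\<close>, so
  the same theory applies to the element and to its cells. \<open>Q\<close> contains both
  orientations of each plane because either one may be the outward normal of a facet.\<close>

locale flat_domain =
  fixes K :: "(real^'n) set" and Q :: "((real^'n) \<times> real) set"
  assumes open_K: "open K" and bounded_K: "bounded K" and finite_Q: "finite Q"
    and unit_Q: "\<And>\<nu> c. (\<nu>, c) \<in> Q \<Longrightarrow> norm \<nu> = 1"
    and sym_Q: "\<And>\<nu> c. (\<nu>, c) \<in> Q \<Longrightarrow> (-\<nu>, -c) \<in> Q"
    and frontier_Q: "frontier K \<subseteq> (\<Union>(\<nu>, c)\<in>Q. {x. \<nu> \<bullet> x = c})"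
begin

text \<open>A facet contains a relatively open disc, which has positive measure in its plane. Its
  points are frontier points and lie on planes of \<open>Q\<close>; if the plane of the facet were
  not among them, they would all lie in finitely many null sets.\<close>

lemma facet_planes_subset: "facet_planes K \<subseteq> Q"
proof clarify
  fix \<nu> c assume "(\<nu>, c) \<in> facet_planes K"
  then obtain x where n: "norm \<nu> = 1" and "x \<in> facet K \<nu> c" by (auto simp: facet_planes_def)
  then obtain e where e: "\<nu> \<bullet> x = c" "e > 0" "K \<inter> ball x e = {y \<in> ball x e. \<nu> \<bullet> y < c}"
    by (auto simp: facet_def)
  have nn: "\<nu> \<bullet> \<nu> = 1" using n by (simp add: dot_square_norm)
  show "(\<nu>, c) \<in> Q"
  proof (rule ccontr)
    assume nQ: "(\<nu>, c) \<notin> Q"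
    have "AE y in plane_measure \<nu> c. \<forall>(\<nu>', c')\<in>Q. \<nu>' \<bullet> y \<noteq> c'"
    proof (subst AE_finite_all[OF finite_Q], clarify)
      fix \<nu>' c' assume q: "(\<nu>', c') \<in> Q"
      then have "(\<nu>', c') \<noteq> (\<nu>, c)" "(\<nu>', c') \<noteq> (-\<nu>, -c)" using nQ sym_Q[OF q] by auto
      then show "AE y in plane_measure \<nu> c. \<nu>' \<bullet> y \<noteq> c'"
        using AE_plane_measure_other[OF n unit_Q[OF q]] by blast
    qed
    moreover have "AE y in plane_measure \<nu> c. \<nu> \<bullet> y = c" by (rule AE_plane_measure_on[OF n])
    ultimately have "AE y in plane_measure \<nu> c. y \<notin> ball x e"
    proof eventually_elim
      case (elim y)
      show "y \<notin> ball x e"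
      proof
        assume y: "y \<in> ball x e"
        define \<delta> where "\<delta> = e - dist x y"
        have \<delta>: "\<delta> > 0" using y by (simp add: \<delta>_def)
        have "ball y \<delta> \<subseteq> ball x e"
        proof
          fix z assume "z \<in> ball y \<delta>"
          then show "z \<in> ball x e" using dist_triangle[of x z y] unfolding mem_ball \<delta>_def by linarith
        qed
        have "y \<in> facet K \<nu> c"
          unfolding facet_def mem_Collect_eq
        proof (intro conjI exI)
          show "K \<inter> ball y \<delta> = {z \<in> ball y \<delta>. \<nu> \<bullet> z < c}"
          proof -
            have "K \<inter> ball y \<delta> = (K \<inter> ball x e) \<inter> ball y \<delta>" using \<open>ball y \<delta> \<subseteq> ball x e\<close> by auto
            then show ?thesis unfolding e(3) using \<open>ball y \<delta> \<subseteq> ball x e\<close> by auto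
          qed
        qed (use \<delta> elim in auto)
        moreover have "\<nu> \<noteq> 0" using n by auto
        ultimately have "y \<in> frontier K" using facet_subset_frontier[OF open_K] by blast
        then show False using frontier_Q elim(1) by blast
      qed
    qed
    then have "emeasure (plane_measure \<nu> c) (ball x e) = 0"
      by (subst (asm) AE_iff_measurable[where N = "ball x e"]) auto
    \<comment> \<open>The prism over the disc contains a ball around its centre at height 1/2, hence
      has positive volume.\<close>
    moreover have "ball (x + (1/2) *\<^sub>R \<nu>) (min (e/2) (1/2)) \<subseteq> {y \<in> slab \<nu> c. plane_proj \<nu> c y \<in> ball x e}"
    proof
      fix y assume y: "y \<in> ball (x + (1/2) *\<^sub>R \<nu>) (min (e/2) (1/2))"
      define z where "z = y - (x + (1/2) *\<^sub>R \<nu>)"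
      have z: "norm z < e/2" "norm z < 1/2" using y by (auto simp: z_def dist_norm norm_minus_commute)
      have yz: "y = x + (1/2) *\<^sub>R \<nu> + z" by (simp add: z_def)
      have nz: "\<bar>\<nu> \<bullet> z\<bar> \<le> norm z" using Cauchy_Schwarz_ineq2[of \<nu> z] n by simp
      have ny: "\<nu> \<bullet> y = c + 1/2 + \<nu> \<bullet> z" using nn e(1) by (simp add: yz algebra_simps)
      have "plane_proj \<nu> c y - x = z - (\<nu> \<bullet> z) *\<^sub>R \<nu>"
        unfolding plane_proj_def ny by (simp add: yz algebra_simps)
      then have "norm (plane_proj \<nu> c y - x) \<le> norm z + \<bar>\<nu> \<bullet> z\<bar>"
        using n by (metis norm_triangle_ineq4 norm_scaleR mult.right_neutral)
      then have "norm (plane_proj \<nu> c y - x) < e" using z nz by linarith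
      then show "y \<in> {y \<in> slab \<nu> c. plane_proj \<nu> c y \<in> ball x e}"
        using z nz ny by (auto simp: slab_def dist_norm norm_minus_commute abs_le_iff)
    qed
    then have "emeasure lborel (ball (x + (1/2) *\<^sub>R \<nu>) (min (e/2) (1/2))) \<le> emeasure (plane_measure \<nu> c) (ball x e)"
      by (subst emeasure_plane_measure) (auto intro!: emeasure_mono)
    moreover have "emeasure lborel (ball (x + (1/2) *\<^sub>R \<nu>) (min (e/2) (1/2))) \<noteq> 0"
      using content_ball_pos[of "min (e/2) (1/2)" "x + (1/2) *\<^sub>R \<nu>"] e(2) by (auto simp: measure_def)
    ultimately show False by simp
  qed
qed

lemma finite_facet_planes: "finite (facet_planes K)"
  using facet_planes_subset finite_Q finite_subset by blast

lemma unit_facet_planes: "(\<nu>, c) \<in> facet_planes K \<Longrightarrow> norm \<nu> = 1"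
  by (simp add: facet_planes_def)

lemma facet_in_frontier:
  assumes "(\<nu>, c) \<in> facet_planes K"
  shows "facet K \<nu> c \<subseteq> frontier K"
proof -
  have "\<nu> \<noteq> 0" using unit_facet_planes[OF assms] by auto
  then show ?thesis by (rule facet_subset_frontier[OF open_K])
qed

lemma bounded_facet:
  assumes "(\<nu>, c) \<in> facet_planes K"
  shows "bounded (facet K \<nu> c)"
  using bounded_subset[OF compact_imp_bounded[OF compact_frontier_bounded[OF bounded_K]] facet_in_frontier[OF assms]] .

lemma sets_surf [simp, measurable_cong]: "sets (surf K) = sets borel"
  and space_surf [simp]: "space (surf K) = UNIV"
  using sets.sigma_sets_eq[of "borel :: (real^'n) measure"] by (simp_all add: surf_def)

text \<open>\<open>measure_of\<close> returns the given set function only if that function is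
  countably additive, which has to be verified for the sum over the facets.\<close>

lemma emeasure_surf:
  assumes "A \<in> sets borel"
  shows "emeasure (surf K) A = (\<Sum>(\<nu>, c)\<in>facet_planes K. emeasure (plane_measure \<nu> c) (A \<inter> facet K \<nu> c))"
proof (rule emeasure_measure_of[OF surf_def])
  show "countably_additive (sets (surf K)) (\<lambda>A. \<Sum>(\<nu>, c)\<in>facet_planes K. emeasure (plane_measure \<nu> c) (A \<inter> facet K \<nu> c))"
  proof (rule countably_additiveI)
    fix A :: "nat \<Rightarrow> (real^'n) set"
    assume A: "range A \<subseteq> sets (surf K)" "disjoint_family A"
    have "(\<Sum>i. \<Sum>(\<nu>, c)\<in>facet_planes K. emeasure (plane_measure \<nu> c) (A i \<inter> facet K \<nu> c))
        = (\<Sum>(\<nu>, c)\<in>facet_planes K. \<Sum>i. emeasure (plane_measure \<nu> c) (A i \<inter> facet K \<nu> c))"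
      by (subst suminf_sum) (auto intro!: sum.cong)
    also have "\<dots> = (\<Sum>(\<nu>, c)\<in>facet_planes K. emeasure (plane_measure \<nu> c) (\<Union> (range A) \<inter> facet K \<nu> c))"
    proof (intro sum.cong refl, clarify)
      fix \<nu> c
      have [measurable]: "A i \<in> sets borel" for i using A by auto
      have "disjoint_family (\<lambda>i. A i \<inter> facet K \<nu> c)" using A(2) by (auto simp: disjoint_family_on_def)
      then have "(\<Sum>i. emeasure (plane_measure \<nu> c) (A i \<inter> facet K \<nu> c)) = emeasure (plane_measure \<nu> c) (\<Union>i. A i \<inter> facet K \<nu> c)"
        by (intro suminf_emeasure) auto
      then show "(\<Sum>i. emeasure (plane_measure \<nu> c) (A i \<inter> facet K \<nu> c)) = emeasure (plane_measure \<nu> c) (\<Union> (range A) \<inter> facet K \<nu> c)"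
        by simp
    qed
    finally show "(\<Sum>i. \<Sum>(\<nu>, c)\<in>facet_planes K. emeasure (plane_measure \<nu> c) (A i \<inter> facet K \<nu> c))
        = (\<Sum>(\<nu>, c)\<in>facet_planes K. emeasure (plane_measure \<nu> c) (\<Union> (range A) \<inter> facet K \<nu> c))" .
  qed
qed (use assms in \<open>auto simp: positive_def\<close>)

text \<open>Follows from \<open>emeasure_surf\<close> through simple functions and increasing
  limits, since a finite sum commutes with suprema of increasing sequences.\<close>

lemma nn_integral_surf:
  assumes "f \<in> borel_measurable borel"
  shows "(\<integral>\<^sup>+x. f x \<partial>surf K) = (\<Sum>(\<nu>, c)\<in>facet_planes K. \<integral>\<^sup>+x. f x * indicator (facet K \<nu> c) x \<partial>plane_measure \<nu> c)"
proof -
  let ?ms = "\<lambda>f. \<Sum>(\<nu>, c)\<in>facet_planes K. \<integral>\<^sup>+x. f x * indicator (facet K \<nu> c) x \<partial>plane_measure \<nu> c"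
  show ?thesis
    using assms
  proof (induction rule: borel_measurable_induct)
    case (cong f g)
    then show ?case by (simp cong: nn_integral_cong)
  next
    case (set A)
    then show ?case
      by (simp add: emeasure_surf indicator_inter_arith[symmetric])
  next
    case (mult u a)
    then show ?case
      by (simp add: nn_integral_cmult mult.assoc sum_distrib_left case_prod_beta cong: measurable_cong_sets)
  next
    case (add u v)
    then show ?case
      by (simp add: nn_integral_add distrib_right sum.distrib case_prod_beta cong: measurable_cong_sets)
  next
    case (seq U)
    have [measurable]: "U i \<in> borel_measurable borel" for i using seq by simp
    have inc: "incseq (\<lambda>i x. U i x * indicator A x)" for A
      using seq(3) by (auto simp: incseq_def le_fun_def intro!: mult_right_mono)
    have sup: "(SUP i. U i) x * indicator A x = (SUP i. U i x * indicator A x)" for A x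
      by (simp only: SUP_apply SUP_mult_right_ennreal)
    have "(\<integral>\<^sup>+x. (SUP i. U i) x \<partial>surf K) = (SUP i. \<integral>\<^sup>+x. U i x \<partial>surf K)"
      unfolding SUP_apply by (rule nn_integral_monotone_convergence_SUP) (use seq(3) in auto)
    also have "\<dots> = (SUP i. ?ms (U i))" using seq by simp
    also have "\<dots> = (\<Sum>(\<nu>, c)\<in>facet_planes K. SUP i. \<integral>\<^sup>+x. U i x * indicator (facet K \<nu> c) x \<partial>plane_measure \<nu> c)"
      unfolding case_prod_beta
      by (rule ennreal_SUP_sum) (auto intro!: monoI nn_integral_mono mult_right_mono incseqD[OF seq(3), THEN le_funD])
    also have "\<dots> = ?ms (SUP i. U i)"
      unfolding sup
      by (intro sum.cong refl) (auto intro!: nn_integral_monotone_convergence_SUP[symmetric] inc)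
    finally show ?case .
  qed
qed

lemma finite_measure_surf: "finite_measure (surf K)"
proof
  have "emeasure (surf K) UNIV < \<infinity>"
    using finite_facet_planes emeasure_plane_measure_bounded[OF unit_facet_planes bounded_facet]
    by (subst emeasure_surf) (auto simp: less_top[symmetric] )
  then show "emeasure (surf K) (space (surf K)) \<noteq> \<infinity>" by simp
qed

lemma AE_surf_frontier: "AE x in surf K. x \<in> frontier K"
proof (rule AE_I[where N = "- frontier K"])
  have "emeasure (surf K) (- frontier K) = (\<Sum>(\<nu>, c)\<in>facet_planes K. emeasure (plane_measure \<nu> c) (- frontier K \<inter> facet K \<nu> c))"
    by (rule emeasure_surf) (simp add: borel_comp)
  also have "\<dots> = 0"
  proof (intro sum.neutral ballI, clarify)
    fix \<nu> c assume "(\<nu>, c) \<in> facet_planes K"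
    then have "- frontier K \<inter> facet K \<nu> c = {}" using facet_in_frontier by blast
    then show "emeasure (plane_measure \<nu> c) (- frontier K \<inter> facet K \<nu> c) = 0" by simp
  qed
  finally show "emeasure (surf K) (- frontier K) = 0" .
qed (auto simp: borel_comp)

end

section \<open>The jump of the indicator of a domain across a plane\<close>

text \<open>\<open>AE_plane_measure_other\<close> pulled back to the slab, in the form used for
  dominated convergence over \<open>lborel\<close>.\<close>

lemma AE_lborel_proj_other:
  assumes "norm \<nu> = 1" "norm \<nu>' = 1" "(\<nu>', c') \<noteq> (\<nu>, c)" "(\<nu>', c') \<noteq> (-\<nu>, -c)"
  shows "AE y in lborel. y \<in> slab \<nu> c \<longrightarrow> \<nu>' \<bullet> plane_proj \<nu> c y \<noteq> c'"
proof -
  have "{x. \<nu>' \<bullet> x \<noteq> c'} \<in> sets borel" by measurable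
  then have "AE y in restrict_space lborel (slab \<nu> c). \<nu>' \<bullet> plane_proj \<nu> c y \<noteq> c'"
    using AE_plane_measure_other[OF assms] unfolding plane_measure_eq
    by (subst (asm) AE_distr_iff) auto
  then show ?thesis by (subst (asm) AE_restrict_space_iff) auto
qed

lemma AE_lborel_hyperplane:
  fixes \<nu> :: "real^'n"
  assumes "\<nu> \<noteq> 0"
  shows "AE x in lborel. \<nu> \<bullet> x \<noteq> c"
proof (rule AE_I[where N = "{x. \<nu> \<bullet> x = c}"])
  have "negligible {x. \<nu> \<bullet> x = c}" using assms by (intro negligible_hyperplane) auto
  then show "emeasure lborel {x. \<nu> \<bullet> x = c} = 0"
    by (subst (asm) negligible_iff_null_sets) (auto simp: null_sets_def)
qed auto

lemma connected_disjoint_frontier_subset: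
  assumes "connected L" "L \<inter> frontier K = {}" "L \<inter> K \<noteq> {}"
  shows "L \<subseteq> K"
  using connected_Int_frontier[OF assms(1,3)] assms(2) by auto

text \<open>Each open half of the ball is connected and misses the frontier, so it lies in
  \<open>K\<close> entirely or not at all. One sample point on either side therefore decides the
  shape of \<open>K\<close> near \<open>z\<close>.\<close>

lemma facet_iff_sides:
  assumes oK: "open K" and n: "norm \<nu> = 1" and z: "\<nu> \<bullet> z = c" and r: "r > 0"
    and fr: "frontier K \<inter> ball z r \<subseteq> {y. \<nu> \<bullet> y = c}"
    and w1: "w1 \<in> ball z r" "\<nu> \<bullet> w1 < c" and w2: "w2 \<in> ball z r" "c < \<nu> \<bullet> w2"
  shows "z \<in> facet K \<nu> c \<longleftrightarrow> w1 \<in> K \<and> w2 \<notin> K"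
proof -
  have nn: "\<nu> \<bullet> \<nu> = 1" using n by (simp add: dot_square_norm)
  define L where "L = ball z r \<inter> {y. \<nu> \<bullet> y < c}"
  define U where "U = ball z r \<inter> {y. \<nu> \<bullet> y > c}"
  have "connected L" "connected U" unfolding L_def U_def
    by (intro convex_connected convex_Int convex_ball convex_halfspace_lt convex_halfspace_gt)+
  moreover have "L \<inter> frontier K = {}" "U \<inter> frontier K = {}" using fr by (auto simp: L_def U_def)
  ultimately have LU: "L \<inter> K \<noteq> {} \<Longrightarrow> L \<subseteq> K" "U \<inter> K \<noteq> {} \<Longrightarrow> U \<subseteq> K"
    using connected_disjoint_frontier_subset by blast+
  have wLU: "w1 \<in> L" "w2 \<in> U" using w1 w2 by (auto simp: L_def U_def)
  have near: "z - s *\<^sub>R \<nu> \<in> L \<inter> ball z e" "z + s *\<^sub>R \<nu> \<in> U \<inter> ball z e" if "0 < s" "s < r" "s < e" for s e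
    using that n nn z by (auto simp: L_def U_def dist_norm algebra_simps)
  show ?thesis
  proof
    assume "z \<in> facet K \<nu> c"
    then obtain e where e: "e > 0" "K \<inter> ball z e = {y \<in> ball z e. \<nu> \<bullet> y < c}" by (auto simp: facet_def)
    define s where "s = min r e / 2"
    have s: "0 < s" "s < r" "s < e" using r e by (auto simp: s_def)
    have "z - s *\<^sub>R \<nu> \<in> K \<inter> ball z e" unfolding e(2) using near(1)[OF s] by (auto simp: L_def)
    then have "L \<subseteq> K" using near(1)[OF s] LU(1) by blast
    moreover have "z + s *\<^sub>R \<nu> \<notin> K"
    proof
      assume "z + s *\<^sub>R \<nu> \<in> K"
      then have "z + s *\<^sub>R \<nu> \<in> K \<inter> ball z e" using near(2)[OF s] by simp
      then show False unfolding e(2) using near(2)[OF s] by (auto simp: U_def)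
    qed
    then have "U \<inter> K = {}" using near(2)[OF s] LU(2) by blast
    ultimately show "w1 \<in> K \<and> w2 \<notin> K" using wLU by blast
  next
    assume w: "w1 \<in> K \<and> w2 \<notin> K"
    then have L: "L \<subseteq> K" and U: "U \<inter> K = {}" using LU wLU by blast+
    \<comment> \<open>Since \<open>K\<close> is open, a point of it on the plane would bring points
      above the plane into \<open>K\<close>.\<close>
    have "y \<notin> K" if y: "y \<in> ball z r" "\<nu> \<bullet> y = c" for y
    proof
      assume "y \<in> K"
      then have "y \<in> K \<inter> ball z r" using y by simp
      then obtain d where d: "d > 0" "ball y d \<subseteq> K \<inter> ball z r"
        using oK by (meson open_Int open_ball open_contains_ball)
      have "y + (d/2) *\<^sub>R \<nu> \<in> ball y d" using d n by (simp add: dist_norm)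
      moreover have "\<nu> \<bullet> (y + (d/2) *\<^sub>R \<nu>) > c" using d y nn by (simp add: algebra_simps)
      ultimately show False using d(2) U unfolding U_def by blast
    qed
    then have side: "y \<in> K \<longleftrightarrow> \<nu> \<bullet> y < c" if "y \<in> ball z r" for y
      using that L U unfolding L_def U_def by (cases "\<nu> \<bullet> y" c rule: linorder_cases) (blast | auto)+
    have "K \<inter> ball z r = {y \<in> ball z r. \<nu> \<bullet> y < c}"
      using side by blast
    then show "z \<in> facet K \<nu> c" using z r unfolding facet_def by blast
  qed
qed

text \<open>The facet with normal \<open>-\<nu>\<close> accounts for \<open>K\<close> lying above
  the plane. If \<open>K\<close> lies on both sides or on neither, both differences vanish.\<close>

lemma facet_jump:
  assumes oK: "open K" and n: "norm \<nu> = 1" and z: "\<nu> \<bullet> z = c" and r: "r > 0"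
    and fr: "frontier K \<inter> ball z r \<subseteq> {y. \<nu> \<bullet> y = c}"
    and w1: "w1 \<in> ball z r" "\<nu> \<bullet> w1 < c" and w2: "w2 \<in> ball z r" "c < \<nu> \<bullet> w2"
  shows "(indicator K w1 - indicator K w2 :: real) = indicator (facet K \<nu> c) z - indicator (facet K (-\<nu>) (-c)) z"
proof -
  have "z \<in> facet K \<nu> c \<longleftrightarrow> w1 \<in> K \<and> w2 \<notin> K" by (rule facet_iff_sides[OF assms])
  moreover have "z \<in> facet K (-\<nu>) (-c) \<longleftrightarrow> w2 \<in> K \<and> w1 \<notin> K"
    by (rule facet_iff_sides[OF oK _ _ r]) (use assms in auto)
  ultimately show ?thesis by (auto simp: indicator_def)
qed

section \<open>The outward normal and surface integrals of bounded functions\<close>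

text \<open>At most one summand is nonzero, by \<open>facet_unique\<close>. The value off the facets
  is 0, and those points form a null set of \<open>surf K\<close>.\<close>

definition outer_normal :: "(real^'n) set \<Rightarrow> real^'n \<Rightarrow> real^'n" where
  "outer_normal K x = (\<Sum>(\<nu>, c)\<in>facet_planes K. indicator (facet K \<nu> c) x *\<^sub>R \<nu>)"

context flat_domain
begin

lemma outer_normal_facet:
  assumes q: "(\<nu>, c) \<in> facet_planes K" and x: "x \<in> facet K \<nu> c"
  shows "outer_normal K x = \<nu>"
proof -
  have "outer_normal K x = (\<Sum>q\<in>facet_planes K. if q = (\<nu>, c) then \<nu> else 0)"
    unfolding outer_normal_def
  proof (rule sum.cong[OF refl])
    fix q' assume "q' \<in> facet_planes K"
    moreover obtain \<nu>' c' where [simp]: "q' = (\<nu>', c')" by fastforce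
    ultimately have q': "(\<nu>', c') \<in> facet_planes K" by simp
    show "(case q' of (\<nu>, c) \<Rightarrow> indicator (facet K \<nu> c) x *\<^sub>R \<nu>) = (if q' = (\<nu>, c) then \<nu> else 0)"
    proof (cases "x \<in> facet K \<nu>' c'")
      case True
      then show ?thesis
        using facet_unique[OF unit_facet_planes[OF q] unit_facet_planes[OF q'] x] by simp
    next
      case False
      then show ?thesis using x by auto
    qed
  qed
  also have "\<dots> = \<nu>" using q by (simp add: sum.delta[OF finite_facet_planes])
  finally show ?thesis .
qed

lemma outer_normal_borel [measurable]: "outer_normal K \<in> borel_measurable borel"
  unfolding outer_normal_def[abs_def] case_prod_beta by measurable

text \<open>The decomposition of \<open>surf K\<close> is available for nonnegative integrals, so
  nonnegative functions come first; the signed case is obtained from the positive and the negative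
  part. A bound on the frontier suffices because \<open>surf K\<close> lives there.\<close>

lemma integral_surf_nonneg:
  fixes f :: "real^'n \<Rightarrow> real"
  assumes [measurable]: "f \<in> borel_measurable borel"
    and B: "\<And>x. x \<in> frontier K \<Longrightarrow> f x \<le> B" and nneg: "\<And>x. 0 \<le> f x"
  shows "integrable (surf K) f
    \<and> (\<forall>(\<nu>, c)\<in>facet_planes K. integrable (plane_measure \<nu> c) (\<lambda>x. indicator (facet K \<nu> c) x * f x))
    \<and> (\<integral>x. f x \<partial>surf K) = (\<Sum>(\<nu>, c)\<in>facet_planes K. \<integral>x. indicator (facet K \<nu> c) x * f x \<partial>plane_measure \<nu> c)"
proof -
  interpret finite_measure "surf K" by (rule finite_measure_surf)
  have int: "integrable (surf K) f"
    by (rule integrable_const_bound[where B = B]) (use AE_surf_frontier in eventually_elim, auto simp: B nneg)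
  have intp: "integrable (plane_measure \<nu> c) (\<lambda>x. indicator (facet K \<nu> c) x * f x)"
    if q: "(\<nu>, c) \<in> facet_planes K" for \<nu> c
  proof (rule Bochner_Integration.integrable_bound)
    show "integrable (plane_measure \<nu> c) (\<lambda>x. indicator (facet K \<nu> c) x * B)"
      using emeasure_plane_measure_bounded[OF unit_facet_planes[OF q] bounded_facet[OF q]]
      by (intro integrable_mult_left integrable_real_indicator) auto
    show "AE x in plane_measure \<nu> c. norm (indicator (facet K \<nu> c) x * f x) \<le> norm (indicator (facet K \<nu> c) x * B)"
    proof (intro AE_I2)
      fix x
      show "norm (indicator (facet K \<nu> c) x * f x) \<le> norm (indicator (facet K \<nu> c) x * B)"
        using facet_in_frontier[OF q] B[of x] nneg[of x] by (auto simp: indicator_def)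
    qed
  qed measurable
  have "ennreal (\<integral>x. f x \<partial>surf K) = (\<integral>\<^sup>+x. ennreal (f x) \<partial>surf K)"
    using int nneg by (simp add: nn_integral_eq_integral)
  also have "\<dots> = (\<Sum>(\<nu>, c)\<in>facet_planes K. \<integral>\<^sup>+x. ennreal (f x) * indicator (facet K \<nu> c) x \<partial>plane_measure \<nu> c)"
    by (rule nn_integral_surf) measurable
  also have "\<dots> = (\<Sum>(\<nu>, c)\<in>facet_planes K. ennreal (\<integral>x. indicator (facet K \<nu> c) x * f x \<partial>plane_measure \<nu> c))"
  proof (intro sum.cong refl, clarify)
    fix \<nu> c assume q: "(\<nu>, c) \<in> facet_planes K"
    have "(\<integral>\<^sup>+x. ennreal (f x) * indicator (facet K \<nu> c) x \<partial>plane_measure \<nu> c)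
        = (\<integral>\<^sup>+x. ennreal (indicator (facet K \<nu> c) x * f x) \<partial>plane_measure \<nu> c)"
      by (intro nn_integral_cong) (auto simp: indicator_def)
    then show "(\<integral>\<^sup>+x. ennreal (f x) * indicator (facet K \<nu> c) x \<partial>plane_measure \<nu> c)
        = ennreal (\<integral>x. indicator (facet K \<nu> c) x * f x \<partial>plane_measure \<nu> c)"
      using intp[OF q] nneg by (simp add: nn_integral_eq_integral)
  qed
  also have "\<dots> = ennreal (\<Sum>(\<nu>, c)\<in>facet_planes K. \<integral>x. indicator (facet K \<nu> c) x * f x \<partial>plane_measure \<nu> c)"
    unfolding case_prod_beta by (rule sum_ennreal) (simp add: nneg)
  finally have "(\<integral>x. f x \<partial>surf K) = (\<Sum>(\<nu>, c)\<in>facet_planes K. \<integral>x. indicator (facet K \<nu> c) x * f x \<partial>plane_measure \<nu> c)"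
    using nneg by (subst (asm) ennreal_inj) (auto intro!: sum_nonneg integral_nonneg_AE)
  then show ?thesis using int intp by auto
qed

lemma integral_surf:
  fixes f :: "real^'n \<Rightarrow> real"
  assumes [measurable]: "f \<in> borel_measurable borel" and B: "\<And>x. x \<in> frontier K \<Longrightarrow> \<bar>f x\<bar> \<le> B"
  shows "integrable (surf K) f"
    and "(\<integral>x. f x \<partial>surf K) = (\<Sum>(\<nu>, c)\<in>facet_planes K. \<integral>x. indicator (facet K \<nu> c) x * f x \<partial>plane_measure \<nu> c)"
proof -
  define p m where "p x = max 0 (f x)" and "m x = max 0 (- f x)" for x
  have [measurable]: "p \<in> borel_measurable borel" "m \<in> borel_measurable borel"
    unfolding p_def[abs_def] m_def[abs_def] by measurable
  have f: "f x = p x - m x" for x by (simp add: p_def m_def)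
  have pm: "p x \<le> B" "m x \<le> B" if "x \<in> frontier K" for x
    using B[OF that] by (auto simp: p_def m_def max_def abs_if split: if_splits)
  have P: "integrable (surf K) p
    \<and> (\<forall>(\<nu>, c)\<in>facet_planes K. integrable (plane_measure \<nu> c) (\<lambda>x. indicator (facet K \<nu> c) x * p x))
    \<and> (\<integral>x. p x \<partial>surf K) = (\<Sum>(\<nu>, c)\<in>facet_planes K. \<integral>x. indicator (facet K \<nu> c) x * p x \<partial>plane_measure \<nu> c)"
    by (rule integral_surf_nonneg[where B = B]) (auto simp: pm, simp add: p_def)
  have M: "integrable (surf K) m
    \<and> (\<forall>(\<nu>, c)\<in>facet_planes K. integrable (plane_measure \<nu> c) (\<lambda>x. indicator (facet K \<nu> c) x * m x))
    \<and> (\<integral>x. m x \<partial>surf K) = (\<Sum>(\<nu>, c)\<in>facet_planes K. \<integral>x. indicator (facet K \<nu> c) x * m x \<partial>plane_measure \<nu> c)"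
    by (rule integral_surf_nonneg[where B = B]) (auto simp: pm, simp add: m_def)
  show "integrable (surf K) f" unfolding f[abs_def] using P M by simp
  have "(\<integral>x. f x \<partial>surf K) = (\<integral>x. p x \<partial>surf K) - (\<integral>x. m x \<partial>surf K)"
    unfolding f using P M by (subst Bochner_Integration.integral_diff) auto
  also have "\<dots> = (\<Sum>(\<nu>, c)\<in>facet_planes K. (\<integral>x. indicator (facet K \<nu> c) x * p x \<partial>plane_measure \<nu> c) - (\<integral>x. indicator (facet K \<nu> c) x * m x \<partial>plane_measure \<nu> c))"
    using P M by (simp add: sum_subtractf case_prod_beta)
  also have "\<dots> = (\<Sum>(\<nu>, c)\<in>facet_planes K. \<integral>x. indicator (facet K \<nu> c) x * f x \<partial>plane_measure \<nu> c)"
    unfolding f right_diff_distrib using P M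
    by (intro sum.cong refl, clarify, subst Bochner_Integration.integral_diff) auto
  finally show "(\<integral>x. f x \<partial>surf K) = (\<Sum>(\<nu>, c)\<in>facet_planes K. \<integral>x. indicator (facet K \<nu> c) x * f x \<partial>plane_measure \<nu> c)" .
qed

end

section \<open>The divergence theorem\<close>

lemma C1_function_continuous:
  assumes "C1_function f Df"
  shows "continuous_on UNIV f" "continuous_on UNIV Df"
proof -
  have "isCont f x" for x
    using assms unfolding C1_function_def gderiv_def by (meson has_derivative_continuous)
  then show "continuous_on UNIV f" by (simp add: continuous_at_imp_continuous_on)
  show "continuous_on UNIV Df" using assms by (simp add: C1_function_def)
qed

lemma C1_function_measurable:
  assumes "C1_function f Df"
  shows "f \<in> borel_measurable borel" "Df \<in> borel_measurable borel"
  using C1_function_continuous[OF assms] by (auto intro: borel_measurable_continuous_onI)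

lemma bounded_on_cball:
  fixes f :: "real^'n \<Rightarrow> 'a::real_normed_vector"
  assumes "continuous_on UNIV f"
  obtains B where "B > 0" "\<And>x. norm x \<le> r \<Longrightarrow> norm (f x) \<le> B"
proof -
  have "bounded (f ` cball 0 r)"
    by (intro compact_imp_bounded compact_continuous_image continuous_on_subset[OF assms]) auto
  then show ?thesis using that by (auto simp: bounded_pos)
qed

text \<open>\<open>shift_strip \<nu> c a t\<close> consists of the points \<open>x\<close> such that a segment from \<open>x\<close> with
  displacement \<open>- t e\<close>, where \<open>\<nu> \<bullet> e = a\<close>, meets the hyperplane \<open>\<nu> \<bullet> x = c\<close>.\<close>

definition shift_strip :: "real^'n \<Rightarrow> real \<Rightarrow> real \<Rightarrow> real \<Rightarrow> (real^'n) set" where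
  "shift_strip \<nu> c a t = {x. c \<le> \<nu> \<bullet> x \<and> \<nu> \<bullet> x \<le> c + t * a}"

lemma shift_strip_borel [measurable]: "shift_strip \<nu> c a t \<in> sets borel"
  unfolding shift_strip_def by measurable

section \<open>Crossing a single plane by a small shift\<close>

context flat_domain
begin

definition plane_flux :: "(real^'n \<Rightarrow> real) \<Rightarrow> (real^'n) \<times> real \<Rightarrow> real" where
  "plane_flux f = (\<lambda>(\<nu>, c). \<integral>x. indicator (facet K \<nu> c) x * f x \<partial>plane_measure \<nu> c)"

text \<open>The remaining planes of \<open>Q\<close> form a closed set that misses
  \<open>z\<close>.\<close>

lemma frontier_near_plane:
  assumes q: "(\<nu>, c) \<in> Q" and z: "\<And>\<nu>' c'. (\<nu>', c') \<in> Q \<Longrightarrow> (\<nu>', c') \<noteq> (\<nu>, c) \<Longrightarrow> (\<nu>', c') \<noteq> (-\<nu>, -c) \<Longrightarrow> \<nu>' \<bullet> z \<noteq> c'"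
  obtains r where "r > 0" "frontier K \<inter> ball z r \<subseteq> {y. \<nu> \<bullet> y = c}"
proof -
  define Q' where "Q' = Q - {(\<nu>, c), (-\<nu>, -c)}"
  define F where "F = (\<Union>(\<nu>', c')\<in>Q'. {x. \<nu>' \<bullet> x = c'})"
  have "closed F" unfolding F_def using finite_Q by (intro closed_UN) (auto simp: Q'_def closed_hyperplane)
  moreover have "z \<notin> F" using z by (auto simp: F_def Q'_def)
  ultimately obtain r where r: "r > 0" "ball z r \<inter> F = {}"
    by (metis Compl_iff disjoint_eq_subset_Compl open_Compl open_contains_ball)
  have "frontier K \<inter> ball z r \<subseteq> {y. \<nu> \<bullet> y = c}"
  proof
    fix y assume y: "y \<in> frontier K \<inter> ball z r"
    then obtain \<nu>' c' where q': "(\<nu>', c') \<in> Q" "\<nu>' \<bullet> y = c'" using frontier_Q by blast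
    moreover have "y \<notin> F" using y r by blast
    ultimately have "(\<nu>', c') = (\<nu>, c) \<or> (\<nu>', c') = (-\<nu>, -c)" by (auto simp: F_def Q'_def)
    then show "y \<in> {y. \<nu> \<bullet> y = c}" using q' by auto
  qed
  then show ?thesis using that r by blast
qed

text \<open>\<open>T t\<close> has the same projection to the plane as \<open>y\<close>, with its
  height scaled into the strip of thickness \<open>t * \<nu> $ i\<close>. For small \<open>t\<close>
  it is so close to the projection that neither it nor its shift reaches another plane: no other
  strip contains it, and the jump is that of the one facet.\<close>

lemma shift_limit:
  fixes i :: 'n
  defines "e \<equiv> axis i (1::real)"
  defines "Qp \<equiv> {(\<nu>, c) \<in> Q. 0 < \<nu> $ i}"
  defines "N t x \<equiv> (\<Sum>(\<nu>, c)\<in>Qp. indicator (shift_strip \<nu> c (\<nu> $ i) t) x :: real)"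
  assumes q: "(\<nu>, c) \<in> Qp" and y: "c < \<nu> \<bullet> y" "\<nu> \<bullet> y < c + 1"
    and z: "\<And>\<nu>' c'. (\<nu>', c') \<in> Q \<Longrightarrow> (\<nu>', c') \<noteq> (\<nu>, c) \<Longrightarrow> (\<nu>', c') \<noteq> (-\<nu>, -c) \<Longrightarrow> \<nu>' \<bullet> plane_proj \<nu> c y \<noteq> c'"
  defines "T t \<equiv> y + ((t * \<nu> $ i - 1) * (\<nu> \<bullet> y - c)) *\<^sub>R \<nu>"
  shows "\<exists>\<delta>>0. \<forall>t. 0 < t \<longrightarrow> t < \<delta> \<longrightarrow> N t (T t) = 1
    \<and> (indicator K (T t - t *\<^sub>R e) - indicator K (T t) :: real)
       = indicator (facet K \<nu> c) (plane_proj \<nu> c y) - indicator (facet K (-\<nu>) (-c)) (plane_proj \<nu> c y)"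
proof -
  define z0 where "z0 = plane_proj \<nu> c y"
  define a where "a = \<nu> $ i"
  define s where "s = \<nu> \<bullet> y - c"
  have qQ: "(\<nu>, c) \<in> Q" and a: "a > 0" using q by (auto simp: Qp_def a_def)
  have n: "norm \<nu> = 1" using unit_Q[OF qQ] .
  have nn: "\<nu> \<bullet> \<nu> = 1" using n by (simp add: dot_square_norm)
  have a1: "a \<le> 1" using n component_le_norm_cart[of \<nu> i] by (simp add: a_def)
  have s: "0 < s" "s < 1" using y by (auto simp: s_def)
  have zc: "\<nu> \<bullet> z0 = c" using inner_plane_proj[OF n] by (simp add: z0_def)
  have T: "T t = z0 + (t * a * s) *\<^sub>R \<nu>" for t
    by (simp add: T_def z0_def plane_proj_def a_def s_def algebra_simps)
  have ie: "\<nu>' \<bullet> e = \<nu>' $ i" for \<nu>' :: "real^'n" by (simp add: e_def inner_axis)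
  obtain r where r: "r > 0" "frontier K \<inter> ball z0 r \<subseteq> {y. \<nu> \<bullet> y = c}"
    using frontier_near_plane[OF qQ] z z0_def by blast
  \<comment> \<open>The least offset of \<open>z0\<close> from the competing planes; the inserted 1
    keeps \<open>Min\<close> meaningful when there are none.\<close>
  define m where "m = Min (insert 1 ((\<lambda>(\<nu>', c'). \<bar>\<nu>' \<bullet> z0 - c'\<bar>) ` (Qp - {(\<nu>, c)})))"
  have finQp: "finite Qp" using finite_Q by (auto simp: Qp_def intro: finite_subset[of _ Q])
  have other: "\<nu>' \<bullet> z0 \<noteq> c'" if "(\<nu>', c') \<in> Qp - {(\<nu>, c)}" for \<nu>' c'
  proof -
    have "(\<nu>', c') \<in> Q" "(\<nu>', c') \<noteq> (\<nu>, c)" "(\<nu>', c') \<noteq> (-\<nu>, -c)"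
      using that a by (auto simp: Qp_def a_def)
    then show ?thesis using z unfolding z0_def by blast
  qed
  have "0 < (case q' of (\<nu>', c') \<Rightarrow> \<bar>\<nu>' \<bullet> z0 - c'\<bar>)" if "q' \<in> Qp - {(\<nu>, c)}" for q'
    using other[of "fst q'" "snd q'"] that by (simp add: case_prod_beta)
  then have m: "m > 0" unfolding m_def using finQp by (subst Min_gr_iff) auto
  have mle: "m \<le> \<bar>\<nu>' \<bullet> z0 - c'\<bar>" if "(\<nu>', c') \<in> Qp - {(\<nu>, c)}" for \<nu>' c'
    unfolding m_def using finQp that by (intro Min_le) force+
  \<comment> \<open>The point and its shift lie within \<open>2 * t\<close> of \<open>z0\<close>;
    and the displacement of the point together with the width of a competing strip uses up at most
    \<open>2 * t\<close> of the offset \<open>m\<close>.\<close>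
  define \<delta> where "\<delta> = min (r/2) (m/2)"
  show ?thesis
  proof (intro exI[of _ \<delta>] conjI allI impI)
    show "\<delta> > 0" using r m by (simp add: \<delta>_def)
    fix t :: real assume t: "0 < t" "t < \<delta>"
    have tas: "0 < t * a * s" "t * a * s < t * a" "t * a \<le> t" using t a a1 s by auto
    show "N t (T t) = 1"
    proof -
      have "N t (T t) = (\<Sum>q'\<in>Qp. if q' = (\<nu>, c) then 1 else 0)"
        unfolding N_def
      proof (rule sum.cong[OF refl])
        fix q' assume "q' \<in> Qp"
        moreover obtain \<nu>' c' where [simp]: "q' = (\<nu>', c')" by fastforce
        ultimately have q': "(\<nu>', c') \<in> Qp" by simp
        show "(case q' of (\<nu>, c) \<Rightarrow> indicator (shift_strip \<nu> c (\<nu> $ i) t) (T t)) = (if q' = (\<nu>, c) then 1 else 0 :: real)"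
        proof (cases "(\<nu>', c') = (\<nu>, c)")
          case True
          have "\<nu> \<bullet> T t = c + t * a * s" using nn zc by (simp add: T inner_add_right)
          then have "T t \<in> shift_strip \<nu> c (\<nu> $ i) t"
            using tas(1,2) unfolding shift_strip_def a_def mem_Collect_eq by linarith
          then show ?thesis using True by simp
        next
          case False
          have n': "norm \<nu>' = 1" using q' unit_Q by (auto simp: Qp_def)
          have "\<nu>' $ i \<le> 1" using n' component_le_norm_cart[of \<nu>' i] by simp
          then have t1: "t * \<nu>' $ i \<le> t" using t by simp
          have "\<bar>\<nu>' \<bullet> \<nu>\<bar> \<le> 1" using Cauchy_Schwarz_ineq2[of \<nu>' \<nu>] n n' by simp
          then have "(t * a * s) * \<bar>\<nu>' \<bullet> \<nu>\<bar> \<le> (t * a * s) * 1"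
            using tas(1) by (intro mult_left_mono) simp_all
          moreover have "\<bar>(t * a * s) * (\<nu>' \<bullet> \<nu>)\<bar> = (t * a * s) * \<bar>\<nu>' \<bullet> \<nu>\<bar>"
            using tas(1) by (simp only: abs_mult[of "t * a * s"] abs_of_pos)
          ultimately have "\<bar>(t * a * s) * (\<nu>' \<bullet> \<nu>)\<bar> \<le> t" using tas by linarith
          moreover have "\<nu>' \<bullet> T t = \<nu>' \<bullet> z0 + (t * a * s) * (\<nu>' \<bullet> \<nu>)" by (simp add: T inner_add_right)
          moreover have "2 * t < \<bar>\<nu>' \<bullet> z0 - c'\<bar>" using mle q' False t by (force simp: \<delta>_def)
          ultimately have "\<not> (c' \<le> \<nu>' \<bullet> T t \<and> \<nu>' \<bullet> T t \<le> c' + t * \<nu>' $ i)" using t t1 by linarith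
          then show ?thesis using False by (simp add: shift_strip_def)
        qed
      qed
      also have "\<dots> = 1" using q finQp by simp
      finally show ?thesis .
    qed
    show "(indicator K (T t - t *\<^sub>R e) - indicator K (T t) :: real)
       = indicator (facet K \<nu> c) (plane_proj \<nu> c y) - indicator (facet K (-\<nu>) (-c)) (plane_proj \<nu> c y)"
      unfolding z0_def[symmetric]
    proof (rule facet_jump[OF open_K n zc r])
      have d2: "dist z0 (T t) = t * a * s" using tas n by (simp add: T dist_norm)
      have tr: "2 * t < r" using t by (simp add: \<delta>_def)
      show "T t \<in> ball z0 r" unfolding mem_ball d2 using tas tr t by linarith
      have "dist z0 (T t - t *\<^sub>R e) \<le> dist z0 (T t) + dist (T t) (T t - t *\<^sub>R e)" by (rule dist_triangle)
      also have "dist (T t) (T t - t *\<^sub>R e) = t" using t by (simp add: dist_norm e_def norm_axis_1)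
      finally show "T t - t *\<^sub>R e \<in> ball z0 r" unfolding mem_ball using d2 tas tr by linarith
      \<comment> \<open>The shift lowers the height by \<open>t * a\<close>, and
        \<open>0 < s < 1\<close> places the height \<open>t * a * s\<close> strictly between 0 and
        \<open>t * a\<close>.\<close>
      show "\<nu> \<bullet> (T t - t *\<^sub>R e) < c" using tas zc nn
        by (simp add: T inner_add_right inner_diff_right ie a_def)
      show "c < \<nu> \<bullet> T t" using tas zc nn by (simp add: T inner_add_right)
    qed
  qed
qed

text \<open>The segment from \<open>x\<close> to its shift meets the frontier, hence a plane of
  \<open>Q\<close>. A plane parallel to \<open>e\<close> would contain \<open>x\<close> as well,
  which \<open>tang\<close> excludes; any other plane has one orientation with
  \<open>\<nu> $ i\<close> positive, and \<open>x\<close> is then above it by at most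
  \<open>t * \<nu> $ i\<close>.\<close>

lemma jump_in_strip:
  fixes i :: 'n
  defines "e \<equiv> axis i (1::real)"
  assumes t: "0 < t" and jump: "(x \<in> K) \<noteq> (x - t *\<^sub>R e \<in> K)"
    and tang: "\<And>\<nu> c. (\<nu>, c) \<in> Q \<Longrightarrow> \<nu> $ i = 0 \<Longrightarrow> \<nu> \<bullet> x \<noteq> c"
  obtains \<nu> c where "(\<nu>, c) \<in> Q" "0 < \<nu> $ i" "x \<in> shift_strip \<nu> c (\<nu> $ i) t"
proof -
  have "closed_segment x (x - t *\<^sub>R e) \<inter> frontier K \<noteq> {}"
  proof (rule connected_Int_frontier)
    show "closed_segment x (x - t *\<^sub>R e) \<inter> K \<noteq> {}" "closed_segment x (x - t *\<^sub>R e) - K \<noteq> {}"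
      using jump by auto
  qed simp
  then obtain u where u: "0 \<le> u" "u \<le> 1" "(1 - u) *\<^sub>R x + u *\<^sub>R (x - t *\<^sub>R e) \<in> frontier K"
    by (auto simp: closed_segment_def)
  have "(1 - u) *\<^sub>R x + u *\<^sub>R (x - t *\<^sub>R e) = x - (u * t) *\<^sub>R e" by (simp add: algebra_simps)
  then obtain \<nu> c where q: "(\<nu>, c) \<in> Q" "\<nu> \<bullet> (x - (u * t) *\<^sub>R e) = c" using u(3) frontier_Q by auto
  have ie: "\<nu> \<bullet> x = c + u * t * \<nu> $ i" using q(2) by (simp add: e_def inner_diff_right inner_axis)
  have ut: "0 \<le> u * t" "u * t \<le> t" using u t by (simp_all add: mult_left_le_one_le)
  have nz: "\<nu> $ i \<noteq> 0" using tang[OF q(1)] ie by auto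
  show ?thesis
  proof (cases "0 < \<nu> $ i")
    case True
    then have "x \<in> shift_strip \<nu> c (\<nu> $ i) t"
      using ie ut mult_right_mono[OF ut(2), of "\<nu> $ i"] by (simp add: shift_strip_def)
    then show ?thesis using that q True by blast
  next
    case False
    then have "0 < (-\<nu>) $ i" using nz by simp
    moreover from this have "x \<in> shift_strip (-\<nu>) (-c) ((-\<nu>) $ i) t"
      using ie ut mult_right_mono[OF ut(2), of "- \<nu> $ i"] by (simp add: shift_strip_def mult_nonneg_nonpos)
    ultimately show ?thesis using that sym_Q[OF q(1)] by blast
  qed
qed

end

section \<open>The two limits of the shift quotient\<close>

lemma integrable_bounded_cball:
  fixes h :: "real^'n \<Rightarrow> real"
  assumes "h \<in> borel_measurable borel" "\<And>x. \<bar>h x\<bar> \<le> C * indicator (cball 0 r) x"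
  shows "integrable lborel h"
proof (rule Bochner_Integration.integrable_bound)
  show "integrable lborel (\<lambda>x::real^'n. C * indicator (cball 0 r) x :: real)"
    using emeasure_bounded_finite[of "cball (0::real^'n) r"]
    by (intro integrable_mult_right integrable_real_indicator) auto
  show "AE x in lborel. norm (h x) \<le> norm (C * indicator (cball 0 r) x :: real)"
    using assms(2) by (intro AE_I2) (simp, smt (verit))
qed (use assms in auto)

lemma C1_function_Lipschitz:
  assumes C1: "C1_function f Df" and L: "\<And>x. norm x \<le> r \<Longrightarrow> norm (Df x) \<le> L"
    and x: "norm x \<le> r" "norm y \<le> r"
  shows "\<bar>f x - f y\<bar> \<le> L * norm (x - y)"
proof -
  have "norm (f x - f y) \<le> L * norm (x - y)"
  proof (rule differentiable_bound[where S = "cball 0 r" and f' = "\<lambda>x h. h \<bullet> Df x"])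
    fix z :: "real^'a" assume z: "z \<in> cball 0 r"
    show "(f has_derivative (\<lambda>h. h \<bullet> Df z)) (at z within cball 0 r)"
      using C1 unfolding C1_function_def gderiv_def by (meson has_derivative_at_withinI)
    show "onorm (\<lambda>h. h \<bullet> Df z) \<le> L"
    proof (rule onorm_bound)
      have zL: "norm (Df z) \<le> L" using L z by simp
      then show "0 \<le> L" using norm_ge_zero order_trans by blast
      fix h :: "real^'a"
      have "norm (h \<bullet> Df z) \<le> norm h * norm (Df z)" using Cauchy_Schwarz_ineq2 by auto
      also have "\<dots> \<le> norm h * L" using zL by (simp add: mult_left_mono)
      finally show "norm (h \<bullet> Df z) \<le> L * norm h" by (simp add: mult.commute)
    qed
  qed (use x in auto)
  then show ?thesis by simp
qed

lemma C1_function_difference_quotient: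
  assumes C1: "C1_function f Df" and t: "t \<longlonglongrightarrow> 0" "\<And>k::nat. t k > 0"
  shows "(\<lambda>k. (f (x + t k *\<^sub>R e) - f x) / t k) \<longlonglongrightarrow> e \<bullet> Df x"
proof -
  have d: "(f has_derivative (\<lambda>h. h \<bullet> Df x)) (at (x + 0 *\<^sub>R e))"
    using C1 by (simp add: C1_function_def gderiv_def)
  have "((\<lambda>s. x + s *\<^sub>R e) has_derivative (\<lambda>s. s *\<^sub>R e)) (at 0)"
    by (auto intro!: derivative_eq_intros)
  then have "((\<lambda>s. f (x + s *\<^sub>R e)) has_derivative (\<lambda>s. (s *\<^sub>R e) \<bullet> Df x)) (at 0)"
    by (rule has_derivative_compose[of "\<lambda>s. x + s *\<^sub>R e" "\<lambda>s. s *\<^sub>R e" 0 UNIV f "\<lambda>h. h \<bullet> Df x", OF _ d])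
  then have "((\<lambda>s. f (x + s *\<^sub>R e)) has_field_derivative (e \<bullet> Df x)) (at 0)"
    by (simp add: has_field_derivative_def mult.commute[of _ "e \<bullet> Df x"])
  then have "((\<lambda>s. (f (x + s *\<^sub>R e) - f x) / s) \<longlongrightarrow> e \<bullet> Df x) (at 0)"
    by (simp add: has_field_derivative_iff)
  moreover have "filterlim t (at 0) sequentially"
    using t by (auto simp: filterlim_at intro!: always_eventually) (metis less_irrefl)
  ultimately show ?thesis by (rule filterlim_compose)
qed

context flat_domain
begin

text \<open>Translation invariance moves the shift from the indicator to \<open>f\<close>. What
  remains is a difference quotient of \<open>f\<close> over \<open>K\<close>, dominated by a
  Lipschitz constant.\<close>

lemma shift_integral_limit:
  fixes i :: 'n
  defines "e \<equiv> axis i (1::real)"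
  assumes C1: "C1_function f Df" and t: "t \<longlonglongrightarrow> 0" "\<And>k::nat. 0 < t k" "\<And>k. t k \<le> 1"
  shows "(\<lambda>k. (\<integral>x. (indicator K (x - t k *\<^sub>R e) - indicator K x) * f x \<partial>lborel) / t k)
    \<longlonglongrightarrow> (\<integral>x. indicator K x * Df x $ i \<partial>lborel)"
proof -
  note [measurable] = C1_function_measurable[OF C1]
  have [measurable]: "K \<in> sets borel" using open_K by simp
  have [measurable]: "(\<lambda>x. Df x $ i) \<in> borel_measurable borel"
    using C1_function_continuous(2)[OF C1] by (intro borel_measurable_continuous_onI continuous_on_component)
  obtain R where R: "R > 0" "\<And>x. x \<in> K \<Longrightarrow> norm x \<le> R" using bounded_K by (auto simp: bounded_pos)
  \<comment> \<open>Radius \<open>R + 1\<close> because the shifts have length at most 1.\<close>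
  obtain L where L: "L > 0" "\<And>x. norm x \<le> R + 1 \<Longrightarrow> norm (Df x) \<le> L"
    using bounded_on_cball[OF C1_function_continuous(2)[OF C1]] by blast
  obtain B where B: "B > 0" "\<And>x. norm x \<le> R + 1 \<Longrightarrow> norm (f x) \<le> B"
    using bounded_on_cball[OF C1_function_continuous(1)[OF C1]] by blast
  have ne: "norm (s *\<^sub>R e) = \<bar>s\<bar>" for s by (simp add: e_def norm_axis_1)
  have nt: "norm (x + t k *\<^sub>R e) \<le> R + 1" if "norm x \<le> R" for x k
    using norm_triangle_ineq[of x "t k *\<^sub>R e"] that t(2)[of k] t(3)[of k] ne[of "t k"] by linarith
  have fB: "\<bar>f x\<bar> \<le> B" if "x \<in> K" for x
    using B(2)[of x] R(2)[OF that] by simp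
  have quot: "(\<integral>x. (indicator K (x - t k *\<^sub>R e) - indicator K x) * f x \<partial>lborel) / t k
      = (\<integral>x. indicator K x * ((f (x + t k *\<^sub>R e) - f x) / t k) \<partial>lborel)" for k
  proof -
    have i1: "integrable lborel (\<lambda>x. indicator K x * f (x + t k *\<^sub>R e))"
      by (rule integrable_bounded_cball[where C = B and r = R])
        (use R B nt in \<open>auto simp: indicator_def\<close>)
    have i2: "integrable lborel (\<lambda>x. indicator K x * f x)"
      by (rule integrable_bounded_cball[where C = B and r = R])
        (use R fB B(1) in \<open>auto simp: indicator_def\<close>)
    have i3: "integrable lborel (\<lambda>x. indicator K (x - t k *\<^sub>R e) * f x)"
    proof (rule integrable_bounded_cball[where C = B and r = "R + 1"])
      show "\<bar>indicator K (x - t k *\<^sub>R e) * f x\<bar> \<le> B * indicator (cball 0 (R + 1)) x" for x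
        using nt[of "x - t k *\<^sub>R e" k] R(2)[of "x - t k *\<^sub>R e"] B by (auto simp: indicator_def)
    qed measurable
    have "(\<integral>x. indicator K (x - t k *\<^sub>R e) * f x \<partial>lborel)
        = (\<integral>x. indicator K (x - t k *\<^sub>R e) * f x \<partial>distr lborel borel ((+) (t k *\<^sub>R e)))"
      by (simp add: lborel_distr_plus)
    also have "\<dots> = (\<integral>x. indicator K x * f (x + t k *\<^sub>R e) \<partial>lborel)"
      by (subst integral_distr) (auto simp: add.commute)
    finally have eq: "(\<integral>x. indicator K (x - t k *\<^sub>R e) * f x \<partial>lborel) = (\<integral>x. indicator K x * f (x + t k *\<^sub>R e) \<partial>lborel)" .
    have "(\<integral>x. (indicator K (x - t k *\<^sub>R e) - indicator K x) * f x \<partial>lborel)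
       = (\<integral>x. indicator K (x - t k *\<^sub>R e) * f x \<partial>lborel) - (\<integral>x. indicator K x * f x \<partial>lborel)"
      using i2 i3 by (simp add: left_diff_distrib)
    also have "\<dots> = (\<integral>x. indicator K x * (f (x + t k *\<^sub>R e) - f x) \<partial>lborel)"
      unfolding eq using i1 i2 by (simp add: right_diff_distrib)
    finally show ?thesis by simp
  qed
  show ?thesis
    unfolding quot
  proof (rule integral_dominated_convergence[where w = "\<lambda>x. L * indicator (cball 0 R) x"])
    show "integrable lborel (\<lambda>x::real^'n. L * indicator (cball 0 R) x :: real)"
      by (rule integrable_bounded_cball[where C = L and r = R]) (measurable, use L(1) in \<open>auto simp: indicator_def\<close>)
    show "AE x in lborel. (\<lambda>k. indicator K x * ((f (x + t k *\<^sub>R e) - f x) / t k)) \<longlonglongrightarrow> indicator K x * Df x $ i"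
    proof (intro AE_I2 tendsto_mult tendsto_const)
      fix x
      show "(\<lambda>k. (f (x + t k *\<^sub>R e) - f x) / t k) \<longlonglongrightarrow> Df x $ i"
        using C1_function_difference_quotient[OF C1 t(1,2), of x e] by (simp add: e_def inner_axis')
    qed
    show "AE x in lborel. norm (indicator K x * ((f (x + t k *\<^sub>R e) - f x) / t k)) \<le> L * indicator (cball 0 R) x" for k
    proof (intro AE_I2)
      fix x
      show "norm (indicator K x * ((f (x + t k *\<^sub>R e) - f x) / t k)) \<le> L * indicator (cball 0 R) x"
      proof (cases "x \<in> K")
        case True
        have "\<bar>f (x + t k *\<^sub>R e) - f x\<bar> \<le> L * norm (x + t k *\<^sub>R e - x)"
          by (rule C1_function_Lipschitz[where r = "R + 1", OF C1 L(2)]) (use nt[OF R(2)[OF True], of k] R(2)[OF True] in \<open>linarith+\<close>)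
        also have "\<dots> = L * t k" using t(2)[of k] ne[of "t k"] by simp
        finally show ?thesis using True R(2)[OF True] t(2)[of k] by (simp add: field_simps abs_divide)
      qed (use L in auto)
    qed
  qed (measurable, measurable)
qed

text \<open>The substitution \<open>T k\<close> maps the slab of height 1 onto the shrinking strip,
  so the domain of integration becomes fixed and \<open>shift_limit\<close> gives the pointwise
  limit almost everywhere.\<close>

lemma strip_integral_limit:
  fixes i :: 'n
  defines "e \<equiv> axis i (1::real)"
  defines "Qp \<equiv> {(\<nu>, c) \<in> Q. 0 < \<nu> $ i}"
  defines "N s x \<equiv> (\<Sum>(\<nu>, c)\<in>Qp. indicator (shift_strip \<nu> c (\<nu> $ i) s) x :: real)"
  assumes C1: "C1_function f Df" and t: "t \<longlonglongrightarrow> 0" "\<And>k::nat. 0 < t k" "\<And>k. t k \<le> 1"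
    and q: "(\<nu>, c) \<in> Qp"
  shows "(\<lambda>k. (\<integral>x. indicator (shift_strip \<nu> c (\<nu> $ i) (t k)) x / N (t k) x
        * ((indicator K (x - t k *\<^sub>R e) - indicator K x) * f x) \<partial>lborel) / t k)
    \<longlonglongrightarrow> \<nu> $ i * (\<integral>y. indicator (slab \<nu> c) y * ((indicator (facet K \<nu> c) (plane_proj \<nu> c y)
        - indicator (facet K (-\<nu>) (-c)) (plane_proj \<nu> c y)) * f (plane_proj \<nu> c y)) \<partial>lborel)"
proof -
  note [measurable] = C1_function_measurable[OF C1]
  have [measurable]: "K \<in> sets borel" using open_K by simp
  define a where "a = \<nu> $ i"
  have qQ: "(\<nu>, c) \<in> Q" and a: "a > 0" using q by (auto simp: Qp_def a_def)
  have n: "norm \<nu> = 1" using unit_Q[OF qQ] .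
  have nn: "\<nu> \<bullet> \<nu> = 1" using n by (simp add: dot_square_norm)
  have a1: "a \<le> 1" using n component_le_norm_cart[of \<nu> i] by (simp add: a_def)
  have finQp: "finite Qp" using finite_Q by (auto simp: Qp_def intro: finite_subset[of _ Q])
  obtain R where R: "R > 0" "\<And>x. x \<in> K \<Longrightarrow> norm x \<le> R" using bounded_K by (auto simp: bounded_pos)
  obtain B where B: "B > 0" "\<And>x. norm x \<le> R + 1 \<Longrightarrow> norm (f x) \<le> B"
    using bounded_on_cball[OF C1_function_continuous(1)[OF C1]] by blast
  have ne: "norm (s *\<^sub>R e) = \<bar>s\<bar>" for s by (simp add: e_def norm_axis_1)
  have [measurable]: "N s \<in> borel_measurable borel" for s
    unfolding N_def[abs_def] case_prod_beta by measurable
  define g where "g k x = (indicator K (x - t k *\<^sub>R e) - indicator K x :: real)" for k x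
  define W where "W k x = indicator (shift_strip \<nu> c a (t k)) x / N (t k) x" for k x
  define T where "T k y = y + ((t k * a - 1) * (\<nu> \<bullet> y - c)) *\<^sub>R \<nu>" for k y
  have [measurable]: "g k \<in> borel_measurable borel" "W k \<in> borel_measurable borel" "T k \<in> borel_measurable borel" for k
    unfolding g_def[abs_def] W_def[abs_def] T_def[abs_def] by measurable
  have ta: "0 < t k * a" "t k * a \<le> 1" for k
    using t(2)[of k] t(3)[of k] a a1 by (auto simp: mult_le_one)
  have \<nu>T: "\<nu> \<bullet> T k y = c + t k * a * (\<nu> \<bullet> y - c)" for k y
    using nn by (simp add: T_def inner_add_right algebra_simps)
  have strip_T: "T k y \<in> shift_strip \<nu> c a (t k) \<longleftrightarrow> y \<in> slab \<nu> c" for k y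
  proof -
    have "T k y \<in> shift_strip \<nu> c a (t k) \<longleftrightarrow> 0 \<le> (t k * a) * (\<nu> \<bullet> y - c) \<and> (t k * a) * (\<nu> \<bullet> y - c) \<le> t k * a * 1"
      by (simp add: shift_strip_def \<nu>T)
    also have "\<dots> \<longleftrightarrow> y \<in> slab \<nu> c"
    proof -
      have "0 \<le> (t k * a) * (\<nu> \<bullet> y - c) \<longleftrightarrow> 0 \<le> \<nu> \<bullet> y - c"
        using mult_le_cancel_left_pos[OF ta(1)[of k], of 0 "\<nu> \<bullet> y - c"] by simp
      then show ?thesis
        unfolding mult_le_cancel_left_pos[OF ta(1)] by (auto simp: slab_def)
    qed
    finally show ?thesis .
  qed
  \<comment> \<open>The Jacobian \<open>t k * a\<close> divided by \<open>t k\<close> leaves the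
    normal component \<open>a\<close>.\<close>
  have scaled: "(\<integral>x. W k x * (g k x * f x) \<partial>lborel) / t k = a * (\<integral>y. W k (T k y) * (g k (T k y) * f (T k y)) \<partial>lborel)" for k
    using t(2)[of k] integral_normal_scaling[OF n ta(1)[of k], of "\<lambda>x. W k x * (g k x * f x)" c]
    by (simp add: T_def)
  have W1: "\<bar>W k x\<bar> \<le> indicator (shift_strip \<nu> c a (t k)) x" for k x
  proof -
    have "indicator (shift_strip \<nu> c a (t k)) x \<le> N (t k) x"
      unfolding N_def using member_le_sum[OF q, of "\<lambda>(\<nu>, c). indicator (shift_strip \<nu> c (\<nu> $ i) (t k)) x :: real"] finQp
      by (auto simp: a_def)
    then show ?thesis by (auto simp: W_def indicator_def)
  qed
  have lim: "(\<lambda>k. \<integral>y. W k (T k y) * (g k (T k y) * f (T k y)) \<partial>lborel)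
    \<longlonglongrightarrow> (\<integral>y. indicator (slab \<nu> c) y * ((indicator (facet K \<nu> c) (plane_proj \<nu> c y)
        - indicator (facet K (-\<nu>) (-c)) (plane_proj \<nu> c y)) * f (plane_proj \<nu> c y)) \<partial>lborel)"
  proof (rule integral_dominated_convergence[where w = "\<lambda>x. B * indicator (cball 0 (R + 2)) x"])
    show "integrable lborel (\<lambda>x::real^'n. B * indicator (cball 0 (R + 2)) x :: real)"
      by (rule integrable_bounded_cball[where C = B and r = "R + 2"]) (measurable, use B(1) in \<open>auto simp: indicator_def\<close>)
    \<comment> \<open>The integrand vanishes unless \<open>y\<close> is in the slab and
      \<open>T k y\<close> or its shift is in \<open>K\<close>. Then \<open>T k y\<close> has norm
      at most \<open>R + 1\<close>, and \<open>T k\<close> moves points of the slab by at most 1;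
      hence the radius \<open>R + 2\<close>.\<close>
    show "AE y in lborel. norm (W k (T k y) * (g k (T k y) * f (T k y))) \<le> B * indicator (cball 0 (R + 2)) y" for k
    proof (intro AE_I2)
      fix y
      show "norm (W k (T k y) * (g k (T k y) * f (T k y))) \<le> B * indicator (cball 0 (R + 2)) y"
      proof (cases "y \<in> slab \<nu> c \<and> g k (T k y) \<noteq> 0")
        case False
        then have z: "W k (T k y) * (g k (T k y) * f (T k y)) = 0"
          using W1[of k "T k y"] strip_T[of k y] by auto
        show ?thesis unfolding z using B(1) by simp
      next
        case True
        then have "T k y \<in> K \<or> T k y - t k *\<^sub>R e \<in> K" by (auto simp: g_def indicator_def)
        then have nT: "norm (T k y) \<le> R + 1"
        proof
          assume "T k y - t k *\<^sub>R e \<in> K"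
          then show ?thesis
            using R(2) norm_triangle_ineq[of "T k y - t k *\<^sub>R e" "t k *\<^sub>R e"] ne[of "t k"] t(2)[of k] t(3)[of k] by fastforce
        qed (use R(2) in fastforce)
        have "norm (y - T k y) = \<bar>t k * a - 1\<bar> * \<bar>\<nu> \<bullet> y - c\<bar>" using n by (simp add: T_def abs_mult)
        also have "\<dots> \<le> 1 * 1" using ta[of k] True by (intro mult_mono) (auto simp: slab_def abs_le_iff)
        finally have "norm y \<le> R + 2" using nT norm_triangle_ineq[of "T k y" "y - T k y"] by simp
        moreover have "\<bar>W k (T k y) * (g k (T k y) * f (T k y))\<bar> \<le> 1 * (1 * B)"
          unfolding abs_mult
        proof (intro mult_mono)
          show "\<bar>W k (T k y)\<bar> \<le> 1" using W1[of k "T k y"] by (rule order_trans) (simp add: indicator_def)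
          show "\<bar>g k (T k y)\<bar> \<le> 1" by (simp add: g_def indicator_def)
          show "\<bar>f (T k y)\<bar> \<le> B" using B(2)[OF nT] by simp
        qed auto
        ultimately show ?thesis by simp
      qed
    qed
    \<comment> \<open>Two null sets are left out to apply \<open>shift_limit\<close>: points of the
      slab that project to another plane, and the two faces of the slab.\<close>
    have "AE y in lborel. \<forall>q'\<in>Q. q' \<noteq> (\<nu>, c) \<longrightarrow> q' \<noteq> (-\<nu>, -c) \<longrightarrow> y \<in> slab \<nu> c \<longrightarrow> fst q' \<bullet> plane_proj \<nu> c y \<noteq> snd q'"
    proof (subst AE_finite_all[OF finite_Q], intro ballI)
      fix q' assume "q' \<in> Q"
      then show "AE y in lborel. q' \<noteq> (\<nu>, c) \<longrightarrow> q' \<noteq> (-\<nu>, -c) \<longrightarrow> y \<in> slab \<nu> c \<longrightarrow> fst q' \<bullet> plane_proj \<nu> c y \<noteq> snd q'"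
        using AE_lborel_proj_other[OF n unit_Q, of "fst q'" "snd q'" "snd q'" c] by (cases "q' = (\<nu>, c) \<or> q' = (-\<nu>, -c)") auto
    qed
    moreover have "\<nu> \<noteq> 0" using n by auto
    then have "AE y in lborel. \<nu> \<bullet> y \<noteq> c" "AE y in lborel. \<nu> \<bullet> y \<noteq> c + 1"
      by (auto intro: AE_lborel_hyperplane)
    ultimately show "AE y in lborel. (\<lambda>k. W k (T k y) * (g k (T k y) * f (T k y)))
      \<longlonglongrightarrow> indicator (slab \<nu> c) y * ((indicator (facet K \<nu> c) (plane_proj \<nu> c y)
        - indicator (facet K (-\<nu>) (-c)) (plane_proj \<nu> c y)) * f (plane_proj \<nu> c y))"
    proof eventually_elim
      case (elim y)
      show ?case
      proof (cases "y \<in> slab \<nu> c")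
        case False
        then have "W k (T k y) = 0" for k using W1[of k "T k y"] strip_T[of k y] by auto
        then show ?thesis using False by simp
      next
        case True
        then have y: "c < \<nu> \<bullet> y" "\<nu> \<bullet> y < c + 1" using elim by (auto simp: slab_def)
        have "\<exists>\<delta>>0. \<forall>t. 0 < t \<longrightarrow> t < \<delta> \<longrightarrow> N t (y + ((t * \<nu> $ i - 1) * (\<nu> \<bullet> y - c)) *\<^sub>R \<nu>) = 1
          \<and> (indicator K (y + ((t * \<nu> $ i - 1) * (\<nu> \<bullet> y - c)) *\<^sub>R \<nu> - t *\<^sub>R e) - indicator K (y + ((t * \<nu> $ i - 1) * (\<nu> \<bullet> y - c)) *\<^sub>R \<nu>) :: real)
          = indicator (facet K \<nu> c) (plane_proj \<nu> c y) - indicator (facet K (-\<nu>) (-c)) (plane_proj \<nu> c y)"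
          unfolding N_def Qp_def e_def
          by (rule shift_limit) (use q y elim(1) True in \<open>auto simp: Qp_def\<close>)
        then obtain \<delta> where \<delta>: "\<delta> > 0" "\<And>k. t k < \<delta> \<Longrightarrow> N (t k) (T k y) = 1
          \<and> g k (T k y) = indicator (facet K \<nu> c) (plane_proj \<nu> c y) - indicator (facet K (-\<nu>) (-c)) (plane_proj \<nu> c y)"
          using t(2) unfolding T_def g_def a_def by metis
        have "eventually (\<lambda>k. t k < \<delta>) sequentially" using order_tendstoD(2)[OF t(1) \<delta>(1)] .
        then have ev: "eventually (\<lambda>k. (indicator (facet K \<nu> c) (plane_proj \<nu> c y) - indicator (facet K (-\<nu>) (-c)) (plane_proj \<nu> c y)) * f (T k y)
           = W k (T k y) * (g k (T k y) * f (T k y))) sequentially"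
        proof eventually_elim
          case (elim k)
          then show ?case using \<delta>(2)[OF elim] strip_T[of k y] True by (simp add: W_def)
        qed
        have "(\<lambda>k. y + ((t k * a - 1) * (\<nu> \<bullet> y - c)) *\<^sub>R \<nu>) \<longlonglongrightarrow> y + ((0 * a - 1) * (\<nu> \<bullet> y - c)) *\<^sub>R \<nu>"
          by (intro tendsto_intros t)
        then have "(\<lambda>k. T k y) \<longlonglongrightarrow> plane_proj \<nu> c y"
          by (simp add: T_def plane_proj_def scaleR_left_diff_distrib add_diff_eq diff_diff_eq2)
        then have "(\<lambda>k. f (T k y)) \<longlonglongrightarrow> f (plane_proj \<nu> c y)"
          using C1_function_continuous(1)[OF C1] by (auto simp: continuous_on_eq_continuous_at intro: isCont_tendsto_compose)
        then have "(\<lambda>k. (indicator (facet K \<nu> c) (plane_proj \<nu> c y) - indicator (facet K (-\<nu>) (-c)) (plane_proj \<nu> c y)) * f (T k y))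
            \<longlonglongrightarrow> (indicator (facet K \<nu> c) (plane_proj \<nu> c y) - indicator (facet K (-\<nu>) (-c)) (plane_proj \<nu> c y)) * f (plane_proj \<nu> c y)"
          by (intro tendsto_intros)
        then show ?thesis using True tendsto_cong[OF ev] by simp
      qed
    qed
  qed (measurable, measurable)
  then show ?thesis
    using tendsto_mult[OF tendsto_const lim, of a] unfolding scaled[symmetric] by (simp add: W_def g_def a_def)
qed

text \<open>The limit of one shift quotient is computed in two ways, as the integral of the partial
  derivative and as a sum of fluxes through planes. The strips of different planes overlap near
  edges; dividing by \<open>N\<close>, the number of strips through a point, shares each point
  equally among them.\<close>

lemma divergence_planes:
  assumes C1: "C1_function f Df"
  shows "(\<integral>x. indicator K x * Df x $ i \<partial>lborel) = (\<Sum>(\<nu>, c)\<in>facet_planes K. \<nu> $ i * plane_flux f (\<nu>, c))"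
proof -
  note [measurable] = C1_function_measurable[OF C1]
  have [measurable]: "K \<in> sets borel" using open_K by simp
  define e where "e = axis i (1::real)"
  define Qp where "Qp = {(\<nu>, c) \<in> Q. 0 < \<nu> $ i}"
  define N where "N s x = (\<Sum>(\<nu>, c)\<in>Qp. indicator (shift_strip \<nu> c (\<nu> $ i) s) x :: real)" for s x
  define t where "t k = inverse (real (Suc k))" for k
  have t: "t \<longlonglongrightarrow> 0" "\<And>k. 0 < t k" "\<And>k. t k \<le> 1"
    using LIMSEQ_inverse_real_of_nat by (auto simp: t_def[abs_def] divide_simps)
  have finQp: "finite Qp" using finite_Q by (auto simp: Qp_def intro: finite_subset[of _ Q])
  have [measurable]: "N s \<in> borel_measurable borel" for s
    unfolding N_def[abs_def] case_prod_beta by measurable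
  obtain R where R: "R > 0" "\<And>x. x \<in> K \<Longrightarrow> norm x \<le> R" using bounded_K by (auto simp: bounded_pos)
  obtain B where B: "B > 0" "\<And>x. norm x \<le> R + 1 \<Longrightarrow> norm (f x) \<le> B"
    using bounded_on_cball[OF C1_function_continuous(1)[OF C1]] by blast
  define G where "G k x = (indicator K (x - t k *\<^sub>R e) - indicator K x) * f x" for k x
  define F where "F q k x = (case q of (\<nu>, c) \<Rightarrow> indicator (shift_strip \<nu> c (\<nu> $ i) (t k)) x / N (t k) x * G k x)" for q k x
  have [measurable]: "G k \<in> borel_measurable borel" for k
    unfolding G_def[abs_def] by measurable
  have [measurable]: "F q k \<in> borel_measurable borel" for q k
    unfolding F_def[abs_def] case_prod_beta by measurable
  have GB: "\<bar>G k x\<bar> \<le> B * indicator (cball 0 (R + 1)) x" for k x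
  proof (cases "x \<in> K \<or> x - t k *\<^sub>R e \<in> K")
    case True
    have "norm x \<le> R + 1"
      using True
    proof
      assume "x - t k *\<^sub>R e \<in> K"
      moreover have "norm (t k *\<^sub>R e) \<le> 1" using t(2,3)[of k] by (simp add: e_def norm_axis_1)
      ultimately show ?thesis using R(2) norm_triangle_ineq[of "x - t k *\<^sub>R e" "t k *\<^sub>R e"] by fastforce
    qed (use R(2) in fastforce)
    then show ?thesis using B(2)[of x] B(1) by (auto simp: G_def indicator_def)
  next
    case False
    then show ?thesis using B(1) by (auto simp: G_def indicator_def)
  qed
  have N1: "indicator (shift_strip \<nu> c (\<nu> $ i) s) x \<le> N s x" if "(\<nu>, c) \<in> Qp" for \<nu> c s x
    unfolding N_def using member_le_sum[OF that, of "\<lambda>(\<nu>, c). indicator (shift_strip \<nu> c (\<nu> $ i) s) x :: real"] finQp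
    by auto
  have intF: "integrable lborel (F q k)" if "q \<in> Qp" for q k
  proof (rule integrable_bounded_cball[where C = B and r = "R + 1"])
    fix x
    obtain \<nu> c where q: "q = (\<nu>, c)" by fastforce
    have "\<bar>indicator (shift_strip \<nu> c (\<nu> $ i) (t k)) x / N (t k) x\<bar> \<le> 1"
      using N1[of \<nu> c "t k" x] that q by (auto simp: indicator_def)
    then have "\<bar>F q k x\<bar> \<le> 1 * \<bar>G k x\<bar>"
      unfolding F_def q abs_mult prod.case by (rule mult_right_mono) simp
    then show "\<bar>F q k x\<bar> \<le> B * indicator (cball 0 (R + 1)) x" using GB[of k x] by simp
  qed measurable
  have "AE x in lborel. \<forall>q\<in>Q. fst q $ i = 0 \<longrightarrow> fst q \<bullet> x \<noteq> snd q"
  proof (subst AE_finite_all[OF finite_Q], intro ballI)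
    fix q assume "q \<in> Q"
    then have "fst q \<noteq> 0" using unit_Q[of "fst q" "snd q"] by auto
    then show "AE x in lborel. fst q $ i = 0 \<longrightarrow> fst q \<bullet> x \<noteq> snd q" using AE_lborel_hyperplane by fastforce
  qed
  \<comment> \<open>Where \<open>G\<close> is nonzero, \<open>jump_in_strip\<close> provides a strip
    through \<open>x\<close>, so the weights add up to 1. Elsewhere both sides are 0, also at points
    with \<open>N = 0\<close>.\<close>
  then have split: "AE x in lborel. G k x = (\<Sum>q\<in>Qp. F q k x)" for k
  proof eventually_elim
    case (elim x)
    have sumF: "(\<Sum>q\<in>Qp. F q k x) = N (t k) x / N (t k) x * G k x"
      unfolding N_def[of "t k" x] F_def sum_divide_distrib sum_distrib_right case_prod_beta by simp
    show ?case
    proof (cases "G k x = 0")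
      case True
      then show ?thesis using sumF by simp
    next
      case False
      then have jump: "(x \<in> K) \<noteq> (x - t k *\<^sub>R axis i 1 \<in> K)" by (auto simp: G_def e_def indicator_def)
      have tang: "\<nu> \<bullet> x \<noteq> c" if "(\<nu>, c) \<in> Q" "\<nu> $ i = 0" for \<nu> c
        using elim[rule_format, OF that(1)] that(2) by simp
      obtain \<nu> c where "(\<nu>, c) \<in> Q" "0 < \<nu> $ i" "x \<in> shift_strip \<nu> c (\<nu> $ i) (t k)"
        by (rule jump_in_strip[OF t(2) jump tang])
      then have "N (t k) x \<ge> 1" using N1[of \<nu> c "t k" x] by (simp add: Qp_def)
      then show ?thesis using sumF by simp
    qed
  qed
  have "(\<integral>x. G k x \<partial>lborel) = (\<Sum>q\<in>Qp. \<integral>x. F q k x \<partial>lborel)" for k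
    using intF by (subst integral_cong_AE[OF _ _ split]) auto
  then have Gk: "(\<integral>x. G k x \<partial>lborel) / t k = (\<Sum>q\<in>Qp. (\<integral>x. F q k x \<partial>lborel) / t k)" for k
    by (simp add: sum_divide_distrib)
  \<comment> \<open>One plane can carry facets of both orientations; those that face against
    \<open>\<nu>\<close> count negatively.\<close>
  define J where "J = (\<lambda>(\<nu>, c). \<nu> $ i * (plane_flux f (\<nu>, c) - plane_flux f (-\<nu>, -c)))"
  have bnd: "integrable (plane_measure \<nu> c) (\<lambda>x. indicator (facet K \<nu>' c') x * f x)"
    if n: "norm \<nu> = 1" "norm \<nu>' = 1" for \<nu> c \<nu>' c'
  proof (rule Bochner_Integration.integrable_bound)
    have sub: "facet K \<nu>' c' \<subseteq> frontier K" using n by (intro facet_subset_frontier[OF open_K]) auto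
    then have "bounded (facet K \<nu>' c')"
      by (rule bounded_subset[OF compact_imp_bounded[OF compact_frontier_bounded[OF bounded_K]]])
    then show "integrable (plane_measure \<nu> c) (\<lambda>x. indicator (facet K \<nu>' c') x * B)"
      using emeasure_plane_measure_bounded[OF n(1), of "facet K \<nu>' c'" c]
      by (intro integrable_mult_left integrable_real_indicator) auto
    have "norm x \<le> R" if "x \<in> frontier K" for x
    proof -
      have "K \<subseteq> cball 0 R" using R by auto
      then have "closure K \<subseteq> cball 0 R" by (rule closure_minimal) simp
      then show ?thesis using that by (auto simp: frontier_def)
    qed
    then show "AE x in plane_measure \<nu> c. norm (indicator (facet K \<nu>' c') x * f x) \<le> norm (indicator (facet K \<nu>' c') x * B)"
      using sub B(1) B(2) by (intro AE_I2) (fastforce simp: indicator_def)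
  qed measurable
  have "(\<lambda>k. (\<integral>x. F q k x \<partial>lborel) / t k) \<longlonglongrightarrow> J q" if q: "q \<in> Qp" for q
  proof -
    obtain \<nu> c where qe: "q = (\<nu>, c)" by fastforce
    have n: "norm \<nu> = 1" using q qe unit_Q by (auto simp: Qp_def)
    have "(\<integral>y. indicator (slab \<nu> c) y * ((indicator (facet K \<nu> c) (plane_proj \<nu> c y)
        - indicator (facet K (-\<nu>) (-c)) (plane_proj \<nu> c y)) * f (plane_proj \<nu> c y)) \<partial>lborel)
      = (\<integral>x. (indicator (facet K \<nu> c) x - indicator (facet K (-\<nu>) (-c)) x) * f x \<partial>plane_measure \<nu> c)"
      by (rule integral_plane_measure[symmetric]) measurable
    also have "\<dots> = (\<integral>x. indicator (facet K \<nu> c) x * f x \<partial>plane_measure \<nu> c)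
        - (\<integral>x. indicator (facet K (-\<nu>) (-c)) x * f x \<partial>plane_measure \<nu> c)"
      unfolding left_diff_distrib using n by (intro Bochner_Integration.integral_diff bnd) auto
    also have "\<dots> = plane_flux f (\<nu>, c) - plane_flux f (-\<nu>, -c)"
      by (simp add: plane_flux_def plane_measure_uminus[OF n])
    finally show ?thesis
      using strip_integral_limit[OF C1 t, of \<nu> c i] q
      unfolding qe F_def G_def J_def N_def Qp_def e_def by simp
  qed
  then have "(\<lambda>k. (\<integral>x. G k x \<partial>lborel) / t k) \<longlonglongrightarrow> (\<Sum>q\<in>Qp. J q)"
    unfolding Gk by (intro tendsto_sum) auto
  moreover have "(\<lambda>k. (\<integral>x. G k x \<partial>lborel) / t k) \<longlonglongrightarrow> (\<integral>x. indicator K x * Df x $ i \<partial>lborel)"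
    using shift_integral_limit[OF C1 t, of i] by (simp add: G_def e_def)
  ultimately have "(\<integral>x. indicator K x * Df x $ i \<partial>lborel) = (\<Sum>q\<in>Qp. J q)"
    by (rule LIMSEQ_unique[rotated])
  \<comment> \<open>Negation exchanges the planes with positive and with negative
    \<open>i\<close>-th component, so the differences unfold into one sum over \<open>Q\<close>;
    planes with vanishing component add nothing.\<close>
  also have "\<dots> = (\<Sum>q\<in>Q. fst q $ i * plane_flux f q)"
  proof -
    define Qm where "Qm = {(\<nu>, c) \<in> Q. \<nu> $ i < 0}"
    define Qz where "Qz = {(\<nu>, c) \<in> Q. \<nu> $ i = 0}"
    have QU: "Q = Qp \<union> (Qm \<union> Qz)" by (auto simp: Qp_def Qm_def Qz_def)
    have d: "Qm \<inter> Qz = {}" "Qp \<inter> (Qm \<union> Qz) = {}" by (auto simp: Qp_def Qm_def Qz_def)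
    have fin: "finite Qm" "finite Qz" using finite_Q QU by (metis finite_Un)+
    have "(\<Sum>q\<in>Q. fst q $ i * plane_flux f q)
      = (\<Sum>q\<in>Qp. fst q $ i * plane_flux f q) + ((\<Sum>q\<in>Qm. fst q $ i * plane_flux f q) + (\<Sum>q\<in>Qz. fst q $ i * plane_flux f q))"
      using fin finQp d by (simp add: QU sum.union_disjoint)
    also have "(\<Sum>q\<in>Qz. fst q $ i * plane_flux f q) = 0" by (intro sum.neutral) (auto simp: Qz_def)
    also have "(\<Sum>q\<in>Qm. fst q $ i * plane_flux f q) = (\<Sum>q\<in>Qp. fst (- q) $ i * plane_flux f (- q))"
      by (rule sum.reindex_bij_witness[of _ uminus uminus]) (auto simp: Qp_def Qm_def sym_Q)
    finally show ?thesis
      unfolding J_def by (simp add: case_prod_beta right_diff_distrib sum_subtractf sum_negf uminus_prod_def)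
  qed
  also have "\<dots> = (\<Sum>q\<in>facet_planes K. fst q $ i * plane_flux f q)"
  proof (rule sum.mono_neutral_right[OF finite_Q facet_planes_subset], intro ballI)
    fix q assume "q \<in> Q - facet_planes K"
    then have "facet K (fst q) (snd q) = {}" using unit_Q[of "fst q" "snd q"] by (auto simp: facet_planes_def)
    then show "fst q $ i * plane_flux f q = 0" by (simp add: plane_flux_def case_prod_beta)
  qed
  finally show ?thesis by (simp add: case_prod_beta)
qed

end

section \<open>The trace inequality\<close>

context flat_domain
begin

lemma AE_surf_facet: "AE x in surf K. \<exists>(\<nu>, c)\<in>facet_planes K. x \<in> facet K \<nu> c"
proof (rule AE_I[where N = "- (\<Union>(\<nu>, c)\<in>facet_planes K. facet K \<nu> c)"])
  have mU: "(\<Union>(\<nu>, c)\<in>facet_planes K. facet K \<nu> c) \<in> sets borel"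
    using finite_facet_planes by (intro sets.finite_UN) auto
  show "- (\<Union>(\<nu>, c)\<in>facet_planes K. facet K \<nu> c) \<in> sets (surf K)"
    unfolding sets_surf by (rule borel_comp[OF mU])
  have "emeasure (surf K) (- (\<Union>(\<nu>, c)\<in>facet_planes K. facet K \<nu> c))
    = (\<Sum>(\<nu>', c')\<in>facet_planes K. emeasure (plane_measure \<nu>' c') (- (\<Union>(\<nu>, c)\<in>facet_planes K. facet K \<nu> c) \<inter> facet K \<nu>' c'))"
    by (rule emeasure_surf[OF borel_comp[OF mU]])
  also have "\<dots> = 0"
  proof (intro sum.neutral ballI, clarify)
    fix \<nu> c assume "(\<nu>, c) \<in> facet_planes K"
    then have "- (\<Union>(\<nu>, c)\<in>facet_planes K. facet K \<nu> c) \<inter> facet K \<nu> c = {}" by blast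
    then show "emeasure (plane_measure \<nu> c) (- (\<Union>(\<nu>, c)\<in>facet_planes K. facet K \<nu> c) \<inter> facet K \<nu> c) = 0" by simp
  qed
  finally show "emeasure (surf K) (- (\<Union>(\<nu>, c)\<in>facet_planes K. facet K \<nu> c)) = 0" .
qed auto

lemma norm_outer_normal: "norm (outer_normal K x) \<le> 1"
proof (cases "\<exists>(\<nu>, c)\<in>facet_planes K. x \<in> facet K \<nu> c")
  case True
  then obtain \<nu> c where "(\<nu>, c) \<in> facet_planes K" "x \<in> facet K \<nu> c" by blast
  then show ?thesis using outer_normal_facet unit_facet_planes by fastforce
next
  case False
  then have "outer_normal K x = 0"
    unfolding outer_normal_def by (intro sum.neutral) auto
  then show ?thesis by simp
qed

lemma bounded_on_frontier:
  fixes f :: "real^'n \<Rightarrow> 'a::real_normed_vector"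
  assumes "continuous_on UNIV f"
  obtains B where "B > 0" "\<And>x. x \<in> frontier K \<Longrightarrow> norm (f x) \<le> B"
proof -
  have "bounded (f ` frontier K)"
    by (intro compact_imp_bounded compact_continuous_image continuous_on_subset[OF assms]
        compact_frontier_bounded bounded_K) auto
  then show ?thesis using that by (auto simp: bounded_pos)
qed

text \<open>On each facet the outer normal is the constant \<open>\<nu>\<close>, which absorbs the
  factors \<open>\<nu> $ i\<close> of \<open>divergence_planes\<close> into an integral against
  \<open>surf K\<close>.\<close>

lemma green_C1:
  assumes C1: "C1_function f Df"
  shows "(\<integral>x. indicator K x * Df x $ i \<partial>lborel) = (\<integral>x. f x * outer_normal K x $ i \<partial>surf K)"
proof -
  note [measurable] = C1_function_measurable[OF C1]
  have [measurable]: "(\<lambda>x. outer_normal K x $ i) \<in> borel_measurable borel"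
    unfolding outer_normal_def[abs_def] case_prod_beta by (simp add: sum_component)
  obtain B where B: "B > 0" "\<And>x. x \<in> frontier K \<Longrightarrow> norm (f x) \<le> B"
    using bounded_on_frontier[OF C1_function_continuous(1)[OF C1]] by blast
  have bd: "\<bar>f x * outer_normal K x $ i\<bar> \<le> B" if "x \<in> frontier K" for x
  proof -
    have "\<bar>outer_normal K x $ i\<bar> \<le> 1" using component_le_norm_cart[of "outer_normal K x" i] norm_outer_normal[of x] by linarith
    then have "\<bar>f x\<bar> * \<bar>outer_normal K x $ i\<bar> \<le> B * 1" using B(1) B(2)[OF that] by (intro mult_mono) auto
    then show ?thesis by (simp add: abs_mult)
  qed
  have "(\<integral>x. f x * outer_normal K x $ i \<partial>surf K)
    = (\<Sum>(\<nu>, c)\<in>facet_planes K. \<integral>x. indicator (facet K \<nu> c) x * (f x * outer_normal K x $ i) \<partial>plane_measure \<nu> c)"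
    by (rule integral_surf(2)[where B = B]) (measurable, use bd in blast)
  also have "\<dots> = (\<Sum>(\<nu>, c)\<in>facet_planes K. \<nu> $ i * plane_flux f (\<nu>, c))"
  proof (intro sum.cong refl, clarify)
    fix \<nu> c assume q: "(\<nu>, c) \<in> facet_planes K"
    have "(\<integral>x. indicator (facet K \<nu> c) x * (f x * outer_normal K x $ i) \<partial>plane_measure \<nu> c)
      = (\<integral>x. \<nu> $ i * (indicator (facet K \<nu> c) x * f x) \<partial>plane_measure \<nu> c)"
      using outer_normal_facet[OF q] by (intro Bochner_Integration.integral_cong refl) (auto simp: indicator_def)
    then show "(\<integral>x. indicator (facet K \<nu> c) x * (f x * outer_normal K x $ i) \<partial>plane_measure \<nu> c) = \<nu> $ i * plane_flux f (\<nu>, c)"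
      by (simp add: plane_flux_def)
  qed
  also have "\<dots> = (\<integral>x. indicator K x * Df x $ i \<partial>lborel)" by (rule divergence_planes[OF C1, symmetric])
  finally show ?thesis by simp
qed

lemma integrable_indicator_continuous:
  fixes f :: "real^'n \<Rightarrow> real"
  assumes "continuous_on UNIV f"
  shows "integrable lborel (\<lambda>x. indicator K x * f x)"
proof -
  obtain R where R: "R > 0" "\<And>x. x \<in> K \<Longrightarrow> norm x \<le> R" using bounded_K by (auto simp: bounded_pos)
  obtain B where B: "B > 0" "\<And>x. norm x \<le> R \<Longrightarrow> norm (f x) \<le> B"
    using bounded_on_cball[OF assms] by blast
  have [measurable]: "f \<in> borel_measurable borel" using assms by (rule borel_measurable_continuous_onI)
  have [measurable]: "K \<in> sets borel" using open_K by simp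
  show ?thesis
    by (rule integrable_bounded_cball[where C = B and r = R]) (measurable, use R B in \<open>auto simp: indicator_def\<close>)
qed

text \<open>A short step from \<open>z\<close> towards \<open>x\<close> stays in \<open>K\<close> by
  convexity and in the ball where \<open>K\<close> is a half-space. The sign found there carries
  over along the segment.\<close>

lemma convex_facet_side:
  assumes "convex K" "x \<in> K" and q: "(\<nu>, c) \<in> facet_planes K" and z: "z \<in> facet K \<nu> c"
  shows "\<nu> \<bullet> x < c"
proof -
  obtain e where e: "\<nu> \<bullet> z = c" "e > 0" "K \<inter> ball z e = {y \<in> ball z e. \<nu> \<bullet> y < c}"
    using z by (auto simp: facet_def)
  define s where "s = min (1/2) (e / (2 * (norm (x - z) + 1)))"
  have np: "norm (x - z) + 1 > 0" by (simp add: add_nonneg_pos)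
  have s: "0 < s" "s < 1" using e(2) np by (auto simp: s_def)
  have "s * norm (x - z) \<le> s * (norm (x - z) + 1)" using s by simp
  also have "\<dots> \<le> e / (2 * (norm (x - z) + 1)) * (norm (x - z) + 1)"
    using np by (intro mult_right_mono) (auto simp: s_def)
  also have "\<dots> = e / 2" using np by (simp add: field_simps)
  finally have sn: "s * norm (x - z) < e" using e(2) by linarith
  have "z \<in> closure K" using facet_in_frontier[OF q] z by (auto simp: frontier_def)
  then have "z - s *\<^sub>R (z - x) \<in> interior K"
    using assms(1,2) s open_K by (intro mem_interior_closure_convex_shrink) (auto simp: interior_open)
  then have inK: "z - s *\<^sub>R (z - x) \<in> K" using interior_subset by blast
  have "dist z (z - s *\<^sub>R (z - x)) = s * norm (x - z)" using s by (simp add: dist_norm norm_minus_commute)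
  then have "z - s *\<^sub>R (z - x) \<in> K \<inter> ball z e" using inK sn by simp
  then have "\<nu> \<bullet> (z - s *\<^sub>R (z - x)) < c" unfolding e(3) by simp
  then have "s * (\<nu> \<bullet> x - c) < 0" using e(1) by (simp add: inner_diff_right algebra_simps)
  then show ?thesis using s by (simp add: mult_less_0_iff)
qed

text \<open>Convexity gives the lower bound on \<open>(x - x0) \<bullet> \<nu>\<close>: a ball
  around \<open>x0\<close> lies in \<open>K\<close>, so \<open>x0\<close> moved by
  \<open>r / 2\<close> along \<open>\<nu>\<close> is still below the plane of the facet.\<close>

lemma trace_inequality_convex:
  assumes conv: "convex K" and ne: "K \<noteq> {}"
  shows "\<exists>C\<ge>0. \<forall>f Df. C1_function f Df \<longrightarrow>
    (\<integral>x. (f x)\<^sup>2 \<partial>surf K) \<le> C * ((\<integral>x. indicator K x * (f x)\<^sup>2 \<partial>lborel) + (\<integral>x. indicator K x * (norm (Df x))\<^sup>2 \<partial>lborel))"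
proof -
  interpret finite_measure "surf K" by (rule finite_measure_surf)
  obtain x0 where x0: "x0 \<in> K" using ne by auto
  then obtain r where r: "r > 0" "ball x0 r \<subseteq> K" using open_K open_contains_ball by blast
  obtain R where R: "R > 0" "\<And>x. x \<in> K \<Longrightarrow> norm x \<le> R" using bounded_K by (auto simp: bounded_pos)
  \<comment> \<open>\<open>r / 2\<close> is the lower bound of the normal component on the facets,
    \<open>2 * R\<close> bounds the length of \<open>x - x0\<close> on \<open>K\<close>, and the
    dimension is the divergence of that field.\<close>
  define C where "C = (2 * R + CARD('n)) / (r / 2)"
  have "C \<ge> 0" using R r by (simp add: C_def)
  have "(\<integral>x. (f x)\<^sup>2 \<partial>surf K) \<le> C * ((\<integral>x. indicator K x * (f x)\<^sup>2 \<partial>lborel) + (\<integral>x. indicator K x * (norm (Df x))\<^sup>2 \<partial>lborel))"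
    if C1: "C1_function f Df" for f Df
  proof -
    note cont = C1_function_continuous[OF C1]
    note [measurable] = C1_function_measurable[OF C1]
    have cn: "continuous_on UNIV (\<lambda>x. x $ i - x0 $ i)" for i by (intro continuous_intros)
    have C1i: "C1_function (\<lambda>x. (f x)\<^sup>2 * (x $ i - x0 $ i)) (\<lambda>x. (2 * f x * (x $ i - x0 $ i)) *\<^sub>R Df x + (f x)\<^sup>2 *\<^sub>R axis i 1)" for i
      unfolding C1_function_def gderiv_def
    proof (intro conjI allI)
      fix x
      have d: "(f has_derivative (\<lambda>h. h \<bullet> Df x)) (at x)" using C1 by (simp add: C1_function_def gderiv_def)
      have di: "((\<lambda>x. x $ i - x0 $ i) has_derivative (\<lambda>h. h $ i)) (at x)"
        by (auto intro!: derivative_eq_intros bounded_linear_vec_nth[THEN bounded_linear_imp_has_derivative])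
      have "((\<lambda>x. (f x * f x) * (x $ i - x0 $ i)) has_derivative
        (\<lambda>h. (f x * f x) * h $ i + (f x * (h \<bullet> Df x) + (h \<bullet> Df x) * f x) * (x $ i - x0 $ i))) (at x)"
        by (intro has_derivative_mult d di)
      moreover have "(\<lambda>h. (f x * f x) * h $ i + (f x * (h \<bullet> Df x) + (h \<bullet> Df x) * f x) * (x $ i - x0 $ i))
        = (\<lambda>h. h \<bullet> ((2 * f x * (x $ i - x0 $ i)) *\<^sub>R Df x + (f x)\<^sup>2 *\<^sub>R axis i 1))"
        by (auto simp: inner_add_right inner_axis algebra_simps power2_eq_square)
      ultimately show "((\<lambda>x. (f x)\<^sup>2 * (x $ i - x0 $ i)) has_derivative
        (\<lambda>h. h \<bullet> ((2 * f x * (x $ i - x0 $ i)) *\<^sub>R Df x + (f x)\<^sup>2 *\<^sub>R axis i 1))) (at x)"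
        by (simp add: power2_eq_square)
    next
      show "continuous_on UNIV (\<lambda>x. (2 * f x * (x $ i - x0 $ i)) *\<^sub>R Df x + (f x)\<^sup>2 *\<^sub>R axis i 1)"
        by (intro continuous_intros cont)
    qed
    have nm: "(\<lambda>x. outer_normal K x $ i) \<in> borel_measurable borel" for i
      unfolding outer_normal_def[abs_def] case_prod_beta by (simp add: sum_component)
    obtain B where B: "B > 0" "\<And>x. x \<in> frontier K \<Longrightarrow> norm (f x) \<le> B"
      using bounded_on_frontier[OF cont(1)] by blast
    have fB: "(f x)\<^sup>2 \<le> B\<^sup>2" if "x \<in> frontier K" for x using B(2)[OF that] B(1) by (simp add: abs_le_square_iff[symmetric])
    have "continuous_on UNIV (\<lambda>x. (f x)\<^sup>2 *\<^sub>R (x - x0))" by (intro continuous_intros cont)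
    then obtain B' where B': "B' > 0" "\<And>x. x \<in> frontier K \<Longrightarrow> norm ((f x)\<^sup>2 *\<^sub>R (x - x0)) \<le> B'"
      by (rule bounded_on_frontier) blast
    have int_i: "integrable (surf K) (\<lambda>x. (f x)\<^sup>2 * (x $ i - x0 $ i) * outer_normal K x $ i)" for i
    proof (rule integral_surf(1)[where B = B'])
      have [measurable]: "(\<lambda>x. x $ i - x0 $ i) \<in> borel_measurable borel" by (rule borel_measurable_continuous_onI[OF cn])
      note nm[measurable]
      show "(\<lambda>x. (f x)\<^sup>2 * (x $ i - x0 $ i) * outer_normal K x $ i) \<in> borel_measurable borel" by measurable
      fix x assume x: "x \<in> frontier K"
      have "\<bar>(f x)\<^sup>2 * (x $ i - x0 $ i)\<bar> \<le> B'"
        using B'(2)[OF x] component_le_norm_cart[of "(f x)\<^sup>2 *\<^sub>R (x - x0)" i] by (simp add: abs_mult)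
      moreover have "\<bar>outer_normal K x $ i\<bar> \<le> 1" using component_le_norm_cart[of "outer_normal K x" i] norm_outer_normal[of x] by linarith
      ultimately have "\<bar>(f x)\<^sup>2 * (x $ i - x0 $ i)\<bar> * \<bar>outer_normal K x $ i\<bar> \<le> B' * 1" using B' by (intro mult_mono) auto
      then show "\<bar>(f x)\<^sup>2 * (x $ i - x0 $ i) * outer_normal K x $ i\<bar> \<le> B'" by (simp add: abs_mult)
    qed
    have int_f: "integrable (surf K) (\<lambda>x. (f x)\<^sup>2)"
      by (rule integral_surf(1)[where B = "B\<^sup>2"]) (measurable, use fB in simp)
    have "r / 2 * (\<integral>x. (f x)\<^sup>2 \<partial>surf K) = (\<integral>x. r / 2 * (f x)\<^sup>2 \<partial>surf K)" by simp
    also have "\<dots> \<le> (\<integral>x. (\<Sum>i\<in>UNIV. (f x)\<^sup>2 * (x $ i - x0 $ i) * outer_normal K x $ i) \<partial>surf K)"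
    proof (rule integral_mono_AE)
      show "integrable (surf K) (\<lambda>x. r / 2 * (f x)\<^sup>2)" using int_f by simp
      show "integrable (surf K) (\<lambda>x. \<Sum>i\<in>UNIV. (f x)\<^sup>2 * (x $ i - x0 $ i) * outer_normal K x $ i)"
        using int_i by (intro Bochner_Integration.integrable_sum) auto
      show "AE x in surf K. r / 2 * (f x)\<^sup>2 \<le> (\<Sum>i\<in>UNIV. (f x)\<^sup>2 * (x $ i - x0 $ i) * outer_normal K x $ i)"
        using AE_surf_facet
      proof eventually_elim
        case (elim x)
        then obtain \<nu> c where q: "(\<nu>, c) \<in> facet_planes K" "x \<in> facet K \<nu> c" by blast
        have n: "norm \<nu> = 1" using unit_facet_planes q by blast
        then have nn: "\<nu> \<bullet> \<nu> = 1" by (simp add: dot_square_norm)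
        have "x0 + (r / 2) *\<^sub>R \<nu> \<in> ball x0 r" using r n by (simp add: dist_norm)
        then have "\<nu> \<bullet> (x0 + (r / 2) *\<^sub>R \<nu>) < c" using r(2) by (intro convex_facet_side[OF conv _ q]) auto
        moreover have "\<nu> \<bullet> x = c" using q(2) by (simp add: facet_def)
        ultimately have "r / 2 \<le> \<nu> \<bullet> (x - x0)" using nn by (simp add: inner_add_right inner_diff_right)
        then have "r / 2 \<le> (x - x0) \<bullet> \<nu>" by (simp only: inner_commute)
        then have "r / 2 * (f x)\<^sup>2 \<le> (x - x0) \<bullet> \<nu> * (f x)\<^sup>2" by (intro mult_right_mono) auto
        also have "\<dots> = (\<Sum>i\<in>UNIV. (f x)\<^sup>2 * (x $ i - x0 $ i) * outer_normal K x $ i)"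
          unfolding outer_normal_facet[OF q] inner_vec_def sum_distrib_right by (intro sum.cong) (auto simp: algebra_simps)
        finally show ?case .
      qed
    qed
    also have "\<dots> = (\<Sum>i\<in>UNIV. \<integral>x. (f x)\<^sup>2 * (x $ i - x0 $ i) * outer_normal K x $ i \<partial>surf K)"
      using int_i by (intro Bochner_Integration.integral_sum) auto
    also have "\<dots> = (\<Sum>i\<in>UNIV. \<integral>x. indicator K x * ((2 * f x * (x $ i - x0 $ i)) *\<^sub>R Df x + (f x)\<^sup>2 *\<^sub>R axis i 1) $ i \<partial>lborel)"
      by (intro sum.cong refl green_C1[OF C1i, symmetric])
    also have "\<dots> = (\<integral>x. (\<Sum>i\<in>UNIV. indicator K x * ((2 * f x * (x $ i - x0 $ i)) *\<^sub>R Df x + (f x)\<^sup>2 *\<^sub>R axis i 1) $ i) \<partial>lborel)"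
      by (intro Bochner_Integration.integral_sum[symmetric] integrable_indicator_continuous continuous_intros cont)
    also have "\<dots> \<le> (\<integral>x. (2 * R + CARD('n)) * (indicator K x * (f x)\<^sup>2 + indicator K x * (norm (Df x))\<^sup>2) \<partial>lborel)"
    proof (rule integral_mono)
      show "integrable lborel (\<lambda>x. \<Sum>i\<in>UNIV. indicator K x * ((2 * f x * (x $ i - x0 $ i)) *\<^sub>R Df x + (f x)\<^sup>2 *\<^sub>R axis i 1) $ i)"
        by (intro Bochner_Integration.integrable_sum integrable_indicator_continuous continuous_intros cont)
      show "integrable lborel (\<lambda>x. (2 * R + CARD('n)) * (indicator K x * (f x)\<^sup>2 + indicator K x * (norm (Df x))\<^sup>2))"
        by (intro integrable_mult_right Bochner_Integration.integrable_add integrable_indicator_continuous continuous_intros cont)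
      fix x
      show "(\<Sum>i\<in>UNIV. indicator K x * ((2 * f x * (x $ i - x0 $ i)) *\<^sub>R Df x + (f x)\<^sup>2 *\<^sub>R axis i 1) $ i)
        \<le> (2 * R + CARD('n)) * (indicator K x * (f x)\<^sup>2 + indicator K x * (norm (Df x))\<^sup>2)"
      proof (cases "x \<in> K")
        case True
        have "norm (x - x0) \<le> 2 * R" using R(2)[OF True] R(2)[OF x0] norm_triangle_ineq4[of x x0] by linarith
        then have "\<bar>(x - x0) \<bullet> Df x\<bar> \<le> 2 * R * norm (Df x)"
          using Cauchy_Schwarz_ineq2[of "x - x0" "Df x"] by (meson mult_right_mono norm_ge_zero order_trans)
        then have "\<bar>2 * f x\<bar> * \<bar>(x - x0) \<bullet> Df x\<bar> \<le> \<bar>2 * f x\<bar> * (2 * R * norm (Df x))" by (intro mult_left_mono) auto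
        then have "2 * f x * ((x - x0) \<bullet> Df x) \<le> 2 * R * (2 * \<bar>f x\<bar> * norm (Df x))"
          using abs_ge_self[of "2 * f x * ((x - x0) \<bullet> Df x)"] by (simp add: abs_mult mult_ac)
        also have "\<dots> \<le> 2 * R * ((f x)\<^sup>2 + (norm (Df x))\<^sup>2)"
          using R(1) sum_squares_bound[of "\<bar>f x\<bar>" "norm (Df x)"] by (intro mult_left_mono) auto
        finally have 1: "2 * f x * ((x - x0) \<bullet> Df x) \<le> 2 * R * ((f x)\<^sup>2 + (norm (Df x))\<^sup>2)" .
        have 2: "CARD('n) * (f x)\<^sup>2 \<le> CARD('n) * ((f x)\<^sup>2 + (norm (Df x))\<^sup>2)" by (intro mult_left_mono) auto
        have "(\<Sum>i\<in>UNIV. indicator K x * ((2 * f x * (x $ i - x0 $ i)) *\<^sub>R Df x + (f x)\<^sup>2 *\<^sub>R axis i 1) $ i)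
            = (\<Sum>i\<in>UNIV. 2 * f x * ((x $ i - x0 $ i) * Df x $ i) + (f x)\<^sup>2)"
          using True by (intro sum.cong) (auto simp: axis_def)
        also have "\<dots> = 2 * f x * ((x - x0) \<bullet> Df x) + CARD('n) * (f x)\<^sup>2"
          by (simp add: sum.distrib inner_vec_def sum_distrib_left)
        finally have lhs: "(\<Sum>i\<in>UNIV. indicator K x * ((2 * f x * (x $ i - x0 $ i)) *\<^sub>R Df x + (f x)\<^sup>2 *\<^sub>R axis i 1) $ i)
          = 2 * f x * ((x - x0) \<bullet> Df x) + CARD('n) * (f x)\<^sup>2" .
        have rhs: "(2 * R + CARD('n)) * (indicator K x * (f x)\<^sup>2 + indicator K x * (norm (Df x))\<^sup>2)
          = 2 * R * ((f x)\<^sup>2 + (norm (Df x))\<^sup>2) + CARD('n) * ((f x)\<^sup>2 + (norm (Df x))\<^sup>2)"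
          using True by (simp add: distrib_right)
        show ?thesis unfolding lhs rhs using 1 2 by linarith
      qed simp
    qed
    also have "\<dots> = (2 * R + CARD('n)) * ((\<integral>x. indicator K x * (f x)\<^sup>2 \<partial>lborel) + (\<integral>x. indicator K x * (norm (Df x))\<^sup>2 \<partial>lborel))"
    proof -
      have "integrable lborel (\<lambda>x. indicator K x * (f x)\<^sup>2)" "integrable lborel (\<lambda>x. indicator K x * (norm (Df x))\<^sup>2)"
        by (intro integrable_indicator_continuous continuous_intros cont)+
      then show ?thesis by simp
    qed
    finally show ?thesis using r(1) by (simp add: C_def field_simps)
  qed
  then show ?thesis using \<open>C \<ge> 0\<close> by blast
qed

end

section \<open>Convex cells of a hyperplane arrangement\<close>

text \<open>\<open>A\<close> selects a side of every oriented plane. Selections that contradict each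
  other on the two orientations of a plane give the empty cell, so no consistency is
  imposed.\<close>

definition cell :: "((real^'n) \<times> real) set \<Rightarrow> ((real^'n) \<times> real) set \<Rightarrow> (real^'n) set" where
  "cell Q A = {x. \<forall>(\<nu>, c)\<in>Q. if (\<nu>, c) \<in> A then \<nu> \<bullet> x < c else c < \<nu> \<bullet> x}"

lemma cell_eq: "cell Q A = (\<Inter>(\<nu>, c)\<in>Q. if (\<nu>, c) \<in> A then {x. \<nu> \<bullet> x < c} else {x. \<nu> \<bullet> x > c})"
  unfolding cell_def by (rule set_eqI) (auto split: if_splits)

lemma open_cell: "finite Q \<Longrightarrow> open (cell Q A)"
  unfolding cell_eq by (intro open_INT) (auto simp: open_halfspace_lt open_halfspace_gt)

lemma convex_cell: "convex (cell Q A)"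
  unfolding cell_eq by (intro convex_INT) (auto simp: convex_halfspace_lt convex_halfspace_gt)

lemma mem_cellI:
  assumes "\<And>\<nu> c. (\<nu>, c) \<in> Q \<Longrightarrow> \<nu> \<bullet> x \<noteq> c"
  shows "x \<in> cell Q {(\<nu>, c) \<in> Q. \<nu> \<bullet> x < c}"
  unfolding cell_def
proof (intro CollectI ballI, clarify)
  fix \<nu> c assume "(\<nu>, c) \<in> Q"
  then show "if (\<nu>, c) \<in> {(\<nu>, c) \<in> Q. \<nu> \<bullet> x < c} then \<nu> \<bullet> x < c else c < \<nu> \<bullet> x"
    using assms[of \<nu> c] by (cases "\<nu> \<bullet> x < c") simp_all
qed

text \<open>A point off all planes lies in an open cell of its own. If it is in the closure of
  another cell, the two cells meet; a common point shows that they make the same choices, so the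
  point is interior.\<close>

lemma frontier_cell:
  assumes fin: "finite Q"
  shows "frontier (cell Q A) \<subseteq> (\<Union>(\<nu>, c)\<in>Q. {x. \<nu> \<bullet> x = c})"
proof
  fix x assume x: "x \<in> frontier (cell Q A)"
  show "x \<in> (\<Union>(\<nu>, c)\<in>Q. {x. \<nu> \<bullet> x = c})"
  proof (rule ccontr)
    assume "x \<notin> (\<Union>(\<nu>, c)\<in>Q. {x. \<nu> \<bullet> x = c})"
    then have no: "\<And>\<nu> c. (\<nu>, c) \<in> Q \<Longrightarrow> \<nu> \<bullet> x \<noteq> c" by blast
    define B where "B = {(\<nu>, c) \<in> Q. \<nu> \<bullet> x < c}"
    have xB: "x \<in> cell Q B" unfolding B_def by (rule mem_cellI[OF no])
    have "x \<in> closure (cell Q A)" using x by (simp add: frontier_def)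
    then have "cell Q B \<inter> cell Q A \<noteq> {}"
      using open_Int_closure_eq_empty[OF open_cell[OF fin]] xB by blast
    then obtain y where y: "y \<in> cell Q B" "y \<in> cell Q A" by blast
    have AB: "q \<in> A \<longleftrightarrow> q \<in> B" if "q \<in> Q" for q
    proof -
      obtain \<nu> c where q: "q = (\<nu>, c)" by fastforce
      have "if q \<in> A then \<nu> \<bullet> y < c else c < \<nu> \<bullet> y" "if q \<in> B then \<nu> \<bullet> y < c else c < \<nu> \<bullet> y"
        using y that q by (auto simp: cell_def)
      then show ?thesis by (auto split: if_splits)
    qed
    have "cell Q B = cell Q A" unfolding cell_def using AB by auto
    then have "x \<in> interior (cell Q A)" using xB open_cell[OF fin] by (simp add: interior_open)
    then show False using x by (simp add: frontier_def)
  qed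
qed

context flat_domain
begin

text \<open>A cell is connected and avoids every plane of \<open>Q\<close>, hence the frontier of
  \<open>K\<close>.\<close>

lemma cell_subset_domain:
  assumes "cell Q A \<inter> K \<noteq> {}"
  shows "cell Q A \<subseteq> K"
proof (rule connected_disjoint_frontier_subset[OF convex_connected[OF convex_cell] _ assms])
  have "\<nu> \<bullet> x \<noteq> c" if "(\<nu>, c) \<in> Q" "x \<in> cell Q A" for \<nu> c x
    using that by (auto simp: cell_def split: if_splits)
  then show "cell Q A \<inter> frontier K = {}" using frontier_Q by blast
qed

lemma flat_domain_cell:
  assumes "cell Q A \<subseteq> K"
  shows "flat_domain (cell Q A) Q"
proof
  show "open (cell Q A)" by (rule open_cell[OF finite_Q])
  show "bounded (cell Q A)" using bounded_subset[OF bounded_K assms] .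
qed (use finite_Q unit_Q sym_Q frontier_cell[OF finite_Q] in auto)

text \<open>Away from the other planes, a small half-ball under the facet meets no plane at all.
  Being convex it stays on one side of each, so a single cell contains it; that cell lies below the
  plane of the facet and therefore has the same outward normal at \<open>x\<close>.\<close>

lemma facet_in_cell:
  assumes q: "(\<nu>, c) \<in> Q" and x: "x \<in> facet K \<nu> c"
    and other: "\<And>\<nu>' c'. (\<nu>', c') \<in> Q \<Longrightarrow> (\<nu>', c') \<noteq> (\<nu>, c) \<Longrightarrow> (\<nu>', c') \<noteq> (-\<nu>, -c) \<Longrightarrow> \<nu>' \<bullet> x \<noteq> c'"
  shows "\<exists>A\<subseteq>Q. cell Q A \<noteq> {} \<and> cell Q A \<subseteq> K \<and> x \<in> facet (cell Q A) \<nu> c"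
proof -
  have n: "norm \<nu> = 1" using unit_Q[OF q] .
  have nn: "\<nu> \<bullet> \<nu> = 1" using n by (simp add: dot_square_norm)
  obtain e where e: "\<nu> \<bullet> x = c" "e > 0" "K \<inter> ball x e = {y \<in> ball x e. \<nu> \<bullet> y < c}"
    using x by (auto simp: facet_def)
  define F where "F = (\<Union>(\<nu>', c')\<in>Q - {(\<nu>, c), (-\<nu>, -c)}. {x. \<nu>' \<bullet> x = c'})"
  have "closed F" unfolding F_def using finite_Q by (intro closed_UN) (auto simp: closed_hyperplane)
  moreover have "x \<notin> F" using other by (auto simp: F_def)
  ultimately obtain d where d: "d > 0" "ball x d \<inter> F = {}"
    by (metis Compl_iff disjoint_eq_subset_Compl open_Compl open_contains_ball)
  define r where "r = min d e"
  have r: "r > 0" "ball x r \<subseteq> ball x d" "ball x r \<subseteq> ball x e" using d e by (auto simp: r_def)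
  define H where "H = ball x r \<inter> {y. \<nu> \<bullet> y < c}"
  have convH: "convex H" unfolding H_def by (intro convex_Int convex_ball convex_halfspace_lt)
  have "H \<subseteq> K \<inter> ball x e" unfolding e(3) H_def using r(3) by blast
  then have HK: "H \<subseteq> K" by blast
  have off: "\<nu>' \<bullet> y \<noteq> c'" if "y \<in> H" "(\<nu>', c') \<in> Q" for y \<nu>' c'
  proof (cases "(\<nu>', c') = (\<nu>, c) \<or> (\<nu>', c') = (-\<nu>, -c)")
    case True
    then show ?thesis using that(1) by (auto simp: H_def)
  next
    case False
    have "y \<notin> F" using that(1) r(2) d(2) by (auto simp: H_def)
    then show ?thesis using False that(2) by (auto simp: F_def)
  qed
  define w where "w = x - (r / 2) *\<^sub>R \<nu>"
  have wH: "w \<in> H" using r(1) n nn e(1) by (simp add: H_def w_def dist_norm inner_diff_right)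
  define A where "A = {(\<nu>, c) \<in> Q. \<nu> \<bullet> w < c}"
  have wA: "w \<in> cell Q A" unfolding A_def using off[OF wH] by (rule mem_cellI)
  have HA: "H \<subseteq> cell Q A"
  proof
    fix y assume y: "y \<in> H"
    have same: "\<nu>' \<bullet> w < c' \<longleftrightarrow> \<nu>' \<bullet> y < c'" if q': "(\<nu>', c') \<in> Q" for \<nu>' c'
    proof (rule ccontr)
      assume "\<not> (\<nu>' \<bullet> w < c' \<longleftrightarrow> \<nu>' \<bullet> y < c')"
      then have "(\<nu>' \<bullet> w \<le> c' \<and> c' \<le> \<nu>' \<bullet> y) \<or> (\<nu>' \<bullet> y \<le> c' \<and> c' \<le> \<nu>' \<bullet> w)" by linarith
      then obtain z where "z \<in> H" "\<nu>' \<bullet> z = c'"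
        using connected_ivt_hyperplane[OF convex_connected[OF convH]] wH y by metis
      then show False using off q' by blast
    qed
    have "{(\<nu>, c) \<in> Q. \<nu> \<bullet> y < c} = A" unfolding A_def using same by auto
    then show "y \<in> cell Q A" using mem_cellI[of Q y, OF off[OF y]] by simp
  qed
  have "(\<nu>, c) \<in> A" using wH q by (simp add: A_def H_def)
  then have "cell Q A \<subseteq> {y. \<nu> \<bullet> y < c}" using q by (auto simp: cell_def)
  then have "cell Q A \<inter> ball x r = {y \<in> ball x r. \<nu> \<bullet> y < c}" using HA by (auto simp: H_def)
  then have "x \<in> facet (cell Q A) \<nu> c" unfolding facet_def using e(1) r(1) by blast
  moreover have "cell Q A \<subseteq> K" using cell_subset_domain wA wH HK by blast
  moreover have "A \<subseteq> Q" by (auto simp: A_def)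
  ultimately show ?thesis using wA by blast
qed

text \<open>By \<open>facet_in_cell\<close> almost every surface point of \<open>K\<close> is a
  surface point, with the same plane, of a cell inside \<open>K\<close>. The walls between cells
  only add nonnegative terms, so the constants of the finitely many cells can be summed.\<close>

lemma trace_inequality_C1:
  "\<exists>C\<ge>0. \<forall>f Df. C1_function f Df \<longrightarrow>
    (\<integral>x. (f x)\<^sup>2 \<partial>surf K) \<le> C * ((\<integral>x. indicator K x * (f x)\<^sup>2 \<partial>lborel) + (\<integral>x. indicator K x * (norm (Df x))\<^sup>2 \<partial>lborel))"
proof -
  define \<A> where "\<A> = {A. A \<subseteq> Q \<and> cell Q A \<noteq> {} \<and> cell Q A \<subseteq> K}"
  have fin: "finite \<A>" using finite_Q by (auto simp: \<A>_def intro: finite_subset[of _ "Pow Q"])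
  have fl: "flat_domain (cell Q A) Q" if "A \<in> \<A>" for A using that flat_domain_cell by (auto simp: \<A>_def)
  define P where "P A C \<longleftrightarrow> (\<forall>f Df. C1_function f Df \<longrightarrow>
    (\<integral>x. (f x)\<^sup>2 \<partial>surf (cell Q A)) \<le> C * ((\<integral>x. indicator (cell Q A) x * (f x)\<^sup>2 \<partial>lborel) + (\<integral>x. indicator (cell Q A) x * (norm (Df x))\<^sup>2 \<partial>lborel)))" for A and C :: real
  have "\<forall>A\<in>\<A>. \<exists>C. 0 \<le> C \<and> P A C"
    unfolding P_def using flat_domain.trace_inequality_convex[OF fl convex_cell] by (auto simp: \<A>_def)
  then obtain C where CP: "\<forall>A\<in>\<A>. 0 \<le> C A \<and> P A (C A)"
    using bchoice[of \<A> "\<lambda>A C. 0 \<le> C \<and> P A C"] by blast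
  have C: "\<And>A. A \<in> \<A> \<Longrightarrow> C A \<ge> 0" "\<And>A f Df. A \<in> \<A> \<Longrightarrow> C1_function f Df \<Longrightarrow>
    (\<integral>x. (f x)\<^sup>2 \<partial>surf (cell Q A)) \<le> C A * ((\<integral>x. indicator (cell Q A) x * (f x)\<^sup>2 \<partial>lborel) + (\<integral>x. indicator (cell Q A) x * (norm (Df x))\<^sup>2 \<partial>lborel))"
    using CP unfolding P_def by blast+
  have "(\<integral>x. (f x)\<^sup>2 \<partial>surf K) \<le> (\<Sum>A\<in>\<A>. C A) * ((\<integral>x. indicator K x * (f x)\<^sup>2 \<partial>lborel) + (\<integral>x. indicator K x * (norm (Df x))\<^sup>2 \<partial>lborel))"
    if C1: "C1_function f Df" for f Df
  proof -
    note cont = C1_function_continuous[OF C1]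
    note [measurable] = C1_function_measurable[OF C1]
    define E where "E = (\<integral>x. indicator K x * (f x)\<^sup>2 \<partial>lborel) + (\<integral>x. indicator K x * (norm (Df x))\<^sup>2 \<partial>lborel)"
    have E0: "E \<ge> 0" unfolding E_def by (intro add_nonneg_nonneg Bochner_Integration.integral_nonneg) auto
    have int_surf: "integrable (surf D) (\<lambda>x. (f x)\<^sup>2)" if D: "flat_domain D Q" for D
    proof -
      obtain B where B: "B > 0" "\<And>x. x \<in> frontier D \<Longrightarrow> norm (f x) \<le> B"
        using flat_domain.bounded_on_frontier[OF D cont(1)] by blast
      have fB: "(f x)\<^sup>2 \<le> B\<^sup>2" if "x \<in> frontier D" for x using B(2)[OF that] B(1) by (simp add: abs_le_square_iff[symmetric])
      show ?thesis
        by (rule flat_domain.integral_surf(1)[OF D, where B = "B\<^sup>2"]) (measurable, use fB in simp)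
    qed
    have cellE: "(\<integral>\<^sup>+x. ennreal ((f x)\<^sup>2) \<partial>surf (cell Q A)) \<le> ennreal (C A * E)" if A: "A \<in> \<A>" for A
    proof -
      have sub: "cell Q A \<subseteq> K" using A by (simp add: \<A>_def)
      have le: "(\<integral>x. indicator (cell Q A) x * g x \<partial>lborel) \<le> (\<integral>x. indicator K x * g x \<partial>lborel)"
        if "continuous_on UNIV g" "\<And>x. g x \<ge> 0" for g :: "real^'n \<Rightarrow> real"
        by (rule integral_mono[OF flat_domain.integrable_indicator_continuous[OF fl[OF A] that(1)] integrable_indicator_continuous[OF that(1)]])
          (use sub that(2) in \<open>auto simp: indicator_def\<close>)
      have "(\<integral>x. (f x)\<^sup>2 \<partial>surf (cell Q A)) \<le> C A * ((\<integral>x. indicator (cell Q A) x * (f x)\<^sup>2 \<partial>lborel) + (\<integral>x. indicator (cell Q A) x * (norm (Df x))\<^sup>2 \<partial>lborel))"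
        by (rule C(2)[OF A C1])
      also have "\<dots> \<le> C A * E"
        unfolding E_def by (intro mult_left_mono add_mono le continuous_intros cont C(1) A) auto
      finally show ?thesis
        using int_surf[OF fl[OF A]] by (simp add: nn_integral_eq_integral ennreal_leI)
    qed
    have "ennreal (\<integral>x. (f x)\<^sup>2 \<partial>surf K) = (\<integral>\<^sup>+x. ennreal ((f x)\<^sup>2) \<partial>surf K)"
      using int_surf[OF flat_domain_axioms] by (simp add: nn_integral_eq_integral)
    also have "\<dots> = (\<Sum>(\<nu>, c)\<in>facet_planes K. \<integral>\<^sup>+x. ennreal ((f x)\<^sup>2) * indicator (facet K \<nu> c) x \<partial>plane_measure \<nu> c)"
      by (rule nn_integral_surf) measurable
    also have "\<dots> \<le> (\<Sum>(\<nu>, c)\<in>facet_planes K. \<Sum>A\<in>\<A>. \<integral>\<^sup>+x. ennreal ((f x)\<^sup>2) * indicator (facet (cell Q A) \<nu> c) x \<partial>plane_measure \<nu> c)"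
    proof (intro sum_mono, clarify)
      fix \<nu> c assume "(\<nu>, c) \<in> facet_planes K"
      then have q: "(\<nu>, c) \<in> Q" using facet_planes_subset by blast
      have "AE x in plane_measure \<nu> c. \<forall>q'\<in>Q. q' \<noteq> (\<nu>, c) \<longrightarrow> q' \<noteq> (-\<nu>, -c) \<longrightarrow> fst q' \<bullet> x \<noteq> snd q'"
      proof (subst AE_finite_all[OF finite_Q], intro ballI)
        fix q' assume q': "q' \<in> Q"
        show "AE x in plane_measure \<nu> c. q' \<noteq> (\<nu>, c) \<longrightarrow> q' \<noteq> (-\<nu>, -c) \<longrightarrow> fst q' \<bullet> x \<noteq> snd q'"
          using AE_plane_measure_other[OF unit_Q[OF q] unit_Q, of "fst q'" "snd q'" "snd q'" c] q'
          by (cases "q' = (\<nu>, c) \<or> q' = (-\<nu>, -c)") auto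
      qed
      then have ae: "AE x in plane_measure \<nu> c. ennreal ((f x)\<^sup>2) * indicator (facet K \<nu> c) x
         \<le> (\<Sum>A\<in>\<A>. ennreal ((f x)\<^sup>2) * indicator (facet (cell Q A) \<nu> c) x)"
      proof eventually_elim
        case (elim x)
        show ?case
        proof (cases "x \<in> facet K \<nu> c")
          case True
          have "\<exists>A\<subseteq>Q. cell Q A \<noteq> {} \<and> cell Q A \<subseteq> K \<and> x \<in> facet (cell Q A) \<nu> c"
            by (rule facet_in_cell[OF q True]) (use elim in fastforce)
          then obtain A where A: "A \<in> \<A>" "x \<in> facet (cell Q A) \<nu> c" by (auto simp: \<A>_def)
          have "ennreal ((f x)\<^sup>2) * indicator (facet (cell Q A) \<nu> c) x \<le> (\<Sum>A\<in>\<A>. ennreal ((f x)\<^sup>2) * indicator (facet (cell Q A) \<nu> c) x)"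
            by (rule member_le_sum[OF A(1)]) (use fin in auto)
          then show ?thesis using A(2) True by simp
        qed simp
      qed
      have "(\<integral>\<^sup>+x. ennreal ((f x)\<^sup>2) * indicator (facet K \<nu> c) x \<partial>plane_measure \<nu> c)
         \<le> (\<integral>\<^sup>+x. (\<Sum>A\<in>\<A>. ennreal ((f x)\<^sup>2) * indicator (facet (cell Q A) \<nu> c) x) \<partial>plane_measure \<nu> c)"
        by (rule nn_integral_mono_AE[OF ae])
      also have "\<dots> = (\<Sum>A\<in>\<A>. \<integral>\<^sup>+x. ennreal ((f x)\<^sup>2) * indicator (facet (cell Q A) \<nu> c) x \<partial>plane_measure \<nu> c)"
        by (rule nn_integral_sum) measurable
      finally show "(\<integral>\<^sup>+x. ennreal ((f x)\<^sup>2) * indicator (facet K \<nu> c) x \<partial>plane_measure \<nu> c)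
         \<le> (\<Sum>A\<in>\<A>. \<integral>\<^sup>+x. ennreal ((f x)\<^sup>2) * indicator (facet (cell Q A) \<nu> c) x \<partial>plane_measure \<nu> c)" .
    qed
    also have "\<dots> = (\<Sum>A\<in>\<A>. \<Sum>(\<nu>, c)\<in>facet_planes K. \<integral>\<^sup>+x. ennreal ((f x)\<^sup>2) * indicator (facet (cell Q A) \<nu> c) x \<partial>plane_measure \<nu> c)"
      unfolding case_prod_beta by (rule sum.swap)
    also have "\<dots> \<le> (\<Sum>A\<in>\<A>. \<integral>\<^sup>+x. ennreal ((f x)\<^sup>2) \<partial>surf (cell Q A))"
    proof (rule sum_mono)
      fix A assume A: "A \<in> \<A>"
      \<comment> \<open>Planes without a facet of this cell contribute 0, and the facet planes of
        the cell that \<open>K\<close> lacks only enlarge the sum.\<close>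
      have "(\<Sum>(\<nu>, c)\<in>facet_planes K. \<integral>\<^sup>+x. ennreal ((f x)\<^sup>2) * indicator (facet (cell Q A) \<nu> c) x \<partial>plane_measure \<nu> c)
        = (\<Sum>(\<nu>, c)\<in>facet_planes K \<inter> facet_planes (cell Q A). \<integral>\<^sup>+x. ennreal ((f x)\<^sup>2) * indicator (facet (cell Q A) \<nu> c) x \<partial>plane_measure \<nu> c)"
      proof (rule sum.mono_neutral_right[OF finite_facet_planes], simp, intro ballI)
        fix q assume "q \<in> facet_planes K - facet_planes K \<inter> facet_planes (cell Q A)"
        then have "facet (cell Q A) (fst q) (snd q) = {}" by (auto simp: facet_planes_def)
        then show "(case q of (\<nu>, c) \<Rightarrow> \<integral>\<^sup>+x. ennreal ((f x)\<^sup>2) * indicator (facet (cell Q A) \<nu> c) x \<partial>plane_measure \<nu> c) = 0"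
          by (simp add: case_prod_beta)
      qed
      also have "\<dots> \<le> (\<Sum>(\<nu>, c)\<in>facet_planes (cell Q A). \<integral>\<^sup>+x. ennreal ((f x)\<^sup>2) * indicator (facet (cell Q A) \<nu> c) x \<partial>plane_measure \<nu> c)"
        by (rule sum_mono2[OF flat_domain.finite_facet_planes[OF fl[OF A]]]) auto
      also have "\<dots> = (\<integral>\<^sup>+x. ennreal ((f x)\<^sup>2) \<partial>surf (cell Q A))"
        by (rule flat_domain.nn_integral_surf[OF fl[OF A], symmetric]) measurable
      finally show "(\<Sum>(\<nu>, c)\<in>facet_planes K. \<integral>\<^sup>+x. ennreal ((f x)\<^sup>2) * indicator (facet (cell Q A) \<nu> c) x \<partial>plane_measure \<nu> c)
        \<le> (\<integral>\<^sup>+x. ennreal ((f x)\<^sup>2) \<partial>surf (cell Q A))" .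
    qed
    also have "\<dots> \<le> (\<Sum>A\<in>\<A>. ennreal (C A * E))" by (rule sum_mono[OF cellE])
    also have "\<dots> = ennreal (\<Sum>A\<in>\<A>. C A * E)" using C(1) E0 by (intro sum_ennreal) auto
    finally have "(\<integral>x. (f x)\<^sup>2 \<partial>surf K) \<le> (\<Sum>A\<in>\<A>. C A * E)"
      using C(1) E0 by (subst (asm) ennreal_le_iff) (auto intro!: sum_nonneg)
    then show ?thesis by (simp add: E_def sum_distrib_right)
  qed
  moreover have "(\<Sum>A\<in>\<A>. C A) \<ge> 0" using C(1) by (rule sum_nonneg)
  ultimately show ?thesis by blast
qed

end

text \<open>Normalising the given normals and adding the opposite orientations leaves the
  hyperplanes unchanged.\<close>

lemma polyhedral_element_flat_domain:
  fixes K :: "(real^'n) set"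
  assumes "polyhedral_element K"
  obtains Q where "flat_domain K Q"
proof -
  obtain P where P: "finite P" "\<And>\<nu> c. (\<nu>, c) \<in> P \<Longrightarrow> \<nu> \<noteq> 0" "frontier K \<subseteq> (\<Union>(\<nu>, c)\<in>P. {x. \<nu> \<bullet> x = c})"
    using assms unfolding polyhedral_element_def by blast
  define g :: "(real^'n) \<times> real \<Rightarrow> (real^'n) \<times> real" where "g = (\<lambda>(\<nu>, c). (\<nu> /\<^sub>R norm \<nu>, c / norm \<nu>))"
  define Q where "Q = g ` P \<union> uminus ` g ` P"
  have "flat_domain K Q"
  proof
    show "open K" "bounded K" using assms by (auto simp: polyhedral_element_def)
    show "finite Q" using P(1) by (simp add: Q_def)
    show "norm \<nu> = 1" if "(\<nu>, c) \<in> Q" for \<nu> c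
      using that P(2) by (auto simp: Q_def g_def)
    show "(-\<nu>, -c) \<in> Q" if "(\<nu>, c) \<in> Q" for \<nu> c
      using that unfolding Q_def by (metis (no_types, lifting) Un_iff image_iff uminus_Pair minus_minus)
    show "frontier K \<subseteq> (\<Union>(\<nu>, c)\<in>Q. {x. \<nu> \<bullet> x = c})"
    proof
      fix x assume "x \<in> frontier K"
      then obtain \<nu> c where q: "(\<nu>, c) \<in> P" "\<nu> \<bullet> x = c" using P(3) by blast
      have "(\<nu> /\<^sub>R norm \<nu>) \<bullet> x = c / norm \<nu>" using q by (simp add: divide_inverse mult.commute)
      moreover have "(\<nu> /\<^sub>R norm \<nu>, c / norm \<nu>) \<in> Q" using q(1) by (force simp: Q_def g_def)
      ultimately show "x \<in> (\<Union>(\<nu>, c)\<in>Q. {x. \<nu> \<bullet> x = c})" by blast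
    qed
  qed
  then show ?thesis using that by blast
qed

text \<open>Yields Cauchy-Schwarz both for \<open>l2_inner\<close> and for the semidefinite form in
  \<open>riesz_on_finite_set\<close>. A linear polynomial, or one with negative leading coefficient,
  cannot stay nonnegative; otherwise the minimiser \<open>B / C\<close> gives the claim.\<close>

lemma nonneg_quadratic_discriminant:
  fixes A B C :: real
  assumes "\<And>t. 0 \<le> A - 2 * t * B + t\<^sup>2 * C"
  shows "B\<^sup>2 \<le> A * C"
proof (cases "C = 0")
  case True
  have "B = 0"
  proof (rule ccontr)
    assume "B \<noteq> 0"
    \<comment> \<open>This \<open>t\<close> makes the linear polynomial equal to -1.\<close>
    then have "A - 2 * ((A + 1) / (2 * B)) * B = -1" by (simp add: field_simps)
    then show False using assms[of "(A + 1) / (2 * B)"] True by simp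
  qed
  then show ?thesis using True by simp
next
  case False
  have "0 \<le> A" using assms[of 0] by simp
  have "C \<ge> 0"
  proof (rule ccontr)
    assume "\<not> C \<ge> 0"
    then have C: "C < 0" by simp
    \<comment> \<open>Large enough that \<open>s * C\<close> lies below
      \<open>- (2 * \<bar>B\<bar> + A + 1)\<close>, so that the quadratic term outweighs the rest;
      the final \<open>+ 1\<close> ensures \<open>s \<ge> 1\<close>.\<close>
    define s where "s = (\<bar>B\<bar> * 2 + A + 1) / (-C) + 1"
    have "0 \<le> (\<bar>B\<bar> * 2 + A + 1) / (-C)" using C \<open>0 \<le> A\<close> by (intro divide_nonneg_nonneg) auto
    then have s: "s \<ge> 1" by (simp add: s_def)
    have "A + 2 * s * \<bar>B\<bar> + s * (s * C) < 0"
    proof -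
      have "s * (-C) = \<bar>B\<bar> * 2 + A + 1 - C" using C by (simp add: s_def field_simps)
      then have "s * C \<le> - (\<bar>B\<bar> * 2 + A + 1)" using C by linarith
      then have "s * (s * C) \<le> s * (- (\<bar>B\<bar> * 2 + A + 1))" using s by (intro mult_left_mono) auto
      moreover have "s * (A + 1) \<ge> 1 * (A + 1)" using s \<open>0 \<le> A\<close> by (intro mult_right_mono) auto
      ultimately show ?thesis by (simp add: algebra_simps)
    qed
    moreover have "0 \<le> A - 2 * s * B + s\<^sup>2 * C" using assms .
    moreover have "- (2 * s * B) \<le> 2 * s * \<bar>B\<bar>" using s by (cases "B \<ge> 0") (auto simp: mult_nonneg_nonpos)
    ultimately show False by (simp add: power2_eq_square mult.assoc)
  qed
  then have C: "C > 0" using False by simp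
  have "0 \<le> A - 2 * (B / C) * B + (B / C)\<^sup>2 * C" by (rule assms)
  also have "\<dots> = A - B\<^sup>2 / C" using C by (simp add: field_simps power2_eq_square)
  finally show ?thesis using C by (simp add: field_simps)
qed

section \<open>Square-integrable functions\<close>

lemma L2_measurable: "f \<in> L2 M \<Longrightarrow> f \<in> borel_measurable M"
  and L2_integrable: "f \<in> L2 M \<Longrightarrow> integrable M (\<lambda>x. (norm (f x))\<^sup>2)"
  by (simp_all add: L2_def)

lemma L2_integrable_inner:
  assumes f: "f \<in> L2 M" and g: "g \<in> L2 M"
  shows "integrable M (\<lambda>x. f x \<bullet> g x)"
proof (rule Bochner_Integration.integrable_bound)
  show "integrable M (\<lambda>x. (norm (f x))\<^sup>2 + (norm (g x))\<^sup>2)"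
    using L2_integrable[OF f] L2_integrable[OF g] by simp
  show "(\<lambda>x. f x \<bullet> g x) \<in> borel_measurable M"
    using L2_measurable[OF f] L2_measurable[OF g] by measurable
  have "\<bar>f x \<bullet> g x\<bar> \<le> (norm (f x))\<^sup>2 + (norm (g x))\<^sup>2" for x
  proof -
    have "2 * norm (f x) * norm (g x) \<le> (norm (f x))\<^sup>2 + (norm (g x))\<^sup>2" by (rule sum_squares_bound)
    moreover have "0 \<le> norm (f x) * norm (g x)" by simp
    ultimately show ?thesis using Cauchy_Schwarz_ineq2[of "f x" "g x"] by linarith
  qed
  then show "AE x in M. norm (f x \<bullet> g x) \<le> norm ((norm (f x))\<^sup>2 + (norm (g x))\<^sup>2)"
    by (intro AE_I2) (metis abs_ge_self order_trans real_norm_def)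
qed

lemma L2_zero [simp]: "(\<lambda>x. 0) \<in> L2 M"
  by (simp add: L2_def)

lemma L2_scale:
  assumes f: "f \<in> L2 M"
  shows "(\<lambda>x. c *\<^sub>R f x) \<in> L2 M"
  using f by (auto simp: L2_def power_mult_distrib)

lemma L2_add:
  assumes f: "f \<in> L2 M" and g: "g \<in> L2 M"
  shows "(\<lambda>x. f x + g x) \<in> L2 M"
proof -
  have "(norm (f x + g x))\<^sup>2 = (norm (f x))\<^sup>2 + (norm (g x))\<^sup>2 + 2 * (f x \<bullet> g x)" for x
    by (simp add: power2_norm_eq_inner inner_add_left inner_add_right inner_commute)
  moreover have "integrable M (\<lambda>x. (norm (f x))\<^sup>2 + (norm (g x))\<^sup>2 + 2 * (f x \<bullet> g x))"
    using L2_integrable[OF f] L2_integrable[OF g] L2_integrable_inner[OF f g] by simp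
  ultimately show ?thesis using L2_measurable[OF f] L2_measurable[OF g] by (simp add: L2_def)
qed

lemma L2_diff:
  assumes f: "f \<in> L2 M" and g: "g \<in> L2 M"
  shows "f - g \<in> L2 M"
  using L2_add[OF f L2_scale[OF g, of "-1"]] by (simp add: fun_diff_def)

lemma L2_sum:
  assumes "\<And>i. i \<in> I \<Longrightarrow> f i \<in> L2 M"
  shows "(\<lambda>x. \<Sum>i\<in>I. f i x) \<in> L2 M"
  using assms by (induction I rule: infinite_finite_induct) (auto intro: L2_add)

lemma l2_inner_commute: "l2_inner M f g = l2_inner M g f"
  by (simp add: l2_inner_def inner_commute)

lemma l2_inner_add_left:
  assumes "f \<in> L2 M" "g \<in> L2 M" "h \<in> L2 M"
  shows "l2_inner M (\<lambda>x. f x + g x) h = l2_inner M f h + l2_inner M g h"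
  using assms by (simp add: l2_inner_def inner_add_left L2_integrable_inner)

lemma l2_inner_scale_left: "l2_inner M (\<lambda>x. c *\<^sub>R f x) h = c * l2_inner M f h"
  by (simp add: l2_inner_def)

lemma l2_inner_add_right:
  assumes "f \<in> L2 M" "g \<in> L2 M" "h \<in> L2 M"
  shows "l2_inner M h (\<lambda>x. f x + g x) = l2_inner M h f + l2_inner M h g"
  using assms by (simp add: l2_inner_def inner_add_right L2_integrable_inner)

lemma l2_inner_scale_right: "l2_inner M h (\<lambda>x. c *\<^sub>R f x) = c * l2_inner M h f"
  by (simp add: l2_inner_def)

lemma l2_inner_diff_left:
  assumes "f \<in> L2 M" "g \<in> L2 M" "h \<in> L2 M"
  shows "l2_inner M (f - g) h = l2_inner M f h - l2_inner M g h"
  using assms by (simp add: l2_inner_def inner_diff_left L2_integrable_inner)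

lemma l2_inner_diff_right:
  assumes "f \<in> L2 M" "g \<in> L2 M" "h \<in> L2 M"
  shows "l2_inner M h (f - g) = l2_inner M h f - l2_inner M h g"
  using l2_inner_diff_left[OF assms] by (simp add: l2_inner_commute)

lemma l2_inner_zero [simp]: "l2_inner M (\<lambda>x. 0) f = 0" "l2_inner M f (\<lambda>x. 0) = 0"
  by (simp_all add: l2_inner_def)

lemma l2_inner_self: "l2_inner M f f = (l2_norm M f)\<^sup>2"
  by (simp add: l2_inner_def l2_norm_def power2_norm_eq_inner[symmetric])

lemma l2_norm_nonneg [simp]: "0 \<le> l2_norm M f"
  by (simp add: l2_norm_def)

lemma l2_norm_scale: "l2_norm M (\<lambda>x. c *\<^sub>R f x) = \<bar>c\<bar> * l2_norm M f"
  by (simp add: l2_norm_def power_mult_distrib real_sqrt_mult)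

lemma l2_norm_diff_commute: "l2_norm M (f - g) = l2_norm M (g - f)"
  by (simp add: l2_norm_def norm_minus_commute)

lemma l2_inner_le_norm:
  assumes f: "f \<in> L2 M" and g: "g \<in> L2 M"
  shows "\<bar>l2_inner M f g\<bar> \<le> l2_norm M f * l2_norm M g"
proof -
  have "0 \<le> l2_inner M f f - 2 * t * l2_inner M f g + t\<^sup>2 * l2_inner M g g" for t
  proof -
    have "0 \<le> l2_inner M (\<lambda>x. f x + (-t) *\<^sub>R g x) (\<lambda>x. f x + (-t) *\<^sub>R g x)" by (simp only: l2_inner_self zero_le_power2)
    also have "\<dots> = l2_inner M f f - 2 * t * l2_inner M f g + t\<^sup>2 * l2_inner M g g"
      using f g L2_scale[OF g, of "-t"] L2_add[OF f L2_scale[OF g, of "-t"]]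
      by (simp only: l2_inner_add_left l2_inner_add_right l2_inner_scale_left l2_inner_scale_right l2_inner_commute[of M g f])
        (simp add: algebra_simps power2_eq_square)
    finally show ?thesis .
  qed
  then have "(l2_inner M f g)\<^sup>2 \<le> l2_inner M f f * l2_inner M g g" by (rule nonneg_quadratic_discriminant)
  then have "(l2_inner M f g)\<^sup>2 \<le> (l2_norm M f * l2_norm M g)\<^sup>2" by (simp add: l2_inner_self power_mult_distrib)
  then show ?thesis by (metis abs_le_square_iff abs_of_nonneg l2_norm_nonneg mult_nonneg_nonneg)
qed

lemma l2_norm_triangle:
  assumes f: "f \<in> L2 M" and g: "g \<in> L2 M"
  shows "l2_norm M (\<lambda>x. f x + g x) \<le> l2_norm M f + l2_norm M g"
proof -
  have "(l2_norm M (\<lambda>x. f x + g x))\<^sup>2 = (l2_norm M f)\<^sup>2 + 2 * l2_inner M f g + (l2_norm M g)\<^sup>2"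
    using f g L2_add[OF f g] unfolding l2_inner_self[symmetric]
    by (simp only: l2_inner_add_left l2_inner_add_right l2_inner_commute[of M g f])
  also have "\<dots> \<le> (l2_norm M f + l2_norm M g)\<^sup>2"
    using l2_inner_le_norm[OF f g] by (simp add: power2_sum)
  finally show ?thesis by (rule power2_le_imp_le) simp
qed

lemma l2_norm_diff_triangle:
  assumes "f \<in> L2 M" "g \<in> L2 M" "h \<in> L2 M"
  shows "l2_norm M (f - h) \<le> l2_norm M (f - g) + l2_norm M (g - h)"
  using l2_norm_triangle[OF L2_diff[OF assms(1,2)] L2_diff[OF assms(2,3)]]
  by (simp add: fun_diff_def)

lemma ae_eq_refl [simp]: "ae_eq M f f"
  by (simp add: ae_eq_def)

lemma ae_eq_sym: "ae_eq M f g \<Longrightarrow> ae_eq M g f"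
  unfolding ae_eq_def by (auto elim: eventually_mono)

lemma ae_eq_trans: "ae_eq M f g \<Longrightarrow> ae_eq M g h \<Longrightarrow> ae_eq M f h"
  unfolding ae_eq_def by (erule (1) eventually_elim2) simp

lemma ae_eq_add: "ae_eq M f f' \<Longrightarrow> ae_eq M g g' \<Longrightarrow> ae_eq M (\<lambda>x. f x + g x) (\<lambda>x. f' x + g' x)"
  unfolding ae_eq_def by (erule (1) eventually_elim2) simp

lemma ae_eq_diff: "ae_eq M f f' \<Longrightarrow> ae_eq M g g' \<Longrightarrow> ae_eq M (f - g) (f' - g')"
  unfolding ae_eq_def by (erule (1) eventually_elim2) simp

lemma ae_eq_scale: "ae_eq M f f' \<Longrightarrow> ae_eq M (\<lambda>x. c *\<^sub>R f x) (\<lambda>x. c *\<^sub>R f' x)"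
  unfolding ae_eq_def by (erule eventually_mono) simp

lemma l2_inner_cong:
  assumes "ae_eq M f f'" "ae_eq M g g'" "f \<in> L2 M" "f' \<in> L2 M" "g \<in> L2 M" "g' \<in> L2 M"
  shows "l2_inner M f g = l2_inner M f' g'"
  unfolding l2_inner_def
proof (rule integral_cong_AE)
  show "AE x in M. f x \<bullet> g x = f' x \<bullet> g' x"
    using assms(1,2) unfolding ae_eq_def by eventually_elim simp
qed (use assms L2_integrable_inner borel_measurable_integrable in blast)+

lemma l2_norm_cong:
  assumes "ae_eq M f f'" "f \<in> L2 M" "f' \<in> L2 M"
  shows "l2_norm M f = l2_norm M f'"
proof -
  have "(l2_norm M f)\<^sup>2 = (l2_norm M f')\<^sup>2"
    unfolding l2_inner_self[symmetric] using assms by (intro l2_inner_cong)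
  then show ?thesis by simp
qed

lemma l2_norm_eq_0_iff:
  assumes "f \<in> L2 M"
  shows "l2_norm M f = 0 \<longleftrightarrow> ae_eq M f (\<lambda>x. 0)"
proof -
  have "l2_norm M f = 0 \<longleftrightarrow> (\<integral>x. (norm (f x))\<^sup>2 \<partial>M) = 0" by (simp add: l2_norm_def)
  also have "\<dots> \<longleftrightarrow> (AE x in M. (norm (f x))\<^sup>2 = 0)"
    using L2_integrable[OF assms] by (rule integral_nonneg_eq_0_iff_AE) simp
  finally show ?thesis by (simp add: ae_eq_def)
qed

lemma l2_norm_diff_eq_0_iff:
  assumes "f \<in> L2 M" "g \<in> L2 M"
  shows "l2_norm M (f - g) = 0 \<longleftrightarrow> ae_eq M f g"
  unfolding l2_norm_eq_0_iff[OF L2_diff[OF assms]] by (simp add: ae_eq_def)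

lemma tendsto_l2_inner:
  assumes f: "\<And>k. f k \<in> L2 M" "f' \<in> L2 M" "(\<lambda>k. l2_norm M (f k - f')) \<longlonglongrightarrow> 0"
    and g: "\<And>k. g k \<in> L2 M" "g' \<in> L2 M" "(\<lambda>k. l2_norm M (g k - g')) \<longlonglongrightarrow> 0"
  shows "(\<lambda>k. l2_inner M (f k) (g k)) \<longlonglongrightarrow> l2_inner M f' g'"
proof -
  have "(\<lambda>k. l2_inner M (f k) (g k) - l2_inner M f' g') \<longlonglongrightarrow> 0"
  proof (rule Lim_null_comparison)
    let ?b = "\<lambda>k. l2_norm M (f k - f') * l2_norm M (g k - g') + l2_norm M (f k - f') * l2_norm M g' + l2_norm M f' * l2_norm M (g k - g')"
    have "l2_inner M (f k) (g k) - l2_inner M f' g'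
      = l2_inner M (f k - f') (g k - g') + l2_inner M (f k - f') g' + l2_inner M f' (g k - g')" for k
      using f(1)[of k] f(2) g(1)[of k] g(2) L2_diff[OF g(1)[of k] g(2)]
      by (simp add: l2_inner_diff_left l2_inner_diff_right)
    moreover have "\<bar>l2_inner M (f k - f') (g k - g')\<bar> \<le> l2_norm M (f k - f') * l2_norm M (g k - g')"
      "\<bar>l2_inner M (f k - f') g'\<bar> \<le> l2_norm M (f k - f') * l2_norm M g'"
      "\<bar>l2_inner M f' (g k - g')\<bar> \<le> l2_norm M f' * l2_norm M (g k - g')" for k
      using f g by (auto intro!: l2_inner_le_norm L2_diff)
    ultimately have "\<bar>l2_inner M (f k) (g k) - l2_inner M f' g'\<bar> \<le> ?b k" for k
      by (smt (verit))
    then show "\<forall>\<^sub>F k in sequentially. norm (l2_inner M (f k) (g k) - l2_inner M f' g') \<le> ?b k" by simp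
    have "?b \<longlonglongrightarrow> 0 * 0 + 0 * l2_norm M g' + l2_norm M f' * 0"
      by (intro tendsto_intros f g)
    then show "?b \<longlonglongrightarrow> 0" by simp
  qed
  then show ?thesis by (rule LIM_zero_cancel)
qed

section \<open>Completeness of L2 over a finite measure\<close>

lemma L2_norm_L1_bound:
  fixes f :: "'a \<Rightarrow> real"
  assumes "finite_measure M" and f: "f \<in> L2 M"
  shows "integrable M (\<lambda>x. \<bar>f x\<bar>)" "(\<integral>x. \<bar>f x\<bar> \<partial>M) \<le> sqrt (measure M (space M)) * l2_norm M f"
proof -
  interpret finite_measure M by fact
  have one: "(\<lambda>x. 1 :: real) \<in> L2 M" by (simp add: L2_def)
  have af: "(\<lambda>x. \<bar>f x\<bar>) \<in> L2 M" using f by (auto simp: L2_def)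
  show "integrable M (\<lambda>x. \<bar>f x\<bar>)" using L2_integrable_inner[OF one af] by simp
  have "(\<integral>x. \<bar>f x\<bar> \<partial>M) = l2_inner M (\<lambda>x. 1) (\<lambda>x. \<bar>f x\<bar>)" by (simp add: l2_inner_def)
  also have "\<dots> \<le> l2_norm M (\<lambda>x. 1 :: real) * l2_norm M (\<lambda>x. \<bar>f x\<bar>)" using l2_inner_le_norm[OF one af] by linarith
  also have "\<dots> = sqrt (measure M (space M)) * l2_norm M f" by (simp add: l2_norm_def)
  finally show "(\<integral>x. \<bar>f x\<bar> \<partial>M) \<le> sqrt (measure M (space M)) * l2_norm M f" .
qed

text \<open>Riesz-Fischer. Along a fast subsequence the increments have summable L2 norms, hence
  summable L1 norms as the measure is finite, so the subsequence converges a.e.; Fatou turns this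
  into convergence in L2.\<close>

lemma L2_complete:
  fixes f :: "nat \<Rightarrow> 'a \<Rightarrow> real"
  assumes fm: "finite_measure M" and f: "\<And>k. f k \<in> L2 M"
    and Cauchy: "\<And>e. 0 < e \<Longrightarrow> \<exists>N. \<forall>m\<ge>N. \<forall>n\<ge>N. l2_norm M (f m - f n) < e"
  shows "\<exists>g\<in>L2 M. (\<lambda>k. l2_norm M (f k - g)) \<longlonglongrightarrow> 0"
proof -
  note [measurable] = L2_measurable[OF f]
  have "\<forall>k. \<exists>N. \<forall>m\<ge>N. \<forall>n\<ge>N. l2_norm M (f m - f n) < (1/2)^k" by (intro allI Cauchy) simp
  then obtain N0 where N0: "\<And>k m n. N0 k \<le> m \<Longrightarrow> N0 k \<le> n \<Longrightarrow> l2_norm M (f m - f n) < (1/2)^k" by metis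
  \<comment> \<open>Summing all earlier thresholds makes \<open>r\<close> monotone and at least
    \<open>N0 k\<close>; adding \<open>k\<close> sends it to infinity.\<close>
  define r where "r k = (\<Sum>j\<le>k. N0 j) + k" for k
  have r: "N0 k \<le> r k" "r k \<le> r (Suc k)" "k \<le> r k" for k
    by (auto simp: r_def intro: order_trans[OF member_le_sum[of k "{..k}" N0]])
  define h where "h k x = \<bar>f (r (Suc k)) x - f (r k) x\<bar>" for k x
  have [measurable]: "h k \<in> borel_measurable M" for k unfolding h_def[abs_def] by measurable
  have hint: "(\<integral>\<^sup>+x. ennreal (h k x) \<partial>M) \<le> ennreal (sqrt (measure M (space M)) * (1/2)^k)" for k
  proof -
    have d: "f (r (Suc k)) - f (r k) \<in> L2 M" by (intro L2_diff f)
    have n: "l2_norm M (f (r (Suc k)) - f (r k)) \<le> (1/2)^k"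
      using N0[of k "r (Suc k)" "r k"] r[of k] by (auto intro: order_trans less_imp_le)
    have "(\<integral>\<^sup>+x. ennreal (h k x) \<partial>M) = ennreal (\<integral>x. h k x \<partial>M)"
      using L2_norm_L1_bound(1)[OF fm d] by (intro nn_integral_eq_integral) (auto simp: h_def)
    also have "(\<integral>x. h k x \<partial>M) \<le> sqrt (measure M (space M)) * l2_norm M (f (r (Suc k)) - f (r k))"
      using L2_norm_L1_bound(2)[OF fm d] by (simp add: h_def)
    also have "\<dots> \<le> sqrt (measure M (space M)) * (1/2)^k" using n by (intro mult_left_mono) auto
    finally show ?thesis by (simp add: ennreal_leI)
  qed
  have "(\<integral>\<^sup>+x. (\<Sum>k. ennreal (h k x)) \<partial>M) = (\<Sum>k. \<integral>\<^sup>+x. ennreal (h k x) \<partial>M)"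
    by (rule nn_integral_suminf) measurable
  also have "\<dots> \<le> (\<Sum>k. ennreal (sqrt (measure M (space M)) * (1/2)^k))"
    by (intro suminf_le hint) auto
  also have "\<dots> < \<infinity>"
    by (subst suminf_ennreal2) (auto intro!: summable_mult summable_geometric)
  finally have "AE x in M. (\<Sum>k. ennreal (h k x)) \<noteq> \<infinity>"
    by (intro nn_integral_PInf_AE) auto
  then have conv: "AE x in M. convergent (\<lambda>k. f (r k) x)"
  proof eventually_elim
    case (elim x)
    have "summable (\<lambda>k. h k x)"
    proof (rule summable_suminf_not_top)
      show "0 \<le> h k x" for k by (simp add: h_def)
      show "(\<Sum>k. ennreal (h k x)) \<noteq> top" using elim unfolding infinity_ennreal_def .
    qed
    then have "summable (\<lambda>k. norm (f (r (Suc k)) x - f (r k) x))"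
      by (simp only: h_def real_norm_def)
    then have "summable (\<lambda>k. f (r (Suc k)) x - f (r k) x)" by (rule summable_norm_cancel)
    then have "(\<lambda>n. (\<Sum>k<n. f (r (Suc k)) x - f (r k) x) + f (r 0) x)
        \<longlonglongrightarrow> (\<Sum>k. f (r (Suc k)) x - f (r k) x) + f (r 0) x"
      by (intro tendsto_add summable_LIMSEQ tendsto_const)
    moreover have "(\<Sum>k<n. f (r (Suc k)) x - f (r k) x) = f (r n) x - f (r 0) x" for n
      by (rule sum_lessThan_telescope)
    ultimately show ?case by (auto simp: convergent_def)
  qed
  define g where "g x = lim (\<lambda>k. f (r k) x)" for x
  have [measurable]: "g \<in> borel_measurable M" unfolding g_def[abs_def] by measurable
  have lim: "AE x in M. (\<lambda>k. f (r k) x) \<longlonglongrightarrow> g x"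
    using conv by eventually_elim (simp add: g_def convergent_LIMSEQ_iff)
  \<comment> \<open>Fatou: the Cauchy bound on \<open>f m - f (r k)\<close> passes to the limit in
    \<open>k\<close>.\<close>
  have bound: "(\<integral>\<^sup>+x. ennreal ((norm ((f m - g) x))\<^sup>2) \<partial>M) \<le> ennreal (((1/2)^j)\<^sup>2)" if m: "m \<ge> r j" for m j
  proof -
    have "(\<integral>\<^sup>+x. ennreal ((norm ((f m - g) x))\<^sup>2) \<partial>M) = (\<integral>\<^sup>+x. liminf (\<lambda>k. ennreal ((f m x - f (r k) x)\<^sup>2)) \<partial>M)"
    proof (rule nn_integral_cong_AE)
      show "AE x in M. ennreal ((norm ((f m - g) x))\<^sup>2) = liminf (\<lambda>k. ennreal ((f m x - f (r k) x)\<^sup>2))"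
        using lim
      proof eventually_elim
        case (elim x)
        then have "(\<lambda>k. (f m x - f (r k) x)\<^sup>2) \<longlonglongrightarrow> (f m x - g x)\<^sup>2"
          by (intro tendsto_intros)
        then have e: "(\<lambda>k. ennreal ((f m x - f (r k) x)\<^sup>2)) \<longlonglongrightarrow> ennreal ((f m x - g x)\<^sup>2)"
          by (rule tendsto_ennrealI)
        show ?case by (subst lim_imp_Liminf[OF sequentially_bot e]) simp
      qed
    qed
    also have "\<dots> \<le> liminf (\<lambda>k. \<integral>\<^sup>+x. ennreal ((f m x - f (r k) x)\<^sup>2) \<partial>M)"
      by (rule nn_integral_liminf) measurable
    also have "\<dots> \<le> ennreal (((1/2)^j)\<^sup>2)"
    proof (rule Liminf_le)
      show "\<forall>\<^sub>F k in sequentially. (\<integral>\<^sup>+x. ennreal ((f m x - f (r k) x)\<^sup>2) \<partial>M) \<le> ennreal (((1/2)^j)\<^sup>2)"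
        using eventually_ge_at_top[of "r j"]
      proof eventually_elim
        case (elim k)
        have d: "f m - f (r k) \<in> L2 M" by (intro L2_diff f)
        have "l2_norm M (f m - f (r k)) \<le> (1/2)^j"
          using N0[of j m "r k"] m elim r(1)[of j] r(3)[of k] by (auto intro!: less_imp_le)
        then have "(l2_norm M (f m - f (r k)))\<^sup>2 \<le> ((1/2)^j)\<^sup>2" by (intro power_mono) auto
        moreover have "(\<integral>\<^sup>+x. ennreal ((f m x - f (r k) x)\<^sup>2) \<partial>M) = ennreal ((l2_norm M (f m - f (r k)))\<^sup>2)"
          using L2_integrable[OF d] by (simp add: l2_norm_def nn_integral_eq_integral)
        ultimately show ?case by (simp add: ennreal_leI)
      qed
    qed simp
    finally show ?thesis .
  qed
  have dL2: "f m - g \<in> L2 M" and nb: "l2_norm M (f m - g) \<le> (1/2)^j" if m: "m \<ge> r j" for m j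
  proof -
    have i: "integrable M (\<lambda>x. (norm ((f m - g) x))\<^sup>2)"
    proof (rule integrableI_nonneg)
      show "(\<integral>\<^sup>+x. ennreal ((norm ((f m - g) x))\<^sup>2) \<partial>M) < \<infinity>"
        using bound[OF m] by (rule order_le_less_trans) simp
    qed (auto simp: fun_diff_def)
    then show "f m - g \<in> L2 M" by (auto simp: L2_def fun_diff_def)
    have "ennreal (\<integral>x. (norm ((f m - g) x))\<^sup>2 \<partial>M) \<le> ennreal (((1/2)^j)\<^sup>2)"
      using bound[OF m] i by (simp add: nn_integral_eq_integral)
    then have "(\<integral>x. (norm ((f m - g) x))\<^sup>2 \<partial>M) \<le> ((1/2)^j)\<^sup>2" by (subst (asm) ennreal_le_iff) auto
    then show "l2_norm M (f m - g) \<le> (1/2)^j"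
      unfolding l2_norm_def by (intro real_le_lsqrt) auto
  qed
  \<comment> \<open>So far only differences with \<open>g\<close> are known to be in L2;
    \<open>g\<close> is recovered from one of them.\<close>
  have "f (r 0) - (f (r 0) - g) \<in> L2 M" by (intro L2_diff f dL2[of 0 "r 0"]) simp
  moreover have "f (r 0) - (f (r 0) - g) = g" by (auto simp: fun_diff_def)
  ultimately have "g \<in> L2 M" by (simp only:)
  moreover have "(\<lambda>k. l2_norm M (f k - g)) \<longlonglongrightarrow> 0"
  proof (rule LIMSEQ_I)
    fix e :: real assume "0 < e"
    then obtain j where j: "(1/2)^j < e" using real_arch_pow_inv[of e "1/2"] by auto
    then show "\<exists>no. \<forall>n\<ge>no. norm (l2_norm M (f n - g) - 0) < e"
      using nb by (intro exI[of _ "r j"]) (auto intro: order_le_less_trans)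
  qed
  ultimately show ?thesis by blast
qed

section \<open>Vector-valued functions by components\<close>

lemma L2_ae_eq_components:
  fixes f g :: "'a \<Rightarrow> 'b^'n"
  shows "ae_eq M f g \<longleftrightarrow> (\<forall>i. ae_eq M (\<lambda>x. f x $ i) (\<lambda>x. g x $ i))"
  unfolding ae_eq_def vec_eq_iff using eventually_ball_finite_distrib[of UNIV "\<lambda>x i. f x $ i = g x $ i" "ae_filter M"] by simp

lemma L2_components:
  fixes f :: "'a \<Rightarrow> 'b::euclidean_space^'n"
  shows "f \<in> L2 M \<longleftrightarrow> (\<forall>i. (\<lambda>x. f x $ i) \<in> L2 M)"
proof
  assume f: "f \<in> L2 M"
  show "\<forall>i. (\<lambda>x. f x $ i) \<in> L2 M"
  proof
    fix i
    have m: "(\<lambda>x. f x $ i) \<in> borel_measurable M"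
      by (rule measurable_compose[OF L2_measurable[OF f]])
        (intro borel_measurable_continuous_onI continuous_on_component continuous_on_id)
    have "integrable M (\<lambda>x. (norm (f x $ i))\<^sup>2)"
      by (rule Bochner_Integration.integrable_bound[OF L2_integrable[OF f]])
        (use m in \<open>auto intro!: AE_I2 power_mono Finite_Cartesian_Product.norm_nth_le\<close>)
    then show "(\<lambda>x. f x $ i) \<in> L2 M" using m by (simp add: L2_def)
  qed
next
  assume c: "\<forall>i. (\<lambda>x. f x $ i) \<in> L2 M"
  have "f \<in> borel_measurable M"
  proof (subst borel_measurable_euclidean_space, intro ballI)
    fix b :: "'b^'n" assume "b \<in> Basis"
    then obtain i u where b: "b = axis i u" by (auto simp: Basis_vec_def)
    have "(\<lambda>x. f x \<bullet> b) = (\<lambda>x. f x $ i \<bullet> u)" by (simp add: b inner_axis)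
    moreover have "(\<lambda>x. f x $ i) \<in> borel_measurable M" using c L2_measurable by blast
    ultimately show "(\<lambda>x. f x \<bullet> b) \<in> borel_measurable M" by simp
  qed
  moreover have "(norm (f x))\<^sup>2 = (\<Sum>i\<in>UNIV. (norm (f x $ i))\<^sup>2)" for x
    by (simp add: power2_norm_eq_inner inner_vec_def)
  moreover have "integrable M (\<lambda>x. \<Sum>i\<in>UNIV. (norm (f x $ i))\<^sup>2)"
    using c L2_integrable by (intro Bochner_Integration.integrable_sum) blast
  ultimately show "f \<in> L2 M" by (simp add: L2_def)
qed

lemma l2_inner_components:
  fixes f g :: "'a \<Rightarrow> 'b::euclidean_space^'n"
  assumes "f \<in> L2 M" "g \<in> L2 M"
  shows "l2_inner M f g = (\<Sum>i\<in>UNIV. l2_inner M (\<lambda>x. f x $ i) (\<lambda>x. g x $ i))"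
proof -
  have "integrable M (\<lambda>x. f x $ i \<bullet> g x $ i)" for i
    using assms L2_components by (intro L2_integrable_inner) blast+
  then show ?thesis unfolding l2_inner_def inner_vec_def by (intro Bochner_Integration.integral_sum) auto
qed

lemma l2_norm_component_le:
  fixes f :: "'a \<Rightarrow> 'b::euclidean_space^'n"
  assumes f: "f \<in> L2 M"
  shows "l2_norm M (\<lambda>x. f x $ i) \<le> l2_norm M f"
  unfolding l2_norm_def
proof (rule real_sqrt_le_mono, rule integral_mono)
  have "(\<lambda>x. f x $ i) \<in> L2 M" using f L2_components by blast
  then show "integrable M (\<lambda>x. (norm (f x $ i))\<^sup>2)" by (rule L2_integrable)
qed (auto intro!: L2_integrable f power_mono Finite_Cartesian_Product.norm_nth_le)

section \<open>Density of polynomials\<close>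

lemma C1_function_const [intro]: "C1_function (\<lambda>x. c) (\<lambda>x. 0)"
  by (simp add: C1_function_def GDERIV_const)

lemma C1_function_add [intro]:
  "C1_function f Df \<Longrightarrow> C1_function g Dg \<Longrightarrow> C1_function (\<lambda>x. f x + g x) (\<lambda>x. Df x + Dg x)"
  by (auto simp: C1_function_def intro!: GDERIV_add continuous_intros)

lemma C1_function_mult [intro]:
  assumes "C1_function f Df" "C1_function g Dg"
  shows "C1_function (\<lambda>x. f x * g x) (\<lambda>x. f x *\<^sub>R Dg x + g x *\<^sub>R Df x)"
  using assms C1_function_continuous[OF assms(1)] C1_function_continuous[OF assms(2)]
  by (auto simp: C1_function_def intro!: GDERIV_mult continuous_intros)

lemma C1_function_inner: "C1_function (\<lambda>x. x \<bullet> v) (\<lambda>x. v)"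
  unfolding C1_function_def gderiv_def by (auto intro!: derivative_eq_intros)

text \<open>Admits polynomials wherever a C1 test function is asked for.\<close>

lemma real_polynomial_function_C1:
  fixes p :: "real^'n \<Rightarrow> real"
  assumes "real_polynomial_function p"
  shows "\<exists>Dp. C1_function p Dp"
  using assms
proof (induction rule: real_polynomial_function.induct)
  case (linear f)
  have "f x = x \<bullet> (\<Sum>b\<in>Basis. f b *\<^sub>R b)" for x
  proof -
    have "f x = f (\<Sum>b\<in>Basis. (x \<bullet> b) *\<^sub>R b)" by (simp add: euclidean_representation)
    also have "\<dots> = (\<Sum>b\<in>Basis. (x \<bullet> b) * f b)"
      using linear by (simp add: linear_sum linear_scale bounded_linear.linear)
    finally show ?thesis by (simp add: inner_sum_right mult.commute)
  qed
  then have "f = (\<lambda>x. x \<bullet> (\<Sum>b\<in>Basis. f b *\<^sub>R b))" by blast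
  then show ?case using C1_function_inner by metis
qed blast+

text \<open>On the compact set that carries the measure, Stone-Weierstrass extends the vanishing
  from polynomials to continuous functions. Continuous approximations of indicators extend it to
  closed sets, and a Dynkin argument to Borel sets, which makes the density \<open>g\<close>
  vanish.\<close>

lemma polynomial_dense:
  fixes g :: "real^'n \<Rightarrow> real"
  assumes fm: "finite_measure M" and sets_M: "sets M = sets borel" and C: "compact C" "AE x in M. x \<in> C"
    and g: "integrable M g" and zero: "\<And>p. real_polynomial_function p \<Longrightarrow> (\<integral>x. g x * p x \<partial>M) = 0"
  shows "AE x in M. g x = 0"
proof -
  interpret finite_measure M by fact
  note [measurable_cong] = sets_M
  have gm [measurable]: "g \<in> borel_measurable borel" using g by (simp add: measurable_cong_sets[OF sets_M refl, symmetric])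
  have sp: "space M = UNIV" using sets_eq_imp_space_eq[OF sets_M] by simp
  have int_gh: "integrable M (\<lambda>x. g x * h x)" if h: "continuous_on UNIV h" for h
  proof -
    have [measurable]: "h \<in> borel_measurable borel" using h by (rule borel_measurable_continuous_onI)
    have "bounded (h ` C)" by (intro compact_imp_bounded compact_continuous_image continuous_on_subset[OF h] C) auto
    then obtain B where B: "B > 0" "\<And>x. x \<in> C \<Longrightarrow> norm (h x) \<le> B" by (auto simp: bounded_pos)
    show ?thesis
    proof (rule Bochner_Integration.integrable_bound)
      show "integrable M (\<lambda>x. g x * B)" using g by simp
      show "AE x in M. norm (g x * h x) \<le> norm (g x * B)"
        using C(2) by eventually_elim (use B in \<open>auto simp: abs_mult intro!: mult_left_mono\<close>)
    qed measurable
  qed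
  have zero_cont: "(\<integral>x. g x * h x \<partial>M) = 0" if h: "continuous_on UNIV h" for h
  proof (rule ccontr)
    assume nz: "(\<integral>x. g x * h x \<partial>M) \<noteq> 0"
    define G where "G = (\<integral>x. \<bar>g x\<bar> \<partial>M)"
    have G0: "0 \<le> G" by (simp add: G_def)
    \<comment> \<open>Replacing \<open>h\<close> by \<open>p\<close> costs at most
      \<open>G * e\<close>, which is less than \<open>2 * (G + 1) * e\<close>, the absolute value of
      the integral.\<close>
    define e where "e = \<bar>\<integral>x. g x * h x \<partial>M\<bar> / (2 * (G + 1))"
    have e: "e > 0" using nz G0 by (simp add: e_def)
    obtain p where p: "real_polynomial_function p" "\<And>x. x \<in> C \<Longrightarrow> \<bar>h x - p x\<bar> < e"
      using Stone_Weierstrass_real_polynomial_function[OF C(1) continuous_on_subset[OF h] e] by auto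
    have pc: "continuous_on UNIV p"
      using p(1) by (simp add: continuous_on_polymonial_function real_polynomial_function_eq)
    have "(\<integral>x. g x * h x \<partial>M) = (\<integral>x. g x * h x \<partial>M) - (\<integral>x. g x * p x \<partial>M)" using zero[OF p(1)] by simp
    also have "\<dots> = (\<integral>x. g x * (h x - p x) \<partial>M)"
      using int_gh[OF h] int_gh[OF pc] by (simp add: right_diff_distrib)
    finally have "\<bar>\<integral>x. g x * h x \<partial>M\<bar> \<le> (\<integral>x. \<bar>g x * (h x - p x)\<bar> \<partial>M)" by simp
    also have "\<dots> \<le> (\<integral>x. \<bar>g x\<bar> * e \<partial>M)"
    proof (rule integral_mono_AE)
      have "continuous_on UNIV (\<lambda>x. h x - p x)" by (intro continuous_intros h pc)
      then show "integrable M (\<lambda>x. \<bar>g x * (h x - p x)\<bar>)" using int_gh by (intro integrable_abs) blast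
      show "integrable M (\<lambda>x. \<bar>g x\<bar> * e)" using g by simp
      show "AE x in M. \<bar>g x * (h x - p x)\<bar> \<le> \<bar>g x\<bar> * e"
        using C(2) by eventually_elim (use p(2)[THEN less_imp_le] in \<open>auto simp: abs_mult intro!: mult_left_mono\<close>)
    qed
    also have "\<dots> = G * e" by (simp add: G_def)
    also have "\<dots> < 2 * (G + 1) * e" using e G0 by (intro mult_strict_right_mono) auto
    also have "\<dots> = \<bar>\<integral>x. g x * h x \<partial>M\<bar>" using G0 by (simp add: e_def)
    finally show False by simp
  qed
  have zero_closed: "(\<integral>x\<in>F. g x \<partial>M) = 0" if F: "closed F" for F
  proof (cases "F = {}")
    case False
    \<comment> \<open>Continuous functions with values in \<open>[0, 1]\<close> that are 1 on
      \<open>F\<close> and, off the closed set \<open>F\<close>, eventually 0.\<close>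
    define h where "h k x = max 0 (1 - real k * infdist x F)" for k x
    have hc: "continuous_on UNIV (h k)" for k unfolding h_def[abs_def] by (intro continuous_intros)
    have "(\<lambda>k. \<integral>x. g x * h k x \<partial>M) \<longlonglongrightarrow> (\<integral>x. indicator F x * g x \<partial>M)"
    proof (rule integral_dominated_convergence[where w = "\<lambda>x. \<bar>g x\<bar>"])
      show "AE x in M. (\<lambda>k. g x * h k x) \<longlonglongrightarrow> indicator F x * g x"
      proof (intro AE_I2)
        fix x
        have "(\<lambda>k. h k x) \<longlonglongrightarrow> indicator F x"
        proof (cases "x \<in> F")
          case True
          then show ?thesis by (simp add: h_def)
        next
          case nF: False
          then have d: "infdist x F > 0" using F False by (simp add: infdist_pos_not_in_closed)
          then obtain N where "real N * infdist x F > 1" using ex_less_of_nat_mult by blast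
          then have N: "h k x = 0" if "k \<ge> N" for k
          proof -
            have "real N * infdist x F \<le> real k * infdist x F" using that d by (intro mult_right_mono) auto
            then have "1 - real k * infdist x F \<le> 0" using \<open>1 < real N * infdist x F\<close> by linarith
            then show ?thesis unfolding h_def by (rule max_absorb1)
          qed
          have "\<forall>\<^sub>F k in sequentially. h k x = 0" using N eventually_sequentially by blast
          then show ?thesis using nF by (simp add: tendsto_eventually)
        qed
        then show "(\<lambda>k. g x * h k x) \<longlonglongrightarrow> indicator F x * g x"
          by (subst mult.commute) (intro tendsto_intros)
      qed
      show "AE x in M. norm (g x * h k x) \<le> \<bar>g x\<bar>" for k
      proof (intro AE_I2)
        fix x
        have "0 \<le> h k x" "h k x \<le> 1" by (auto simp: h_def infdist_nonneg)
        then show "norm (g x * h k x) \<le> \<bar>g x\<bar>" by (simp add: abs_mult mult_left_le)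
      qed
      show "(\<lambda>x. indicator F x * g x) \<in> borel_measurable M"
        using F by (intro borel_measurable_times borel_measurable_indicator) (auto simp: sets_M)
      show "(\<lambda>x. g x * h k x) \<in> borel_measurable M" for k using int_gh[OF hc] by blast
    qed (use g in simp)
    then have "(\<integral>x. indicator F x * g x \<partial>M) = 0" using zero_cont[OF hc] by (simp add: LIMSEQ_const_iff)
    then show ?thesis by (simp add: set_lebesgue_integral_def)
  qed (simp add: set_lebesgue_integral_def)
  have set_int: "set_integrable M A g" if "A \<in> sets borel" for A
    using that g unfolding set_integrable_def by (intro integrable_mult_indicator) (simp_all only: sets_M)
  have zero_set: "(\<integral>x\<in>A. g x \<partial>M) = 0" if "A \<in> sets borel" for A
  proof -
    \<comment> \<open>Closed sets are stable under intersection and generate the Borel sets, so it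
      suffices that sets with zero integral are closed under complements and disjoint countable
      unions.\<close>
    have cl: "Collect closed \<subseteq> Pow (UNIV :: (real^'n) set)" by auto
    have ist: "Int_stable (Collect closed :: (real^'n) set set)" by (auto simp: Int_stable_def)
    have sb: "sigma_sets UNIV (Collect closed) = sets (borel :: (real^'n) measure)"
      by (simp add: borel_eq_closed)
    have "A \<in> sigma_sets UNIV (Collect closed)" using that sb by simp
    with ist cl show ?thesis
    proof (induction rule: sigma_sets_induct_disjoint)
      case (basic A)
      then show ?case using zero_closed by simp
    next
      case empty
      show ?case by (simp add: set_lebesgue_integral_def)
    next
      case (compl A)
      then have A: "A \<in> sets borel" using sb by simp
      have "(\<integral>x\<in>A \<union> (UNIV - A). g x \<partial>M) = (\<integral>x\<in>A. g x \<partial>M) + (\<integral>x\<in>UNIV - A. g x \<partial>M)"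
        using A by (intro set_integral_Un set_int) (auto simp: borel_comp Compl_eq_Diff_UNIV[symmetric])
      then show ?case using compl zero_closed[of UNIV] by simp
    next
      case (union A)
      then have A: "A i \<in> sets borel" for i using sb by auto
      have "(\<integral>x\<in>(\<Union>i. A i). g x \<partial>M) = (\<Sum>i. \<integral>x\<in>A i. g x \<partial>M)"
        using union(1) A sets_M set_int
        by (intro lebesgue_integral_countable_add) (auto simp: disjoint_family_on_def)
      then show ?case using union by simp
    qed
  qed
  show ?thesis
    by (rule density_zero[OF g]) (use zero_set sets_M in auto)
qed

section \<open>Sobolev functions and their traces\<close>

lemma l2_limit_unique:
  assumes f: "\<And>k. f k \<in> L2 M" and g: "g \<in> L2 M" "h \<in> L2 M"
    and lim: "(\<lambda>k. l2_norm M (f k - g)) \<longlonglongrightarrow> 0" "(\<lambda>k. l2_norm M (f k - h)) \<longlonglongrightarrow> 0"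
  shows "ae_eq M g h"
proof -
  have "l2_norm M (g - h) \<le> l2_norm M (f k - g) + l2_norm M (f k - h)" for k
    using l2_norm_diff_triangle[OF g(1) f g(2), of k] by (simp add: l2_norm_diff_commute[of M g])
  moreover have "(\<lambda>k. l2_norm M (f k - g) + l2_norm M (f k - h)) \<longlonglongrightarrow> 0 + 0" by (intro tendsto_intros lim)
  ultimately have "l2_norm M (g - h) \<le> 0 + 0"
    by (auto intro: LIMSEQ_le_const)
  then have "l2_norm M (g - h) = 0" using l2_norm_nonneg[of M "g - h"] by linarith
  then show ?thesis using l2_norm_diff_eq_0_iff[OF g] by simp
qed

lemma l2_limit_lincomb:
  assumes f: "\<And>k. f k \<in> L2 M" "f' \<in> L2 M" "(\<lambda>k. l2_norm M (f k - f')) \<longlonglongrightarrow> 0"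
    and g: "\<And>k. g k \<in> L2 M" "g' \<in> L2 M" "(\<lambda>k. l2_norm M (g k - g')) \<longlonglongrightarrow> 0"
  shows "(\<lambda>k. l2_norm M ((\<lambda>x. a *\<^sub>R f k x + b *\<^sub>R g k x) - (\<lambda>x. a *\<^sub>R f' x + b *\<^sub>R g' x))) \<longlonglongrightarrow> 0"
proof (rule Lim_null_comparison)
  let ?r = "\<lambda>k. \<bar>a\<bar> * l2_norm M (f k - f') + \<bar>b\<bar> * l2_norm M (g k - g')"
  have "l2_norm M ((\<lambda>x. a *\<^sub>R f k x + b *\<^sub>R g k x) - (\<lambda>x. a *\<^sub>R f' x + b *\<^sub>R g' x)) \<le> ?r k" for k
  proof -
    have "(\<lambda>x. a *\<^sub>R f k x + b *\<^sub>R g k x) - (\<lambda>x. a *\<^sub>R f' x + b *\<^sub>R g' x)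
       = (\<lambda>x. a *\<^sub>R (f k - f') x + b *\<^sub>R (g k - g') x)" by (auto simp: fun_diff_def algebra_simps)
    moreover have "l2_norm M (\<lambda>x. a *\<^sub>R (f k - f') x + b *\<^sub>R (g k - g') x)
        \<le> l2_norm M (\<lambda>x. a *\<^sub>R (f k - f') x) + l2_norm M (\<lambda>x. b *\<^sub>R (g k - g') x)"
      by (intro l2_norm_triangle L2_scale L2_diff f g)
    ultimately show ?thesis by (simp only: l2_norm_scale)
  qed
  then show "\<forall>\<^sub>F k in sequentially. norm (l2_norm M ((\<lambda>x. a *\<^sub>R f k x + b *\<^sub>R g k x) - (\<lambda>x. a *\<^sub>R f' x + b *\<^sub>R g' x))) \<le> ?r k"
    by simp
  have "?r \<longlonglongrightarrow> \<bar>a\<bar> * 0 + \<bar>b\<bar> * 0" by (intro tendsto_intros f g)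
  then show "?r \<longlonglongrightarrow> 0" by simp
qed

lemma C1_function_lincomb:
  assumes "C1_function f Df" "C1_function g Dg"
  shows "C1_function (\<lambda>x. a *\<^sub>R f x + b *\<^sub>R g x) (\<lambda>x. a *\<^sub>R Df x + b *\<^sub>R Dg x)"
  using C1_function_add[OF C1_function_mult[OF C1_function_const[of a] assms(1)] C1_function_mult[OF C1_function_const[of b] assms(2)]]
  by simp

lemma C1_function_diff:
  assumes "C1_function f Df" "C1_function g Dg"
  shows "C1_function (f - g) (Df - Dg)"
  using C1_function_lincomb[OF assms, of 1 "-1"] by (simp add: fun_diff_def)

section \<open>L2 functions and integration by parts on a flat domain\<close>

context flat_domain
begin

lemma K_borel [measurable]: "K \<in> sets borel"
  using open_K by simp

lemma integral_vol: "(\<integral>x. f x \<partial>vol K) = (\<integral>x. indicator K x *\<^sub>R f x \<partial>lborel)"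
  for f :: "real^'n \<Rightarrow> real"
  unfolding vol_def by (rule integral_restrict_space) simp

lemma space_vol: "space (vol K) = K"
  by (simp add: vol_def space_restrict_space)

lemma finite_measure_vol: "finite_measure (vol K)"
proof
  have "emeasure (vol K) K = emeasure lborel K" unfolding vol_def by (intro emeasure_restrict_space) auto
  then show "emeasure (vol K) (space (vol K)) \<noteq> \<infinity>"
    using emeasure_bounded_finite[OF bounded_K] by (simp add: space_vol)
qed

lemma AE_vol: "AE x in lborel. P x \<Longrightarrow> AE x in vol K. P x"
  unfolding vol_def by (subst AE_restrict_space_iff) auto

lemma continuous_L2_vol:
  fixes f :: "real^'n \<Rightarrow> 'b::euclidean_space"
  assumes f: "continuous_on UNIV f"
  shows "f \<in> L2 (vol K)"
proof -
  interpret finite_measure "vol K" by (rule finite_measure_vol)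
  obtain R where R: "\<And>x. x \<in> K \<Longrightarrow> norm x \<le> R" using bounded_K by (auto simp: bounded_pos)
  obtain B where B: "B > 0" "\<And>x. norm x \<le> R \<Longrightarrow> norm (f x) \<le> B" using bounded_on_cball[OF f] by blast
  have m: "f \<in> borel_measurable (vol K)"
    unfolding vol_def by (intro measurable_restrict_space1) (simp add: borel_measurable_continuous_onI[OF f])
  have "integrable (vol K) (\<lambda>x. (norm (f x))\<^sup>2)"
    by (rule integrable_const_bound[where B = "B\<^sup>2"])
      (use m R B in \<open>auto intro!: AE_I2 power_mono simp: space_vol\<close>)
  then show ?thesis using m by (simp add: L2_def)
qed

lemma continuous_L2_surf:
  fixes f :: "real^'n \<Rightarrow> 'b::euclidean_space"
  assumes f: "continuous_on UNIV f"
  shows "f \<in> L2 (surf K)"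
proof -
  interpret finite_measure "surf K" by (rule finite_measure_surf)
  obtain B where B: "B > 0" "\<And>x. x \<in> frontier K \<Longrightarrow> norm (f x) \<le> B" using bounded_on_frontier[OF f] by blast
  have m: "f \<in> borel_measurable (surf K)"
    using borel_measurable_continuous_onI[OF f] by (simp cong: measurable_cong_sets)
  have "integrable (surf K) (\<lambda>x. (norm (f x))\<^sup>2)"
  proof (rule integrable_const_bound[where B = "B\<^sup>2"])
    show "AE x in surf K. norm ((norm (f x))\<^sup>2) \<le> B\<^sup>2"
      using AE_surf_frontier by eventually_elim (use B in \<open>auto intro!: power_mono\<close>)
  qed (use m in simp)
  then show ?thesis using m by (simp add: L2_def)
qed

lemma C1_L2:
  assumes "C1_function f Df"
  shows "f \<in> L2 (vol K)" "Df \<in> L2 (vol K)" "f \<in> L2 (surf K)"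
  using C1_function_continuous[OF assms] by (auto intro: continuous_L2_vol continuous_L2_surf)

lemma C1_L2_component:
  assumes "C1_function f Df"
  shows "(\<lambda>x. Df x $ i) \<in> L2 (vol K)"
  using C1_L2(2)[OF assms] L2_components by blast

lemma normal_times_L2:
  fixes g :: "real^'n \<Rightarrow> real"
  assumes g: "g \<in> L2 (surf K)"
  shows "(\<lambda>x. outer_normal K x $ i * g x) \<in> L2 (surf K)"
    and "l2_norm (surf K) (\<lambda>x. outer_normal K x $ i * g x) \<le> l2_norm (surf K) g"
proof -
  have nm: "(\<lambda>x. outer_normal K x $ i) \<in> borel_measurable borel"
    unfolding outer_normal_def[abs_def] case_prod_beta by (simp add: sum_component)
  then have nm': "(\<lambda>x. outer_normal K x $ i) \<in> borel_measurable (surf K)" by (simp cong: measurable_cong_sets)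
  have m: "(\<lambda>x. outer_normal K x $ i * g x) \<in> borel_measurable (surf K)"
    using nm' L2_measurable[OF g] by (rule borel_measurable_times)
  have le: "(norm (outer_normal K x $ i * g x))\<^sup>2 \<le> (norm (g x))\<^sup>2" for x
  proof (rule power_mono)
    have "\<bar>outer_normal K x $ i\<bar> \<le> 1" using component_le_norm_cart[of "outer_normal K x" i] norm_outer_normal[of x] by linarith
    then show "norm (outer_normal K x $ i * g x) \<le> norm (g x)" by (simp add: abs_mult mult_left_le_one_le)
  qed simp
  have i: "integrable (surf K) (\<lambda>x. (norm (outer_normal K x $ i * g x))\<^sup>2)"
    by (rule Bochner_Integration.integrable_bound[OF L2_integrable[OF g]])
      (use m le in \<open>auto intro!: AE_I2\<close>)
  then show "(\<lambda>x. outer_normal K x $ i * g x) \<in> L2 (surf K)" using m by (simp add: L2_def)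
  show "l2_norm (surf K) (\<lambda>x. outer_normal K x $ i * g x) \<le> l2_norm (surf K) g"
    unfolding l2_norm_def by (intro real_sqrt_le_mono integral_mono i L2_integrable[OF g] le)
qed

lemma C1_green_product:
  assumes f: "C1_function f Df" and g: "C1_function g Dg"
  shows "l2_inner (vol K) f (\<lambda>x. Dg x $ i) + l2_inner (vol K) (\<lambda>x. Df x $ i) g
    = l2_inner (surf K) f (\<lambda>x. outer_normal K x $ i * g x)"
proof -
  have "l2_inner (surf K) f (\<lambda>x. outer_normal K x $ i * g x) = (\<integral>x. f x * g x * outer_normal K x $ i \<partial>surf K)"
    unfolding l2_inner_def by (intro Bochner_Integration.integral_cong) (auto simp: mult_ac)
  also have "\<dots> = (\<integral>x. indicator K x * (f x *\<^sub>R Dg x + g x *\<^sub>R Df x) $ i \<partial>lborel)"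
    by (rule green_C1[OF C1_function_mult[OF f g], symmetric])
  also have "\<dots> = (\<integral>x. f x * Dg x $ i + Df x $ i * g x \<partial>vol K)"
    unfolding integral_vol by (intro Bochner_Integration.integral_cong) (auto simp: algebra_simps)
  also have "\<dots> = l2_inner (vol K) f (\<lambda>x. Dg x $ i) + l2_inner (vol K) (\<lambda>x. Df x $ i) g"
    unfolding l2_inner_def
    using L2_integrable_inner[OF C1_L2(1)[OF f] C1_L2_component[OF g, of i]]
      L2_integrable_inner[OF C1_L2_component[OF f, of i] C1_L2(1)[OF g]] by simp
  finally show ?thesis by simp
qed

lemma trace_inequality:
  "\<exists>C\<ge>0. \<forall>f Df. C1_function f Df \<longrightarrow> l2_norm (surf K) f \<le> C * (l2_norm (vol K) f + l2_norm (vol K) Df)"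
proof -
  obtain C where C: "C \<ge> 0" "\<And>f Df. C1_function f Df \<Longrightarrow>
    (\<integral>x. (f x)\<^sup>2 \<partial>surf K) \<le> C * ((\<integral>x. indicator K x * (f x)\<^sup>2 \<partial>lborel) + (\<integral>x. indicator K x * (norm (Df x))\<^sup>2 \<partial>lborel))"
    using trace_inequality_C1 by blast
  have "l2_norm (surf K) f \<le> sqrt C * (l2_norm (vol K) f + l2_norm (vol K) Df)" if f: "C1_function f Df" for f Df
  proof -
    have "(l2_norm (surf K) f)\<^sup>2 = (\<integral>x. (f x)\<^sup>2 \<partial>surf K)" by (simp add: l2_norm_def)
    also have "\<dots> \<le> C * ((\<integral>x. indicator K x * (f x)\<^sup>2 \<partial>lborel) + (\<integral>x. indicator K x * (norm (Df x))\<^sup>2 \<partial>lborel))" by (rule C(2)[OF f])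
    also have "\<dots> = C * ((l2_norm (vol K) f)\<^sup>2 + (l2_norm (vol K) Df)\<^sup>2)"
      by (simp add: l2_norm_def integral_vol)
    also have "\<dots> \<le> C * (l2_norm (vol K) f + l2_norm (vol K) Df)\<^sup>2"
      using C(1) by (intro mult_left_mono) (simp_all add: power2_sum)
    also have "\<dots> = (sqrt C * (l2_norm (vol K) f + l2_norm (vol K) Df))\<^sup>2"
      using C(1) by (simp add: power_mult_distrib)
    finally show ?thesis by (rule power2_le_imp_le) (use C(1) in simp)
  qed
  moreover have "sqrt C \<ge> 0" using C(1) by simp
  ultimately show ?thesis by blast
qed

text \<open>\<open>vol K\<close> lives on a restricted space, whereas
  \<open>polynomial_dense\<close> asks for all Borel sets. The density of the indicator of
  \<open>K\<close> is an equivalent measure on the whole space.\<close>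

lemma polynomial_dense_vol:
  fixes e :: "real^'n \<Rightarrow> real"
  assumes e: "integrable (vol K) e" and zero: "\<And>p. real_polynomial_function p \<Longrightarrow> (\<integral>x. e x * p x \<partial>vol K) = 0"
  shows "AE x in vol K. e x = 0"
proof -
  define M where "M = density lborel (\<lambda>x. ennreal (indicator K x))"
  have im: "(\<lambda>x. indicator K x * e x) \<in> borel_measurable borel"
    using borel_measurable_integrable[OF e] unfolding vol_def
    by (subst (asm) borel_measurable_restrict_space_iff) auto
  have ii: "integrable lborel (\<lambda>x. indicator K x * e x)"
    using e unfolding vol_def by (subst (asm) integrable_restrict_space) auto
  have "AE x in M. indicator K x * e x = 0"
  proof (rule polynomial_dense)
    show "finite_measure M"
    proof
      have "emeasure M (space M) = emeasure lborel K"
        by (simp add: M_def emeasure_density ennreal_indicator)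
      then show "emeasure M (space M) \<noteq> \<infinity>" using emeasure_bounded_finite[OF bounded_K] by simp
    qed
    show "sets M = sets borel" by (simp add: M_def)
    show "compact (closure K)" using bounded_K by (simp add: compact_closure)
    show "AE x in M. x \<in> closure K"
      unfolding M_def by (subst AE_density) (auto intro!: AE_I2 simp: indicator_def closure_subset[THEN subsetD] split: if_splits)
    have idem: "indicator K x * (indicator K x * e x) = indicator K x * e x" for x by (simp add: indicator_def)
    show "integrable M (\<lambda>x. indicator K x * e x)"
      unfolding M_def using im ii by (subst integrable_density) (auto simp: idem)
    fix p :: "real^'n \<Rightarrow> real" assume p: "real_polynomial_function p"
    then have pm [measurable]: "p \<in> borel_measurable borel"
      by (intro borel_measurable_continuous_onI) (simp add: continuous_on_polymonial_function real_polynomial_function_eq)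
    have "(\<integral>x. indicator K x * e x * p x \<partial>M) = (\<integral>x. indicator K x *\<^sub>R (indicator K x * e x * p x) \<partial>lborel)"
      unfolding M_def using im by (intro integral_density) auto
    also have "\<dots> = (\<integral>x. e x * p x \<partial>vol K)"
      unfolding integral_vol by (intro Bochner_Integration.integral_cong) (auto simp: indicator_def)
    finally show "(\<integral>x. indicator K x * e x * p x \<partial>M) = 0" using zero[OF p] by simp
  qed
  then have "AE x in lborel. x \<in> K \<longrightarrow> e x = 0"
    unfolding M_def by (subst (asm) AE_density) (auto elim!: eventually_mono simp: indicator_def split: if_splits)
  then show ?thesis unfolding vol_def by (subst AE_restrict_space_iff) auto
qed

lemma C1_plane_product: "\<exists>D. C1_function (\<lambda>x. \<Prod>q\<in>A. x \<bullet> fst q - snd q) D" for A :: "((real^'n) \<times> real) set"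
proof (induction A rule: infinite_finite_induct)
  case (insert q A)
  then obtain D where D: "C1_function (\<lambda>x. \<Prod>q\<in>A. x \<bullet> fst q - snd q) D" by blast
  have "C1_function (\<lambda>x. x \<bullet> fst q + (- snd q)) (\<lambda>x. fst q + 0)"
    by (intro C1_function_add C1_function_inner C1_function_const)
  from C1_function_mult[OF this D] show ?case using insert by auto
qed auto

text \<open>The boundary term vanishes along the whole approximating sequence because
  \<open>surf K\<close> lives on the frontier, so the identity is available before \<open>u\<close>
  is known to have a trace.\<close>

lemma ibp_frontier_zero:
  assumes H: "H1_limit K \<phi> u G" and \<psi>: "C1_function \<psi> D\<psi>" "\<And>x. x \<in> frontier K \<Longrightarrow> \<psi> x = 0"
  shows "l2_inner (vol K) u (\<lambda>x. D\<psi> x $ i) + l2_inner (vol K) (\<lambda>x. G x $ i) \<psi> = 0"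
proof -
  obtain D\<phi> where u: "u \<in> L2 (vol K)" "G \<in> L2 (vol K)" and C1: "\<And>k. C1_function (\<phi> k) (D\<phi> k)"
    and lim: "(\<lambda>k. l2_norm (vol K) (\<phi> k - u)) \<longlonglongrightarrow> 0" "(\<lambda>k. l2_norm (vol K) (D\<phi> k - G)) \<longlonglongrightarrow> 0"
    using H unfolding H1_limit_def by blast
  have Gi: "(\<lambda>x. G x $ i) \<in> L2 (vol K)" using u(2) L2_components by blast
  have limi: "(\<lambda>k. l2_norm (vol K) ((\<lambda>x. D\<phi> k x $ i) - (\<lambda>x. G x $ i))) \<longlonglongrightarrow> 0"
  proof (rule Lim_null_comparison[OF _ lim(2)])
    have "l2_norm (vol K) ((\<lambda>x. D\<phi> k x $ i) - (\<lambda>x. G x $ i)) \<le> l2_norm (vol K) (D\<phi> k - G)" for k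
      using l2_norm_component_le[OF L2_diff[OF C1_L2(2)[OF C1] u(2)], of k i] by (simp add: fun_diff_def)
    then show "\<forall>\<^sub>F k in sequentially. norm (l2_norm (vol K) ((\<lambda>x. D\<phi> k x $ i) - (\<lambda>x. G x $ i))) \<le> l2_norm (vol K) (D\<phi> k - G)" by simp
  qed
  have "l2_inner (vol K) (\<phi> k) (\<lambda>x. D\<psi> x $ i) + l2_inner (vol K) (\<lambda>x. D\<phi> k x $ i) \<psi> = 0" for k
  proof -
    have "l2_inner (surf K) (\<phi> k) (\<lambda>x. outer_normal K x $ i * \<psi> x) = 0"
      unfolding l2_inner_def
      by (rule integral_eq_zero_AE) (use AE_surf_frontier in \<open>auto elim!: eventually_mono simp: \<psi>(2)\<close>)
    then show ?thesis using C1_green_product[OF C1 \<psi>(1), of k i] by simp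
  qed
  moreover have "(\<lambda>k. l2_inner (vol K) (\<phi> k) (\<lambda>x. D\<psi> x $ i) + l2_inner (vol K) (\<lambda>x. D\<phi> k x $ i) \<psi>)
    \<longlonglongrightarrow> l2_inner (vol K) u (\<lambda>x. D\<psi> x $ i) + l2_inner (vol K) (\<lambda>x. G x $ i) \<psi>"
    using C1_L2[OF \<psi>(1)] C1_L2_component[OF \<psi>(1)] C1_L2(1)[OF C1] C1_L2_component[OF C1]
    by (intro tendsto_add tendsto_l2_inner u Gi lim limi) (simp_all add: l2_norm_def)
  ultimately show ?thesis by (simp add: LIMSEQ_const_iff)
qed

text \<open>The test functions are the polynomials times the product of the equations of all the planes:
  these vanish on the boundary, but almost nowhere inside.\<close>

lemma H1_limit_gradient_unique:
  assumes H: "H1_limit K \<phi> u G" "H1_limit K \<phi>' u G'"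
  shows "ae_eq (vol K) G G'"
  unfolding L2_ae_eq_components
proof
  fix i
  define w where "w x = (\<Prod>q\<in>Q. x \<bullet> fst q - snd q)" for x :: "real^'n"
  obtain Dw where w: "C1_function w Dw" unfolding w_def[abs_def] using C1_plane_product by blast
  define e where "e = (\<lambda>x. G x $ i) - (\<lambda>x. G' x $ i)"
  have GL: "(\<lambda>x. G x $ i) \<in> L2 (vol K)" "(\<lambda>x. G' x $ i) \<in> L2 (vol K)"
    using H L2_components unfolding H1_limit_def by blast+
  have eL: "e \<in> L2 (vol K)" unfolding e_def by (rule L2_diff[OF GL])
  have w0: "w x = 0" if xK: "x \<in> frontier K" for x
  proof -
    obtain \<nu> c where "(\<nu>, c) \<in> Q" "\<nu> \<bullet> x = c" using xK frontier_Q by blast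
    then show ?thesis unfolding w_def using finite_Q by (intro prod_zero) (auto simp: inner_commute intro!: bexI[of _ "(\<nu>, c)"])
  qed
  have "AE x in vol K. e x * w x = 0"
  proof (rule polynomial_dense_vol)
    show "integrable (vol K) (\<lambda>x. e x * w x)" using L2_integrable_inner[OF eL C1_L2(1)[OF w]] by simp
    fix p :: "real^'n \<Rightarrow> real" assume "real_polynomial_function p"
    then obtain Dp where p: "C1_function p Dp" using real_polynomial_function_C1 by blast
    note wp = C1_function_mult[OF w p]
    have "l2_inner (vol K) (\<lambda>x. G x $ i) (\<lambda>x. w x * p x) = l2_inner (vol K) (\<lambda>x. G' x $ i) (\<lambda>x. w x * p x)"
      using ibp_frontier_zero[OF H(1) wp, of i] ibp_frontier_zero[OF H(2) wp, of i] w0 by simp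
    then have "l2_inner (vol K) e (\<lambda>x. w x * p x) = 0"
      unfolding e_def using l2_inner_diff_left[OF GL C1_L2(1)[OF wp]] by simp
    then show "(\<integral>x. e x * w x * p x \<partial>vol K) = 0" by (simp add: l2_inner_def mult.assoc)
  qed
  moreover have "AE x in vol K. w x \<noteq> 0"
  proof (rule AE_vol)
    have "AE x in lborel. \<forall>q\<in>Q. fst q \<bullet> x \<noteq> snd q"
    proof (subst AE_finite_all[OF finite_Q], intro ballI)
      fix q assume "q \<in> Q"
      then have "fst q \<noteq> 0" using unit_Q[of "fst q" "snd q"] by auto
      then show "AE x in lborel. fst q \<bullet> x \<noteq> snd q" by (rule AE_lborel_hyperplane)
    qed
    then show "AE x in lborel. w x \<noteq> 0"
      by eventually_elim (use finite_Q in \<open>simp add: w_def inner_commute\<close>)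
  qed
  ultimately have "AE x in vol K. e x = 0" by eventually_elim simp
  then show "ae_eq (vol K) (\<lambda>x. G x $ i) (\<lambda>x. G' x $ i)" by (simp add: ae_eq_def e_def)
qed

section \<open>Existence and uniqueness of traces and weak gradients\<close>

lemma trace_difference_tendsto:
  assumes C1: "\<And>k. C1_function (f k) (Df k)"
    and lim: "(\<lambda>k. l2_norm (vol K) (f k)) \<longlonglongrightarrow> 0" "(\<lambda>k. l2_norm (vol K) (Df k)) \<longlonglongrightarrow> 0"
  shows "(\<lambda>k. l2_norm (surf K) (f k)) \<longlonglongrightarrow> 0"
proof -
  obtain C where C: "\<And>f Df. C1_function f Df \<Longrightarrow> l2_norm (surf K) f \<le> C * (l2_norm (vol K) f + l2_norm (vol K) Df)"
    using trace_inequality by blast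
  have "(\<lambda>k. C * (l2_norm (vol K) (f k) + l2_norm (vol K) (Df k))) \<longlonglongrightarrow> C * (0 + 0)" by (intro tendsto_intros lim)
  then have lim0: "(\<lambda>k. C * (l2_norm (vol K) (f k) + l2_norm (vol K) (Df k))) \<longlonglongrightarrow> 0" by simp
  have le: "norm (l2_norm (surf K) (f k)) \<le> C * (l2_norm (vol K) (f k) + l2_norm (vol K) (Df k))" for k
    unfolding real_norm_def abs_of_nonneg[OF l2_norm_nonneg] by (rule C[OF C1])
  show ?thesis
  proof (rule Lim_null_comparison[OF _ lim0])
    show "\<forall>\<^sub>F k in sequentially. norm (l2_norm (surf K) (f k)) \<le> C * (l2_norm (vol K) (f k) + l2_norm (vol K) (Df k))"
      using le by (rule always_eventually[OF allI])
  qed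
qed

text \<open>The trace inequality, applied to differences, turns a sequence that is Cauchy in H1 into
  one that is Cauchy on the boundary.\<close>

lemma H1_limit_trace:
  assumes H: "H1_limit K \<phi> u G"
  shows "\<exists>g\<in>L2 (surf K). (\<lambda>k. l2_norm (surf K) (\<phi> k - g)) \<longlonglongrightarrow> 0"
proof -
  obtain D\<phi> where u: "u \<in> L2 (vol K)" "G \<in> L2 (vol K)" and C1: "\<And>k. C1_function (\<phi> k) (D\<phi> k)"
    and lim: "(\<lambda>k. l2_norm (vol K) (\<phi> k - u)) \<longlonglongrightarrow> 0" "(\<lambda>k. l2_norm (vol K) (D\<phi> k - G)) \<longlonglongrightarrow> 0"
    using H unfolding H1_limit_def by blast
  obtain C where C: "C \<ge> 0" "\<And>f Df. C1_function f Df \<Longrightarrow> l2_norm (surf K) f \<le> C * (l2_norm (vol K) f + l2_norm (vol K) Df)"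
    using trace_inequality by blast
  define \<eta> where "\<eta> k = l2_norm (vol K) (\<phi> k - u) + l2_norm (vol K) (D\<phi> k - G)" for k
  have \<eta>: "\<eta> \<longlonglongrightarrow> 0" unfolding \<eta>_def[abs_def] using tendsto_add[OF lim] by simp
  have est: "l2_norm (surf K) (\<phi> m - \<phi> n) \<le> C * (\<eta> m + \<eta> n)" for m n
  proof -
    have "l2_norm (vol K) (\<phi> m - \<phi> n) \<le> l2_norm (vol K) (\<phi> m - u) + l2_norm (vol K) (\<phi> n - u)"
      using l2_norm_diff_triangle[OF C1_L2(1)[OF C1] u(1) C1_L2(1)[OF C1], of m n] by (simp add: l2_norm_diff_commute[of _ u])
    moreover have "l2_norm (vol K) (D\<phi> m - D\<phi> n) \<le> l2_norm (vol K) (D\<phi> m - G) + l2_norm (vol K) (D\<phi> n - G)"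
      using l2_norm_diff_triangle[OF C1_L2(2)[OF C1] u(2) C1_L2(2)[OF C1], of m n] by (simp add: l2_norm_diff_commute[of _ G])
    ultimately have "C * (l2_norm (vol K) (\<phi> m - \<phi> n) + l2_norm (vol K) (D\<phi> m - D\<phi> n)) \<le> C * (\<eta> m + \<eta> n)"
      unfolding \<eta>_def using C(1) by (intro mult_left_mono) auto
    then show ?thesis using C(2)[OF C1_function_diff[OF C1 C1], of m n] by linarith
  qed
  show ?thesis
  proof (rule L2_complete[OF finite_measure_surf])
    show "\<phi> k \<in> L2 (surf K)" for k by (rule C1_L2(3)[OF C1])
    fix e :: real assume "0 < e"
    \<comment> \<open>\<open>C + 1\<close> instead of \<open>C\<close> avoids division by 0.\<close>
    then have "0 < e / (2 * (C + 1))" using C(1) by simp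
    then obtain N where N: "\<And>k. k \<ge> N \<Longrightarrow> \<eta> k < e / (2 * (C + 1))"
      using order_tendstoD(2)[OF \<eta>] unfolding eventually_sequentially by blast
    have "l2_norm (surf K) (\<phi> m - \<phi> n) < e" if "m \<ge> N" "n \<ge> N" for m n
    proof -
      have "0 \<le> \<eta> m + \<eta> n" by (simp add: \<eta>_def)
      then have "C * (\<eta> m + \<eta> n) \<le> (C + 1) * (\<eta> m + \<eta> n)" by (intro mult_right_mono) auto
      also have "\<dots> < (C + 1) * (e / (2 * (C + 1)) + e / (2 * (C + 1)))"
        using N[OF that(1)] N[OF that(2)] C(1) by (intro mult_strict_left_mono add_strict_mono) auto
      also have "\<dots> = e"
      proof -
        define d where "d = C + 1"
        have "d \<noteq> 0" using C(1) by (simp add: d_def)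
        then show ?thesis unfolding d_def[symmetric] by (simp add: distrib_left)
      qed
      finally show ?thesis using est[of m n] by linarith
    qed
    then show "\<exists>N. \<forall>m\<ge>N. \<forall>n\<ge>N. l2_norm (surf K) (\<phi> m - \<phi> n) < e" by blast
  qed
qed

text \<open>The two sequences come with their own gradients. By
  \<open>H1_limit_gradient_unique\<close> these agree a.e., so the difference of the sequences tends
  to 0 in H1 and hence on the boundary.\<close>

lemma H1_limit_trace_unique:
  assumes H: "H1_limit K \<phi> u G" "H1_limit K \<phi>' u G'"
    and g: "g \<in> L2 (surf K)" "(\<lambda>k. l2_norm (surf K) (\<phi> k - g)) \<longlonglongrightarrow> 0"
  shows "(\<lambda>k. l2_norm (surf K) (\<phi>' k - g)) \<longlonglongrightarrow> 0"
proof -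
  obtain D\<phi> where u: "u \<in> L2 (vol K)" "G \<in> L2 (vol K)" and C1: "\<And>k. C1_function (\<phi> k) (D\<phi> k)"
    and lim: "(\<lambda>k. l2_norm (vol K) (\<phi> k - u)) \<longlonglongrightarrow> 0" "(\<lambda>k. l2_norm (vol K) (D\<phi> k - G)) \<longlonglongrightarrow> 0"
    using H(1) unfolding H1_limit_def by blast
  obtain D\<phi>' where u': "G' \<in> L2 (vol K)" and C1': "\<And>k. C1_function (\<phi>' k) (D\<phi>' k)"
    and lim': "(\<lambda>k. l2_norm (vol K) (\<phi>' k - u)) \<longlonglongrightarrow> 0" "(\<lambda>k. l2_norm (vol K) (D\<phi>' k - G')) \<longlonglongrightarrow> 0"
    using H(2) unfolding H1_limit_def by blast
  have GG: "ae_eq (vol K) G' G" using H1_limit_gradient_unique[OF H(2,1)] .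
  have lim'': "(\<lambda>k. l2_norm (vol K) (D\<phi>' k - G)) \<longlonglongrightarrow> 0"
  proof -
    have "l2_norm (vol K) (D\<phi>' k - G') = l2_norm (vol K) (D\<phi>' k - G)" for k
      by (intro l2_norm_cong ae_eq_diff GG ae_eq_refl L2_diff C1_L2(2)[OF C1'] u u')
    then show ?thesis using lim'(2) by simp
  qed
  have "(\<lambda>k. l2_norm (surf K) (\<phi>' k - \<phi> k)) \<longlonglongrightarrow> 0"
  proof (rule trace_difference_tendsto)
    show "C1_function (\<phi>' k - \<phi> k) (D\<phi>' k - D\<phi> k)" for k by (rule C1_function_diff[OF C1' C1])
    show "(\<lambda>k. l2_norm (vol K) (\<phi>' k - \<phi> k)) \<longlonglongrightarrow> 0"
    proof (rule Lim_null_comparison)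
      show "\<forall>\<^sub>F k in sequentially. norm (l2_norm (vol K) (\<phi>' k - \<phi> k)) \<le> l2_norm (vol K) (\<phi>' k - u) + l2_norm (vol K) (\<phi> k - u)"
        using l2_norm_diff_triangle[OF C1_L2(1)[OF C1'] u(1) C1_L2(1)[OF C1]]
        by (intro always_eventually allI) (simp only: real_norm_def abs_of_nonneg l2_norm_nonneg l2_norm_diff_commute[of _ u])
      show "(\<lambda>k. l2_norm (vol K) (\<phi>' k - u) + l2_norm (vol K) (\<phi> k - u)) \<longlonglongrightarrow> 0" using tendsto_add[OF lim'(1) lim(1)] by simp
    qed
    show "(\<lambda>k. l2_norm (vol K) (D\<phi>' k - D\<phi> k)) \<longlonglongrightarrow> 0"
    proof (rule Lim_null_comparison)
      show "\<forall>\<^sub>F k in sequentially. norm (l2_norm (vol K) (D\<phi>' k - D\<phi> k)) \<le> l2_norm (vol K) (D\<phi>' k - G) + l2_norm (vol K) (D\<phi> k - G)"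
        using l2_norm_diff_triangle[OF C1_L2(2)[OF C1'] u(2) C1_L2(2)[OF C1]]
        by (intro always_eventually allI) (simp only: real_norm_def abs_of_nonneg l2_norm_nonneg l2_norm_diff_commute[of _ G])
      show "(\<lambda>k. l2_norm (vol K) (D\<phi>' k - G) + l2_norm (vol K) (D\<phi> k - G)) \<longlonglongrightarrow> 0" using tendsto_add[OF lim'' lim(2)] by simp
    qed
  qed
  from tendsto_add[OF this g(2)]
  have sum0: "(\<lambda>k. l2_norm (surf K) (\<phi>' k - \<phi> k) + l2_norm (surf K) (\<phi> k - g)) \<longlonglongrightarrow> 0" by simp
  have le: "norm (l2_norm (surf K) (\<phi>' k - g)) \<le> l2_norm (surf K) (\<phi>' k - \<phi> k) + l2_norm (surf K) (\<phi> k - g)" for k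
    using l2_norm_diff_triangle[OF C1_L2(3)[OF C1'] C1_L2(3)[OF C1] g(1), of k k] by simp
  show ?thesis
  proof (rule Lim_null_comparison[OF _ sum0])
    show "\<forall>\<^sub>F k in sequentially. norm (l2_norm (surf K) (\<phi>' k - g)) \<le> l2_norm (surf K) (\<phi>' k - \<phi> k) + l2_norm (surf K) (\<phi> k - g)"
      using le by (rule always_eventually[OF allI])
  qed
qed

text \<open>\<open>trace1\<close> is a choice made through some approximating sequence; this carries
  it over to every other one.\<close>

lemma trace1_limit:
  assumes H: "H1_limit K \<phi> u G"
  shows "trace1 K u \<in> L2 (surf K)" "(\<lambda>k. l2_norm (surf K) (\<phi> k - trace1 K u)) \<longlonglongrightarrow> 0"
proof -
  from H1_limit_trace[OF H] obtain g0
    where "g0 \<in> L2 (surf K)" "(\<lambda>k. l2_norm (surf K) (\<phi> k - g0)) \<longlonglongrightarrow> 0" ..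
  then have "has_trace K u g0" using H unfolding has_trace_def by (intro conjI exI)
  then have "has_trace K u (trace1 K u)" unfolding trace1_def by (rule someI[of "has_trace K u"])
  then obtain \<phi>' G' where g: "trace1 K u \<in> L2 (surf K)" and H': "H1_limit K \<phi>' u G'" "(\<lambda>k. l2_norm (surf K) (\<phi>' k - trace1 K u)) \<longlonglongrightarrow> 0"
    unfolding has_trace_def by blast
  show "trace1 K u \<in> L2 (surf K)" by (rule g)
  show "(\<lambda>k. l2_norm (surf K) (\<phi> k - trace1 K u)) \<longlonglongrightarrow> 0" by (rule H1_limit_trace_unique[OF H'(1) H g H'(2)])
qed

lemma weak_grad_ae:
  assumes H: "H1_limit K \<phi> u G"
  shows "weak_grad K u \<in> L2 (vol K)" "ae_eq (vol K) (weak_grad K u) G"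
proof -
  have "\<exists>\<phi>. H1_limit K \<phi> u (weak_grad K u)" unfolding weak_grad_def by (rule someI[of "\<lambda>G. \<exists>\<phi>. H1_limit K \<phi> u G"]) (use H in blast)
  then obtain \<phi>' where H': "H1_limit K \<phi>' u (weak_grad K u)" by blast
  then show "weak_grad K u \<in> L2 (vol K)" by (simp add: H1_limit_def)
  show "ae_eq (vol K) (weak_grad K u) G" by (rule H1_limit_gradient_unique[OF H' H])
qed

section \<open>Linearity, null sets and Green's formula in H1\<close>

lemma H1_L2: "u \<in> H1 K \<Longrightarrow> u \<in> L2 (vol K)"
  by (auto simp: H1_def H1_limit_def)

lemma H1_trace_L2:
  assumes "u \<in> H1 K"
  shows "trace1 K u \<in> L2 (surf K)"
proof -
  obtain \<phi> G where "H1_limit K \<phi> u G" using assms unfolding H1_def by blast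
  then show ?thesis by (rule trace1_limit(1))
qed

lemma H1_grad_L2:
  assumes "u \<in> H1 K"
  shows "weak_grad K u \<in> L2 (vol K)"
proof -
  obtain \<phi> G where "H1_limit K \<phi> u G" using assms unfolding H1_def by blast
  then show ?thesis by (rule weak_grad_ae(1))
qed

lemma H1_limit_lincomb:
  assumes H: "H1_limit K \<phi> u G" "H1_limit K \<psi> v H"
  shows "H1_limit K (\<lambda>k x. a *\<^sub>R \<phi> k x + b *\<^sub>R \<psi> k x) (\<lambda>x. a *\<^sub>R u x + b *\<^sub>R v x) (\<lambda>x. a *\<^sub>R G x + b *\<^sub>R H x)"
proof -
  obtain D\<phi> where u: "u \<in> L2 (vol K)" "G \<in> L2 (vol K)" and C1: "\<And>k. C1_function (\<phi> k) (D\<phi> k)"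
    and lim: "(\<lambda>k. l2_norm (vol K) (\<phi> k - u)) \<longlonglongrightarrow> 0" "(\<lambda>k. l2_norm (vol K) (D\<phi> k - G)) \<longlonglongrightarrow> 0"
    using H(1) unfolding H1_limit_def by blast
  obtain D\<psi> where v: "v \<in> L2 (vol K)" "H \<in> L2 (vol K)" and C1': "\<And>k. C1_function (\<psi> k) (D\<psi> k)"
    and lim': "(\<lambda>k. l2_norm (vol K) (\<psi> k - v)) \<longlonglongrightarrow> 0" "(\<lambda>k. l2_norm (vol K) (D\<psi> k - H)) \<longlonglongrightarrow> 0"
    using H(2) unfolding H1_limit_def by blast
  show ?thesis
    unfolding H1_limit_def
  proof (intro conjI exI allI)
    show "(\<lambda>x. a *\<^sub>R u x + b *\<^sub>R v x) \<in> L2 (vol K)" "(\<lambda>x. a *\<^sub>R G x + b *\<^sub>R H x) \<in> L2 (vol K)"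
      by (intro L2_add L2_scale u v)+
    show "C1_function (\<lambda>x. a *\<^sub>R \<phi> k x + b *\<^sub>R \<psi> k x) (\<lambda>x. a *\<^sub>R D\<phi> k x + b *\<^sub>R D\<psi> k x)" for k
      by (rule C1_function_lincomb[OF C1 C1'])
    show "(\<lambda>k. l2_norm (vol K) ((\<lambda>x. a *\<^sub>R \<phi> k x + b *\<^sub>R \<psi> k x) - (\<lambda>x. a *\<^sub>R u x + b *\<^sub>R v x))) \<longlonglongrightarrow> 0"
      by (rule l2_limit_lincomb[OF C1_L2(1)[OF C1] u(1) lim(1) C1_L2(1)[OF C1'] v(1) lim'(1)])
    show "(\<lambda>k. l2_norm (vol K) ((\<lambda>x. a *\<^sub>R D\<phi> k x + b *\<^sub>R D\<psi> k x) - (\<lambda>x. a *\<^sub>R G x + b *\<^sub>R H x))) \<longlonglongrightarrow> 0"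
      by (rule l2_limit_lincomb[OF C1_L2(2)[OF C1] u(2) lim(2) C1_L2(2)[OF C1'] v(2) lim'(2)])
  qed
qed

text \<open>The choices behind \<open>weak_grad\<close> and \<open>trace1\<close> know nothing of
  linearity. It holds up to null sets because the combined approximating sequence determines
  both.\<close>

lemma H1_lincomb:
  assumes "u \<in> H1 K" "v \<in> H1 K"
  shows "(\<lambda>x. a *\<^sub>R u x + b *\<^sub>R v x) \<in> H1 K"
    and "ae_eq (vol K) (weak_grad K (\<lambda>x. a *\<^sub>R u x + b *\<^sub>R v x)) (\<lambda>x. a *\<^sub>R weak_grad K u x + b *\<^sub>R weak_grad K v x)"
    and "ae_eq (surf K) (trace1 K (\<lambda>x. a *\<^sub>R u x + b *\<^sub>R v x)) (\<lambda>x. a *\<^sub>R trace1 K u x + b *\<^sub>R trace1 K v x)"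
proof -
  obtain \<phi> G \<psi> H where H: "H1_limit K \<phi> u G" "H1_limit K \<psi> v H" using assms by (auto simp: H1_def)
  note L = H1_limit_lincomb[OF H, of a b]
  show "(\<lambda>x. a *\<^sub>R u x + b *\<^sub>R v x) \<in> H1 K"
    unfolding H1_def by (intro CollectI exI) (rule L)
  have "ae_eq (vol K) (\<lambda>x. a *\<^sub>R G x + b *\<^sub>R H x) (\<lambda>x. a *\<^sub>R weak_grad K u x + b *\<^sub>R weak_grad K v x)"
    by (intro ae_eq_add ae_eq_scale ae_eq_sym[OF weak_grad_ae(2)[OF H(1)]] ae_eq_sym[OF weak_grad_ae(2)[OF H(2)]])
  then show "ae_eq (vol K) (weak_grad K (\<lambda>x. a *\<^sub>R u x + b *\<^sub>R v x)) (\<lambda>x. a *\<^sub>R weak_grad K u x + b *\<^sub>R weak_grad K v x)"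
    by (rule ae_eq_trans[OF weak_grad_ae(2)[OF L]])
  obtain D\<phi> where C1: "\<And>k. C1_function (\<phi> k) (D\<phi> k)" using H(1) unfolding H1_limit_def by blast
  obtain D\<psi> where C1': "\<And>k. C1_function (\<psi> k) (D\<psi> k)" using H(2) unfolding H1_limit_def by blast
  show "ae_eq (surf K) (trace1 K (\<lambda>x. a *\<^sub>R u x + b *\<^sub>R v x)) (\<lambda>x. a *\<^sub>R trace1 K u x + b *\<^sub>R trace1 K v x)"
  proof (rule l2_limit_unique)
    show "(\<lambda>x. a *\<^sub>R \<phi> k x + b *\<^sub>R \<psi> k x) \<in> L2 (surf K)" for k by (intro L2_add L2_scale C1_L2(3)[OF C1] C1_L2(3)[OF C1'])
    show "trace1 K (\<lambda>x. a *\<^sub>R u x + b *\<^sub>R v x) \<in> L2 (surf K)" by (rule trace1_limit(1)[OF L])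
    show "(\<lambda>x. a *\<^sub>R trace1 K u x + b *\<^sub>R trace1 K v x) \<in> L2 (surf K)" by (intro L2_add L2_scale H1_trace_L2 assms)
    show "(\<lambda>k. l2_norm (surf K) ((\<lambda>x. a *\<^sub>R \<phi> k x + b *\<^sub>R \<psi> k x) - trace1 K (\<lambda>x. a *\<^sub>R u x + b *\<^sub>R v x))) \<longlonglongrightarrow> 0"
      by (rule trace1_limit(2)[OF L])
    show "(\<lambda>k. l2_norm (surf K) ((\<lambda>x. a *\<^sub>R \<phi> k x + b *\<^sub>R \<psi> k x) - (\<lambda>x. a *\<^sub>R trace1 K u x + b *\<^sub>R trace1 K v x))) \<longlonglongrightarrow> 0"
      by (rule l2_limit_lincomb[OF C1_L2(3)[OF C1] H1_trace_L2[OF assms(1)] trace1_limit(2)[OF H(1)]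
            C1_L2(3)[OF C1'] H1_trace_L2[OF assms(2)] trace1_limit(2)[OF H(2)]])
  qed
qed

text \<open>A sequence that approximates \<open>u\<close> also approximates \<open>u'\<close>, with
  the same gradients.\<close>

lemma H1_cong:
  assumes u: "u \<in> H1 K" and ae: "ae_eq (vol K) u u'" and u': "u' \<in> L2 (vol K)"
  shows "u' \<in> H1 K" "ae_eq (vol K) (weak_grad K u) (weak_grad K u')" "ae_eq (surf K) (trace1 K u) (trace1 K u')"
proof -
  obtain \<phi> G where H: "H1_limit K \<phi> u G" using u by (auto simp: H1_def)
  then obtain D\<phi> where C1: "\<And>k. C1_function (\<phi> k) (D\<phi> k)" unfolding H1_limit_def by blast
  have "l2_norm (vol K) (\<phi> k - u) = l2_norm (vol K) (\<phi> k - u')" for k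
    by (intro l2_norm_cong ae_eq_diff ae_eq_refl ae L2_diff C1_L2(1)[OF C1] u' H1_L2[OF u])
  then have H': "H1_limit K \<phi> u' G" using H u' unfolding H1_limit_def by simp
  then show "u' \<in> H1 K" by (auto simp: H1_def)
  show "ae_eq (vol K) (weak_grad K u) (weak_grad K u')"
    by (rule ae_eq_trans[OF weak_grad_ae(2)[OF H] ae_eq_sym[OF weak_grad_ae(2)[OF H']]])
  show "ae_eq (surf K) (trace1 K u) (trace1 K u')"
    by (rule l2_limit_unique[OF C1_L2(3)[OF C1] trace1_limit(1)[OF H] trace1_limit(1)[OF H'] trace1_limit(2)[OF H] trace1_limit(2)[OF H']])
qed

lemma H1_limit_C1:
  assumes "C1_function f Df"
  shows "H1_limit K (\<lambda>k. f) f Df"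
  unfolding H1_limit_def
proof (intro conjI exI allI)
  show "f \<in> L2 (vol K)" "Df \<in> L2 (vol K)" by (rule C1_L2[OF assms])+
  show "C1_function f Df" by (rule assms)
qed (simp_all add: l2_norm_def)

lemma C1_H1:
  assumes C1: "C1_function f Df"
  shows "f \<in> H1 K" "ae_eq (vol K) (weak_grad K f) Df" "ae_eq (surf K) (trace1 K f) f"
proof -
  note H = H1_limit_C1[OF C1]
  show "f \<in> H1 K" using H by (auto simp: H1_def)
  show "ae_eq (vol K) (weak_grad K f) Df" by (rule weak_grad_ae(2)[OF H])
  show "ae_eq (surf K) (trace1 K f) f"
    by (rule l2_limit_unique[OF C1_L2(3)[OF C1] trace1_limit(1)[OF H] C1_L2(3)[OF C1] trace1_limit(2)[OF H]]) (simp add: l2_norm_def)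
qed

text \<open>Both sides of \<open>C1_green_product\<close> are continuous along approximating
  sequences: the volume terms in H1, the boundary term by convergence of the traces and boundedness
  of the normal.\<close>

lemma H1_green:
  assumes u: "u \<in> H1 K" and v: "v \<in> H1 K"
  shows "l2_inner (vol K) u (\<lambda>x. weak_grad K v x $ i) + l2_inner (vol K) (\<lambda>x. weak_grad K u x $ i) v
    = l2_inner (surf K) (trace1 K u) (\<lambda>x. outer_normal K x $ i * trace1 K v x)"
proof -
  have "\<exists>\<phi>. H1_limit K \<phi> u (weak_grad K u)" if "u \<in> H1 K" for u
    unfolding weak_grad_def by (rule someI_ex[of "\<lambda>G. \<exists>\<phi>. H1_limit K \<phi> u G"]) (use that in \<open>auto simp: H1_def\<close>)
  then obtain \<phi> \<psi> where H: "H1_limit K \<phi> u (weak_grad K u)" "H1_limit K \<psi> v (weak_grad K v)" using u v by blast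
  obtain D\<phi> where C1: "\<And>k. C1_function (\<phi> k) (D\<phi> k)"
    and lim: "(\<lambda>k. l2_norm (vol K) (\<phi> k - u)) \<longlonglongrightarrow> 0" "(\<lambda>k. l2_norm (vol K) (D\<phi> k - weak_grad K u)) \<longlonglongrightarrow> 0"
    using H(1) unfolding H1_limit_def by blast
  obtain D\<psi> where C1': "\<And>k. C1_function (\<psi> k) (D\<psi> k)"
    and lim': "(\<lambda>k. l2_norm (vol K) (\<psi> k - v)) \<longlonglongrightarrow> 0" "(\<lambda>k. l2_norm (vol K) (D\<psi> k - weak_grad K v)) \<longlonglongrightarrow> 0"
    using H(2) unfolding H1_limit_def by blast
  have comp: "(\<lambda>k. l2_norm (vol K) ((\<lambda>x. D k x $ i) - (\<lambda>x. G x $ i))) \<longlonglongrightarrow> 0"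
    if "\<And>k. D k \<in> L2 (vol K)" "G \<in> L2 (vol K)" "(\<lambda>k. l2_norm (vol K) (D k - G)) \<longlonglongrightarrow> 0" for D :: "nat \<Rightarrow> real^'n \<Rightarrow> real^'n" and G
  proof (rule Lim_null_comparison[OF _ that(3)])
    have "l2_norm (vol K) ((\<lambda>x. D k x $ i) - (\<lambda>x. G x $ i)) \<le> l2_norm (vol K) (D k - G)" for k
      using l2_norm_component_le[OF L2_diff[OF that(1,2)], of k i] by (simp add: fun_diff_def)
    then show "\<forall>\<^sub>F k in sequentially. norm (l2_norm (vol K) ((\<lambda>x. D k x $ i) - (\<lambda>x. G x $ i))) \<le> l2_norm (vol K) (D k - G)" by simp
  qed
  have gi: "(\<lambda>x. weak_grad K u x $ i) \<in> L2 (vol K)" "(\<lambda>x. weak_grad K v x $ i) \<in> L2 (vol K)"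
    using H1_grad_L2 u v L2_components by blast+
  have nlim: "(\<lambda>k. l2_norm (surf K) ((\<lambda>x. outer_normal K x $ i * \<psi> k x) - (\<lambda>x. outer_normal K x $ i * trace1 K v x))) \<longlonglongrightarrow> 0"
  proof (rule Lim_null_comparison[OF _ trace1_limit(2)[OF H(2)]])
    have "l2_norm (surf K) ((\<lambda>x. outer_normal K x $ i * \<psi> k x) - (\<lambda>x. outer_normal K x $ i * trace1 K v x)) \<le> l2_norm (surf K) (\<psi> k - trace1 K v)" for k
      using normal_times_L2(2)[OF L2_diff[OF C1_L2(3)[OF C1'] trace1_limit(1)[OF H(2)]], of i k] by (simp add: fun_diff_def right_diff_distrib)
    then show "\<forall>\<^sub>F k in sequentially. norm (l2_norm (surf K) ((\<lambda>x. outer_normal K x $ i * \<psi> k x) - (\<lambda>x. outer_normal K x $ i * trace1 K v x))) \<le> l2_norm (surf K) (\<psi> k - trace1 K v)" by simp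
  qed
  have "(\<lambda>k. l2_inner (vol K) (\<phi> k) (\<lambda>x. D\<psi> k x $ i) + l2_inner (vol K) (\<lambda>x. D\<phi> k x $ i) (\<psi> k))
    \<longlonglongrightarrow> l2_inner (vol K) u (\<lambda>x. weak_grad K v x $ i) + l2_inner (vol K) (\<lambda>x. weak_grad K u x $ i) v"
    by (intro tendsto_add tendsto_l2_inner C1_L2(1)[OF C1] C1_L2(1)[OF C1'] C1_L2_component[OF C1] C1_L2_component[OF C1'] H1_L2 u v gi lim lim'
        comp C1_L2(2)[OF C1] C1_L2(2)[OF C1'] H1_grad_L2)
  moreover have "(\<lambda>k. l2_inner (surf K) (\<phi> k) (\<lambda>x. outer_normal K x $ i * \<psi> k x))
    \<longlonglongrightarrow> l2_inner (surf K) (trace1 K u) (\<lambda>x. outer_normal K x $ i * trace1 K v x)"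
    by (intro tendsto_l2_inner C1_L2(3)[OF C1] C1_L2(3)[OF C1'] normal_times_L2(1) H1_trace_L2 u v nlim trace1_limit(2)[OF H(1)])
  ultimately show ?thesis unfolding C1_green_product[OF C1 C1'] by (rule LIMSEQ_unique)
qed

end

section \<open>Weak divergence and normal traces\<close>

text \<open>Squaring removes the kink at 0, where the difference quotient is at most
  \<open>\<bar>h\<bar>\<close>.\<close>

lemma DERIV_max_square: "((\<lambda>s::real. (max 0 s)\<^sup>2) has_field_derivative (2 * max 0 s)) (at s)"
proof -
  consider "s > 0" | "s < 0" | "s = 0" by linarith
  then show ?thesis
  proof cases
    case 1
    have "((\<lambda>s::real. s\<^sup>2) has_field_derivative (2 * s)) (at s)" by (auto intro!: derivative_eq_intros)
    moreover have "eventually (\<lambda>x. x\<^sup>2 = (max 0 x)\<^sup>2) (nhds s)"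
      using eventually_nhds_in_open[of "{0<..}" s] 1 by (auto elim!: eventually_mono)
    ultimately have "((\<lambda>s::real. (max 0 s)\<^sup>2) has_field_derivative (2 * s)) (at s)"
      by (subst (asm) DERIV_cong_ev) auto
    then show ?thesis using 1 by simp
  next
    case 2
    have "((\<lambda>s::real. 0) has_field_derivative 0) (at s)" by simp
    moreover have "eventually (\<lambda>x::real. 0 = (max 0 x)\<^sup>2) (nhds s)"
      using eventually_nhds_in_open[of "{..<0}" s] 2 by (auto elim!: eventually_mono)
    ultimately have "((\<lambda>s::real. (max 0 s)\<^sup>2) has_field_derivative 0) (at s)"
      by (subst (asm) DERIV_cong_ev) auto
    then show ?thesis using 2 by simp
  next
    case 3
    have "((\<lambda>h::real. ((max 0 (0 + h))\<^sup>2 - (max 0 0)\<^sup>2) / h) \<longlongrightarrow> 0) (at 0)"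
    proof (rule Lim_null_comparison)
      show "\<forall>\<^sub>F h in at (0::real). norm (((max 0 (0 + h))\<^sup>2 - (max 0 0)\<^sup>2) / h) \<le> \<bar>h\<bar>"
      proof (intro always_eventually allI)
        fix h :: real
        show "norm (((max 0 (0 + h))\<^sup>2 - (max 0 0)\<^sup>2) / h) \<le> \<bar>h\<bar>"
          by (cases "h > 0") (auto simp: power2_eq_square max_def)
      qed
      show "((\<lambda>h::real. \<bar>h\<bar>) \<longlongrightarrow> 0) (at 0)" using tendsto_rabs[OF tendsto_ident_at[of "0::real" UNIV]] by simp
    qed
    then show ?thesis using 3 by (simp add: DERIV_def)
  qed
qed

text \<open>Test functions are only required to be C1, so the squared positive part is smooth enough
  at the rim of the ball.\<close>

lemma C1_bump: "C1_function (\<lambda>x. (max 0 (r\<^sup>2 - (norm (x - x0))\<^sup>2))\<^sup>2)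
  (\<lambda>x. (2 * max 0 (r\<^sup>2 - (norm (x - x0))\<^sup>2)) *\<^sub>R ((-2) *\<^sub>R (x - x0)))"
  unfolding C1_function_def
proof (intro conjI allI)
  fix x :: "real^'a"
  have "GDERIV (\<lambda>x. r\<^sup>2 - (norm (x - x0))\<^sup>2) x :> (-2) *\<^sub>R (x - x0)"
    unfolding gderiv_def power2_norm_eq_inner
    by (auto intro!: derivative_eq_intros simp: inner_commute algebra_simps)
  from GDERIV_DERIV_compose[OF this DERIV_max_square]
  show "GDERIV (\<lambda>x. (max 0 (r\<^sup>2 - (norm (x - x0))\<^sup>2))\<^sup>2) x :> (2 * max 0 (r\<^sup>2 - (norm (x - x0))\<^sup>2)) *\<^sub>R ((-2) *\<^sub>R (x - x0))" .
qed (intro continuous_intros)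

section \<open>Uniqueness and linearity of the weak divergence\<close>

context flat_domain
begin

text \<open>A bump supported in a ball inside \<open>K\<close>, times an arbitrary polynomial, is an admissible test
  function; countably many such balls cover \<open>K\<close>.\<close>

lemma test_function_dense:
  fixes e :: "real^'n \<Rightarrow> real"
  assumes e: "e \<in> L2 (vol K)"
    and zero: "\<And>\<phi> D\<phi> C. C1_function \<phi> D\<phi> \<Longrightarrow> compact C \<Longrightarrow> C \<subseteq> K \<Longrightarrow> (\<And>x. x \<notin> C \<Longrightarrow> \<phi> x = 0) \<Longrightarrow> (\<integral>x. e x * \<phi> x \<partial>vol K) = 0"
  shows "AE x in vol K. e x = 0"
proof -
  have ball: "AE x in vol K. x \<in> ball x0 r \<longrightarrow> e x = 0" if r: "cball x0 r \<subseteq> K" "0 < r" for x0 r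
  proof -
    define \<psi> where "\<psi> x = (max 0 (r\<^sup>2 - (norm (x - x0))\<^sup>2))\<^sup>2" for x
    obtain D where \<psi>: "C1_function \<psi> D" unfolding \<psi>_def[abs_def] using C1_bump by blast
    have "AE x in vol K. e x * \<psi> x = 0"
    proof (rule polynomial_dense_vol)
      show "integrable (vol K) (\<lambda>x. e x * \<psi> x)" using L2_integrable_inner[OF e C1_L2(1)[OF \<psi>]] by simp
      fix p :: "real^'n \<Rightarrow> real" assume "real_polynomial_function p"
      then obtain Dp where p: "C1_function p Dp" using real_polynomial_function_C1 by blast
      have "(\<integral>x. e x * (\<psi> x * p x) \<partial>vol K) = 0"
      proof (rule zero[OF C1_function_mult[OF \<psi> p] compact_cball r(1)])
        fix x assume x: "x \<notin> cball x0 r"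
        have "r\<^sup>2 \<le> (norm (x - x0))\<^sup>2" using x r(2) by (intro power_mono) (auto simp: dist_norm norm_minus_commute)
        then show "\<psi> x * p x = 0" by (simp add: \<psi>_def max_absorb1)
      qed
      then show "(\<integral>x. e x * \<psi> x * p x \<partial>vol K) = 0" by (simp add: mult.assoc)
    qed
    then show ?thesis
    proof eventually_elim
      case (elim x)
      have "\<psi> x \<noteq> 0" if "x \<in> ball x0 r"
      proof -
        have "norm (x - x0) < r" using that by (simp add: dist_norm norm_minus_commute)
        then have "(norm (x - x0))\<^sup>2 < r\<^sup>2" by (intro power_strict_mono) auto
        then show ?thesis by (simp add: \<psi>_def)
      qed
      then show ?case using elim by auto
    qed
  qed
  define \<F> where "\<F> = {ball x r | x r. 0 < r \<and> cball x r \<subseteq> K}"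
  have "\<Union>\<F> = K"
  proof
    show "\<Union>\<F> \<subseteq> K" unfolding \<F>_def using ball_subset_cball by blast
    show "K \<subseteq> \<Union>\<F>"
    proof
      fix x assume "x \<in> K"
      then obtain r where "r > 0" "cball x r \<subseteq> K" using open_K open_contains_cball by blast
      then show "x \<in> \<Union>\<F>" unfolding \<F>_def by (auto intro!: exI[of _ "ball x r"])
    qed
  qed
  moreover have "open B" if "B \<in> \<F>" for B using that by (auto simp: \<F>_def)
  then obtain \<F>' where "\<F>' \<subseteq> \<F>" "countable \<F>'" "\<Union>\<F>' = \<Union>\<F>" by (rule Lindelof)
  ultimately have \<F>': "\<F>' \<subseteq> \<F>" "countable \<F>'" "\<Union>\<F>' = K" by simp_all
  have "AE x in vol K. \<forall>B\<in>\<F>'. x \<in> B \<longrightarrow> e x = 0"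
    using \<F>'(1) ball by (subst AE_ball_countable[OF \<F>'(2)]) (fastforce simp: \<F>_def)
  with AE_space[of "vol K"] show ?thesis
  proof eventually_elim
    case (elim x)
    then have "x \<in> \<Union>\<F>'" by (simp add: space_vol \<F>'(3))
    then show ?case using elim(2) by blast
  qed
qed

text \<open>The right-hand side of the defining identity does not involve the candidate, so the
  difference of two candidates is orthogonal to every test function, component by component.\<close>

lemma weak_div_unique:
  assumes d: "has_weak_div K \<tau> d" "has_weak_div K \<tau> d'"
  shows "ae_eq (vol K) d d'"
  unfolding L2_ae_eq_components
proof
  fix i
  have "d \<in> L2 (vol K)" "d' \<in> L2 (vol K)" using d by (simp_all add: has_weak_div_def)
  then have dL: "(\<lambda>x. d x $ i) \<in> L2 (vol K)" "(\<lambda>x. d' x $ i) \<in> L2 (vol K)"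
    unfolding L2_components[of d] L2_components[of d'] by blast+
  define e where "e = (\<lambda>x. d x $ i) - (\<lambda>x. d' x $ i)"
  have "AE x in vol K. e x = 0"
  proof (rule test_function_dense)
    show "e \<in> L2 (vol K)" unfolding e_def by (rule L2_diff[OF dL])
    fix \<phi> D\<phi> C assume \<phi>: "C1_function \<phi> D\<phi>" "compact C" "C \<subseteq> K" "\<And>x. x \<notin> C \<Longrightarrow> \<phi> x = 0"
    have "(\<integral>x. d x $ i * \<phi> x \<partial>vol K) = - (\<integral>x. \<tau> x $ i \<bullet> D\<phi> x \<partial>vol K)"
      using d(1) \<phi> unfolding has_weak_div_def by blast
    moreover have "(\<integral>x. d' x $ i * \<phi> x \<partial>vol K) = - (\<integral>x. \<tau> x $ i \<bullet> D\<phi> x \<partial>vol K)"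
      using d(2) \<phi> unfolding has_weak_div_def by blast
    ultimately have "(\<integral>x. d x $ i * \<phi> x \<partial>vol K) = (\<integral>x. d' x $ i * \<phi> x \<partial>vol K)" by simp
    then have "l2_inner (vol K) e \<phi> = 0"
      unfolding e_def using l2_inner_diff_left[OF dL C1_L2(1)[OF \<phi>(1)]] by (simp add: l2_inner_def)
    then show "(\<integral>x. e x * \<phi> x \<partial>vol K) = 0" by (simp add: l2_inner_def)
  qed
  then show "ae_eq (vol K) (\<lambda>x. d x $ i) (\<lambda>x. d' x $ i)" by (simp add: ae_eq_def e_def)
qed

lemma has_weak_div_weak_div: "has_weak_div K \<tau> d \<Longrightarrow> has_weak_div K \<tau> (weak_div K \<tau>)"
  unfolding weak_div_def by (rule someI[of "has_weak_div K \<tau>"])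

lemma weak_div_ae: "has_weak_div K \<tau> d \<Longrightarrow> ae_eq (vol K) (weak_div K \<tau>) d"
  by (rule weak_div_unique[OF has_weak_div_weak_div])

lemma has_weak_div_L2: "has_weak_div K \<tau> d \<Longrightarrow> d \<in> L2 (vol K)"
  by (simp add: has_weak_div_def)

lemma row_inner_integrable:
  assumes "\<tau> \<in> L2 (vol K)" "C1_function \<phi> D\<phi>"
  shows "integrable (vol K) (\<lambda>x. \<tau> x $ i \<bullet> D\<phi> x)"
  using L2_integrable_inner[of "\<lambda>x. \<tau> x $ i" "vol K" D\<phi>] C1_L2(2)[OF assms(2)] assms(1) L2_components by blast

lemma has_weak_div_lincomb:
  assumes \<tau>: "\<tau> \<in> L2 (vol K)" "has_weak_div K \<tau> d" and \<sigma>: "\<sigma> \<in> L2 (vol K)" "has_weak_div K \<sigma> d'"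
  shows "has_weak_div K (\<lambda>x. a *\<^sub>R \<tau> x + b *\<^sub>R \<sigma> x) (\<lambda>x. a *\<^sub>R d x + b *\<^sub>R d' x)"
  unfolding has_weak_div_def
proof (intro conjI allI impI)
  note dL = has_weak_div_L2[OF \<tau>(2)] has_weak_div_L2[OF \<sigma>(2)]
  show "(\<lambda>x. a *\<^sub>R d x + b *\<^sub>R d' x) \<in> L2 (vol K)" by (intro L2_add L2_scale dL)
  fix \<phi> :: "real^'n \<Rightarrow> real" and D\<phi> C i
  assume \<phi>: "C1_function \<phi> D\<phi>" "compact C" "C \<subseteq> K" "\<forall>x. x \<notin> C \<longrightarrow> \<phi> x = 0"
  have di: "(\<lambda>x. d x $ i) \<in> L2 (vol K)" "(\<lambda>x. d' x $ i) \<in> L2 (vol K)" using dL L2_components by blast+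
  have i: "integrable (vol K) (\<lambda>x. d x $ i * \<phi> x)" "integrable (vol K) (\<lambda>x. d' x $ i * \<phi> x)"
    using L2_integrable_inner[OF di(1) C1_L2(1)[OF \<phi>(1)]] L2_integrable_inner[OF di(2) C1_L2(1)[OF \<phi>(1)]] by simp_all
  have "(\<integral>x. (a *\<^sub>R d x + b *\<^sub>R d' x) $ i * \<phi> x \<partial>vol K) = (\<integral>x. a * (d x $ i * \<phi> x) + b * (d' x $ i * \<phi> x) \<partial>vol K)"
    by (intro Bochner_Integration.integral_cong) (auto simp: algebra_simps)
  also have "\<dots> = a * (\<integral>x. d x $ i * \<phi> x \<partial>vol K) + b * (\<integral>x. d' x $ i * \<phi> x \<partial>vol K)"
    using i by simp
  also have "(\<integral>x. d x $ i * \<phi> x \<partial>vol K) = - (\<integral>x. \<tau> x $ i \<bullet> D\<phi> x \<partial>vol K)"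
    using \<tau>(2) \<phi> unfolding has_weak_div_def by blast
  also have "(\<integral>x. d' x $ i * \<phi> x \<partial>vol K) = - (\<integral>x. \<sigma> x $ i \<bullet> D\<phi> x \<partial>vol K)"
    using \<sigma>(2) \<phi> unfolding has_weak_div_def by blast
  also have "a * - (\<integral>x. \<tau> x $ i \<bullet> D\<phi> x \<partial>vol K) + b * - (\<integral>x. \<sigma> x $ i \<bullet> D\<phi> x \<partial>vol K)
     = - (\<integral>x. a * (\<tau> x $ i \<bullet> D\<phi> x) + b * (\<sigma> x $ i \<bullet> D\<phi> x) \<partial>vol K)"
    using row_inner_integrable[OF \<tau>(1) \<phi>(1)] row_inner_integrable[OF \<sigma>(1) \<phi>(1)] by simp
  also have "(\<integral>x. a * (\<tau> x $ i \<bullet> D\<phi> x) + b * (\<sigma> x $ i \<bullet> D\<phi> x) \<partial>vol K)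
     = (\<integral>x. (a *\<^sub>R \<tau> x + b *\<^sub>R \<sigma> x) $ i \<bullet> D\<phi> x \<partial>vol K)"
    by (intro Bochner_Integration.integral_cong) (auto simp: inner_add_left)
  finally show "(\<integral>x. (a *\<^sub>R d x + b *\<^sub>R d' x) $ i * \<phi> x \<partial>vol K) = - (\<integral>x. (a *\<^sub>R \<tau> x + b *\<^sub>R \<sigma> x) $ i \<bullet> D\<phi> x \<partial>vol K)" .
qed

section \<open>Vector and matrix fields with H1 entries\<close>

lemma H1_vec_L2: "v \<in> H1_vec K \<Longrightarrow> v \<in> L2 (vol K)"
  unfolding L2_components by (auto simp: H1_vec_def intro: H1_L2)

lemma bd_L2: "v \<in> H1_vec K \<Longrightarrow> bd K v \<in> L2 (surf K)"
  unfolding L2_components by (auto simp: H1_vec_def bd_def intro: H1_trace_L2)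

lemma grad_vec_L2: "v \<in> H1_vec K \<Longrightarrow> grad_vec K v \<in> L2 (vol K)"
  unfolding L2_components[of "grad_vec K v"] by (auto simp: H1_vec_def grad_vec_def intro: H1_grad_L2)

lemma H1_sym_L2: "\<sigma> \<in> H1_sym K \<Longrightarrow> \<sigma> \<in> L2 (vol K)"
  unfolding L2_components[of \<sigma>] L2_components[of "\<lambda>x. \<sigma> x $ _"] by (auto simp: H1_sym_def intro: H1_L2)

lemma H1_vec_lincomb:
  assumes u: "u \<in> H1_vec K" and v: "v \<in> H1_vec K"
  shows "(\<lambda>x. a *\<^sub>R u x + b *\<^sub>R v x) \<in> H1_vec K"
    and "ae_eq (surf K) (bd K (\<lambda>x. a *\<^sub>R u x + b *\<^sub>R v x)) (\<lambda>x. a *\<^sub>R bd K u x + b *\<^sub>R bd K v x)"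
proof -
  have uv: "(\<lambda>x. u x $ i) \<in> H1 K" "(\<lambda>x. v x $ i) \<in> H1 K" for i using u v by (auto simp: H1_vec_def)
  show "(\<lambda>x. a *\<^sub>R u x + b *\<^sub>R v x) \<in> H1_vec K"
    using H1_lincomb(1)[OF uv] by (simp add: H1_vec_def)
  show "ae_eq (surf K) (bd K (\<lambda>x. a *\<^sub>R u x + b *\<^sub>R v x)) (\<lambda>x. a *\<^sub>R bd K u x + b *\<^sub>R bd K v x)"
    unfolding L2_ae_eq_components using H1_lincomb(3)[OF uv] by (simp add: bd_def)
qed

lemma bd_cong:
  assumes u: "u \<in> H1_vec K" and ae: "ae_eq (vol K) u u'" and u': "u' \<in> L2 (vol K)"
  shows "u' \<in> H1_vec K" "ae_eq (surf K) (bd K u) (bd K u')"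
proof -
  have c: "(\<lambda>x. u x $ i) \<in> H1 K" "ae_eq (vol K) (\<lambda>x. u x $ i) (\<lambda>x. u' x $ i)" "(\<lambda>x. u' x $ i) \<in> L2 (vol K)" for i
    using u ae u' L2_ae_eq_components[of "vol K" u u'] L2_components[of u'] by (auto simp: H1_vec_def)
  show "u' \<in> H1_vec K" using H1_cong(1)[OF c] by (simp add: H1_vec_def)
  show "ae_eq (surf K) (bd K u) (bd K u')"
    unfolding L2_ae_eq_components using H1_cong(3)[OF c] by (simp add: bd_def)
qed

text \<open>The explicit candidate for the normal trace of an H1 field;
  \<open>has_normal_trace_H1\<close> confirms it.\<close>

definition trace_normal :: "(real^'n \<Rightarrow> real^'n^'n) \<Rightarrow> (real^'n \<Rightarrow> real^'n)" where
  "trace_normal \<sigma> = (\<lambda>x. \<chi> i. \<Sum>j\<in>UNIV. outer_normal K x $ j * trace1 K (\<lambda>y. \<sigma> y $ i $ j) x)"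

definition div_grad :: "(real^'n \<Rightarrow> real^'n^'n) \<Rightarrow> (real^'n \<Rightarrow> real^'n)" where
  "div_grad \<sigma> = (\<lambda>x. \<chi> i. \<Sum>j\<in>UNIV. weak_grad K (\<lambda>y. \<sigma> y $ i $ j) x $ j)"

lemma div_grad_L2:
  assumes \<sigma>: "\<And>i j. (\<lambda>x. \<sigma> x $ i $ j) \<in> H1 K"
  shows "div_grad \<sigma> \<in> L2 (vol K)" "(\<lambda>x. weak_grad K (\<lambda>y. \<sigma> y $ i $ j) x $ k) \<in> L2 (vol K)"
proof -
  show w: "(\<lambda>x. weak_grad K (\<lambda>y. \<sigma> y $ i $ j) x $ k) \<in> L2 (vol K)" for i j k
    using H1_grad_L2[OF \<sigma>] L2_components by blast
  show "div_grad \<sigma> \<in> L2 (vol K)"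
    unfolding L2_components[of "div_grad \<sigma>"] by (simp add: div_grad_def L2_sum w)
qed

text \<open>A test function with compact support inside the open set \<open>K\<close> vanishes on
  the frontier, so \<open>ibp_frontier_zero\<close> applies to every entry.\<close>

lemma has_weak_div_H1:
  assumes \<sigma>: "\<sigma> \<in> H1_sym K"
  shows "has_weak_div K \<sigma> (div_grad \<sigma>)"
  unfolding has_weak_div_def
proof (intro conjI allI impI)
  have h: "(\<lambda>x. \<sigma> x $ i $ j) \<in> H1 K" for i j using \<sigma> by (simp add: H1_sym_def)
  show "div_grad \<sigma> \<in> L2 (vol K)" by (rule div_grad_L2(1)[OF h])
  fix \<phi> :: "real^'n \<Rightarrow> real" and D\<phi> C i
  assume \<phi>: "C1_function \<phi> D\<phi>" "compact C" "C \<subseteq> K" "\<forall>x. x \<notin> C \<longrightarrow> \<phi> x = 0"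
  have fr: "\<phi> x = 0" if "x \<in> frontier K" for x
    using that \<phi>(3,4) open_K by (auto simp: frontier_def interior_open)
  have ibp: "l2_inner (vol K) (\<lambda>x. weak_grad K (\<lambda>y. \<sigma> y $ i $ j) x $ j) \<phi> = - l2_inner (vol K) (\<lambda>x. \<sigma> x $ i $ j) (\<lambda>x. D\<phi> x $ j)" for j
  proof -
    have "\<exists>\<psi>. H1_limit K \<psi> (\<lambda>x. \<sigma> x $ i $ j) (weak_grad K (\<lambda>x. \<sigma> x $ i $ j))"
      unfolding weak_grad_def by (rule someI_ex[of "\<lambda>G. \<exists>\<phi>. H1_limit K \<phi> (\<lambda>x. \<sigma> x $ i $ j) G"]) (use h[of i j] in \<open>auto simp: H1_def\<close>)
    then obtain \<psi> where "H1_limit K \<psi> (\<lambda>x. \<sigma> x $ i $ j) (weak_grad K (\<lambda>x. \<sigma> x $ i $ j))" by blast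
    from ibp_frontier_zero[OF this \<phi>(1) fr, of j] show ?thesis by simp
  qed
  have "(\<integral>x. div_grad \<sigma> x $ i * \<phi> x \<partial>vol K) = (\<integral>x. (\<Sum>j\<in>UNIV. weak_grad K (\<lambda>y. \<sigma> y $ i $ j) x $ j * \<phi> x) \<partial>vol K)"
    by (simp add: div_grad_def sum_distrib_right)
  also have "\<dots> = (\<Sum>j\<in>UNIV. l2_inner (vol K) (\<lambda>x. weak_grad K (\<lambda>y. \<sigma> y $ i $ j) x $ j) \<phi>)"
    unfolding l2_inner_def inner_real_def
    using L2_integrable_inner[OF div_grad_L2(2)[OF h] C1_L2(1)[OF \<phi>(1)]] by (intro Bochner_Integration.integral_sum) simp
  also have "\<dots> = - (\<Sum>j\<in>UNIV. l2_inner (vol K) (\<lambda>x. \<sigma> x $ i $ j) (\<lambda>x. D\<phi> x $ j))"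
    unfolding ibp by (simp add: sum_negf)
  also have "(\<Sum>j\<in>UNIV. l2_inner (vol K) (\<lambda>x. \<sigma> x $ i $ j) (\<lambda>x. D\<phi> x $ j)) = (\<integral>x. \<sigma> x $ i \<bullet> D\<phi> x \<partial>vol K)"
    unfolding l2_inner_def inner_vec_def inner_real_def
    using L2_integrable_inner[OF H1_L2[OF h] C1_L2_component[OF \<phi>(1)]] by (intro Bochner_Integration.integral_sum[symmetric]) simp
  finally show "(\<integral>x. div_grad \<sigma> x $ i * \<phi> x \<partial>vol K) = - (\<integral>x. \<sigma> x $ i \<bullet> D\<phi> x \<partial>vol K)" .
qed

lemma H1_sym_Hdiv: "\<sigma> \<in> H1_sym K \<Longrightarrow> \<sigma> \<in> Hdiv_sym K"
  using has_weak_div_H1 H1_sym_L2 by (auto simp: Hdiv_sym_def H1_sym_def)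

text \<open>Green's formula for matrix fields is the sum of \<open>H1_green\<close> over all
  entries.\<close>

lemma has_normal_trace_H1:
  assumes \<sigma>: "\<sigma> \<in> H1_sym K"
  shows "has_normal_trace K \<sigma> (trace_normal \<sigma>)"
  unfolding has_normal_trace_def
proof (intro conjI ballI)
  have h: "(\<lambda>x. \<sigma> x $ i $ j) \<in> H1 K" for i j using \<sigma> by (simp add: H1_sym_def)
  have nt: "(\<lambda>x. outer_normal K x $ j * trace1 K (\<lambda>y. \<sigma> y $ i $ j) x) \<in> L2 (surf K)" for i j
    by (rule normal_times_L2(1)[OF H1_trace_L2[OF h]])
  show tL: "trace_normal \<sigma> \<in> L2 (surf K)"
    unfolding L2_components[of "trace_normal \<sigma>"] by (simp add: trace_normal_def L2_sum nt)
  fix v assume v: "v \<in> H1_vec K"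
  have vi: "(\<lambda>x. v x $ i) \<in> H1 K" for i using v by (simp add: H1_vec_def)
  have gi: "(\<lambda>x. weak_grad K (\<lambda>y. v y $ i) x $ j) \<in> L2 (vol K)" for i j
    using H1_grad_L2[OF vi] L2_components by blast
  have sum_l: "l2_inner M (\<lambda>x. \<Sum>j\<in>UNIV. f j x) g = (\<Sum>j\<in>UNIV. l2_inner M (f j) g)"
    if "\<And>j. f j \<in> L2 M" "g \<in> L2 M" for M :: "(real^'n) measure" and f :: "'n \<Rightarrow> real^'n \<Rightarrow> real" and g
    unfolding l2_inner_def inner_sum_left using L2_integrable_inner[OF that] by (intro Bochner_Integration.integral_sum) simp
  have "l2_inner (surf K) (trace_normal \<sigma>) (bd K v)
    = (\<Sum>i\<in>UNIV. l2_inner (surf K) (\<lambda>x. \<Sum>j\<in>UNIV. outer_normal K x $ j * trace1 K (\<lambda>y. \<sigma> y $ i $ j) x) (trace1 K (\<lambda>y. v y $ i)))"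
    using l2_inner_components[OF tL bd_L2[OF v]] by (simp add: trace_normal_def bd_def)
  also have "\<dots> = (\<Sum>i\<in>UNIV. \<Sum>j\<in>UNIV. l2_inner (surf K) (\<lambda>x. outer_normal K x $ j * trace1 K (\<lambda>y. \<sigma> y $ i $ j) x) (trace1 K (\<lambda>y. v y $ i)))"
    using nt H1_trace_L2[OF vi] by (intro sum.cong refl sum_l) auto
  also have "\<dots> = (\<Sum>i\<in>UNIV. \<Sum>j\<in>UNIV. l2_inner (vol K) (\<lambda>x. weak_grad K (\<lambda>y. \<sigma> y $ i $ j) x $ j) (\<lambda>x. v x $ i)
      + l2_inner (vol K) (\<lambda>x. \<sigma> x $ i $ j) (\<lambda>x. weak_grad K (\<lambda>y. v y $ i) x $ j))"
  proof (intro sum.cong refl)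
    fix i j
    have "l2_inner (surf K) (\<lambda>x. outer_normal K x $ j * trace1 K (\<lambda>y. \<sigma> y $ i $ j) x) (trace1 K (\<lambda>y. v y $ i))
      = l2_inner (surf K) (trace1 K (\<lambda>y. v y $ i)) (\<lambda>x. outer_normal K x $ j * trace1 K (\<lambda>y. \<sigma> y $ i $ j) x)"
      by (rule l2_inner_commute)
    also have "\<dots> = l2_inner (vol K) (\<lambda>x. v x $ i) (\<lambda>x. weak_grad K (\<lambda>y. \<sigma> y $ i $ j) x $ j)
      + l2_inner (vol K) (\<lambda>x. weak_grad K (\<lambda>y. v y $ i) x $ j) (\<lambda>x. \<sigma> x $ i $ j)"
      by (rule H1_green[OF vi h, symmetric])
    finally show "l2_inner (surf K) (\<lambda>x. outer_normal K x $ j * trace1 K (\<lambda>y. \<sigma> y $ i $ j) x) (trace1 K (\<lambda>y. v y $ i))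
      = l2_inner (vol K) (\<lambda>x. weak_grad K (\<lambda>y. \<sigma> y $ i $ j) x $ j) (\<lambda>x. v x $ i)
      + l2_inner (vol K) (\<lambda>x. \<sigma> x $ i $ j) (\<lambda>x. weak_grad K (\<lambda>y. v y $ i) x $ j)"
      by (simp only: l2_inner_commute)
  qed
  also have "\<dots> = l2_inner (vol K) (div_grad \<sigma>) v + l2_inner (vol K) \<sigma> (grad_vec K v)"
  proof -
    have "l2_inner (vol K) (div_grad \<sigma>) v = (\<Sum>i\<in>UNIV. l2_inner (vol K) (\<lambda>x. \<Sum>j\<in>UNIV. weak_grad K (\<lambda>y. \<sigma> y $ i $ j) x $ j) (\<lambda>x. v x $ i))"
      using l2_inner_components[OF div_grad_L2(1)[OF h] H1_vec_L2[OF v]] by (simp add: div_grad_def)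
    also have "\<dots> = (\<Sum>i\<in>UNIV. \<Sum>j\<in>UNIV. l2_inner (vol K) (\<lambda>x. weak_grad K (\<lambda>y. \<sigma> y $ i $ j) x $ j) (\<lambda>x. v x $ i))"
      using div_grad_L2(2)[OF h] H1_L2[OF vi] by (intro sum.cong refl sum_l) auto
    finally have 1: "l2_inner (vol K) (div_grad \<sigma>) v = (\<Sum>i\<in>UNIV. \<Sum>j\<in>UNIV. l2_inner (vol K) (\<lambda>x. weak_grad K (\<lambda>y. \<sigma> y $ i $ j) x $ j) (\<lambda>x. v x $ i))" .
    have "l2_inner (vol K) \<sigma> (grad_vec K v) = (\<Sum>i\<in>UNIV. l2_inner (vol K) (\<lambda>x. \<sigma> x $ i) (weak_grad K (\<lambda>y. v y $ i)))"
      using l2_inner_components[OF H1_sym_L2[OF \<sigma>] grad_vec_L2[OF v]] by (simp add: grad_vec_def)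
    also have "\<dots> = (\<Sum>i\<in>UNIV. \<Sum>j\<in>UNIV. l2_inner (vol K) (\<lambda>x. \<sigma> x $ i $ j) (\<lambda>x. weak_grad K (\<lambda>y. v y $ i) x $ j))"
    proof (intro sum.cong refl l2_inner_components)
      fix i
      show "(\<lambda>x. \<sigma> x $ i) \<in> L2 (vol K)" using H1_sym_L2[OF \<sigma>] L2_components by blast
      show "weak_grad K (\<lambda>y. v y $ i) \<in> L2 (vol K)" by (rule H1_grad_L2[OF vi])
    qed
    finally have 2: "l2_inner (vol K) \<sigma> (grad_vec K v) = (\<Sum>i\<in>UNIV. \<Sum>j\<in>UNIV. l2_inner (vol K) (\<lambda>x. \<sigma> x $ i $ j) (\<lambda>x. weak_grad K (\<lambda>y. v y $ i) x $ j))" .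
    show ?thesis unfolding 1 2 by (simp add: sum.distrib)
  qed
  \<comment> \<open>\<open>weak_div\<close> is a choice and equals the explicit divergence only up
    to a null set.\<close>
  also have "l2_inner (vol K) (div_grad \<sigma>) v = l2_inner (vol K) (weak_div K \<sigma>) v"
  proof (rule l2_inner_cong)
    show "ae_eq (vol K) (div_grad \<sigma>) (weak_div K \<sigma>)" by (rule ae_eq_sym[OF weak_div_ae[OF has_weak_div_H1[OF \<sigma>]]])
    show "weak_div K \<sigma> \<in> L2 (vol K)" by (rule has_weak_div_L2[OF has_weak_div_weak_div[OF has_weak_div_H1[OF \<sigma>]]])
  qed (auto intro: H1_vec_L2[OF v] div_grad_L2(1)[OF h])
  finally show "l2_inner (surf K) (trace_normal \<sigma>) (bd K v) = l2_inner (vol K) (weak_div K \<sigma>) v + l2_inner (vol K) \<sigma> (grad_vec K v)" .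
qed

section \<open>Uniqueness and linearity of the normal trace\<close>

text \<open>Vector fields with a single polynomial component are H1 fields that equal their own
  trace a.e. on the boundary, and polynomials separate functions on the compact frontier.\<close>

lemma has_normal_trace_unique:
  assumes g: "has_normal_trace K \<tau> g" "has_normal_trace K \<tau> g'"
  shows "ae_eq (surf K) g g'"
  unfolding L2_ae_eq_components
proof
  fix i
  have gL: "g \<in> L2 (surf K)" "g' \<in> L2 (surf K)" using g by (auto simp: has_normal_trace_def)
  have dL: "(\<lambda>x. (g - g') x $ i) \<in> L2 (surf K)" using L2_diff[OF gL] L2_components by blast
  have "AE x in surf K. (g - g') x $ i = 0"
  proof (rule polynomial_dense[OF finite_measure_surf sets_surf])
    show "compact (frontier K)" using bounded_K by (rule compact_frontier_bounded)
    show "AE x in surf K. x \<in> frontier K" by (rule AE_surf_frontier)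
    have one: "(\<lambda>x. 1 :: real) \<in> L2 (surf K)" by (rule continuous_L2_surf) simp
    show "integrable (surf K) (\<lambda>x. (g - g') x $ i)" using L2_integrable_inner[OF dL one] by simp
    fix p :: "real^'n \<Rightarrow> real" assume "real_polynomial_function p"
    then obtain Dp where p: "C1_function p Dp" using real_polynomial_function_C1 by blast
    define v where "v x = p x *\<^sub>R axis i (1::real)" for x
    have vj: "(\<lambda>x. v x $ j) = (if j = i then p else (\<lambda>x. 0))" for j by (auto simp: v_def axis_def)
    have v: "v \<in> H1_vec K"
      unfolding H1_vec_def using vj C1_H1(1)[OF p] C1_H1(1)[OF C1_function_const[of 0]] by auto
    have bv: "ae_eq (surf K) (bd K v) v"
      unfolding L2_ae_eq_components using vj C1_H1(3)[OF p] C1_H1(3)[OF C1_function_const[of 0]] by (auto simp: bd_def)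
    have vc: "continuous_on UNIV v" unfolding v_def[abs_def] using C1_function_continuous(1)[OF p] by (intro continuous_intros)
    have "l2_inner (surf K) (g - g') v = l2_inner (surf K) (g - g') (bd K v)"
      by (intro l2_inner_cong ae_eq_refl ae_eq_sym[OF bv] L2_diff gL bd_L2[OF v] continuous_L2_surf[OF vc])
    also have "\<dots> = l2_inner (surf K) g (bd K v) - l2_inner (surf K) g' (bd K v)"
      by (rule l2_inner_diff_left[OF gL bd_L2[OF v]])
    also have "\<dots> = 0" using g v by (simp add: has_normal_trace_def)
    finally show "(\<integral>x. (g - g') x $ i * p x \<partial>surf K) = 0"
      by (simp add: l2_inner_def v_def inner_axis mult.commute)
  qed
  then show "ae_eq (surf K) (\<lambda>x. g x $ i) (\<lambda>x. g' x $ i)" by (simp add: ae_eq_def)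
qed

lemma normal_trace_ae:
  assumes "has_normal_trace K \<tau> g"
  shows "has_normal_trace K \<tau> (normal_trace K \<tau>)" "ae_eq (surf K) (normal_trace K \<tau>) g"
proof -
  show "has_normal_trace K \<tau> (normal_trace K \<tau>)"
    unfolding normal_trace_def by (rule someI[of "has_normal_trace K \<tau>"]) (rule assms)
  then show "ae_eq (surf K) (normal_trace K \<tau>) g" by (rule has_normal_trace_unique) (rule assms)
qed

lemma has_normal_trace_lincomb:
  assumes \<tau>: "\<tau> \<in> Hdiv_sym K" "has_normal_trace K \<tau> g" and \<sigma>: "\<sigma> \<in> Hdiv_sym K" "has_normal_trace K \<sigma> g'"
  shows "has_normal_trace K (\<lambda>x. a *\<^sub>R \<tau> x + b *\<^sub>R \<sigma> x) (\<lambda>x. a *\<^sub>R g x + b *\<^sub>R g' x)"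
  unfolding has_normal_trace_def
proof (intro conjI ballI)
  have gL: "g \<in> L2 (surf K)" "g' \<in> L2 (surf K)" using \<tau>(2) \<sigma>(2) by (auto simp: has_normal_trace_def)
  show "(\<lambda>x. a *\<^sub>R g x + b *\<^sub>R g' x) \<in> L2 (surf K)" by (intro L2_add L2_scale gL)
  fix v assume v: "v \<in> H1_vec K"
  have L: "\<tau> \<in> L2 (vol K)" "\<sigma> \<in> L2 (vol K)" using \<tau>(1) \<sigma>(1) by (auto simp: Hdiv_sym_def)
  obtain d d' where d: "has_weak_div K \<tau> d" "has_weak_div K \<sigma> d'" using \<tau>(1) \<sigma>(1) by (auto simp: Hdiv_sym_def)
  note w = has_weak_div_weak_div[OF d(1)] has_weak_div_weak_div[OF d(2)]
  note wL = has_weak_div_L2[OF w(1)] has_weak_div_L2[OF w(2)]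
  note wl = has_weak_div_lincomb[OF L(1) w(1) L(2) w(2), of a b]
  have "l2_inner (vol K) (weak_div K (\<lambda>x. a *\<^sub>R \<tau> x + b *\<^sub>R \<sigma> x)) v
    = l2_inner (vol K) (\<lambda>x. a *\<^sub>R weak_div K \<tau> x + b *\<^sub>R weak_div K \<sigma> x) v"
    by (intro l2_inner_cong weak_div_ae[OF wl] ae_eq_refl has_weak_div_L2[OF has_weak_div_weak_div[OF wl]] L2_add L2_scale wL H1_vec_L2[OF v])
  also have "\<dots> = a * l2_inner (vol K) (weak_div K \<tau>) v + b * l2_inner (vol K) (weak_div K \<sigma>) v"
    using wL H1_vec_L2[OF v] by (simp add: l2_inner_add_left L2_scale l2_inner_scale_left)
  finally have 1: "l2_inner (vol K) (weak_div K (\<lambda>x. a *\<^sub>R \<tau> x + b *\<^sub>R \<sigma> x)) v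
    = a * l2_inner (vol K) (weak_div K \<tau>) v + b * l2_inner (vol K) (weak_div K \<sigma>) v" .
  have 2: "l2_inner (vol K) (\<lambda>x. a *\<^sub>R \<tau> x + b *\<^sub>R \<sigma> x) (grad_vec K v)
    = a * l2_inner (vol K) \<tau> (grad_vec K v) + b * l2_inner (vol K) \<sigma> (grad_vec K v)"
    using L grad_vec_L2[OF v] by (simp add: l2_inner_add_left L2_scale l2_inner_scale_left)
  have 3: "l2_inner (surf K) (\<lambda>x. a *\<^sub>R g x + b *\<^sub>R g' x) (bd K v) = a * l2_inner (surf K) g (bd K v) + b * l2_inner (surf K) g' (bd K v)"
    using gL bd_L2[OF v] by (simp add: l2_inner_add_left L2_scale l2_inner_scale_left)
  have 4: "l2_inner (surf K) g (bd K v) = l2_inner (vol K) (weak_div K \<tau>) v + l2_inner (vol K) \<tau> (grad_vec K v)"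
    "l2_inner (surf K) g' (bd K v) = l2_inner (vol K) (weak_div K \<sigma>) v + l2_inner (vol K) \<sigma> (grad_vec K v)"
    using \<tau>(2) \<sigma>(2) v by (auto simp: has_normal_trace_def)
  show "l2_inner (surf K) (\<lambda>x. a *\<^sub>R g x + b *\<^sub>R g' x) (bd K v)
    = l2_inner (vol K) (weak_div K (\<lambda>x. a *\<^sub>R \<tau> x + b *\<^sub>R \<sigma> x)) v + l2_inner (vol K) (\<lambda>x. a *\<^sub>R \<tau> x + b *\<^sub>R \<sigma> x) (grad_vec K v)"
    unfolding 1 2 3 4 by (simp add: algebra_simps)
qed

text \<open>A symmetric matrix has the same inner product with a matrix and with its transpose; this
  puts \<open>\<epsilon>(v)\<close> in place of the gradient in Green's formula.\<close>

lemma inner_sym_grad: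
  assumes \<tau>: "\<tau> \<in> L2 (vol K)" "AE x in vol K. transpose (\<tau> x) = \<tau> x" and v: "v \<in> H1_vec K"
  shows "sym_grad K v \<in> L2 (vol K)" "l2_inner (vol K) \<tau> (sym_grad K v) = l2_inner (vol K) \<tau> (grad_vec K v)"
proof -
  have gL: "grad_vec K v \<in> L2 (vol K)" by (rule grad_vec_L2[OF v])
  have "(\<lambda>x. grad_vec K v x $ j $ i) \<in> L2 (vol K)" for i j
    using gL L2_components[of "grad_vec K v"] L2_components[of "\<lambda>x. grad_vec K v x $ j"] by blast
  then have tL: "(\<lambda>x. transpose (grad_vec K v x)) \<in> L2 (vol K)"
    unfolding L2_components[of "\<lambda>x. transpose (grad_vec K v x)"] L2_components[of "\<lambda>x. transpose (grad_vec K v x) $ _"]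
    by (simp add: transpose_def)
  show sL: "sym_grad K v \<in> L2 (vol K)" unfolding sym_grad_def by (intro L2_scale L2_add gL tL)
  have tt: "A \<bullet> transpose B = transpose A \<bullet> B" for A B :: "real^'n^'n"
    unfolding inner_vec_def transpose_def by (simp add: inner_vec_def) (rule sum.swap)
  show "l2_inner (vol K) \<tau> (sym_grad K v) = l2_inner (vol K) \<tau> (grad_vec K v)"
    unfolding l2_inner_def
  proof (rule integral_cong_AE)
    show "(\<lambda>x. \<tau> x \<bullet> sym_grad K v x) \<in> borel_measurable (vol K)" using L2_integrable_inner[OF \<tau>(1) sL] by blast
    show "(\<lambda>x. \<tau> x \<bullet> grad_vec K v x) \<in> borel_measurable (vol K)" using L2_integrable_inner[OF \<tau>(1) gL] by blast
    show "AE x in vol K. \<tau> x \<bullet> sym_grad K v x = \<tau> x \<bullet> grad_vec K v x"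
      using \<tau>(2) by eventually_elim (simp add: sym_grad_def inner_add_right tt)
  qed
qed

end

section \<open>Finite-dimensional subspaces\<close>

lemma l2_subspaceD:
  assumes "l2_subspace M S"
  shows "S \<subseteq> L2 M" "(\<lambda>x. 0) \<in> S" "f \<in> S \<Longrightarrow> g \<in> S \<Longrightarrow> (\<lambda>x. f x + g x) \<in> S"
    "f \<in> S \<Longrightarrow> (\<lambda>x. c *\<^sub>R f x) \<in> S" "f \<in> S \<Longrightarrow> g \<in> L2 M \<Longrightarrow> ae_eq M f g \<Longrightarrow> g \<in> S"
  using assms unfolding l2_subspace_def by auto

lemma l2_subspace_diff:
  assumes "l2_subspace M S" "f \<in> S" "g \<in> S"
  shows "f - g \<in> S"
  using l2_subspaceD(3)[OF assms(1,2) l2_subspaceD(4)[OF assms(1,3), of "-1"]] by (simp add: fun_diff_def)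

lemma l2_subspace_sum:
  assumes S: "l2_subspace M S" and B: "B \<subseteq> S"
  shows "(\<lambda>x. \<Sum>b\<in>B. c b *\<^sub>R b x) \<in> S"
  using B by (induction B rule: infinite_finite_induct) (auto intro: l2_subspaceD(2-4)[OF S])

lemma l2_subspace_complement:
  assumes S: "l2_subspace M S" and T: "T \<subseteq> L2 M"
  shows "l2_subspace M (l2_complement M S T)"
  unfolding l2_subspace_def
proof (intro conjI ballI allI impI)
  note SL = l2_subspaceD(1)[OF S]
  show "l2_complement M S T \<subseteq> L2 M" using SL by (auto simp: l2_complement_def)
  show "(\<lambda>x. 0) \<in> l2_complement M S T" using l2_subspaceD(2)[OF S] by (simp add: l2_complement_def)
  fix f g assume f: "f \<in> l2_complement M S T"
  show "(\<lambda>x. c *\<^sub>R f x) \<in> l2_complement M S T" for c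
    using f l2_subspaceD(4)[OF S] by (auto simp: l2_complement_def l2_inner_scale_left)
  {
    assume g: "g \<in> l2_complement M S T"
    show "(\<lambda>x. f x + g x) \<in> l2_complement M S T"
      using f g l2_subspaceD(3)[OF S] SL T
      by (auto simp: l2_complement_def l2_inner_add_left subset_iff)
  next
    assume g: "g \<in> L2 M" "ae_eq M f g"
    have fS: "f \<in> S" using f by (simp add: l2_complement_def)
    have "l2_inner M g t = l2_inner M f t" if "t \<in> T" for t
      using g fS SL T that by (intro l2_inner_cong ae_eq_sym[OF g(2)] ae_eq_refl) auto
    then show "g \<in> l2_complement M S T"
      using f g l2_subspaceD(5)[OF S fS g] by (simp add: l2_complement_def)
  }
qed

text \<open>A spanning set of \<open>V\<close> need not lie in \<open>W\<close>, so a new one is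
  built by induction on its size: the members of \<open>W\<close> that do without the vector
  \<open>b0\<close> form a subspace covered by the induction hypothesis, and at most one further
  generator is missing.\<close>

lemma finite_dim_l2_subspace_subspace:
  assumes V: "finite_dim_l2_subspace M V" and W: "l2_subspace M W" "W \<subseteq> V"
  shows "finite_dim_l2_subspace M W"
proof -
  have *: "\<exists>B'. finite B' \<and> B' \<subseteq> W \<and> (\<forall>f\<in>W. \<exists>c. ae_eq M f (\<lambda>x. \<Sum>b\<in>B'. c b *\<^sub>R b x))"
    if "finite B" "B \<subseteq> L2 M" "l2_subspace M W" "\<forall>f\<in>W. \<exists>c. ae_eq M f (\<lambda>x. \<Sum>b\<in>B. c b *\<^sub>R b x)" for B W
    using that
  proof (induction B arbitrary: W rule: finite_induct)
    case empty
    then show ?case by (intro exI[of _ "{}"]) simp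
  next
    case (insert b0 B)
    note W = insert.prems(2)
    \<comment> \<open>The kernel, within \<open>W\<close>, of the coefficient of \<open>b0\<close>;
      phrased by existence because coefficients need not be unique.\<close>
    define W0 where "W0 = {f \<in> W. \<exists>c. ae_eq M f (\<lambda>x. \<Sum>b\<in>B. c b *\<^sub>R b x)}"
    have W0: "l2_subspace M W0"
      unfolding l2_subspace_def
    proof (intro conjI ballI allI impI)
      show "W0 \<subseteq> L2 M" using l2_subspaceD(1)[OF W] by (auto simp: W0_def)
      show "(\<lambda>x. 0) \<in> W0" using l2_subspaceD(2)[OF W] by (auto simp: W0_def intro!: exI[of _ "\<lambda>_. 0"])
      fix f assume f: "f \<in> W0"
      then obtain c where fW: "f \<in> W" and c: "ae_eq M f (\<lambda>x. \<Sum>b\<in>B. c b *\<^sub>R b x)" by (auto simp: W0_def)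
      show "(\<lambda>x. r *\<^sub>R f x) \<in> W0" for r
      proof -
        have "ae_eq M (\<lambda>x. r *\<^sub>R f x) (\<lambda>x. \<Sum>b\<in>B. (r * c b) *\<^sub>R b x)"
          using ae_eq_scale[OF c, of r] by (simp add: scaleR_sum_right)
        then show ?thesis using l2_subspaceD(4)[OF W fW] by (auto simp: W0_def)
      qed
      fix g
      {
        assume "g \<in> W0"
        then obtain d where gW: "g \<in> W" and d: "ae_eq M g (\<lambda>x. \<Sum>b\<in>B. d b *\<^sub>R b x)" by (auto simp: W0_def)
        have "ae_eq M (\<lambda>x. f x + g x) (\<lambda>x. \<Sum>b\<in>B. (c b + d b) *\<^sub>R b x)"
          using ae_eq_add[OF c d] by (simp add: scaleR_left_distrib sum.distrib)
        then show "(\<lambda>x. f x + g x) \<in> W0" using l2_subspaceD(3)[OF W fW gW] by (auto simp: W0_def)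
      next
        assume g: "g \<in> L2 M" "ae_eq M f g"
        then have "ae_eq M g (\<lambda>x. \<Sum>b\<in>B. c b *\<^sub>R b x)" using c ae_eq_sym ae_eq_trans by blast
        then show "g \<in> W0" using l2_subspaceD(5)[OF W fW g] by (auto simp: W0_def)
      }
    qed
    obtain B0 where B0: "finite B0" "B0 \<subseteq> W0" "\<forall>f\<in>W0. \<exists>c. ae_eq M f (\<lambda>x. \<Sum>b\<in>B0. c b *\<^sub>R b x)"
      using insert.IH[OF _ W0] insert.prems(1) by (auto simp: W0_def)
    show ?case
    proof (cases "W = W0")
      case True
      then show ?thesis using B0 by blast
    next
      case False
      then obtain w where w: "w \<in> W" "w \<notin> W0" by (auto simp: W0_def)
      then obtain cw where cw: "ae_eq M w (\<lambda>x. \<Sum>b\<in>insert b0 B. cw b *\<^sub>R b x)" using insert.prems(3) by blast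
      then have cw': "ae_eq M w (\<lambda>x. cw b0 *\<^sub>R b0 x + (\<Sum>b\<in>B. cw b *\<^sub>R b x))" using insert.hyps by simp
      have nz: "cw b0 \<noteq> 0" using cw' w by (auto simp: W0_def)
      have wB0: "w \<notin> B0" using w B0(2) by blast
      have "\<exists>c. ae_eq M f (\<lambda>x. \<Sum>b\<in>insert w B0. c b *\<^sub>R b x)" if f: "f \<in> W" for f
      proof -
        obtain c where "ae_eq M f (\<lambda>x. \<Sum>b\<in>insert b0 B. c b *\<^sub>R b x)" using insert.prems(3) f by blast
        then have c: "ae_eq M f (\<lambda>x. c b0 *\<^sub>R b0 x + (\<Sum>b\<in>B. c b *\<^sub>R b x))" using insert.hyps by simp
        \<comment> \<open>Subtracting this multiple of \<open>w\<close> cancels the coefficient of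
          \<open>b0\<close>.\<close>
        define t where "t = c b0 / cw b0"
        define f0 where "f0 = (\<lambda>x. f x + (- t) *\<^sub>R w x)"
        have f0W: "f0 \<in> W" unfolding f0_def by (intro l2_subspaceD(3,4)[OF W] f w)
        have "ae_eq M f0 (\<lambda>x. (c b0 *\<^sub>R b0 x + (\<Sum>b\<in>B. c b *\<^sub>R b x)) + (- t) *\<^sub>R (cw b0 *\<^sub>R b0 x + (\<Sum>b\<in>B. cw b *\<^sub>R b x)))"
          unfolding f0_def by (intro ae_eq_add ae_eq_scale c cw')
        also have "(\<lambda>x. (c b0 *\<^sub>R b0 x + (\<Sum>b\<in>B. c b *\<^sub>R b x)) + (- t) *\<^sub>R (cw b0 *\<^sub>R b0 x + (\<Sum>b\<in>B. cw b *\<^sub>R b x)))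
          = (\<lambda>x. \<Sum>b\<in>B. (c b - t * cw b) *\<^sub>R b x)"
          using nz by (auto simp: t_def scaleR_add_right scaleR_sum_right scaleR_diff_left sum_subtractf sum_negf)
        finally have "f0 \<in> W0" using f0W by (auto simp: W0_def)
        then obtain c0 where c0: "ae_eq M f0 (\<lambda>x. \<Sum>b\<in>B0. c0 b *\<^sub>R b x)" using B0(3) by blast
        have "ae_eq M (\<lambda>x. t *\<^sub>R w x + f0 x) (\<lambda>x. t *\<^sub>R w x + (\<Sum>b\<in>B0. c0 b *\<^sub>R b x))"
          by (intro ae_eq_add c0 ae_eq_refl)
        moreover have "(\<lambda>x. t *\<^sub>R w x + f0 x) = f" by (auto simp: f0_def)
        moreover have "(\<lambda>x. t *\<^sub>R w x + (\<Sum>b\<in>B0. c0 b *\<^sub>R b x)) = (\<lambda>x. \<Sum>b\<in>insert w B0. (c0(w := t)) b *\<^sub>R b x)"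
        proof
          fix x
          have "(\<Sum>b\<in>B0. (c0(w := t)) b *\<^sub>R b x) = (\<Sum>b\<in>B0. c0 b *\<^sub>R b x)" using wB0 by (intro sum.cong) auto
          then show "t *\<^sub>R w x + (\<Sum>b\<in>B0. c0 b *\<^sub>R b x) = (\<Sum>b\<in>insert w B0. (c0(w := t)) b *\<^sub>R b x)"
            using wB0 B0(1) by simp
        qed
        ultimately show ?thesis by metis
      qed
      then show ?thesis using B0 w by (intro exI[of _ "insert w B0"]) (auto simp: W0_def)
    qed
  qed
  obtain B where B: "finite B" "B \<subseteq> V" "\<forall>f\<in>V. \<exists>c. ae_eq M f (\<lambda>x. \<Sum>b\<in>B. c b *\<^sub>R b x)"
    using V unfolding finite_dim_l2_subspace_def by blast
  have "B \<subseteq> L2 M" using B(2) V l2_subspaceD(1) unfolding finite_dim_l2_subspace_def by blast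
  then have "\<exists>B'. finite B' \<and> B' \<subseteq> W \<and> (\<forall>f\<in>W. \<exists>c. ae_eq M f (\<lambda>x. \<Sum>b\<in>B'. c b *\<^sub>R b x))"
    using *[OF B(1) _ W(1)] B(3) W(2) by blast
  then show ?thesis using W(1) unfolding finite_dim_l2_subspace_def by blast
qed

section \<open>Riesz representation on a finite-dimensional subspace\<close>

text \<open>Linearity on functions, with exact equality of values. That a functional vanishes on
  null functions is a separate hypothesis wherever it enters.\<close>

definition l2_linear_on :: "('a \<Rightarrow> 'b::euclidean_space) set \<Rightarrow> (('a \<Rightarrow> 'b) \<Rightarrow> real) \<Rightarrow> bool" where
  "l2_linear_on S L \<longleftrightarrow> (\<forall>f\<in>S. \<forall>g\<in>S. L (\<lambda>x. f x + g x) = L f + L g) \<and> (\<forall>c. \<forall>f\<in>S. L (\<lambda>x. c *\<^sub>R f x) = c * L f)"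

lemma l2_linear_on_lincomb:
  assumes "l2_linear_on S L" "l2_subspace M S" "f \<in> S" "g \<in> S"
  shows "L (\<lambda>x. f x + c *\<^sub>R g x) = L f + c * L g"
  using assms l2_subspaceD(4)[OF assms(2,4), of c] unfolding l2_linear_on_def by metis

text \<open>Gram-Schmidt in disguise. The second conjunct says that the solution lies in the span
  of \<open>B\<close>.\<close>

lemma riesz_on_finite_set:
  assumes S: "l2_subspace M S" and b_lin: "\<And>g. g \<in> S \<Longrightarrow> l2_linear_on S (\<lambda>f. b f g)"
    and b_sym: "\<And>f g. f \<in> S \<Longrightarrow> g \<in> S \<Longrightarrow> b f g = b g f" and b_pos: "\<And>f. f \<in> S \<Longrightarrow> 0 \<le> b f f"
    and B: "finite B" "B \<subseteq> S"
    and l: "l2_linear_on S l" "\<And>f. f \<in> S \<Longrightarrow> b f f = 0 \<Longrightarrow> l f = 0"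
  shows "\<exists>x\<in>S. (\<forall>f\<in>B. b x f = l f) \<and> (\<forall>L. l2_linear_on S L \<longrightarrow> (\<forall>f\<in>B. L f = 0) \<longrightarrow> L x = 0)"
  using B l
proof (induction B arbitrary: l rule: finite_induct)
  case empty
  have "L (\<lambda>x. 0) = 0" if "l2_linear_on S L" for L
    using l2_linear_on_lincomb[OF that S l2_subspaceD(2)[OF S] l2_subspaceD(2)[OF S], of "-1"] by simp
  then show ?case using l2_subspaceD(2)[OF S] by blast
next
  case (insert f0 B)
  have f0: "f0 \<in> S" and BS: "B \<subseteq> S" using insert.prems by auto
  have lin: "l2_linear_on S (\<lambda>f. b f g)" "l2_linear_on S (\<lambda>f. b g f)" if "g \<in> S" for g
  proof -
    show l: "l2_linear_on S (\<lambda>f. b f g)" by (rule b_lin[OF that])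
    show "l2_linear_on S (\<lambda>f. b g f)"
      unfolding l2_linear_on_def
    proof (intro conjI ballI allI)
      fix f f' assume f: "f \<in> S" "f' \<in> S"
      show "b g (\<lambda>x. f x + f' x) = b g f + b g f'"
        unfolding b_sym[OF that l2_subspaceD(3)[OF S f]] b_sym[OF that f(1)] b_sym[OF that f(2)]
        using l f unfolding l2_linear_on_def by simp
    next
      fix c f assume f: "f \<in> S"
      show "b g (\<lambda>x. c *\<^sub>R f x) = c * b g f"
        unfolding b_sym[OF that l2_subspaceD(4)[OF S f]] b_sym[OF that f]
        using l f unfolding l2_linear_on_def by simp
    qed
  qed
  \<comment> \<open>Cauchy-Schwarz for a semidefinite form: a null vector is orthogonal to
    everything. Hence \<open>b f0\<close> satisfies the compatibility condition of the induction
    hypothesis.\<close>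
  have null: "b f g = 0" if "f \<in> S" "g \<in> S" "b f f = 0" for f g
  proof -
    have "0 \<le> b g g - 2 * t * b f g + t\<^sup>2 * b f f" for t
    proof -
      have m: "(\<lambda>x. g x + (-t) *\<^sub>R f x) \<in> S" using that by (intro l2_subspaceD(3,4)[OF S])
      have "0 \<le> b (\<lambda>x. g x + (-t) *\<^sub>R f x) (\<lambda>x. g x + (-t) *\<^sub>R f x)" by (rule b_pos[OF m])
      also have "\<dots> = b g (\<lambda>x. g x + (-t) *\<^sub>R f x) + (-t) * b f (\<lambda>x. g x + (-t) *\<^sub>R f x)"
        by (rule l2_linear_on_lincomb[OF lin(1)[OF m] S that(2,1)])
      also have "b g (\<lambda>x. g x + (-t) *\<^sub>R f x) = b g g + (-t) * b g f"
        by (rule l2_linear_on_lincomb[OF lin(2)[OF that(2)] S that(2,1)])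
      also have "b f (\<lambda>x. g x + (-t) *\<^sub>R f x) = b f g + (-t) * b f f"
        by (rule l2_linear_on_lincomb[OF lin(2)[OF that(1)] S that(2,1)])
      finally show ?thesis using b_sym[OF that(1,2)] by (simp add: algebra_simps power2_eq_square)
    qed
    then have "(b f g)\<^sup>2 \<le> b g g * b f f" by (rule nonneg_quadratic_discriminant)
    then show ?thesis using that by simp
  qed
  \<comment> \<open>The \<open>b\<close>-orthogonal projection of \<open>f0\<close> to the span of
    \<open>B\<close>, obtained as the representer of the functional \<open>b f0\<close>.\<close>
  obtain p where p: "p \<in> S" "\<forall>f\<in>B. b p f = b f0 f" "\<And>L. l2_linear_on S L \<Longrightarrow> \<forall>f\<in>B. L f = 0 \<Longrightarrow> L p = 0"
    using insert.IH[OF BS lin(2)[OF f0]] null f0 b_sym by metis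
  obtain x1 where x1: "x1 \<in> S" "\<forall>f\<in>B. b x1 f = l f" "\<And>L. l2_linear_on S L \<Longrightarrow> \<forall>f\<in>B. L f = 0 \<Longrightarrow> L x1 = 0"
    using insert.IH[OF BS insert.prems(2,3)] by blast
  define r where "r = (\<lambda>x. f0 x + (-1) *\<^sub>R p x)"
  have r: "r \<in> S" unfolding r_def by (intro l2_subspaceD(3,4)[OF S] f0 p)
  have Lr: "L r = L f0 - L p" if "l2_linear_on S L" for L
    unfolding r_def using l2_linear_on_lincomb[OF that S f0 p(1), of "-1"] by simp
  have rB: "\<forall>f\<in>B. b r f = 0"
  proof
    fix f assume f: "f \<in> B"
    then have "b r f = b f0 f - b p f" using Lr[OF lin(1)] BS by blast
    then show "b r f = 0" using p(2) f by simp
  qed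
  have rp: "b r p = 0" using p(3)[OF lin(2)[OF r] rB] .
  have rx1: "b r x1 = 0" using x1(3)[OF lin(2)[OF r] rB] .
  have rr: "b r r = b r f0" using Lr[OF lin(2)[OF r]] rp by simp
  show ?case
  proof (cases "b r r = 0")
    \<comment> \<open>The residual is null, so \<open>f0\<close> behaves like \<open>p\<close> for
      \<open>l\<close> and for \<open>b x1\<close>. The functional \<open>b x1 - l\<close> vanishes
      on \<open>B\<close>, hence at \<open>p\<close>, so \<open>x1\<close> already represents
      \<open>l\<close> at \<open>f0\<close>.\<close>
    case True
    have "l r = 0" using insert.prems(3)[OF r True] .
    then have lf0: "l f0 = l p" using Lr[OF insert.prems(2)] by simp
    have "b x1 r = 0" using rx1 b_sym[OF r x1(1)] by simp
    then have bx: "b x1 f0 = b x1 p" using Lr[OF lin(2)[OF x1(1)]] by simp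
    have "l2_linear_on S (\<lambda>f. b x1 f - l f)"
      using lin(2)[OF x1(1)] insert.prems(2) unfolding l2_linear_on_def by (simp add: algebra_simps)
    then have "b x1 p - l p = 0" using p(3)[of "\<lambda>f. b x1 f - l f"] x1(2) by simp
    then show ?thesis using x1 lf0 bx by (intro bexI[of _ x1]) auto
  next
    case False
    \<comment> \<open>Corrects the value at \<open>f0\<close>; the values on \<open>B\<close> stay
      because \<open>r\<close> is orthogonal to \<open>B\<close>, and
      \<open>b r f0 = b r r\<close>.\<close>
    define t where "t = (l f0 - b x1 f0) / b r r"
    define x where "x = (\<lambda>y. x1 y + t *\<^sub>R r y)"
    have x: "x \<in> S" unfolding x_def by (intro l2_subspaceD(3,4)[OF S] x1 r)
    have Lx: "L x = L x1 + t * L r" if "l2_linear_on S L" for L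
      unfolding x_def by (rule l2_linear_on_lincomb[OF that S x1(1) r])
    show ?thesis
    proof (intro bexI[of _ x] conjI ballI allI impI x)
      fix f assume f: "f \<in> insert f0 B"
      then have fS: "f \<in> S" using f0 BS by auto
      have bx: "b x f = b x1 f + t * b r f" by (rule Lx[OF lin(1)[OF fS]])
      show "b x f = l f"
      proof (cases "f = f0")
        case True
        then show ?thesis using bx rr False by (simp add: t_def)
      next
        case False
        then show ?thesis using bx f x1(2) rB by simp
      qed
    next
      fix L assume L: "l2_linear_on S L" "\<forall>f\<in>insert f0 B. L f = 0"
      then have "L x1 = 0" "L p = 0" using x1(3) p(3) by auto
      then show "L x = 0" using Lx[OF L(1)] Lr[OF L(1)] L(2) by simp
    qed
  qed
qed

lemma l2_linear_on_sum:
  assumes S: "l2_subspace M S" and L: "l2_linear_on S L" and B: "B \<subseteq> S" "\<forall>b\<in>B. L b = 0"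
  shows "L (\<lambda>x. \<Sum>b\<in>B. c b *\<^sub>R b x) = 0"
  using B
proof (induction B rule: infinite_finite_induct)
  case (insert b B)
  have "L (\<lambda>x. c b *\<^sub>R b x + (\<Sum>b\<in>B. c b *\<^sub>R b x)) = L (\<lambda>x. c b *\<^sub>R b x) + L (\<lambda>x. \<Sum>b\<in>B. c b *\<^sub>R b x)"
    using L insert.prems l2_subspaceD(4)[OF S] l2_subspace_sum[OF S] unfolding l2_linear_on_def by auto
  moreover have "L (\<lambda>x. c b *\<^sub>R b x) = c b * L b" using L insert.prems unfolding l2_linear_on_def by auto
  ultimately show ?case using insert by simp
qed (use l2_linear_on_lincomb[OF L S l2_subspaceD(2)[OF S] l2_subspaceD(2)[OF S], of "-1"] in auto)

text \<open>A member of \<open>S\<close> equals a combination of the spanning set only up to a null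
  function. Both \<open>l\<close> and the form vanish on that remainder, so the identity extends
  from the spanning set to \<open>S\<close>.\<close>

lemma finite_dim_riesz:
  assumes S: "finite_dim_l2_subspace M S" and b_lin: "\<And>g. g \<in> S \<Longrightarrow> l2_linear_on S (\<lambda>f. b f g)"
    and b_sym: "\<And>f g. f \<in> S \<Longrightarrow> g \<in> S \<Longrightarrow> b f g = b g f" and b_pos: "\<And>f. f \<in> S \<Longrightarrow> 0 \<le> b f f"
    and l: "l2_linear_on S l" and b_def: "\<And>f. f \<in> S \<Longrightarrow> b f f = 0 \<Longrightarrow> ae_eq M f (\<lambda>x. 0)"
    and l_ae: "\<And>f. f \<in> S \<Longrightarrow> ae_eq M f (\<lambda>x. 0) \<Longrightarrow> l f = 0"
    and b_ae: "\<And>f g. f \<in> S \<Longrightarrow> g \<in> S \<Longrightarrow> ae_eq M f (\<lambda>x. 0) \<Longrightarrow> b f g = 0"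
  shows "\<exists>x\<in>S. \<forall>f\<in>S. b x f = l f"
proof -
  obtain B where sub: "l2_subspace M S" and B: "finite B" "B \<subseteq> S" "\<forall>f\<in>S. \<exists>c. ae_eq M f (\<lambda>x. \<Sum>b\<in>B. c b *\<^sub>R b x)"
    using S unfolding finite_dim_l2_subspace_def by blast
  have "\<exists>x\<in>S. (\<forall>f\<in>B. b x f = l f) \<and> (\<forall>L. l2_linear_on S L \<longrightarrow> (\<forall>f\<in>B. L f = 0) \<longrightarrow> L x = 0)"
    by (rule riesz_on_finite_set[OF sub b_lin b_sym b_pos B(1,2) l]) (auto intro: l_ae b_def)
  then obtain x where x: "x \<in> S" "\<forall>f\<in>B. b x f = l f" by blast
  define L where "L f = b f x - l f" for f
  have L: "l2_linear_on S L"
    using b_lin[OF x(1)] l unfolding l2_linear_on_def L_def by (simp add: algebra_simps)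
  have LB: "\<forall>f\<in>B. L f = 0" using x b_sym[OF _ x(1)] B(2) by (auto simp: L_def subset_iff)
  have "L f = 0" if f: "f \<in> S" for f
  proof -
    obtain c where c: "ae_eq M f (\<lambda>x. \<Sum>b\<in>B. c b *\<^sub>R b x)" using B(3) f by blast
    define s where "s = (\<lambda>x. \<Sum>b\<in>B. c b *\<^sub>R b x)"
    have sS: "s \<in> S" unfolding s_def by (rule l2_subspace_sum[OF sub B(2)])
    have Ls: "L s = 0" unfolding s_def by (rule l2_linear_on_sum[OF sub L B(2) LB])
    define d where "d = (\<lambda>x. f x + (-1) *\<^sub>R s x)"
    have dS: "d \<in> S" unfolding d_def by (intro l2_subspaceD(3,4)[OF sub] f sS)
    have "ae_eq M d (\<lambda>x. 0)" using c unfolding ae_eq_def d_def s_def by eventually_elim simp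
    then have "L d = 0" using l_ae[OF dS] b_ae[OF dS x(1)] by (simp add: L_def)
    then show ?thesis using l2_linear_on_lincomb[OF L sub f sS, of "-1"] Ls by (simp add: d_def)
  qed
  then show ?thesis using x(1) b_sym by (intro bexI[of _ x]) (auto simp: L_def)
qed

lemma l2_linear_on_inner:
  assumes "S \<subseteq> L2 M" "g \<in> L2 M"
  shows "l2_linear_on S (\<lambda>f. l2_inner M f g)" "l2_linear_on S (\<lambda>f. l2_inner M g f)"
  using assms unfolding l2_linear_on_def
  by (auto simp: l2_inner_add_left l2_inner_add_right l2_inner_scale_left l2_inner_scale_right subset_iff)

text \<open>Existence is \<open>finite_dim_riesz\<close> for the inner product itself; it entitles
  the choice in \<open>l2_proj\<close> to its defining property.\<close>

lemma l2_proj: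
  assumes S: "finite_dim_l2_subspace M S" and f: "f \<in> L2 M"
  shows "l2_proj M S f \<in> S" "\<And>s. s \<in> S \<Longrightarrow> l2_inner M (f - l2_proj M S f) s = 0"
proof -
  have sub: "l2_subspace M S" using S by (simp add: finite_dim_l2_subspace_def)
  note SL = l2_subspaceD(1)[OF sub]
  have "\<exists>p\<in>S. \<forall>s\<in>S. l2_inner M p s = l2_inner M f s"
  proof (rule finite_dim_riesz[OF S])
    show "ae_eq M g (\<lambda>x. 0)" if "g \<in> S" "l2_inner M g g = 0" for g
      using that SL l2_norm_eq_0_iff[of g M] by (auto simp: l2_inner_self)
    have z: "l2_inner M g h = 0" if "g \<in> L2 M" "h \<in> L2 M" "ae_eq M g (\<lambda>x. 0)" for g h
      using l2_inner_cong[OF that(3) ae_eq_refl that(1) L2_zero that(2,2)] by simp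
    show "l2_inner M f g = 0" if "g \<in> S" "ae_eq M g (\<lambda>x. 0)" for g
      using z[of g f] that SL f by (auto simp: l2_inner_commute)
    show "l2_inner M g h = 0" if "g \<in> S" "h \<in> S" "ae_eq M g (\<lambda>x. 0)" for g h
      using z[of g h] that SL by auto
  qed (use SL f in \<open>auto intro: l2_linear_on_inner l2_inner_commute simp: l2_inner_self\<close>)
  then obtain p where p: "p \<in> S" "\<forall>s\<in>S. l2_inner M p s = l2_inner M f s" by blast
  have "l2_inner M (f - p) s = 0" if "s \<in> S" for s
    using l2_inner_diff_left[OF f, of p s] p that SL by (simp add: subset_iff)
  then have "p \<in> S \<and> (\<forall>s\<in>S. l2_inner M (f - p) s = 0)" using p(1) by blast
  then have P: "l2_proj M S f \<in> S \<and> (\<forall>s\<in>S. l2_inner M (f - l2_proj M S f) s = 0)"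
    unfolding l2_proj_def by (rule someI[of "\<lambda>p. p \<in> S \<and> (\<forall>s\<in>S. l2_inner M (f - p) s = 0)"])
  then show "l2_proj M S f \<in> S" "\<And>s. s \<in> S \<Longrightarrow> l2_inner M (f - l2_proj M S f) s = 0" by auto
qed

section \<open>The projection\<close>

text \<open>The cancelled factor is finite and positive while \<open>Y\<close> and \<open>Z\<close>
  may be infinite.\<close>

lemma ennreal_mult_le_cancel:
  assumes x: "0 < x" and le: "Y * ennreal x \<le> Z * ennreal x"
  shows "Y \<le> Z"
proof -
  have e: "ennreal x * inverse (ennreal x) = 1" using x by (simp add: ennreal_divide_self[unfolded divide_ennreal_def])
  have "Y * ennreal x * inverse (ennreal x) \<le> Z * ennreal x * inverse (ennreal x)" using le by (rule mult_right_mono) simp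
  then show ?thesis using e by (simp add: mult.assoc)
qed

locale hdg = flat_domain K Q for K :: "(real^'n) set" and Q +
  fixes S S' :: "(real^'n \<Rightarrow> real^'n^'n) set" and V V' M :: "(real^'n \<Rightarrow> real^'n) set"
    and \<alpha> :: "(real^'n \<Rightarrow> real^'n) \<Rightarrow> (real^'n \<Rightarrow> real^'n)"
  assumes nonempty_K: "K \<noteq> {}"
    and fin_S: "finite_dim_l2_subspace (vol K) S"
    and S_sub: "S \<subseteq> {\<tau> \<in> Hdiv_sym K. \<exists>g. has_normal_trace K \<tau> g}"
    and fin_V: "finite_dim_l2_subspace (vol K) V" and V_sub: "V \<subseteq> H1_vec K"
    and fin_M: "finite_dim_l2_subspace (surf K) M"
    and M_dec: "M_decomposition K S V M S' V'"
    and stab: "stabilization K \<alpha> (l2_complement (vol K) V V')"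
begin

abbreviation "Sp \<equiv> l2_complement (vol K) S S'"
abbreviation "Vp \<equiv> l2_complement (vol K) V V'"
abbreviation "nt \<equiv> normal_trace K"

section \<open>Fields with a divergence and a normal trace\<close>

text \<open>A linear class that contains both the members of \<open>S\<close> and all of
  \<open>H1_sym K\<close>, so that differences such as \<open>\<sigma> - \<eta>\<close> can be
  handled by the same rules.\<close>

definition good :: "(real^'n \<Rightarrow> real^'n^'n) \<Rightarrow> bool" where
  "good \<tau> \<longleftrightarrow> \<tau> \<in> Hdiv_sym K \<and> (\<exists>g. has_normal_trace K \<tau> g)"

lemma good_S: "\<tau> \<in> S \<Longrightarrow> good \<tau>"
  using S_sub by (auto simp: good_def)

lemma good_H1: "\<sigma> \<in> H1_sym K \<Longrightarrow> good \<sigma>"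
  using H1_sym_Hdiv has_normal_trace_H1 by (auto simp: good_def)

lemma good_trace: "good \<tau> \<Longrightarrow> has_normal_trace K \<tau> (nt \<tau>)"
  using normal_trace_ae(1) by (auto simp: good_def)

lemma good_L2: "good \<tau> \<Longrightarrow> \<tau> \<in> L2 (vol K)"
  and good_sym: "good \<tau> \<Longrightarrow> AE x in vol K. transpose (\<tau> x) = \<tau> x"
  by (auto simp: good_def Hdiv_sym_def)

lemma nt_L2: "good \<tau> \<Longrightarrow> nt \<tau> \<in> L2 (surf K)"
  using good_trace by (simp add: has_normal_trace_def)

lemma good_div: "good \<tau> \<Longrightarrow> has_weak_div K \<tau> (weak_div K \<tau>)"
  using has_weak_div_weak_div by (auto simp: good_def Hdiv_sym_def)

lemma div_L2: "good \<tau> \<Longrightarrow> weak_div K \<tau> \<in> L2 (vol K)"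
  using good_div has_weak_div_L2 by blast

lemma good_lincomb:
  assumes \<tau>: "good \<tau>" and \<sigma>: "good \<sigma>"
  shows "good (\<lambda>x. a *\<^sub>R \<tau> x + b *\<^sub>R \<sigma> x)"
    and "ae_eq (surf K) (nt (\<lambda>x. a *\<^sub>R \<tau> x + b *\<^sub>R \<sigma> x)) (\<lambda>x. a *\<^sub>R nt \<tau> x + b *\<^sub>R nt \<sigma> x)"
    and "ae_eq (vol K) (weak_div K (\<lambda>x. a *\<^sub>R \<tau> x + b *\<^sub>R \<sigma> x)) (\<lambda>x. a *\<^sub>R weak_div K \<tau> x + b *\<^sub>R weak_div K \<sigma> x)"
proof -
  have H: "\<tau> \<in> Hdiv_sym K" "\<sigma> \<in> Hdiv_sym K" using \<tau> \<sigma> by (auto simp: good_def)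
  note d = has_weak_div_lincomb[OF good_L2[OF \<tau>] good_div[OF \<tau>] good_L2[OF \<sigma>] good_div[OF \<sigma>], of a b]
  note n = has_normal_trace_lincomb[OF H(1) good_trace[OF \<tau>] H(2) good_trace[OF \<sigma>], of a b]
  have "AE x in vol K. transpose (a *\<^sub>R \<tau> x + b *\<^sub>R \<sigma> x) = a *\<^sub>R \<tau> x + b *\<^sub>R \<sigma> x"
    using good_sym[OF \<tau>] good_sym[OF \<sigma>]
  proof eventually_elim
    case (elim x)
    have "transpose (a *\<^sub>R \<tau> x + b *\<^sub>R \<sigma> x) = a *\<^sub>R transpose (\<tau> x) + b *\<^sub>R transpose (\<sigma> x)"
      by (simp add: transpose_def vec_eq_iff)
    then show ?case using elim by simp
  qed
  moreover have "(\<lambda>x. a *\<^sub>R \<tau> x + b *\<^sub>R \<sigma> x) \<in> L2 (vol K)" by (intro L2_add L2_scale good_L2 \<tau> \<sigma>)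
  ultimately show "good (\<lambda>x. a *\<^sub>R \<tau> x + b *\<^sub>R \<sigma> x)"
    unfolding good_def Hdiv_sym_def using d n by blast
  show "ae_eq (surf K) (nt (\<lambda>x. a *\<^sub>R \<tau> x + b *\<^sub>R \<sigma> x)) (\<lambda>x. a *\<^sub>R nt \<tau> x + b *\<^sub>R nt \<sigma> x)"
    by (rule normal_trace_ae(2)[OF n])
  show "ae_eq (vol K) (weak_div K (\<lambda>x. a *\<^sub>R \<tau> x + b *\<^sub>R \<sigma> x)) (\<lambda>x. a *\<^sub>R weak_div K \<tau> x + b *\<^sub>R weak_div K \<sigma> x)"
    by (rule weak_div_ae[OF d])
qed

lemma good_diff:
  assumes "good \<tau>" "good \<sigma>"
  shows "good (\<tau> - \<sigma>)" "ae_eq (surf K) (nt (\<tau> - \<sigma>)) (nt \<tau> - nt \<sigma>)"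
    "ae_eq (vol K) (weak_div K (\<tau> - \<sigma>)) (weak_div K \<tau> - weak_div K \<sigma>)"
  using good_lincomb[OF assms, of 1 "-1"] by (simp_all add: fun_diff_def)

lemma green:
  assumes "good \<tau>" "v \<in> H1_vec K"
  shows "l2_inner (surf K) (nt \<tau>) (bd K v) = l2_inner (vol K) (weak_div K \<tau>) v + l2_inner (vol K) \<tau> (sym_grad K v)"
  using good_trace[OF assms(1)] assms(2) inner_sym_grad(2)[OF good_L2[OF assms(1)] good_sym[OF assms(1)] assms(2)]
  by (simp add: has_normal_trace_def)

lemma sub_S: "l2_subspace (vol K) S" and sub_V: "l2_subspace (vol K) V" and sub_M: "l2_subspace (surf K) M"
  using fin_S fin_V fin_M by (simp_all add: finite_dim_l2_subspace_def)

lemma sub_S': "l2_subspace (vol K) S'" and S'_S: "S' \<subseteq> S"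
  and sub_V': "l2_subspace (vol K) V'" and V'_V: "V' \<subseteq> V"
  and sym_grad_S': "v \<in> V \<Longrightarrow> sym_grad K v \<in> S'" and div_V': "\<tau> \<in> S \<Longrightarrow> weak_div K \<tau> \<in> V'"
  and tr_M: "\<tau> \<in> S \<Longrightarrow> v \<in> V \<Longrightarrow> tr K \<tau> v \<in> M"
  using M_dec unfolding M_decomposition_def by blast+

lemma tr_inj: "\<tau> \<in> Sp \<Longrightarrow> v \<in> Vp \<Longrightarrow> \<tau>' \<in> Sp \<Longrightarrow> v' \<in> Vp \<Longrightarrow> ae_eq (surf K) (tr K \<tau> v) (tr K \<tau>' v')
     \<Longrightarrow> ae_eq (vol K) \<tau> \<tau>' \<and> ae_eq (vol K) v v'"
  and tr_surj: "\<mu> \<in> M \<Longrightarrow> \<exists>\<tau>\<in>Sp. \<exists>v\<in>Vp. ae_eq (surf K) (tr K \<tau> v) \<mu>"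
  using M_dec unfolding M_decomposition_def Let_def by blast+

lemma fin_S': "finite_dim_l2_subspace (vol K) S'" and fin_V': "finite_dim_l2_subspace (vol K) V'"
  using finite_dim_l2_subspace_subspace[OF fin_S sub_S' S'_S] finite_dim_l2_subspace_subspace[OF fin_V sub_V' V'_V] by blast+

lemma Sp_S: "Sp \<subseteq> S" and Vp_V: "Vp \<subseteq> V"
  by (auto simp: l2_complement_def)

lemma sub_Sp: "l2_subspace (vol K) Sp" and sub_Vp: "l2_subspace (vol K) Vp"
  using l2_subspace_complement[OF sub_S l2_subspaceD(1)[OF sub_S']] l2_subspace_complement[OF sub_V l2_subspaceD(1)[OF sub_V']] by blast+

lemma fin_Sp: "finite_dim_l2_subspace (vol K) Sp" and fin_Vp: "finite_dim_l2_subspace (vol K) Vp"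
  using finite_dim_l2_subspace_subspace[OF fin_S sub_Sp Sp_S] finite_dim_l2_subspace_subspace[OF fin_V sub_Vp Vp_V] by blast+

lemma V_L2: "v \<in> V \<Longrightarrow> v \<in> L2 (vol K)" and V_H1: "v \<in> V \<Longrightarrow> v \<in> H1_vec K" and M_L2: "\<mu> \<in> M \<Longrightarrow> \<mu> \<in> L2 (surf K)"
  using l2_subspaceD(1)[OF sub_V] V_sub l2_subspaceD(1)[OF sub_M] by auto

lemma bdV_L2: "v \<in> V \<Longrightarrow> bd K v \<in> L2 (surf K)"
  using bd_L2 V_H1 by blast

lemma bd_lincomb:
  assumes "u \<in> H1_vec K" "v \<in> H1_vec K"
  shows "ae_eq (surf K) (bd K (\<lambda>x. u x + v x)) (\<lambda>x. bd K u x + bd K v x)"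
    "ae_eq (surf K) (bd K (\<lambda>x. c *\<^sub>R u x)) (\<lambda>x. c *\<^sub>R bd K u x)"
    "u - v \<in> H1_vec K" "ae_eq (surf K) (bd K (u - v)) (bd K u - bd K v)"
  using H1_vec_lincomb(2)[OF assms, of 1 1] H1_vec_lincomb(2)[OF assms, of c 0] H1_vec_lincomb[OF assms, of 1 "-1"]
  by (simp_all add: fun_diff_def)

lemma nt_lincomb:
  assumes "good \<tau>" "good \<sigma>"
  shows "ae_eq (surf K) (nt (\<lambda>x. \<tau> x + \<sigma> x)) (\<lambda>x. nt \<tau> x + nt \<sigma> x)"
    "ae_eq (surf K) (nt (\<lambda>x. c *\<^sub>R \<tau> x)) (\<lambda>x. c *\<^sub>R nt \<tau> x)"
  using good_lincomb(2)[OF assms, of 1 1] good_lincomb(2)[OF assms, of c 0] by simp_all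

lemma zero_S: "(\<lambda>x. 0) \<in> S" and zero_V: "(\<lambda>x. 0) \<in> V" and zero_Sp: "(\<lambda>x. 0) \<in> Sp" and zero_Vp: "(\<lambda>x. 0) \<in> Vp"
  using l2_subspaceD(2) sub_S sub_V sub_Sp sub_Vp by blast+

lemma bd_zero: "ae_eq (surf K) (bd K (\<lambda>x. 0)) (\<lambda>x. 0)"
  using bd_lincomb(2)[OF V_H1[OF zero_V] V_H1[OF zero_V], of 0] by simp

lemma nt_zero: "ae_eq (surf K) (nt (\<lambda>x. 0)) (\<lambda>x. 0)"
  using nt_lincomb(2)[OF good_S[OF zero_S] good_S[OF zero_S], of 0] by simp

lemma bd_null:
  assumes v: "v \<in> V" "ae_eq (vol K) v (\<lambda>x. 0)"
  shows "ae_eq (surf K) (bd K v) (\<lambda>x. 0)"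
  using bd_cong(2)[OF V_H1[OF v(1)] v(2) L2_zero] bd_zero ae_eq_trans by blast

text \<open>\<open>normal_trace\<close> is chosen for each representative separately. For a null
  \<open>\<tau>\<close> the function \<open>nt \<tau>\<close> satisfies Green's formula for the zero
  field too, and uniqueness identifies it with the trace of 0.\<close>

lemma nt_null:
  assumes \<tau>: "\<tau> \<in> S" "ae_eq (vol K) \<tau> (\<lambda>x. 0)"
  shows "ae_eq (surf K) (nt \<tau>) (\<lambda>x. 0)"
proof -
  have "has_normal_trace K (\<lambda>x. 0) (nt \<tau>)"
    unfolding has_normal_trace_def
  proof (intro conjI ballI)
    have g: "good \<tau>" "good (\<lambda>x. 0)" using good_S \<tau>(1) zero_S by blast+
    show "nt \<tau> \<in> L2 (surf K)" by (rule nt_L2[OF g(1)])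
    fix v assume v: "v \<in> H1_vec K"
    have "has_weak_div K (\<lambda>x. 0) (weak_div K \<tau>)"
      unfolding has_weak_div_def
    proof (intro conjI allI impI)
      show "weak_div K \<tau> \<in> L2 (vol K)" by (rule div_L2[OF g(1)])
      fix \<phi> :: "real^'n \<Rightarrow> real" and D\<phi> C i assume \<phi>: "C1_function \<phi> D\<phi>" "compact C" "C \<subseteq> K" "\<forall>x. x \<notin> C \<longrightarrow> \<phi> x = 0"
      have "(\<integral>x. weak_div K \<tau> x $ i * \<phi> x \<partial>vol K) = - (\<integral>x. \<tau> x $ i \<bullet> D\<phi> x \<partial>vol K)"
        using good_div[OF g(1)] \<phi> unfolding has_weak_div_def by blast
      also have "(\<integral>x. \<tau> x $ i \<bullet> D\<phi> x \<partial>vol K) = 0"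
        by (rule integral_eq_zero_AE) (use \<tau>(2) in \<open>auto simp: ae_eq_def elim!: eventually_mono\<close>)
      finally show "(\<integral>x. weak_div K \<tau> x $ i * \<phi> x \<partial>vol K) = - (\<integral>x. (0 :: real^'n^'n) $ i \<bullet> D\<phi> x \<partial>vol K)" by simp
    qed
    then have "ae_eq (vol K) (weak_div K \<tau>) (weak_div K (\<lambda>x. 0))" by (rule ae_eq_sym[OF weak_div_ae])
    then have "l2_inner (vol K) (weak_div K \<tau>) v = l2_inner (vol K) (weak_div K (\<lambda>x. 0)) v"
      by (intro l2_inner_cong ae_eq_refl div_L2 g H1_vec_L2 v)
    moreover have "l2_inner (vol K) \<tau> (grad_vec K v) = l2_inner (vol K) (\<lambda>x. 0) (grad_vec K v)"
      by (intro l2_inner_cong ae_eq_refl \<tau> good_L2 g grad_vec_L2 v)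
    ultimately show "l2_inner (surf K) (nt \<tau>) (bd K v)
      = l2_inner (vol K) (weak_div K (\<lambda>x. 0)) v + l2_inner (vol K) (\<lambda>x. 0) (grad_vec K v)"
      using good_trace[OF g(1)] v by (simp add: has_normal_trace_def)
  qed
  from normal_trace_ae(2)[OF this] have "ae_eq (surf K) (nt \<tau>) (nt (\<lambda>x. 0))" by (rule ae_eq_sym)
  then show ?thesis using nt_zero ae_eq_trans by blast
qed

lemma bd_M: "v \<in> V \<Longrightarrow> bd K v \<in> M"
proof -
  assume v: "v \<in> V"
  have "ae_eq (surf K) (tr K (\<lambda>x. 0) v) (\<lambda>x. 0 + bd K v x)"
    unfolding tr_def by (intro ae_eq_add nt_zero ae_eq_refl)
  then show "bd K v \<in> M" using l2_subspaceD(5)[OF sub_M tr_M[OF zero_S v] bdV_L2[OF v]] by simp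
qed

lemma nt_M: "\<tau> \<in> S \<Longrightarrow> nt \<tau> \<in> M"
proof -
  assume \<tau>: "\<tau> \<in> S"
  have "ae_eq (surf K) (tr K \<tau> (\<lambda>x. 0)) (\<lambda>x. nt \<tau> x + 0)"
    unfolding tr_def by (intro ae_eq_add bd_zero ae_eq_refl)
  then show "nt \<tau> \<in> M" using l2_subspaceD(5)[OF sub_M tr_M[OF \<tau> zero_V] nt_L2[OF good_S[OF \<tau>]]] by simp
qed

text \<open>Injectivity of \<open>tr\<close> on pairs whose displacement entry is 0.\<close>

lemma nt_inj:
  assumes \<tau>: "\<tau> \<in> Sp" "ae_eq (surf K) (nt \<tau>) (\<lambda>x. 0)"
  shows "ae_eq (vol K) \<tau> (\<lambda>x. 0)"
proof -
  have "ae_eq (surf K) (tr K \<tau> (\<lambda>x. 0)) (tr K (\<lambda>x. 0) (\<lambda>x. 0))"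
    unfolding tr_def by (intro ae_eq_add ae_eq_refl ae_eq_trans[OF \<tau>(2) ae_eq_sym[OF nt_zero]])
  then show ?thesis using tr_inj[OF \<tau>(1) zero_Vp zero_Sp zero_Vp] by blast
qed

lemma bd_inj:
  assumes v: "v \<in> Vp" "ae_eq (surf K) (bd K v) (\<lambda>x. 0)"
  shows "ae_eq (vol K) v (\<lambda>x. 0)"
proof -
  have "ae_eq (surf K) (tr K (\<lambda>x. 0) v) (tr K (\<lambda>x. 0) (\<lambda>x. 0))"
    unfolding tr_def by (intro ae_eq_add ae_eq_refl ae_eq_trans[OF v(2) ae_eq_sym[OF bd_zero]])
  then show ?thesis using tr_inj[OF zero_Sp v(1) zero_Sp zero_Vp] by blast
qed

lemma nt_bd_orthogonal:
  assumes \<tau>: "\<tau> \<in> Sp" and v: "v \<in> Vp"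
  shows "l2_inner (surf K) (nt \<tau>) (bd K v) = 0"
proof -
  have S: "\<tau> \<in> S" and V: "v \<in> V" using \<tau> v by (auto simp: l2_complement_def)
  have "l2_inner (vol K) (weak_div K \<tau>) v = 0"
    using v div_V'[OF S] by (auto simp: l2_complement_def l2_inner_commute)
  moreover have "l2_inner (vol K) \<tau> (sym_grad K v) = 0" using \<tau> sym_grad_S'[OF V] by (auto simp: l2_complement_def)
  ultimately show ?thesis using green[OF good_S[OF S] V_H1[OF V]] by simp
qed

section \<open>The stabilization operator on traces\<close>

lemma alpha_L2: "f \<in> L2 (surf K) \<Longrightarrow> \<alpha> f \<in> L2 (surf K)"
  and alpha_cong: "f \<in> L2 (surf K) \<Longrightarrow> g \<in> L2 (surf K) \<Longrightarrow> ae_eq (surf K) f g \<Longrightarrow> ae_eq (surf K) (\<alpha> f) (\<alpha> g)"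
  and alpha_add: "f \<in> L2 (surf K) \<Longrightarrow> g \<in> L2 (surf K) \<Longrightarrow> ae_eq (surf K) (\<alpha> (\<lambda>x. f x + g x)) (\<lambda>x. \<alpha> f x + \<alpha> g x)"
  and alpha_scale: "f \<in> L2 (surf K) \<Longrightarrow> ae_eq (surf K) (\<alpha> (\<lambda>x. c *\<^sub>R f x)) (\<lambda>x. c *\<^sub>R \<alpha> f x)"
  and alpha_sym: "f \<in> L2 (surf K) \<Longrightarrow> g \<in> L2 (surf K) \<Longrightarrow> l2_inner (surf K) (\<alpha> f) g = l2_inner (surf K) (\<alpha> g) f"
  and alpha_pos: "f \<in> L2 (surf K) \<Longrightarrow> 0 \<le> l2_inner (surf K) (\<alpha> f) f"
  and a_pos: "0 < a_const K \<alpha> Vp"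
  using stab unfolding stabilization_def linear_L2_operator_def by blast+

lemma alpha_diff:
  assumes f: "f \<in> L2 (surf K)" and g: "g \<in> L2 (surf K)"
  shows "ae_eq (surf K) (\<alpha> (f - g)) (\<alpha> f - \<alpha> g)"
proof -
  have "ae_eq (surf K) (\<alpha> (\<lambda>x. f x + (-1) *\<^sub>R g x)) (\<lambda>x. \<alpha> f x + \<alpha> (\<lambda>x. (-1) *\<^sub>R g x) x)"
    by (rule alpha_add[OF f L2_scale[OF g]])
  moreover have "ae_eq (surf K) (\<lambda>x. \<alpha> f x + \<alpha> (\<lambda>x. (-1) *\<^sub>R g x) x) (\<lambda>x. \<alpha> f x + (-1) *\<^sub>R \<alpha> g x)"
    by (rule ae_eq_add[OF ae_eq_refl alpha_scale[OF g]])
  ultimately have "ae_eq (surf K) (\<alpha> (\<lambda>x. f x + (-1) *\<^sub>R g x)) (\<lambda>x. \<alpha> f x + (-1) *\<^sub>R \<alpha> g x)" by (rule ae_eq_trans)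
  then show ?thesis by (simp add: fun_diff_def)
qed

lemma alpha_null:
  assumes f: "f \<in> L2 (surf K)" "ae_eq (surf K) f (\<lambda>x. 0)" and g: "g \<in> L2 (surf K)"
  shows "l2_inner (surf K) (\<alpha> f) g = 0"
proof -
  have "l2_inner (surf K) (\<alpha> f) g = l2_inner (surf K) (\<alpha> g) f" by (rule alpha_sym[OF f(1) g])
  also have "\<dots> = l2_inner (surf K) (\<alpha> g) (\<lambda>x. 0)" by (intro l2_inner_cong ae_eq_refl f alpha_L2 g L2_zero)
  finally show ?thesis by simp
qed

text \<open>By injectivity of the trace on \<open>Vp\<close>, a nonzero \<open>v\<close> has a
  nonzero trace, so its quotient is among those over which the infimum is taken.\<close>

lemma a_bound:
  assumes v: "v \<in> Vp" "\<not> ae_eq (vol K) v (\<lambda>x. 0)"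
  shows "a_const K \<alpha> Vp \<le> ennreal (l2_inner (surf K) (\<alpha> (bd K v)) (bd K v) / (l2_norm (surf K) (bd K v))\<^sup>2)"
proof -
  have "v \<in> nonzero (vol K) Vp" using v by (simp add: nonzero_def)
  moreover have "bd K v \<in> nonzero (surf K) (bd K ` Vp)" using v bd_inj by (auto simp: nonzero_def)
  ultimately show ?thesis unfolding a_const_def by (auto intro: INF_lower)
qed

lemma bd_norm_pos:
  assumes v: "v \<in> Vp" "\<not> ae_eq (vol K) v (\<lambda>x. 0)"
  shows "0 < l2_norm (surf K) (bd K v)"
proof -
  have "bd K v \<in> L2 (surf K)" using v(1) Vp_V bdV_L2 by blast
  then have "l2_norm (surf K) (bd K v) \<noteq> 0" using l2_norm_eq_0_iff bd_inj v by blast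
  then show ?thesis using l2_norm_nonneg[of "surf K" "bd K v"] by linarith
qed

lemma alpha_definite:
  assumes v: "v \<in> Vp" "l2_inner (surf K) (\<alpha> (bd K v)) (bd K v) = 0"
  shows "ae_eq (vol K) v (\<lambda>x. 0)"
proof (rule ccontr)
  assume "\<not> ae_eq (vol K) v (\<lambda>x. 0)"
  from a_bound[OF v(1) this] v(2) have "a_const K \<alpha> Vp \<le> 0" by simp
  then show False using a_pos by simp
qed

section \<open>Solvability of the boundary equation and its energy identities\<close>

text \<open>Riesz for the form \<open>\<langle>\<alpha> v, v'\<rangle>\<close> on traces from
  \<open>Vp\<close>: symmetric by (S1), nonnegative by (S2), and definite by (S3).\<close>

lemma solve_V:
  assumes r: "r \<in> L2 (surf K)"
  shows "\<exists>v\<in>Vp. \<forall>v'\<in>Vp. l2_inner (surf K) (\<alpha> (bd K v)) (bd K v') = l2_inner (surf K) r (bd K v')"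
proof (rule finite_dim_riesz[OF fin_Vp])
  have H: "f \<in> H1_vec K" "bd K f \<in> L2 (surf K)" "f \<in> V" if "f \<in> Vp" for f using that Vp_V V_H1 bdV_L2 by blast+
  have lin: "l2_linear_on Vp (\<lambda>f. l2_inner (surf K) g (bd K f))" if g: "g \<in> L2 (surf K)" for g
    unfolding l2_linear_on_def
  proof (intro conjI ballI allI)
    fix f f' assume f: "f \<in> Vp" "f' \<in> Vp"
    have "(\<lambda>x. f x + f' x) \<in> Vp" by (rule l2_subspaceD(3)[OF sub_Vp f])
    then have "l2_inner (surf K) g (bd K (\<lambda>x. f x + f' x)) = l2_inner (surf K) g (\<lambda>x. bd K f x + bd K f' x)"
      using f by (intro l2_inner_cong ae_eq_refl bd_lincomb(1) g L2_add H)
    then show "l2_inner (surf K) g (bd K (\<lambda>x. f x + f' x)) = l2_inner (surf K) g (bd K f) + l2_inner (surf K) g (bd K f')"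
      using l2_inner_add_right[OF H(2)[OF f(1)] H(2)[OF f(2)] g] by simp
  next
    fix c f assume f: "f \<in> Vp"
    have "(\<lambda>x. c *\<^sub>R f x) \<in> Vp" by (rule l2_subspaceD(4)[OF sub_Vp f])
    then have "l2_inner (surf K) g (bd K (\<lambda>x. c *\<^sub>R f x)) = l2_inner (surf K) g (\<lambda>x. c *\<^sub>R bd K f x)"
      using f by (intro l2_inner_cong ae_eq_refl bd_lincomb(2)[OF H(1) H(1)] g L2_scale H)
    then show "l2_inner (surf K) g (bd K (\<lambda>x. c *\<^sub>R f x)) = c * l2_inner (surf K) g (bd K f)"
      by (simp add: l2_inner_scale_right)
  qed
  show "l2_linear_on Vp (\<lambda>f. l2_inner (surf K) r (bd K f))" by (rule lin[OF r])
  show "l2_linear_on Vp (\<lambda>f. l2_inner (surf K) (\<alpha> (bd K f)) (bd K g))" if g: "g \<in> Vp" for g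
  proof -
    have "l2_inner (surf K) (\<alpha> (bd K f)) (bd K g) = l2_inner (surf K) (\<alpha> (bd K g)) (bd K f)" if "f \<in> Vp" for f
      by (rule alpha_sym[OF H(2)[OF that] H(2)[OF g]])
    then show ?thesis
      using lin[OF alpha_L2[OF H(2)[OF g]]] l2_subspaceD(3,4)[OF sub_Vp] unfolding l2_linear_on_def by simp
  qed
  show "l2_inner (surf K) (\<alpha> (bd K f)) (bd K g) = l2_inner (surf K) (\<alpha> (bd K g)) (bd K f)" if "f \<in> Vp" "g \<in> Vp" for f g
    by (rule alpha_sym[OF H(2)[OF that(1)] H(2)[OF that(2)]])
  show "0 \<le> l2_inner (surf K) (\<alpha> (bd K f)) (bd K f)" if "f \<in> Vp" for f by (rule alpha_pos[OF H(2)[OF that]])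
  show "ae_eq (vol K) f (\<lambda>x. 0)" if "f \<in> Vp" "l2_inner (surf K) (\<alpha> (bd K f)) (bd K f) = 0" for f
    by (rule alpha_definite[OF that])
  show "l2_inner (surf K) r (bd K f) = 0" if "f \<in> Vp" "ae_eq (vol K) f (\<lambda>x. 0)" for f
    using l2_inner_cong[OF ae_eq_refl bd_null[OF H(3)[OF that(1)] that(2)] r r H(2)[OF that(1)] L2_zero] by simp
  show "l2_inner (surf K) (\<alpha> (bd K f)) (bd K g) = 0" if "f \<in> Vp" "g \<in> Vp" "ae_eq (vol K) f (\<lambda>x. 0)" for f g
    by (rule alpha_null[OF H(2)[OF that(1)] bd_null[OF H(3)[OF that(1)] that(3)] H(2)[OF that(2)]])
qed

text \<open>Riesz for the boundary inner product of normal traces, which is definite because the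
  normal trace is injective on \<open>Sp\<close>.\<close>

lemma solve_S:
  assumes r: "r \<in> L2 (surf K)"
  shows "\<exists>\<tau>\<in>Sp. \<forall>\<tau>'\<in>Sp. l2_inner (surf K) (nt \<tau>) (nt \<tau>') = l2_inner (surf K) r (nt \<tau>')"
proof (rule finite_dim_riesz[OF fin_Sp])
  have H: "good f" "nt f \<in> L2 (surf K)" "f \<in> S" if "f \<in> Sp" for f using that Sp_S good_S nt_L2 by blast+
  have lin: "l2_linear_on Sp (\<lambda>f. l2_inner (surf K) g (nt f))" if g: "g \<in> L2 (surf K)" for g
    unfolding l2_linear_on_def
  proof (intro conjI ballI allI)
    fix f f' assume f: "f \<in> Sp" "f' \<in> Sp"
    have "(\<lambda>x. f x + f' x) \<in> Sp" by (rule l2_subspaceD(3)[OF sub_Sp f])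
    then have "l2_inner (surf K) g (nt (\<lambda>x. f x + f' x)) = l2_inner (surf K) g (\<lambda>x. nt f x + nt f' x)"
      using f by (intro l2_inner_cong ae_eq_refl nt_lincomb(1) g L2_add H)
    then show "l2_inner (surf K) g (nt (\<lambda>x. f x + f' x)) = l2_inner (surf K) g (nt f) + l2_inner (surf K) g (nt f')"
      using l2_inner_add_right[OF H(2)[OF f(1)] H(2)[OF f(2)] g] by simp
  next
    fix c f assume f: "f \<in> Sp"
    have "(\<lambda>x. c *\<^sub>R f x) \<in> Sp" by (rule l2_subspaceD(4)[OF sub_Sp f])
    then have "l2_inner (surf K) g (nt (\<lambda>x. c *\<^sub>R f x)) = l2_inner (surf K) g (\<lambda>x. c *\<^sub>R nt f x)"
      using f by (intro l2_inner_cong ae_eq_refl nt_lincomb(2)[OF H(1) H(1)] g L2_scale H)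
    then show "l2_inner (surf K) g (nt (\<lambda>x. c *\<^sub>R f x)) = c * l2_inner (surf K) g (nt f)"
      by (simp add: l2_inner_scale_right)
  qed
  show "l2_linear_on Sp (\<lambda>f. l2_inner (surf K) r (nt f))" by (rule lin[OF r])
  show "l2_linear_on Sp (\<lambda>f. l2_inner (surf K) (nt f) (nt g))" if g: "g \<in> Sp" for g
    using lin[OF H(2)[OF g]] by (simp only: l2_inner_commute[of _ _ "nt g"])
  show "l2_inner (surf K) (nt f) (nt g) = l2_inner (surf K) (nt g) (nt f)" for f g by (rule l2_inner_commute)
  show "0 \<le> l2_inner (surf K) (nt f) (nt f)" for f by (simp add: l2_inner_self)
  have null: "l2_inner (surf K) g (nt f) = 0" if "f \<in> Sp" "ae_eq (vol K) f (\<lambda>x. 0)" "g \<in> L2 (surf K)" for f g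
    using l2_inner_cong[OF ae_eq_refl nt_null[OF H(3)[OF that(1)] that(2)] that(3) that(3) H(2)[OF that(1)] L2_zero] by simp
  show "ae_eq (vol K) f (\<lambda>x. 0)" if "f \<in> Sp" "l2_inner (surf K) (nt f) (nt f) = 0" for f
    using that l2_norm_eq_0_iff[OF H(2)[OF that(1)]] nt_inj[OF that(1)] by (simp add: l2_inner_self)
  show "l2_inner (surf K) r (nt f) = 0" if "f \<in> Sp" "ae_eq (vol K) f (\<lambda>x. 0)" for f by (rule null[OF that r])
  show "l2_inner (surf K) (nt f) (nt g) = 0" if "f \<in> Sp" "g \<in> Sp" "ae_eq (vol K) f (\<lambda>x. 0)" for f g
    using null[OF that(1,3) H(2)[OF that(2)]] by (simp add: l2_inner_commute)
qed

text \<open>The system is triangular. Against traces from \<open>Vp\<close> the term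
  \<open>nt \<tau>\<close> drops out and \<open>v\<close> is determined alone; against normal traces
  from \<open>Sp\<close> the term \<open>\<alpha> (bd K v)\<close> remains and moves to the
  right-hand side of the problem for \<open>\<tau>\<close>.\<close>

lemma solve_M:
  assumes r: "r \<in> L2 (surf K)"
  shows "\<exists>\<tau>\<in>Sp. \<exists>v\<in>Vp. \<forall>\<mu>\<in>M. l2_inner (surf K) (nt \<tau> - \<alpha> (bd K v)) \<mu> = l2_inner (surf K) r \<mu>"
proof -
  \<comment> \<open>The factor -1 comes from the minus sign in front of \<open>\<alpha>\<close> in
    the boundary equation.\<close>
  obtain v where v: "v \<in> Vp" "\<And>v'. v' \<in> Vp \<Longrightarrow> l2_inner (surf K) (\<alpha> (bd K v)) (bd K v') = l2_inner (surf K) (\<lambda>x. (-1) *\<^sub>R r x) (bd K v')"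
    using solve_V[OF L2_scale[OF r, of "-1"]] by blast
  have bL: "bd K v \<in> L2 (surf K)" using v(1) Vp_V bdV_L2 by blast
  have aL: "\<alpha> (bd K v) \<in> L2 (surf K)" by (rule alpha_L2[OF bL])
  obtain \<tau> where \<tau>: "\<tau> \<in> Sp" "\<And>\<tau>'. \<tau>' \<in> Sp \<Longrightarrow> l2_inner (surf K) (nt \<tau>) (nt \<tau>') = l2_inner (surf K) (\<lambda>x. r x + \<alpha> (bd K v) x) (nt \<tau>')"
    using solve_S[OF L2_add[OF r aL]] by blast
  have tL: "nt \<tau> \<in> L2 (surf K)" using \<tau>(1) Sp_S good_S nt_L2 by blast
  have "l2_inner (surf K) (nt \<tau> - \<alpha> (bd K v)) \<mu> = l2_inner (surf K) r \<mu>" if \<mu>: "\<mu> \<in> M" for \<mu>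
  proof -
    obtain \<tau>' v' where tv: "\<tau>' \<in> Sp" "v' \<in> Vp" "ae_eq (surf K) (tr K \<tau>' v') \<mu>" using tr_surj[OF \<mu>] by blast
    have L: "nt \<tau>' \<in> L2 (surf K)" "bd K v' \<in> L2 (surf K)" using tv Sp_S Vp_V good_S nt_L2 bdV_L2 by blast+
    have trL: "tr K \<tau>' v' \<in> L2 (surf K)" unfolding tr_def by (intro L2_add L)
    have split: "l2_inner (surf K) g \<mu> = l2_inner (surf K) g (nt \<tau>') + l2_inner (surf K) g (bd K v')" if g: "g \<in> L2 (surf K)" for g
    proof -
      have "l2_inner (surf K) g \<mu> = l2_inner (surf K) g (tr K \<tau>' v')"
        by (intro l2_inner_cong ae_eq_refl ae_eq_sym[OF tv(3)] g trL M_L2 \<mu>)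
      then show ?thesis unfolding tr_def using l2_inner_add_right[OF L g] by simp
    qed
    have "l2_inner (surf K) (nt \<tau> - \<alpha> (bd K v)) (nt \<tau>') = l2_inner (surf K) r (nt \<tau>')"
      using \<tau>(2)[OF tv(1)] l2_inner_diff_left[OF tL aL L(1)] l2_inner_add_left[OF r aL L(1)] by simp
    moreover have "l2_inner (surf K) (nt \<tau> - \<alpha> (bd K v)) (bd K v') = l2_inner (surf K) r (bd K v')"
      using v(2)[OF tv(2)] l2_inner_diff_left[OF tL aL L(2)] nt_bd_orthogonal[OF \<tau>(1) tv(2)] l2_inner_scale_left[of "surf K" "-1" r "bd K v'"] by simp
    ultimately show ?thesis using split[OF L2_diff[OF tL aL]] split[OF r] by simp
  qed
  then show ?thesis using \<tau>(1) v(1) by blast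
qed

text \<open>The mixed term survives in the second identity only, so \<open>v\<close> has to be
  estimated before \<open>\<tau>\<close>.\<close>

lemma energy_identities:
  assumes \<tau>: "\<tau> \<in> Sp" and v: "v \<in> Vp" and r: "r \<in> L2 (surf K)"
    and eq: "\<forall>\<mu>\<in>M. l2_inner (surf K) (nt \<tau> - \<alpha> (bd K v)) \<mu> = l2_inner (surf K) r \<mu>"
  shows "l2_inner (surf K) (\<alpha> (bd K v)) (bd K v) = - l2_inner (surf K) r (bd K v)"
    and "(l2_norm (surf K) (nt \<tau>))\<^sup>2 = l2_inner (surf K) (\<alpha> (bd K v)) (nt \<tau>) + l2_inner (surf K) r (nt \<tau>)"
proof -
  have S: "\<tau> \<in> S" and V: "v \<in> V" using \<tau> v Sp_S Vp_V by blast+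
  have L: "nt \<tau> \<in> L2 (surf K)" "bd K v \<in> L2 (surf K)" using S V good_S nt_L2 bdV_L2 by blast+
  note aL = alpha_L2[OF L(2)]
  show "l2_inner (surf K) (\<alpha> (bd K v)) (bd K v) = - l2_inner (surf K) r (bd K v)"
    using eq[rule_format, OF bd_M[OF V]] l2_inner_diff_left[OF L(1) aL L(2)] nt_bd_orthogonal[OF \<tau> v] by simp
  show "(l2_norm (surf K) (nt \<tau>))\<^sup>2 = l2_inner (surf K) (\<alpha> (bd K v)) (nt \<tau>) + l2_inner (surf K) r (nt \<tau>)"
    using eq[rule_format, OF nt_M[OF S]] l2_inner_diff_left[OF L(1) aL L(1)] by (simp add: l2_inner_self)
qed

lemma bd_alpha_diff:
  assumes "w \<in> V" "w' \<in> V"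
  shows "ae_eq (surf K) (\<alpha> (bd K (w - w'))) (\<alpha> (bd K w) - \<alpha> (bd K w'))"
proof -
  have "w - w' \<in> V" by (rule l2_subspace_diff[OF sub_V assms])
  then have "ae_eq (surf K) (\<alpha> (bd K (w - w'))) (\<alpha> (bd K w - bd K w'))"
    by (intro alpha_cong bd_lincomb(4) L2_diff bdV_L2 V_H1 assms)
  then show ?thesis using alpha_diff[OF bdV_L2[OF assms(1)] bdV_L2[OF assms(2)]] ae_eq_trans by blast
qed

section \<open>Existence and uniqueness of the projection\<close>

text \<open>The projections \<open>p\<close> and \<open>q\<close> to \<open>S'\<close> and
  \<open>V'\<close> satisfy the volume equations. Corrections from \<open>Sp\<close> and
  \<open>Vp\<close> do not disturb these, and \<open>solve_M\<close> chooses them so that the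
  boundary equation holds.\<close>

lemma projection_exists:
  assumes \<sigma>: "\<sigma> \<in> H1_sym K" and u: "u \<in> H1_vec K"
  shows "\<exists>\<xi> w. hdg_projection K S V M S' V' \<alpha> \<sigma> u \<xi> w"
proof -
  have \<sigma>L: "\<sigma> \<in> L2 (vol K)" and uL: "u \<in> L2 (vol K)" by (rule H1_sym_L2[OF \<sigma>], rule H1_vec_L2[OF u])
  define p where "p = l2_proj (vol K) S' \<sigma>"
  define q where "q = l2_proj (vol K) V' u"
  have p: "p \<in> S'" "\<And>s. s \<in> S' \<Longrightarrow> l2_inner (vol K) (\<sigma> - p) s = 0" unfolding p_def by (rule l2_proj[OF fin_S' \<sigma>L])+
  have q: "q \<in> V'" "\<And>s. s \<in> V' \<Longrightarrow> l2_inner (vol K) (u - q) s = 0" unfolding q_def by (rule l2_proj[OF fin_V' uL])+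
  have pS: "p \<in> S" and qV: "q \<in> V" using p q S'_S V'_V by blast+
  define m where "m = l2_proj (surf K) M (bd K u)"
  have mL: "m \<in> L2 (surf K)" unfolding m_def using l2_proj(1)[OF fin_M bd_L2[OF u]] M_L2 by blast
  define R where "R = nt \<sigma> - \<alpha> m"
  have RL: "R \<in> L2 (surf K)" unfolding R_def by (intro L2_diff nt_L2 good_H1 \<sigma> alpha_L2 mL)
  \<comment> \<open>The part of the boundary equation already supplied by \<open>p\<close> and
    \<open>q\<close>; \<open>R - r0\<close> is left for the corrections.\<close>
  define r0 where "r0 = nt p - \<alpha> (bd K q)"
  have r0L: "r0 \<in> L2 (surf K)" unfolding r0_def by (intro L2_diff nt_L2 good_S pS alpha_L2 bdV_L2 qV)
  obtain \<tau> v where tv: "\<tau> \<in> Sp" "v \<in> Vp" "\<And>\<mu>. \<mu> \<in> M \<Longrightarrow> l2_inner (surf K) (nt \<tau> - \<alpha> (bd K v)) \<mu> = l2_inner (surf K) (R - r0) \<mu>"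
    using solve_M[OF L2_diff[OF RL r0L]] by blast
  have \<tau>S: "\<tau> \<in> S" and vV: "v \<in> V" using tv Sp_S Vp_V by blast+
  define \<xi> where "\<xi> = (\<lambda>x. p x + \<tau> x)"
  define w where "w = (\<lambda>x. q x + v x)"
  have \<xi>S: "\<xi> \<in> S" unfolding \<xi>_def by (rule l2_subspaceD(3)[OF sub_S pS \<tau>S])
  have wV: "w \<in> V" unfolding w_def by (rule l2_subspaceD(3)[OF sub_V qV vV])
  note SL = l2_subspaceD(1)[OF sub_S] l2_subspaceD(1)[OF sub_S']
  note VL = l2_subspaceD(1)[OF sub_V] l2_subspaceD(1)[OF sub_V']
  have "hdg_projection K S V M S' V' \<alpha> \<sigma> u \<xi> w"
    unfolding hdg_projection_def m_def[symmetric] R_def[symmetric]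
  proof (intro conjI ballI \<xi>S wV)
    fix s assume s: "s \<in> S'"
    have sL: "s \<in> L2 (vol K)" using s SL by blast
    have "l2_inner (vol K) \<xi> s = l2_inner (vol K) p s + l2_inner (vol K) \<tau> s"
      unfolding \<xi>_def using pS \<tau>S SL sL by (intro l2_inner_add_left) auto
    also have "l2_inner (vol K) \<tau> s = 0" using tv(1) s by (simp add: l2_complement_def)
    also have "l2_inner (vol K) p s = l2_inner (vol K) \<sigma> s"
      using p(2)[OF s] l2_inner_diff_left[OF \<sigma>L _ sL, of p] pS SL by auto
    finally show "l2_inner (vol K) \<xi> s = l2_inner (vol K) \<sigma> s" by simp
  next
    fix s assume s: "s \<in> V'"
    have sL: "s \<in> L2 (vol K)" using s VL by blast
    have "l2_inner (vol K) w s = l2_inner (vol K) q s + l2_inner (vol K) v s"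
      unfolding w_def using qV vV VL sL by (intro l2_inner_add_left) auto
    also have "l2_inner (vol K) v s = 0" using tv(2) s by (simp add: l2_complement_def)
    also have "l2_inner (vol K) q s = l2_inner (vol K) u s"
      using q(2)[OF s] l2_inner_diff_left[OF uL _ sL, of q] qV VL by auto
    finally show "l2_inner (vol K) w s = l2_inner (vol K) u s" by simp
  next
    fix \<mu> assume \<mu>: "\<mu> \<in> M"
    note \<mu>L = M_L2[OF \<mu>]
    have dw: "w - q = v" and d\<xi>: "\<xi> - p = \<tau>" by (auto simp: w_def \<xi>_def)
    have n: "l2_inner (surf K) (nt \<tau>) \<mu> = l2_inner (surf K) (nt \<xi> - nt p) \<mu>"
      using good_diff(2)[OF good_S[OF \<xi>S] good_S[OF pS]] unfolding d\<xi>
      by (intro l2_inner_cong ae_eq_refl L2_diff nt_L2 good_S \<tau>S \<xi>S pS \<mu>L)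
    have a: "l2_inner (surf K) (\<alpha> (bd K v)) \<mu> = l2_inner (surf K) (\<alpha> (bd K w) - \<alpha> (bd K q)) \<mu>"
      using bd_alpha_diff[OF wV qV] unfolding dw
      by (intro l2_inner_cong ae_eq_refl L2_diff alpha_L2 bdV_L2 vV wV qV \<mu>L)
    have L: "nt \<tau> \<in> L2 (surf K)" "nt \<xi> \<in> L2 (surf K)" "nt p \<in> L2 (surf K)" using nt_L2 good_S \<tau>S \<xi>S pS by blast+
    have A: "\<alpha> (bd K v) \<in> L2 (surf K)" "\<alpha> (bd K w) \<in> L2 (surf K)" "\<alpha> (bd K q) \<in> L2 (surf K)" using alpha_L2 bdV_L2 vV wV qV by blast+
    show "l2_inner (surf K) (nt \<xi> - \<alpha> (bd K w)) \<mu> = l2_inner (surf K) R \<mu>"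
      using tv(3)[OF \<mu>] n a l2_inner_diff_left[OF L(1) A(1) \<mu>L] l2_inner_diff_left[OF L(2,3) \<mu>L] l2_inner_diff_left[OF A(2,3) \<mu>L]
        l2_inner_diff_left[OF L(2) A(2) \<mu>L] l2_inner_diff_left[OF RL r0L \<mu>L] l2_inner_diff_left[OF L(3) A(3) \<mu>L]
      unfolding r0_def by simp
  qed
  then show ?thesis by blast
qed

text \<open>Serves twice: with another solution in place of \<open>\<eta>\<close> and
  \<open>z\<close> for uniqueness, and with the L2 projections to \<open>S\<close> and
  \<open>V\<close> for the estimates. Equal moments against \<open>S'\<close> and \<open>V'\<close>
  are what put the differences into \<open>Sp\<close> and \<open>Vp\<close>.\<close>

lemma projection_diff:
  assumes P: "hdg_projection K S V M S' V' \<alpha> \<sigma> u \<xi> w" and \<sigma>: "\<sigma> \<in> H1_sym K" and u: "u \<in> H1_vec K"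
    and \<eta>: "\<eta> \<in> S" "\<forall>\<tau>\<in>S'. l2_inner (vol K) \<eta> \<tau> = l2_inner (vol K) \<sigma> \<tau>"
    and z: "z \<in> V" "\<forall>v\<in>V'. l2_inner (vol K) z v = l2_inner (vol K) u v"
  defines "r \<equiv> (nt \<sigma> - nt \<eta>) - (\<alpha> (l2_proj (surf K) M (bd K u)) - \<alpha> (bd K z))"
  shows "\<xi> - \<eta> \<in> Sp" "w - z \<in> Vp" "r \<in> L2 (surf K)"
    and "\<forall>\<mu>\<in>M. l2_inner (surf K) (nt (\<xi> - \<eta>) - \<alpha> (bd K (w - z))) \<mu> = l2_inner (surf K) r \<mu>"
proof -
  have \<xi>: "\<xi> \<in> S" "\<And>\<tau>. \<tau> \<in> S' \<Longrightarrow> l2_inner (vol K) \<xi> \<tau> = l2_inner (vol K) \<sigma> \<tau>"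
    and w: "w \<in> V" "\<And>v. v \<in> V' \<Longrightarrow> l2_inner (vol K) w v = l2_inner (vol K) u v"
    and eq: "\<And>\<mu>. \<mu> \<in> M \<Longrightarrow> l2_inner (surf K) (nt \<xi> - \<alpha> (bd K w)) \<mu>
           = l2_inner (surf K) (nt \<sigma> - \<alpha> (l2_proj (surf K) M (bd K u))) \<mu>"
    using P by (auto simp: hdg_projection_def)
  have SL: "f \<in> L2 (vol K)" if "f \<in> S" for f using that l2_subspaceD(1)[OF sub_S] by blast
  have dS: "\<xi> - \<eta> \<in> S" by (rule l2_subspace_diff[OF sub_S \<xi>(1) \<eta>(1)])
  have dV: "w - z \<in> V" by (rule l2_subspace_diff[OF sub_V w(1) z(1)])
  have "l2_inner (vol K) (\<xi> - \<eta>) \<tau> = 0" if "\<tau> \<in> S'" for \<tau>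
    using l2_inner_diff_left[OF SL[OF \<xi>(1)] SL[OF \<eta>(1)] SL[of \<tau>]] \<xi>(2)[OF that] \<eta>(2)[rule_format, OF that] that S'_S by auto
  then show "\<xi> - \<eta> \<in> Sp" using dS by (simp add: l2_complement_def)
  have "l2_inner (vol K) (w - z) v = 0" if "v \<in> V'" for v
    using l2_inner_diff_left[OF V_L2[OF w(1)] V_L2[OF z(1)] V_L2[of v]] w(2)[OF that] z(2)[rule_format, OF that] that V'_V by auto
  then show "w - z \<in> Vp" using dV by (simp add: l2_complement_def)
  have mL: "l2_proj (surf K) M (bd K u) \<in> L2 (surf K)" using l2_proj(1)[OF fin_M bd_L2[OF u]] M_L2 by blast
  note L = nt_L2[OF good_H1[OF \<sigma>]] nt_L2[OF good_S[OF \<eta>(1)]] nt_L2[OF good_S[OF \<xi>(1)]] nt_L2[OF good_S[OF dS]]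
  note A = alpha_L2[OF mL] alpha_L2[OF bdV_L2[OF z(1)]] alpha_L2[OF bdV_L2[OF w(1)]] alpha_L2[OF bdV_L2[OF dV]]
  show "r \<in> L2 (surf K)" unfolding r_def by (intro L2_diff L A)
  show "\<forall>\<mu>\<in>M. l2_inner (surf K) (nt (\<xi> - \<eta>) - \<alpha> (bd K (w - z))) \<mu> = l2_inner (surf K) r \<mu>"
  proof
    fix \<mu> assume \<mu>: "\<mu> \<in> M"
    note \<mu>L = M_L2[OF \<mu>]
    have n: "l2_inner (surf K) (nt (\<xi> - \<eta>)) \<mu> = l2_inner (surf K) (nt \<xi> - nt \<eta>) \<mu>"
      by (intro l2_inner_cong ae_eq_refl L2_diff L \<mu>L good_diff(2) good_S \<xi> \<eta>)
    have a: "l2_inner (surf K) (\<alpha> (bd K (w - z))) \<mu> = l2_inner (surf K) (\<alpha> (bd K w) - \<alpha> (bd K z)) \<mu>"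
      by (intro l2_inner_cong ae_eq_refl L2_diff A \<mu>L bd_alpha_diff w z)
    show "l2_inner (surf K) (nt (\<xi> - \<eta>) - \<alpha> (bd K (w - z))) \<mu> = l2_inner (surf K) r \<mu>"
      using eq[OF \<mu>] n a
      unfolding r_def l2_inner_diff_left[OF L(4) A(4) \<mu>L] l2_inner_diff_left[OF L(3,2) \<mu>L] l2_inner_diff_left[OF A(3,2) \<mu>L]
        l2_inner_diff_left[OF L2_diff[OF L(1,2)] L2_diff[OF A(1,2)] \<mu>L] l2_inner_diff_left[OF L(1,2) \<mu>L] l2_inner_diff_left[OF A(1,2) \<mu>L]
        l2_inner_diff_left[OF L(3) A(3) \<mu>L] l2_inner_diff_left[OF L(1) A(1) \<mu>L] by linarith
  qed
qed

text \<open>For a second solution the residual \<open>r\<close> is orthogonal to \<open>M\<close>,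
  so both energy identities become homogeneous: the first gives \<open>v = 0\<close> by
  definiteness, after which the second gives a vanishing normal trace.\<close>

lemma projection_unique:
  assumes P: "hdg_projection K S V M S' V' \<alpha> \<sigma> u \<xi> w" and P': "hdg_projection K S V M S' V' \<alpha> \<sigma> u \<xi>' w'"
    and \<sigma>: "\<sigma> \<in> H1_sym K" and u: "u \<in> H1_vec K"
  shows "ae_eq (vol K) \<xi> \<xi>' \<and> ae_eq (vol K) w w'"
proof -
  have \<xi>': "\<xi>' \<in> S" "\<forall>\<tau>\<in>S'. l2_inner (vol K) \<xi>' \<tau> = l2_inner (vol K) \<sigma> \<tau>"
    and w': "w' \<in> V" "\<forall>v\<in>V'. l2_inner (vol K) w' v = l2_inner (vol K) u v"
    and eq': "\<And>\<mu>. \<mu> \<in> M \<Longrightarrow> l2_inner (surf K) (nt \<xi>' - \<alpha> (bd K w')) \<mu>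
           = l2_inner (surf K) (nt \<sigma> - \<alpha> (l2_proj (surf K) M (bd K u))) \<mu>"
    using P' by (auto simp: hdg_projection_def)
  define r where "r = (nt \<sigma> - nt \<xi>') - (\<alpha> (l2_proj (surf K) M (bd K u)) - \<alpha> (bd K w'))"
  note D = projection_diff[OF P \<sigma> u \<xi>' w', folded r_def]
  have mL: "l2_proj (surf K) M (bd K u) \<in> L2 (surf K)" using l2_proj(1)[OF fin_M bd_L2[OF u]] M_L2 by blast
  note L = nt_L2[OF good_H1[OF \<sigma>]] nt_L2[OF good_S[OF \<xi>'(1)]]
  note A = alpha_L2[OF mL] alpha_L2[OF bdV_L2[OF w'(1)]]
  have r0: "l2_inner (surf K) r \<mu> = 0" if \<mu>: "\<mu> \<in> M" for \<mu>
    using eq'[OF \<mu>]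
    unfolding r_def l2_inner_diff_left[OF L2_diff[OF L] L2_diff[OF A] M_L2[OF \<mu>]] l2_inner_diff_left[OF L M_L2[OF \<mu>]]
      l2_inner_diff_left[OF A M_L2[OF \<mu>]] l2_inner_diff_left[OF L(2) A(2) M_L2[OF \<mu>]] l2_inner_diff_left[OF L(1) A(1) M_L2[OF \<mu>]]
    by linarith
  have dS: "\<xi> - \<xi>' \<in> S" and dV: "w - w' \<in> V" using D(1,2) Sp_S Vp_V by blast+
  note E = energy_identities[OF D(1,2,3) D(4)]
  have "l2_inner (surf K) (\<alpha> (bd K (w - w'))) (bd K (w - w')) = 0" using E(1) r0[OF bd_M[OF dV]] by simp
  with D(2) have v0: "ae_eq (vol K) (w - w') (\<lambda>x. 0)" by (rule alpha_definite[of "w - w'"])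
  have "l2_inner (surf K) (\<alpha> (bd K (w - w'))) (nt (\<xi> - \<xi>')) = 0"
    by (rule alpha_null[OF bdV_L2[OF dV] bd_null[OF dV v0] nt_L2[OF good_S[OF dS]]])
  then have "(l2_norm (surf K) (nt (\<xi> - \<xi>')))\<^sup>2 = 0" using E(2) r0[OF nt_M[OF dS]] by simp
  then have "ae_eq (surf K) (nt (\<xi> - \<xi>')) (\<lambda>x. 0)" using l2_norm_eq_0_iff[OF nt_L2[OF good_S[OF dS]]] by simp
  then have "ae_eq (vol K) (\<xi> - \<xi>') (\<lambda>x. 0)" by (rule nt_inj[OF D(1)])
  then show ?thesis using v0 by (simp add: ae_eq_def)
qed

section \<open>The constants and the error estimates\<close>

lemma diameter_pos: "0 < diameter K"
proof -
  obtain x where "x \<in> K" using nonempty_K by auto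
  then obtain r where r: "r > 0" "ball x r \<subseteq> K" using open_K open_contains_ball by blast
  fix k :: 'n
  define y where "y = x + (r / 2) *\<^sub>R axis k (1::real)"
  have d: "dist x y = r / 2" using r(1) by (simp add: y_def dist_norm norm_axis_1)
  then have "y \<in> K" using r by auto
  then have "dist x y \<le> diameter K" using diameter_bounded_bound[OF bounded_K \<open>x \<in> K\<close>] by blast
  then show ?thesis using d r(1) by linarith
qed

text \<open>Turns a bounded quotient from the definition of \<open>C_displ\<close> or
  \<open>C_stress\<close> into a product estimate inside \<open>[0, \<infinity>]\<close>. Here
  \<open>d\<close> is the factor \<open>h powr (-1/2)\<close> and \<open>s\<close> its
  inverse.\<close>

lemma quotient_bound:
  assumes C: "ennreal (d * N) / ennreal A \<le> C" and A: "0 < A" and s: "s * d = 1" "0 \<le> s" "0 \<le> d" "0 \<le> N"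
  shows "ennreal N \<le> C * ennreal s * ennreal A"
proof -
  have "ennreal (d * N) / ennreal A = ennreal (d * N / A)" using A s by (simp add: divide_ennreal)
  then have "ennreal (d * N / A) * ennreal A \<le> C * ennreal A" using C by (intro mult_right_mono) auto
  then have "ennreal (d * N) \<le> C * ennreal A" using A s by (simp add: ennreal_mult[symmetric])
  then have "ennreal s * ennreal (d * N) \<le> ennreal s * (C * ennreal A)" by (intro mult_left_mono) auto
  moreover have "ennreal s * ennreal (d * N) = ennreal N"
    using s by (simp add: ennreal_mult[symmetric] mult.assoc[symmetric])
  ultimately show ?thesis by (simp add: mult_ac)
qed

lemma powr_half: "diameter K powr (1/2) * diameter K powr (-1/2) = 1"
  "ennreal (diameter K powr (1/2)) * ennreal (diameter K powr (1/2)) = ennreal (diameter K)"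
  using diameter_pos by (simp_all add: powr_add[symmetric] ennreal_mult[symmetric])

lemma C_displ_bound:
  assumes v: "v \<in> Vp"
  shows "ennreal (l2_norm (vol K) v) \<le> C_displ K Vp * ennreal (diameter K powr (1/2)) * ennreal (l2_norm (surf K) (bd K v))"
proof (cases "ae_eq (vol K) v (\<lambda>x. 0)")
  case True
  then have "l2_norm (vol K) v = 0" using l2_norm_eq_0_iff V_L2 v Vp_V by blast
  then show ?thesis by simp
next
  case False
  then have "v \<in> nonzero (vol K) Vp" using v by (simp add: nonzero_def)
  then have "ennreal (diameter K powr (-1/2) * l2_norm (vol K) v) / ennreal (l2_norm (surf K) (bd K v)) \<le> C_displ K Vp"
    unfolding C_displ_def by (rule SUP_upper)
  then show ?thesis by (rule quotient_bound[OF _ bd_norm_pos[OF v False] powr_half(1)]) simp_all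
qed

lemma C_stress_bound:
  assumes \<tau>: "\<tau> \<in> Sp"
  shows "ennreal (l2_norm (vol K) \<tau>) \<le> C_stress K Sp * ennreal (diameter K powr (1/2)) * ennreal (l2_norm (surf K) (nt \<tau>))"
proof (cases "ae_eq (vol K) \<tau> (\<lambda>x. 0)")
  case True
  then have "l2_norm (vol K) \<tau> = 0" using l2_norm_eq_0_iff good_L2 good_S \<tau> Sp_S by blast
  then show ?thesis by simp
next
  case False
  have "l2_norm (surf K) (nt \<tau>) \<noteq> 0" using l2_norm_eq_0_iff nt_L2 good_S \<tau> Sp_S nt_inj False by blast
  then have pos: "0 < l2_norm (surf K) (nt \<tau>)" using l2_norm_nonneg[of "surf K" "nt \<tau>"] by linarith
  have "\<tau> \<in> nonzero (vol K) Sp" using \<tau> False by (simp add: nonzero_def)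
  then have "ennreal (diameter K powr (-1/2) * l2_norm (vol K) \<tau>) / ennreal (l2_norm (surf K) (nt \<tau>)) \<le> C_stress K Sp"
    unfolding C_stress_def by (rule SUP_upper)
  then show ?thesis by (rule quotient_bound[OF _ pos powr_half(1)]) simp_all
qed

text \<open>The supremum in \<open>alpha_norm\<close> runs over signed values, and
  \<open>ennreal\<close> sends negative ones to 0. The absolute value is reached by testing with
  \<open>-\<mu>\<close> as well.\<close>

lemma alpha_bound:
  assumes \<eta>: "\<eta> \<in> M" and \<mu>: "\<mu> \<in> M"
  shows "ennreal \<bar>l2_inner (surf K) (\<alpha> \<eta>) \<mu>\<bar> \<le> alpha_norm K \<alpha> M * ennreal (l2_norm (surf K) \<eta>) * ennreal (l2_norm (surf K) \<mu>)"
proof -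
  have one: "ennreal (l2_inner (surf K) (\<alpha> \<eta>) \<mu>) \<le> alpha_norm K \<alpha> M * ennreal (l2_norm (surf K) \<eta>) * ennreal (l2_norm (surf K) \<mu>)"
    if \<mu>: "\<mu> \<in> M" for \<mu>
  proof (cases "l2_inner (surf K) (\<alpha> \<eta>) \<mu> \<le> 0")
    case True
    then show ?thesis by (simp add: ennreal_neg)
  next
    case False
    note L = M_L2[OF \<eta>] M_L2[OF \<mu>]
    have nz: "\<not> ae_eq (surf K) \<eta> (\<lambda>x. 0)" "\<not> ae_eq (surf K) \<mu> (\<lambda>x. 0)"
      using False alpha_null[OF L(1) _ L(2)] alpha_null[OF L(2) _ L(1)] alpha_sym[OF L] by auto
    then have "l2_norm (surf K) \<eta> \<noteq> 0" "l2_norm (surf K) \<mu> \<noteq> 0" using l2_norm_eq_0_iff L by blast+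
    then have pos: "0 < l2_norm (surf K) \<eta>" "0 < l2_norm (surf K) \<mu>"
      using l2_norm_nonneg[of "surf K" \<eta>] l2_norm_nonneg[of "surf K" \<mu>] by linarith+
    have "\<eta> \<in> nonzero (surf K) M" "\<mu> \<in> nonzero (surf K) M" using nz \<eta> \<mu> by (simp_all add: nonzero_def)
    then have "ennreal (l2_inner (surf K) (\<alpha> \<eta>) \<mu> / (l2_norm (surf K) \<eta> * l2_norm (surf K) \<mu>)) \<le> alpha_norm K \<alpha> M"
      unfolding alpha_norm_def by (intro SUP_upper2[of \<eta>] SUP_upper2[of \<mu>]) auto
    then have "ennreal (l2_inner (surf K) (\<alpha> \<eta>) \<mu> / (l2_norm (surf K) \<eta> * l2_norm (surf K) \<mu>)) * ennreal (l2_norm (surf K) \<eta> * l2_norm (surf K) \<mu>)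
      \<le> alpha_norm K \<alpha> M * ennreal (l2_norm (surf K) \<eta> * l2_norm (surf K) \<mu>)" by (intro mult_right_mono) auto
    moreover have "ennreal (l2_inner (surf K) (\<alpha> \<eta>) \<mu> / (l2_norm (surf K) \<eta> * l2_norm (surf K) \<mu>)) * ennreal (l2_norm (surf K) \<eta> * l2_norm (surf K) \<mu>)
      = ennreal (l2_inner (surf K) (\<alpha> \<eta>) \<mu>)"
      using pos False by (subst ennreal_mult[symmetric]) auto
    ultimately show ?thesis using pos by (simp add: ennreal_mult mult.assoc)
  qed
  have n: "l2_norm (surf K) (\<lambda>x. (-1) *\<^sub>R \<mu> x) = l2_norm (surf K) \<mu>" using l2_norm_scale[of "surf K" "-1" \<mu>] by simp
  have "ennreal (l2_inner (surf K) (\<alpha> \<eta>) (\<lambda>x. (-1) *\<^sub>R \<mu> x)) \<le> alpha_norm K \<alpha> M * ennreal (l2_norm (surf K) \<eta>) * ennreal (l2_norm (surf K) \<mu>)"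
    using one[OF l2_subspaceD(4)[OF sub_M \<mu>, of "-1"]] unfolding n .
  then have two: "ennreal (- l2_inner (surf K) (\<alpha> \<eta>) \<mu>) \<le> alpha_norm K \<alpha> M * ennreal (l2_norm (surf K) \<eta>) * ennreal (l2_norm (surf K) \<mu>)"
    unfolding l2_inner_scale_right by simp
  show ?thesis using one[OF \<mu>] two by (cases "0 \<le> l2_inner (surf K) (\<alpha> \<eta>) \<mu>") auto
qed

text \<open>The common quotient by \<open>a\<close> bounds the trace of \<open>v = w - z\<close> on
  the boundary. \<open>C_displ\<close> turns it into a bound on \<open>v\<close>; multiplied by
  \<open>al\<close> it enters the bound on the normal trace of
  \<open>\<tau> = \<xi> - \<eta>\<close>, which \<open>C_stress\<close> turns into a bound on
  \<open>\<tau>\<close>.\<close>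

lemma projection_estimates:
  assumes P: "hdg_projection K S V M S' V' \<alpha> \<sigma> u \<xi> w" and \<sigma>: "\<sigma> \<in> H1_sym K" and u: "u \<in> H1_vec K"
  defines "s \<equiv> ennreal (diameter K powr (1/2))"
    and "a \<equiv> a_const K \<alpha> Vp" and "al \<equiv> alpha_norm K \<alpha> M" and "CS \<equiv> C_stress K Sp" and "CV \<equiv> C_displ K Vp"
    and "X \<equiv> ennreal (l2_norm (surf K) (nt (\<sigma> - l2_proj (vol K) S \<sigma>)))"
    and "U \<equiv> ennreal (l2_norm (surf K) (bd K (u - l2_proj (vol K) V u)))"
    and "D \<equiv> ennreal (l2_norm (vol K) (weak_div K \<sigma> - l2_proj (vol K) V' (weak_div K \<sigma>)))"
  shows "ennreal (l2_norm (vol K) (\<xi> - l2_proj (vol K) S \<sigma>))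
      \<le> CS * s * (al * ((CV * s * D + al * U) / a) + X + al * U)" (is ?stress)
    and "ennreal (l2_norm (vol K) (w - l2_proj (vol K) V u)) \<le> CV * s * ((CV * s * D + al * U) / a)" (is ?displ)
proof -
  have \<sigma>L: "\<sigma> \<in> L2 (vol K)" and uL: "u \<in> L2 (vol K)" by (rule H1_sym_L2[OF \<sigma>], rule H1_vec_L2[OF u])
  define \<eta> where "\<eta> = l2_proj (vol K) S \<sigma>"
  define z where "z = l2_proj (vol K) V u"
  define d where "d = weak_div K \<sigma>"
  define d' where "d' = l2_proj (vol K) V' d"
  define P\<^sub>M where "P\<^sub>M = l2_proj (surf K) M (bd K u)"
  note g\<sigma> = good_H1[OF \<sigma>]
  have dL: "d \<in> L2 (vol K)" unfolding d_def by (rule div_L2[OF g\<sigma>])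
  have \<eta>: "\<eta> \<in> S" "\<And>t. t \<in> S \<Longrightarrow> l2_inner (vol K) (\<sigma> - \<eta>) t = 0" unfolding \<eta>_def by (rule l2_proj[OF fin_S \<sigma>L])+
  have z: "z \<in> V" "\<And>t. t \<in> V \<Longrightarrow> l2_inner (vol K) (u - z) t = 0" unfolding z_def by (rule l2_proj[OF fin_V uL])+
  have d': "d' \<in> V'" unfolding d'_def by (rule l2_proj(1)[OF fin_V' dL])
  have PM: "P\<^sub>M \<in> M" "\<And>t. t \<in> M \<Longrightarrow> l2_inner (surf K) (bd K u - P\<^sub>M) t = 0"
    unfolding P\<^sub>M_def by (rule l2_proj[OF fin_M bd_L2[OF u]])+
  note g\<eta> = good_S[OF \<eta>(1)]
  define e where "e = \<sigma> - \<eta>"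
  have ge: "good e" unfolding e_def by (rule good_diff(1)[OF g\<sigma> g\<eta>])
  have eL: "e \<in> L2 (vol K)" by (rule good_L2[OF ge])
  \<comment> \<open>The residual splits into \<open>nt e\<close> minus \<open>\<alpha> m\<close>,
    and since \<open>m\<close> belongs to \<open>M\<close> the constant \<open>alpha_norm\<close>
    applies to it.\<close>
  define m where "m = P\<^sub>M - bd K z"
  have mM: "m \<in> M" unfolding m_def by (rule l2_subspace_diff[OF sub_M PM(1) bd_M[OF z(1)]])
  have mL: "m \<in> L2 (surf K)" by (rule M_L2[OF mM])
  have \<eta>': "\<forall>t\<in>S'. l2_inner (vol K) \<eta> t = l2_inner (vol K) \<sigma> t"
  proof
    fix t assume that: "t \<in> S'"
    have "t \<in> S" using that S'_S by blast
    then show "l2_inner (vol K) \<eta> t = l2_inner (vol K) \<sigma> t" using \<eta>(2)[of t] l2_inner_diff_left[OF \<sigma>L good_L2[OF g\<eta>] good_L2[OF good_S[of t]]] by simp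
  qed
  have z': "\<forall>t\<in>V'. l2_inner (vol K) z t = l2_inner (vol K) u t"
  proof
    fix t assume that: "t \<in> V'"
    have "t \<in> V" using that V'_V by blast
    then show "l2_inner (vol K) z t = l2_inner (vol K) u t" using z(2)[of t] l2_inner_diff_left[OF uL V_L2[OF z(1)] V_L2[of t]] by simp
  qed
  define r where "r = (nt \<sigma> - nt \<eta>) - (\<alpha> P\<^sub>M - \<alpha> (bd K z))"
  note D = projection_diff[OF P \<sigma> u \<eta>(1) \<eta>' z(1) z', folded P\<^sub>M_def, folded r_def]
  define \<tau> where "\<tau> = \<xi> - \<eta>"
  define v where "v = w - z"
  have \<tau>: "\<tau> \<in> Sp" and v: "v \<in> Vp" and rL: "r \<in> L2 (surf K)" unfolding \<tau>_def v_def by (rule D(1), rule D(2), rule D(3))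
  have \<tau>S: "\<tau> \<in> S" and vV: "v \<in> V" using \<tau> v Sp_S Vp_V by blast+
  have eqM: "\<forall>\<mu>\<in>M. l2_inner (surf K) (nt \<tau> - \<alpha> (bd K v)) \<mu> = l2_inner (surf K) r \<mu>"
    unfolding \<tau>_def v_def by (rule D(4))
  note E = energy_identities[OF \<tau> v rL eqM]
  have rsplit: "l2_inner (surf K) r \<mu> = l2_inner (surf K) (nt e) \<mu> - l2_inner (surf K) (\<alpha> m) \<mu>" if \<mu>: "\<mu> \<in> L2 (surf K)" for \<mu>
  proof -
    have "l2_inner (surf K) (nt e) \<mu> = l2_inner (surf K) (nt \<sigma> - nt \<eta>) \<mu>"
      unfolding e_def by (intro l2_inner_cong ae_eq_refl good_diff L2_diff nt_L2 g\<sigma> g\<eta> \<mu>)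
    moreover have "l2_inner (surf K) (\<alpha> m) \<mu> = l2_inner (surf K) (\<alpha> P\<^sub>M - \<alpha> (bd K z)) \<mu>"
      unfolding m_def by (intro l2_inner_cong ae_eq_refl alpha_diff L2_diff alpha_L2 M_L2 PM(1) bdV_L2 z(1) \<mu>)
    moreover have "nt \<sigma> - nt \<eta> \<in> L2 (surf K)" "\<alpha> P\<^sub>M - \<alpha> (bd K z) \<in> L2 (surf K)"
      by (intro L2_diff nt_L2 g\<sigma> g\<eta> alpha_L2 M_L2 PM(1) bdV_L2 z(1))+
    ultimately show ?thesis unfolding r_def using l2_inner_diff_left[OF _ _ \<mu>] by simp
  qed
  \<comment> \<open>Green's formula trades the boundary error of \<open>\<sigma>\<close> for its
    divergence: \<open>e\<close> is orthogonal to \<open>\<epsilon>(v)\<close>, and as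
    \<open>v\<close> is orthogonal to \<open>V'\<close>, the divergence of \<open>\<eta>\<close> may
    be replaced by the projection \<open>d'\<close>. Hence \<open>X\<close> is absent from the
    estimate of \<open>v\<close>.\<close>
  have ntbd: "l2_inner (surf K) (nt e) (bd K v) = l2_inner (vol K) (d - d') v"
  proof -
    have vL: "v \<in> L2 (vol K)" by (rule V_L2[OF vV])
    have d\<eta>: "weak_div K \<eta> \<in> V'" by (rule div_V'[OF \<eta>(1)])
    have orth: "l2_inner (vol K) t v = 0" if "t \<in> V'" for t using v that by (auto simp: l2_complement_def l2_inner_commute)
    have tL: "t \<in> L2 (vol K)" if "t \<in> V'" for t using that V'_V V_L2 by blast
    have "l2_inner (vol K) (weak_div K e) v = l2_inner (vol K) (d - weak_div K \<eta>) v"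
      unfolding e_def d_def by (intro l2_inner_cong ae_eq_refl good_diff L2_diff div_L2 g\<sigma> g\<eta> vL)
    also have "\<dots> = l2_inner (vol K) (d - d') v"
      using l2_inner_diff_left[OF dL tL[OF d\<eta>] vL] l2_inner_diff_left[OF dL tL[OF d'] vL] orth[OF d\<eta>] orth[OF d'] by simp
    finally have "l2_inner (vol K) (weak_div K e) v = l2_inner (vol K) (d - d') v" .
    moreover have "l2_inner (vol K) e (sym_grad K v) = 0"
      unfolding e_def by (rule \<eta>(2)) (use sym_grad_S'[OF vV] S'_S in blast)
    ultimately show ?thesis using green[OF ge V_H1[OF vV]] by simp
  qed
  have d'L: "d' \<in> L2 (vol K)" using d' V'_V V_L2 by blast
  have bL: "bd K v \<in> L2 (surf K)" and tL: "nt \<tau> \<in> L2 (surf K)" by (rule bdV_L2[OF vV], rule nt_L2[OF good_S[OF \<tau>S]])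
  have bM: "bd K v \<in> M" and tM: "nt \<tau> \<in> M" by (rule bd_M[OF vV], rule nt_M[OF \<tau>S])
  define A where "A = l2_norm (surf K) (bd K v)"
  define T where "T = l2_norm (surf K) (nt \<tau>)"
  define Nv where "Nv = l2_norm (vol K) v"
  define D0 where "D0 = l2_norm (vol K) (d - d')"
  define X0 where "X0 = l2_norm (surf K) (nt e)"
  have n0: "0 \<le> A" "0 \<le> T" "0 \<le> Nv" "0 \<le> D0" "0 \<le> X0" by (simp_all add: A_def T_def Nv_def D0_def X0_def)
  have DD: "D = ennreal D0" and XX: "X = ennreal X0"
    by (simp_all add: D_def X_def D0_def X0_def d'_def d_def e_def \<eta>_def)
  \<comment> \<open>\<open>bd K u - P\<^sub>M\<close> is orthogonal to \<open>m\<close>, so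
    \<open>m\<close> is no longer than \<open>bd K u - bd K z\<close>.\<close>
  have mU: "ennreal (l2_norm (surf K) m) \<le> U"
  proof -
    have uz: "bd K u - bd K z \<in> L2 (surf K)" by (intro L2_diff bd_L2 u bdV_L2 z(1))
    have "l2_inner (surf K) (bd K u - P\<^sub>M) m = 0" by (rule PM(2)[OF mM])
    then have "(l2_norm (surf K) m)\<^sup>2 = l2_inner (surf K) (bd K u - bd K z) m"
      using l2_inner_diff_left[OF bd_L2[OF u] M_L2[OF PM(1)] mL] l2_inner_diff_left[OF bd_L2[OF u] bdV_L2[OF z(1)] mL]
        l2_inner_diff_left[OF M_L2[OF PM(1)] bdV_L2[OF z(1)] mL]
      by (simp add: l2_inner_self[symmetric] m_def)
    also have "\<dots> \<le> l2_norm (surf K) (bd K u - bd K z) * l2_norm (surf K) m" using l2_inner_le_norm[OF uz mL] by linarith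
    finally have "l2_norm (surf K) m \<le> l2_norm (surf K) (bd K u - bd K z)"
      by (metis l2_norm_nonneg mult_le_cancel_right order_less_le power2_eq_square)
    also have "\<dots> = l2_norm (surf K) (bd K (u - z))"
      by (intro l2_norm_cong ae_eq_sym[OF bd_lincomb(4)] uz bd_L2 bd_lincomb(3) u V_H1 z(1))
    finally show ?thesis unfolding U_def z_def by (rule ennreal_leI)
  qed
  have alm: "ennreal \<bar>l2_inner (surf K) (\<alpha> m) \<mu>\<bar> \<le> al * U * ennreal (l2_norm (surf K) \<mu>)" if "\<mu> \<in> M" for \<mu>
    using alpha_bound[OF mM that] mU unfolding al_def
    by (meson mult_left_mono mult_right_mono order_trans zero_le)
  have NvA: "ennreal Nv \<le> CV * s * ennreal A"
    unfolding Nv_def CV_def s_def A_def by (rule C_displ_bound[OF v])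
  define q where "q = l2_inner (surf K) (\<alpha> (bd K v)) (bd K v)"
  have q0: "0 \<le> q" unfolding q_def by (rule alpha_pos[OF bL])
  \<comment> \<open>The first energy identity with both terms bounded by Cauchy-Schwarz; the volume
    norm of \<open>v\<close> is converted to its trace norm so that one factor \<open>A\<close> can
    be split off.\<close>
  have qle: "ennreal q \<le> (CV * s * D + al * U) * ennreal A"
  proof -
    have "\<bar>l2_inner (vol K) (d - d') v\<bar> \<le> D0 * Nv"
      unfolding D0_def Nv_def by (rule l2_inner_le_norm[OF L2_diff[OF dL d'L] V_L2[OF vV]])
    then have "q \<le> D0 * Nv + \<bar>l2_inner (surf K) (\<alpha> m) (bd K v)\<bar>"
      using E(1) rsplit[OF bL] ntbd unfolding q_def by linarith
    then have "ennreal q \<le> D * ennreal Nv + ennreal \<bar>l2_inner (surf K) (\<alpha> m) (bd K v)\<bar>"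
      using n0 by (simp add: DD ennreal_mult[symmetric] ennreal_plus[symmetric] ennreal_leI del: ennreal_plus)
    also have "\<dots> \<le> D * (CV * s * ennreal A) + al * U * ennreal A"
      using alm[OF bM] by (intro add_mono mult_left_mono NvA) (simp_all add: A_def)
    also have "\<dots> = (CV * s * D + al * U) * ennreal A" by (simp add: distrib_left distrib_right mult_ac)
    finally show ?thesis .
  qed
  \<comment> \<open>A null \<open>v\<close> has \<open>A = 0\<close>, which also covers
    \<open>a = \<infinity>\<close>. For any other \<open>v\<close> the value \<open>a\<close> is at
    most a real quotient, hence finite, and by (S3) nonzero, so it may be divided by.\<close>
  have Ale: "ennreal A \<le> (CV * s * D + al * U) / a"
  proof (cases "ae_eq (vol K) v (\<lambda>x. 0)")
    case True
    then have "A = 0" unfolding A_def using l2_norm_eq_0_iff[OF bL] bd_null[OF vV] by blast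
    then show ?thesis by simp
  next
    case False
    have A0: "0 < A" unfolding A_def by (rule bd_norm_pos[OF v False])
    have ab: "a \<le> ennreal (q / A\<^sup>2)" unfolding a_def q_def A_def by (rule a_bound[OF v False])
    then have "a \<noteq> top" using ennreal_less_top[of "q / A\<^sup>2"] by (auto simp: top_unique)
    moreover have "a \<noteq> 0" using a_pos unfolding a_def by simp
    ultimately have aa: "a * inverse a = 1"
      using ennreal_divide_self[of a] by (simp add: divide_ennreal_def less_top)
    have "a * ennreal A * ennreal A \<le> ennreal (q / A\<^sup>2) * ennreal A * ennreal A" using ab by (intro mult_right_mono) auto
    also have "\<dots> = ennreal q" using A0 q0 by (simp add: ennreal_mult[symmetric] power2_eq_square)
    also have "\<dots> \<le> (CV * s * D + al * U) * ennreal A" by (rule qle)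
    finally have "a * ennreal A \<le> CV * s * D + al * U" by (rule ennreal_mult_le_cancel[OF A0])
    then have "a * ennreal A * inverse a \<le> (CV * s * D + al * U) * inverse a" by (rule mult_right_mono) simp
    moreover have "a * ennreal A * inverse a = ennreal A" using aa by (metis mult.assoc mult.commute mult.right_neutral)
    ultimately show ?thesis by (simp add: divide_ennreal_def)
  qed
  have "ennreal Nv \<le> CV * s * ((CV * s * D + al * U) / a)"
    using NvA by (rule order_trans) (intro mult_left_mono Ale, simp)
  then show ?displ by (simp only: Nv_def v_def z_def)
  \<comment> \<open>The second energy identity, divided by \<open>T\<close>; the three summands come
    from \<open>\<alpha> (bd K v)\<close>, from \<open>nt e\<close> and from
    \<open>\<alpha> m\<close>.\<close>
  have Tle: "ennreal T \<le> al * ((CV * s * D + al * U) / a) + X + al * U"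
  proof (cases "T = 0")
    case False
    then have T0: "0 < T" using n0 by simp
    have "\<bar>l2_inner (surf K) (nt e) (nt \<tau>)\<bar> \<le> X0 * T" unfolding X0_def T_def by (rule l2_inner_le_norm[OF nt_L2[OF ge] tL])
    then have "T * T \<le> \<bar>l2_inner (surf K) (\<alpha> (bd K v)) (nt \<tau>)\<bar> + (X0 * T + \<bar>l2_inner (surf K) (\<alpha> m) (nt \<tau>)\<bar>)"
      using E(2) rsplit[OF tL] unfolding T_def[symmetric] power2_eq_square by linarith
    then have "ennreal T * ennreal T \<le> ennreal \<bar>l2_inner (surf K) (\<alpha> (bd K v)) (nt \<tau>)\<bar> + (X * ennreal T + ennreal \<bar>l2_inner (surf K) (\<alpha> m) (nt \<tau>)\<bar>)"
      using n0 by (simp add: XX ennreal_mult[symmetric] ennreal_plus[symmetric] ennreal_leI del: ennreal_plus)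
    also have "\<dots> \<le> al * ennreal A * ennreal T + (X * ennreal T + al * U * ennreal T)"
      using alpha_bound[OF bM tM] alm[OF tM] by (intro add_mono order_refl) (simp_all add: al_def A_def T_def)
    also have "\<dots> = (al * ennreal A + X + al * U) * ennreal T" by (simp add: distrib_right add.assoc)
    finally have "ennreal T \<le> al * ennreal A + X + al * U" by (rule ennreal_mult_le_cancel[OF T0])
    also have "\<dots> \<le> al * ((CV * s * D + al * U) / a) + X + al * U"
      by (intro add_mono order_refl mult_left_mono Ale) simp
    finally show ?thesis .
  qed simp
  have "ennreal (l2_norm (vol K) \<tau>) \<le> CS * s * ennreal T"
    unfolding CS_def s_def T_def by (rule C_stress_bound[OF \<tau>])
  also have "\<dots> \<le> CS * s * (al * ((CV * s * D + al * U) / a) + X + al * U)"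
    by (intro mult_left_mono Tle) simp
  finally show ?stress by (simp only: \<tau>_def \<eta>_def)
qed

end

theorem theorem2p2:
  fixes K :: "(real^'n) set"
    and S S' :: "(real^'n \<Rightarrow> real^'n^'n) set"
    and V V' M :: "(real^'n \<Rightarrow> real^'n) set"
    and \<alpha> :: "(real^'n \<Rightarrow> real^'n) \<Rightarrow> (real^'n \<Rightarrow> real^'n)"
    and \<sigma> :: "real^'n \<Rightarrow> real^'n^'n"
    and u :: "real^'n \<Rightarrow> real^'n"
  defines "h \<equiv> diameter K"
    and "Sp \<equiv> l2_complement (vol K) S S'"
    and "Vp \<equiv> l2_complement (vol K) V V'"
  defines "C1 \<equiv> C_stress K Sp"
    and "C2 \<equiv> C_displ K Vp / a_const K \<alpha> Vp * C_stress K Sp * alpha_norm K \<alpha> M"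
    and "C3 \<equiv> (1 + alpha_norm K \<alpha> M / a_const K \<alpha> Vp) * C_stress K Sp * alpha_norm K \<alpha> M"
    and "C4 \<equiv> C_displ K Vp / a_const K \<alpha> Vp * alpha_norm K \<alpha> M"
    and "C5 \<equiv> (C_displ K Vp)\<^sup>2 / a_const K \<alpha> Vp"
  assumes "CARD('n) = 2 \<or> CARD('n) = 3"
    and "polyhedral_element K"
    and "finite_dim_l2_subspace (vol K) S"
    and "S \<subseteq> {\<tau> \<in> Hdiv_sym K. \<exists>g. has_normal_trace K \<tau> g}"
    and "finite_dim_l2_subspace (vol K) V"
    and "V \<subseteq> H1_vec K"
    and "finite_dim_l2_subspace (surf K) M"
    and "M_decomposition K S V M S' V'"
    and "stabilization K \<alpha> Vp"
    and "\<sigma> \<in> H1_sym K"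
    and "u \<in> H1_vec K"
  shows "(\<exists>\<xi> w. hdg_projection K S V M S' V' \<alpha> \<sigma> u \<xi> w)
    \<and> (\<forall>\<xi> w \<xi>' w'. hdg_projection K S V M S' V' \<alpha> \<sigma> u \<xi> w
          \<longrightarrow> hdg_projection K S V M S' V' \<alpha> \<sigma> u \<xi>' w'
          \<longrightarrow> ae_eq (vol K) \<xi> \<xi>' \<and> ae_eq (vol K) w w')
    \<and> (\<forall>\<xi> w. hdg_projection K S V M S' V' \<alpha> \<sigma> u \<xi> w \<longrightarrow>
        ennreal (l2_norm (vol K) (\<sigma> - \<xi>))
          \<le> ennreal (l2_norm (vol K) (\<sigma> - l2_proj (vol K) S \<sigma>))
            + C1 * ennreal (h powr (1/2)
                * l2_norm (surf K) (normal_trace K (\<sigma> - l2_proj (vol K) S \<sigma>)))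
            + C2 * ennreal (h
                * l2_norm (vol K) (weak_div K \<sigma> - l2_proj (vol K) V' (weak_div K \<sigma>)))
            + C3 * ennreal (h powr (1/2)
                * l2_norm (surf K) (bd K (u - l2_proj (vol K) V u)))
        \<and> ennreal (l2_norm (vol K) (u - w))
          \<le> ennreal (l2_norm (vol K) (u - l2_proj (vol K) V u))
            + C4 * ennreal (h powr (1/2)
                * l2_norm (surf K) (bd K (u - l2_proj (vol K) V u)))
            + C5 * ennreal (h
                * l2_norm (vol K) (weak_div K \<sigma> - l2_proj (vol K) V' (weak_div K \<sigma>))))"
proof -
  obtain Q where "flat_domain K Q" using polyhedral_element_flat_domain[OF \<open>polyhedral_element K\<close>] .
  moreover have "K \<noteq> {}" using \<open>polyhedral_element K\<close> by (simp add: polyhedral_element_def)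
  ultimately interpret hdg K Q S S' V V' M \<alpha>
    using assms(10-17) unfolding Vp_def by (intro hdg.intro hdg_axioms.intro)
  define s where "s = ennreal (h powr (1/2))"
  have s: "ennreal (h powr (1/2) * x) = s * ennreal x" "ennreal (h * x) = s * s * ennreal x" if "0 \<le> x" for x
    using that diameter_pos powr_half(2) by (simp_all add: s_def h_def ennreal_mult)
  \<comment> \<open>Distributing the products reveals the constants. The bound on the trace of
    \<open>v\<close> contributes \<open>C2\<close> and the quotient in \<open>C3\<close>; the 1 in
    \<open>C3\<close> is the direct contribution of \<open>\<alpha> m\<close>. Division is
    multiplication by \<open>inverse\<close>, so \<open>a = \<infinity>\<close> is included.\<close>
  have expand: "A * s * (al * ((B * s * D + al * U) / a) + X + al * U)
      = A * (s * X) + B / a * A * al * (s * s * D) + (1 + al / a) * A * al * (s * U)"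
    "B * s * ((B * s * D + al * U) / a) = B / a * al * (s * U) + B\<^sup>2 / a * (s * s * D)" for A B D U X al a :: ennreal
    by (simp_all add: divide_ennreal_def power2_eq_square distrib_left distrib_right mult_ac add_ac)
  have est: "ennreal (l2_norm (vol K) (\<sigma> - \<xi>)) \<le> ennreal (l2_norm (vol K) (\<sigma> - l2_proj (vol K) S \<sigma>))
            + C1 * ennreal (h powr (1/2) * l2_norm (surf K) (normal_trace K (\<sigma> - l2_proj (vol K) S \<sigma>)))
            + C2 * ennreal (h * l2_norm (vol K) (weak_div K \<sigma> - l2_proj (vol K) V' (weak_div K \<sigma>)))
            + C3 * ennreal (h powr (1/2) * l2_norm (surf K) (bd K (u - l2_proj (vol K) V u)))"
      "ennreal (l2_norm (vol K) (u - w)) \<le> ennreal (l2_norm (vol K) (u - l2_proj (vol K) V u))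
            + C4 * ennreal (h powr (1/2) * l2_norm (surf K) (bd K (u - l2_proj (vol K) V u)))
            + C5 * ennreal (h * l2_norm (vol K) (weak_div K \<sigma> - l2_proj (vol K) V' (weak_div K \<sigma>)))"
    if P: "hdg_projection K S V M S' V' \<alpha> \<sigma> u \<xi> w" for \<xi> w
  proof -
    have L: "\<sigma> \<in> L2 (vol K)" "u \<in> L2 (vol K)" by (rule H1_sym_L2[OF \<open>\<sigma> \<in> H1_sym K\<close>], rule H1_vec_L2[OF \<open>u \<in> H1_vec K\<close>])
    have "\<xi> \<in> S" "w \<in> V" using P by (auto simp: hdg_projection_def)
    then have L': "\<xi> \<in> L2 (vol K)" "w \<in> L2 (vol K)" using good_L2 good_S V_L2 by blast+
    have L'': "l2_proj (vol K) S \<sigma> \<in> L2 (vol K)" "l2_proj (vol K) V u \<in> L2 (vol K)"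
      using l2_proj(1)[OF fin_S L(1)] l2_proj(1)[OF fin_V L(2)] good_L2 good_S V_L2 by blast+
    \<comment> \<open>The best-approximation terms of the estimates come from passing through the L2
      projections; the remaining differences are those of
      \<open>projection_estimates\<close>.\<close>
    have tri: "ennreal (l2_norm (vol K) (f - g)) \<le> ennreal (l2_norm (vol K) (f - p)) + ennreal (l2_norm (vol K) (g - p))"
      if "f \<in> L2 (vol K)" "p \<in> L2 (vol K)" "g \<in> L2 (vol K)" for f p g :: "real^'n \<Rightarrow> 'b::euclidean_space"
      using l2_norm_diff_triangle[OF that] l2_norm_diff_commute[of "vol K" p g]
      by (simp add: ennreal_plus[symmetric] ennreal_leI del: ennreal_plus)
    note e = projection_estimates[OF P \<open>\<sigma> \<in> H1_sym K\<close> \<open>u \<in> H1_vec K\<close>, folded h_def, folded s_def, unfolded expand]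
    show "ennreal (l2_norm (vol K) (\<sigma> - \<xi>)) \<le> ennreal (l2_norm (vol K) (\<sigma> - l2_proj (vol K) S \<sigma>))
            + C1 * ennreal (h powr (1/2) * l2_norm (surf K) (normal_trace K (\<sigma> - l2_proj (vol K) S \<sigma>)))
            + C2 * ennreal (h * l2_norm (vol K) (weak_div K \<sigma> - l2_proj (vol K) V' (weak_div K \<sigma>)))
            + C3 * ennreal (h powr (1/2) * l2_norm (surf K) (bd K (u - l2_proj (vol K) V u)))"
      using order_trans[OF tri[OF L(1) L''(1) L'(1)] add_left_mono[OF e(1)]]
      unfolding s[OF l2_norm_nonneg] C1_def C2_def C3_def Sp_def Vp_def add.assoc .
    show "ennreal (l2_norm (vol K) (u - w)) \<le> ennreal (l2_norm (vol K) (u - l2_proj (vol K) V u))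
            + C4 * ennreal (h powr (1/2) * l2_norm (surf K) (bd K (u - l2_proj (vol K) V u)))
            + C5 * ennreal (h * l2_norm (vol K) (weak_div K \<sigma> - l2_proj (vol K) V' (weak_div K \<sigma>)))"
      using order_trans[OF tri[OF L(2) L''(2) L'(2)] add_left_mono[OF e(2)]]
      unfolding s[OF l2_norm_nonneg] C4_def C5_def Vp_def add.assoc .
  qed
  show ?thesis
    using projection_exists[OF \<open>\<sigma> \<in> H1_sym K\<close> \<open>u \<in> H1_vec K\<close>]
      projection_unique[OF _ _ \<open>\<sigma> \<in> H1_sym K\<close> \<open>u \<in> H1_vec K\<close>] est by blast
qed

end
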